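(* Let $k\in\mathbb{N}$ be fixed, let $p\in[1,\infty)$, and for each integer $n\ge k$ let $X_p^{(n)}$ be a random vector in $\mathbb{R}^n$ such that either $X_p^{(n)}\sim P^{(n)}_{p,R^{(n)}}$ for some random variable $R^{(n)}$ with values almost surely in $(0,\infty)$, or $X_p^{(n)}\sim\sigma_p^{(n)}$. Then there exists a constant $c_{k,p}\in(0,\infty)$ such that for all $n\ge\max\{k,2\}$, $$d_{\mathrm{Kol}}\Bigl(\sqrt{n}\,\bigl(\mathrm{e}^{-m_p}\,\mathscr{R}^{(n)}_{k,n,p}(X_p^{(n)})-1\bigr),\,Z\Bigr)\le\frac{c_{k,p}\sqrt{\log(n)}}{\sqrt{n}},$$ where $Z\sim\mathcal{N}(0,s_p^2)$.
   Context: For $x\in\mathbb{R}^n$ and $p\in[1,\infty)$ let $\|x\|_p=(\sum_{i=1}^n|x_i|^p)^{1/p}$, $\mathbb{B}_p^n=\{x\in\mathbb{R}^n:\|x\|_p\le1\}$, $\mathbb{S}_p^{n-1}=\{x\in\mathbb{R}^n:\|x\|_p=1\}$. Cone measure: $\mu_p^{(n)}(A)=\lambda^{(n)}(\{ra:r\in[0,1],a\in A\})/\lambda^{(n)}(\mathbb{B}_p^n)$ for Borel $A\subset\mathbb{S}_p^{n-1}$, with $\lambda^{(n)}$ Lebesgue measure. Surface measure $\sigma_p^{(n)}$: the normalized (to total mass 1) $(n-1)$-dimensional Hausdorff measure on $\mathbb{S}_p^{n-1}$. For a random variable $R^{(n)}$ taking values a.s. in $(0,\infty)$, $P^{(n)}_{p,R^{(n)}}$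 is the distribution of $R^{(n)}\Theta$, where $\Theta\sim\mu_p^{(n)}$ is independent of $R^{(n)}$. For $x\in\mathbb{R}^n$ and $1\le k\le n$ let $$S^{(n)}_{k,p}(x)=\Bigl(\tbinom{n}{k}^{-1}\sum_{1\le i_1<\dots<i_k\le n}|x_{i_1}|^p\cdots|x_{i_k}|^p\Bigr)^{1/(kp)},$$ and for $1\le k_1\le k_2\le n$ let $\mathscr{R}^{(n)}_{k_1,k_2,p}(x)=S^{(n)}_{k_2,p}(x)/S^{(n)}_{k_1,p}(x)$. The $p$-Gaussian distribution has Lebesgue density $x\mapsto \frac{1}{2p^{1/p}\Gamma(1+1/p)}\mathrm{e}^{-|x|^p/p}$ on $\mathbb{R}$. For $X$ a $p$-Gaussian random variable, $m_p=\mathbb{E}[\log|X|]$ and $s_p^2=\operatorname{Var}\bigl[\log|X|-\tfrac1p|X|^p\bigr]$. The Kolmogorov distance of real random variables is $d_{\mathrm{Kol}}(X,Y)=\sup_{t\in\mathbb{R}}|\mathbb{P}[X\le t]-\mathbb{P}[Y\le t]|$. *)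

theory Defs
  imports "HOL-Probability.Probability"
begin

(* A point of R^n is an extensional function on {..<n}. *)

definition lebesgue_n :: "nat \<Rightarrow> (nat \<Rightarrow> real) measure" where
  "lebesgue_n n = (\<Pi>\<^sub>M i\<in>{..<n}. lborel)"

definition scale_n :: "nat \<Rightarrow> real \<Rightarrow> (nat \<Rightarrow> real) \<Rightarrow> (nat \<Rightarrow> real)" where
  "scale_n n r x = (\<lambda>i\<in>{..<n}. r * x i)"

definition lp_norm :: "nat \<Rightarrow> real \<Rightarrow> (nat \<Rightarrow> real) \<Rightarrow> real" where
  "lp_norm n p x = (\<Sum>i<n. \<bar>x i\<bar> powr p) powr (1 / p)"

definition lp_ball :: "nat \<Rightarrow> real \<Rightarrow> (nat \<Rightarrow> real) set" where
  "lp_ball n p = {x \<in> space (lebesgue_n n). lp_norm n p x \<le> 1}"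

definition lp_sphere :: "nat \<Rightarrow> real \<Rightarrow> (nat \<Rightarrow> real) set" where
  "lp_sphere n p = {x \<in> space (lebesgue_n n). lp_norm n p x = 1}"

(* The cone measure, as a Borel measure on R^n concentrated on the sphere. For n >= 1 the set
   function below is countably additive: the cones over disjoint sets meet at most in the origin. *)
definition cone_measure :: "nat \<Rightarrow> real \<Rightarrow> (nat \<Rightarrow> real) measure" where
  "cone_measure n p =
     measure_of (space (lebesgue_n n)) (sets (lebesgue_n n))
       (\<lambda>A. emeasure (lebesgue_n n)
               {scale_n n r a | r a. r \<in> {0..1} \<and> a \<in> A \<inter> lp_sphere n p}
             / emeasure (lebesgue_n n) (lp_ball n p))"

(* Hausdorff measure is taken with respect to the Euclidean distance, which is not the
   metric that the type nat => real carries in the library. *)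
definition ediam_n :: "nat \<Rightarrow> (nat \<Rightarrow> real) set \<Rightarrow> ennreal" where
  "ediam_n n U = (SUP (x, y)\<in>U \<times> U. ennreal (L2_set (\<lambda>i. x i - y i) {..<n}))"

(* The empty set is treated separately because 0 ^ 0 = 1; the usual dimensional constant is
   omitted, since it cancels in the normalized surface measure. *)
definition hausdorff_outer :: "nat \<Rightarrow> nat \<Rightarrow> (nat \<Rightarrow> real) set \<Rightarrow> ennreal" where
  "hausdorff_outer n m A =
     (SUP \<delta>\<in>{0::real<..}.
        INF U\<in>{U :: nat \<Rightarrow> (nat \<Rightarrow> real) set.
                 (\<forall>i. U i \<subseteq> space (lebesgue_n n) \<and> ediam_n n (U i) \<le> ennreal \<delta>)
                 \<and> A \<subseteq> (\<Union>i. U i)}.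
          \<Sum>i. if U i = {} then 0 else ediam_n n (U i) ^ m)"

(* A metric outer measure is countably additive on the Borel sets. *)
definition hausdorff_measure :: "nat \<Rightarrow> nat \<Rightarrow> (nat \<Rightarrow> real) measure" where
  "hausdorff_measure n m =
     measure_of (space (lebesgue_n n)) (sets (lebesgue_n n)) (hausdorff_outer n m)"

definition surface_measure :: "nat \<Rightarrow> real \<Rightarrow> (nat \<Rightarrow> real) measure" where
  "surface_measure n p = uniform_measure (hausdorff_measure n (n - 1)) (lp_sphere n p)"

(* Here \<rho> is the law of the radial variable R. *)
definition radial_law :: "nat \<Rightarrow> real \<Rightarrow> real measure \<Rightarrow> (nat \<Rightarrow> real) measure" where
  "radial_law n p \<rho> =
     distr (\<rho> \<Otimes>\<^sub>M cone_measure n p) (lebesgue_n n) (\<lambda>(r, \<theta>). scale_n n r \<theta>)"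

definition sym_mean :: "nat \<Rightarrow> nat \<Rightarrow> real \<Rightarrow> (nat \<Rightarrow> real) \<Rightarrow> real" where
  "sym_mean n k p x =
     ((\<Sum>I | I \<subseteq> {..<n} \<and> card I = k. \<Prod>i\<in>I. \<bar>x i\<bar> powr p) / real (n choose k))
       powr (1 / (real k * p))"

definition mean_ratio :: "nat \<Rightarrow> nat \<Rightarrow> nat \<Rightarrow> real \<Rightarrow> (nat \<Rightarrow> real) \<Rightarrow> real" where
  "mean_ratio n k1 k2 p x = sym_mean n k2 p x / sym_mean n k1 p x"

definition p_gaussian :: "real \<Rightarrow> real measure" where
  "p_gaussian p =
     density lborel
       (\<lambda>x. ennreal (exp (- (\<bar>x\<bar> powr p) / p) / (2 * p powr (1 / p) * Gamma (1 + 1 / p))))"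

definition log_mean :: "real \<Rightarrow> real" where
  "log_mean p = prob_space.expectation (p_gaussian p) (\<lambda>x. ln \<bar>x\<bar>)"

definition limit_variance :: "real \<Rightarrow> real" where
  "limit_variance p = prob_space.variance (p_gaussian p) (\<lambda>x. ln \<bar>x\<bar> - \<bar>x\<bar> powr p / p)"

definition kolmogorov_dist ::
    "'a measure \<Rightarrow> ('a \<Rightarrow> real) \<Rightarrow> 'b measure \<Rightarrow> ('b \<Rightarrow> real) \<Rightarrow> real" where
  "kolmogorov_dist M X N Y =
     (SUP t. \<bar>measure M {\<omega> \<in> space M. X \<omega> \<le> t} - measure N {\<omega> \<in> space N. Y \<omega> \<le> t}\<bar>)"

end

theory Submission
  imports Defs
begin

text \<open>Let \<open>y\<close> have i.i.d. p-Gaussian coordinates. Its density depends only on the p-norm, so every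
  0-homogeneous function of \<open>y\<close> is independent of the norm and has the same law as under the cone
  measure; in particular the radial variable plays no role.

  Write \<open>D\<close> for the mean of the \<open>\<bar>y i\<bar>\<^sup>p\<close>. The 0-homogeneous \<open>V = sqrt n (mean ln \<bar>y i\<bar> - m - (ln D) / p)\<close>
  plus the small independent term \<open>sqrt n (ln D - D + 1) / p\<close> is a normalized i.i.d. sum. Adding an independent
  Gaussian of variance of order \<open>ln n / n\<close> makes Fourier inversion applicable and gives a
  Berry-Esseen bound of order \<open>sqrt (ln n / n)\<close>; by independence the perturbations can be removed by
  deconvolution. With \<open>k\<close>-th means in place of first means the logarithm of the ratio changes by \<open>O(1/n)\<close> only,
  off an event of probability \<open>O(1/n)\<close>.

  The normalized surface measure has density proportional to the Euclidean norm \<open>h\<close> of the gradient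
  of the p-norm with respect to the cone measure. This follows by comparing the sphere locally
  with its tangent hyperplane, where Hausdorff measure is a multiple of Lebesgue measure by
  translation invariance. As \<open>h\<close> is 0-homogeneous and concentrates like an empirical mean, the total
  variation distance of the two measures is \<open>O(1 / sqrt n)\<close>.\<close>

section \<open>A smoothed Berry-Esseen inequality\<close>

lemma norm_interval_integral_le:
  fixes f :: "real \<Rightarrow> complex"
  assumes "integrable lborel B" "\<And>t. t \<noteq> 0 \<Longrightarrow> norm (f t) \<le> B t" "a \<le> b"
  shows "norm (CLBINT t=ereal a..ereal b. f t) \<le> (\<integral>t. B t \<partial>lborel)"
proof -
  have nz: "AE t in lborel. t \<noteq> (0::real)"
    by (rule AE_lborel_singleton)
  have le: "AE t in lborel. norm (indicator {a<..<b} t *\<^sub>R f t) \<le> B t"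
    using nz by eventually_elim
      (auto split: split_indicator intro: assms(2) order_trans[OF norm_ge_zero])
  have "(CLBINT t=ereal a..ereal b. f t) = (\<integral>t. indicator {a<..<b} t *\<^sub>R f t \<partial>lborel)"
    using assms(3) by (simp add: interval_lebesgue_integral_def set_lebesgue_integral_def)
  also have "norm \<dots> \<le> (\<integral>t. norm (indicator {a<..<b} t *\<^sub>R f t) \<partial>lborel)"
    by (rule integral_norm_bound)
  also have "\<dots> \<le> (\<integral>t. B t \<partial>lborel)"
    by (rule integral_mono_AE'[OF assms(1) le]) (rule eventually_mono[OF le], erule order_trans[OF norm_ge_zero])
  finally show ?thesis .
qed

lemma cdf_diff_le_char:
  assumes M1: "real_distribution M1" and M2: "real_distribution M2"
    and no_atoms: "\<And>x. measure M1 {x} = 0" "\<And>x. measure M2 {x} = 0"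
    and B: "integrable lborel B"
    and le: "\<And>t. cmod (char M1 t - char M2 t) \<le> \<bar>t\<bar> * B t"
  shows "\<bar>cdf M1 x - cdf M2 x\<bar> \<le> (\<integral>t. B t \<partial>lborel)"
proof -
  interpret M1: real_distribution M1 by fact
  interpret M2: real_distribution M2 by fact
  have Bnn: "0 \<le> B t" if "t \<noteq> 0" for t
    using le[of t] that by (metis norm_ge_zero order_trans zero_le_mult_iff abs_le_zero_iff)
  have iB: "0 \<le> (\<integral>t. B t \<partial>lborel)"
    by (rule integral_nonneg_AE) (use AE_lborel_singleton[of 0] Bnn in \<open>auto elim!: eventually_mono\<close>)
  have interval: "\<bar>measure M1 {a<..b} - measure M2 {a<..b}\<bar> \<le> (\<integral>t. B t \<partial>lborel)" if "a \<le> b" for a b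
  proof -
    define F where "F t = (iexp (-(t * a)) - iexp (-(t * b))) / (\<i> * t)" for t :: real
    have F_le: "cmod (F t) \<le> b - a" if "t \<noteq> 0" for t
      using Levy_Inversion_aux2[of "- b" "- a" t] that \<open>a \<le> b\<close> by (simp add: F_def)
    have F_le2: "cmod (F t) \<le> 2 / \<bar>t\<bar>" if "t \<noteq> 0" for t
    proof -
      have "cmod (iexp (-(t * a)) - iexp (-(t * b))) \<le> 1 + 1"
        by (rule order_trans[OF norm_triangle_ineq4]) (simp add: norm_exp_i_times)
      then show ?thesis
        using that by (simp add: F_def norm_divide norm_mult divide_right_mono)
    qed
    have [measurable]: "F \<in> borel_measurable borel"
      unfolding F_def by measurable
    have int: "complex_interval_lebesgue_integrable lborel (ereal (- T)) (ereal T) (\<lambda>t. F t * char M t)"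
      if "T \<ge> 0" "real_distribution M" for T :: real and M
    proof -
      interpret real_distribution M by fact
      have "norm (F t * char M t) \<le> b - a" if "t \<noteq> 0" for t
        using mult_mono[OF F_le[OF that] cmod_char_le_1[of t]] \<open>a \<le> b\<close> by (simp add: norm_mult)
      then show ?thesis using \<open>T \<ge> 0\<close>
        by (auto simp: interval_lebesgue_integrable_def set_integrable_def
            intro!: integrableI_bounded_set_indicator[where B="b - a"] AE_I [of _ _ "{0}"])
    qed
    let ?I = "\<lambda>M T. 1 / (2 * pi) * (CLBINT t=ereal (- T)..ereal T. F t * char M t)"
    have "(\<lambda>T::nat. ?I M1 T) \<longlonglongrightarrow> complex_of_real (measure M1 {a<..b})"
      using M1.Levy_Inversion[OF that] no_atoms by (simp add: F_def)
    moreover have "(\<lambda>T::nat. ?I M2 T) \<longlonglongrightarrow> complex_of_real (measure M2 {a<..b})"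
      using M2.Levy_Inversion[OF that] no_atoms by (simp add: F_def)
    ultimately have lim: "(\<lambda>T::nat. norm (?I M1 T - ?I M2 T)) \<longlonglongrightarrow> 
        norm (complex_of_real (measure M1 {a<..b}) - complex_of_real (measure M2 {a<..b}))"
      by (intro tendsto_intros)
    have "norm (?I M1 T - ?I M2 T) \<le> (\<integral>t. B t \<partial>lborel)" for T :: nat
    proof -
      have "?I M1 T - ?I M2 T = 1 / (2 * pi) * (CLBINT t=ereal (- T)..ereal T. F t * char M1 t - F t * char M2 t)"
        by (subst interval_lebesgue_integral_diff(2)) (use int M1 M2 in \<open>auto simp: algebra_simps\<close>)
      also have "norm \<dots> = 1 / (2 * pi) * norm (CLBINT t=ereal (- T)..ereal T. F t * char M1 t - F t * char M2 t)"
        by (simp add: norm_mult norm_divide)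
      also have "\<dots> \<le> 1 / (2 * pi) * (\<integral>t. 2 * B t \<partial>lborel)"
      proof (intro mult_left_mono norm_interval_integral_le)
        fix t :: real assume t: "t \<noteq> 0"
        have "norm (F t * char M1 t - F t * char M2 t) = norm (F t) * norm (char M1 t - char M2 t)"
          by (simp flip: norm_mult right_diff_distrib)
        also have "\<dots> \<le> (2 / \<bar>t\<bar>) * (\<bar>t\<bar> * B t)"
          by (intro mult_mono F_le2 le t) auto
        finally show "norm (F t * char M1 t - F t * char M2 t) \<le> 2 * B t" using t by simp
      qed (use B in auto)
      also have "\<dots> = (\<integral>t. B t \<partial>lborel) / pi" by simp
      also have "\<dots> \<le> (\<integral>t. B t \<partial>lborel) / 1"
        using iB pi_gt3 by (intro divide_left_mono) auto
      finally show ?thesis by simp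
    qed
    with lim have "norm (complex_of_real (measure M1 {a<..b}) - complex_of_real (measure M2 {a<..b})) \<le> (\<integral>t. B t \<partial>lborel)"
      by (intro tendsto_upperbound[OF lim]) auto
    then show ?thesis by (simp flip: of_real_diff)
  qed
  have "((\<lambda>a. \<bar>(cdf M1 x - cdf M1 a) - (cdf M2 x - cdf M2 a)\<bar>) \<longlongrightarrow> \<bar>(cdf M1 x - 0) - (cdf M2 x - 0)\<bar>) at_bot"
    by (intro tendsto_intros M1.cdf_lim_at_bot M2.cdf_lim_at_bot)
  moreover have "\<forall>\<^sub>F a in at_bot. \<bar>(cdf M1 x - cdf M1 a) - (cdf M2 x - cdf M2 a)\<bar> \<le> (\<integral>t. B t \<partial>lborel)"
    using eventually_le_at_bot[of x]
  proof eventually_elim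
    case (elim a)
    then show ?case
      using interval[of a x] by (cases "a = x") (use iB in \<open>auto simp: M1.cdf_diff_eq M2.cdf_diff_eq\<close>)
  qed
  ultimately show ?thesis
    using tendsto_upperbound[of _ "\<bar>(cdf M1 x - 0) - (cdf M2 x - 0)\<bar>" at_bot] by force
qed


lemma exp_square_integral:
  fixes a :: real
  assumes "a > 0"
  shows "integrable lborel (\<lambda>t. exp (- a * t\<^sup>2) * \<bar>t\<bar> ^ k)"
    and "(\<integral>t. exp (- a * t\<^sup>2) \<partial>lborel) = sqrt (pi / a)"
proof -
  define s where "s = sqrt (1 / (2 * a))"
  have s: "s > 0" "2 * s\<^sup>2 = 1 / a" using assms by (auto simp: s_def field_simps)
  have nd: "normal_density 0 s t = exp (- a * t\<^sup>2) / sqrt (pi / a)" for t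
  proof -
    have "t\<^sup>2 / (2 * s\<^sup>2) = a * t\<^sup>2" "2 * pi * s\<^sup>2 = pi / a" using s by (simp_all add: mult.commute mult.left_commute) (metis mult.assoc mult.commute times_divide_eq_right mult_1_right)
    then show ?thesis unfolding normal_density_def by (simp add: field_simps)
  qed
  have "integrable lborel (\<lambda>x. normal_density 0 s x * \<bar>x - 0\<bar> ^ k)"
    using s(1) by (rule integrable_normal_moment_abs)
  then have "integrable lborel (\<lambda>x. sqrt (pi / a) * (exp (- a * x\<^sup>2) / sqrt (pi / a) * \<bar>x\<bar> ^ k))"
    unfolding nd by (intro integrable_mult_right) simp
  also have "(\<lambda>x. sqrt (pi / a) * (exp (- a * x\<^sup>2) / sqrt (pi / a) * \<bar>x\<bar> ^ k)) = (\<lambda>t. exp (- a * t\<^sup>2) * \<bar>t\<bar> ^ k)"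
    using assms by (auto simp: fun_eq_iff)
  finally show "integrable lborel (\<lambda>t. exp (- a * t\<^sup>2) * \<bar>t\<bar> ^ k)" .
  have "(\<integral>t. exp (- a * t\<^sup>2) / sqrt (pi / a) \<partial>lborel) = 1"
    using integral_normal_density[OF s(1), of 0] unfolding nd .
  then have "(\<integral>t. exp (- a * t\<^sup>2) \<partial>lborel) / sqrt (pi / a) = 1"
    by (simp only: integral_divide_zero)
  then show "(\<integral>t. exp (- a * t\<^sup>2) \<partial>lborel) = sqrt (pi / a)"
    by (simp only: divide_eq_1_iff)
qed

lemma char_normal_density:
  assumes "s > 0"
  shows "char (density lborel (normal_density 0 s)) t = exp (- (s\<^sup>2 * t\<^sup>2 / 2))"
proof -
  interpret std: prob_space std_normal_distribution
    by (rule prob_space_normal_density) simp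
  have D: "distributed std_normal_distribution lborel (\<lambda>x. x) std_normal_density"
    unfolding distributed_def by (auto simp: distr_id2 cong: distr_cong)
  have "distributed std_normal_distribution lborel (\<lambda>x. 0 + s * x) (normal_density (0 + s * 0) (\<bar>s\<bar> * 1))"
    using D assms by (intro std.normal_density_affine) auto
  then have *: "density lborel (normal_density 0 s) = distr std_normal_distribution borel (\<lambda>x. s * x)"
    using assms by (auto simp: distributed_def cong: distr_cong)
  have "char (density lborel (normal_density 0 s)) t = char std_normal_distribution (t * s)"
    unfolding * char_def by (subst integral_distr) (auto simp: mult_ac)
  then show ?thesis
    by (simp add: char_std_normal_distribution power_mult_distrib mult_ac flip: exp_of_real)
qed

lemma norm_power_diff_le:
  fixes z w :: complex
  assumes "norm z \<le> q" "norm w \<le> q" "q > 0" "n \<ge> 1"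
  shows "norm (z ^ n - w ^ n) \<le> n * q ^ (n - 1) * norm (z - w)"
proof -
  define z' w' where "z' = z / of_real q" and "w' = w / of_real q"
  have zw: "z = of_real q * z'" "w = of_real q * w'" using assms by (auto simp: z'_def w'_def)
  have "norm (z' ^ n - w' ^ n) \<le> n * norm (z' - w')"
    using assms by (intro norm_power_diff) (auto simp: z'_def w'_def norm_divide)
  then have "q ^ n * norm (z' ^ n - w' ^ n) \<le> q ^ n * (n * norm (z' - w'))"
    using assms by (intro mult_left_mono) auto
  also have "\<dots> = n * q ^ (n - 1) * (q * norm (z' - w'))"
    using assms by (cases n) auto
  also have "q * norm (z' - w') = norm (z - w)"
    unfolding zw right_diff_distrib[symmetric] norm_mult using assms by simp
  also have "q ^ n * norm (z' ^ n - w' ^ n) = norm (z ^ n - w ^ n)"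
    unfolding zw power_mult_distrib right_diff_distrib[symmetric] norm_mult norm_power using assms by simp
  finally show ?thesis .
qed

lemma power_char_diff_le:
  fixes \<phi> :: "real \<Rightarrow> complex"
  assumes approx: "\<And>t. cmod (\<phi> t - of_real (1 - s\<^sup>2 * t\<^sup>2 / 2)) \<le> r * \<bar>t\<bar> ^ 3" and "s > 0" "r \<ge> 0"
    and c: "c > 0" "s * c \<le> 1" "r * c \<le> s\<^sup>2 / 4" and u: "\<bar>u\<bar> \<le> c" and n: "n \<ge> 2"
  shows "cmod (\<phi> u ^ n - of_real (exp (- (s\<^sup>2 * u\<^sup>2 / 2))) ^ n) \<le> n * exp (- (s\<^sup>2 * u\<^sup>2 / 8 * n)) * ((r + s ^ 4 * c) * \<bar>u\<bar> ^ 3)"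
proof -
  let ?q = "exp (- (s\<^sup>2 * u\<^sup>2 / 4))"
  have su: "s\<^sup>2 * u\<^sup>2 \<le> 1"
  proof -
    have "s * \<bar>u\<bar> \<le> 1" using c u \<open>s > 0\<close> by (meson mult_left_mono less_imp_le order_trans)
    then have "(s * \<bar>u\<bar>)\<^sup>2 \<le> 1\<^sup>2" using \<open>s > 0\<close> by (intro power_mono) auto
    then show ?thesis by (simp add: power_mult_distrib)
  qed
  have ru: "r * \<bar>u\<bar> ^ 3 \<le> s\<^sup>2 * u\<^sup>2 / 4"
  proof -
    have "r * \<bar>u\<bar> ^ 3 = (r * \<bar>u\<bar>) * u\<^sup>2" by (simp add: power3_eq_cube power2_eq_square abs_mult_self_eq mult_ac)
    also have "\<dots> \<le> (r * c) * u\<^sup>2" using u assms by (intro mult_right_mono mult_left_mono) auto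
    also have "\<dots> \<le> s\<^sup>2 / 4 * u\<^sup>2" using c by (intro mult_right_mono) auto
    finally show ?thesis by simp
  qed
  have "cmod (\<phi> u) \<le> cmod (\<phi> u - (1 - s\<^sup>2 * u\<^sup>2 / 2)) + cmod (1 - s\<^sup>2 * u\<^sup>2 / 2)"
    using norm_triangle_sub[of "\<phi> u" "1 - s\<^sup>2 * u\<^sup>2 / 2"] by simp
  also have "cmod (1 - s\<^sup>2 * u\<^sup>2 / 2) = 1 - s\<^sup>2 * u\<^sup>2 / 2"
    using su by (simp only: norm_of_real)
  finally have "cmod (\<phi> u) \<le> 1 + (- (s\<^sup>2 * u\<^sup>2 / 4))" using approx[of u] ru by linarith
  also have "\<dots> \<le> ?q" by (rule exp_ge_add_one_self)
  finally have q1: "cmod (\<phi> u) \<le> ?q" .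
  have q2: "cmod (exp (- (s\<^sup>2 * u\<^sup>2 / 2)) :: real) \<le> ?q" by simp
  define x where "x = s\<^sup>2 * u\<^sup>2 / 2"
  have x: "0 \<le> x" "x \<le> 1" using su by (auto simp: x_def)
  have "\<bar>exp (- x) - (1 - x)\<bar> \<le> x\<^sup>2"
  proof -
    have "1 - x \<le> exp (- x)" using exp_ge_add_one_self[of "- x"] by simp
    moreover have "exp (- x) \<le> 1 - x + x\<^sup>2"
    proof -
      have "exp (- x) = 1 / exp x" by (simp add: exp_minus field_simps)
      also have "\<dots> \<le> 1 / (1 + x)" using x exp_ge_add_one_self[of x] by (intro divide_left_mono) auto
      also have "\<dots> \<le> 1 - x + x\<^sup>2" using x by (simp add: field_simps power2_eq_square)
      finally show ?thesis .
    qed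
    ultimately show ?thesis by (simp add: abs_le_iff)
  qed
  also have "x\<^sup>2 \<le> s ^ 4 * c * \<bar>u\<bar> ^ 3"
  proof -
    have "x\<^sup>2 = s ^ 4 * (\<bar>u\<bar> * \<bar>u\<bar> ^ 3) / 4"
      by (simp add: x_def power_divide power_mult_distrib flip: power_mult power_Suc)
    also have "\<dots> \<le> s ^ 4 * (\<bar>u\<bar> * \<bar>u\<bar> ^ 3) / 1" by (intro divide_left_mono) auto
    also have "\<dots> \<le> s ^ 4 * (c * \<bar>u\<bar> ^ 3)" using u by (simp add: mult_left_mono mult_right_mono)
    finally show ?thesis by simp
  qed
  finally have d2: "\<bar>exp (- x) - (1 - x)\<bar> \<le> s ^ 4 * c * \<bar>u\<bar> ^ 3" .
  have "cmod (\<phi> u - of_real (exp (- x))) \<le> cmod (\<phi> u - of_real (1 - s\<^sup>2 * u\<^sup>2 / 2)) + cmod (of_real (exp (- x) - (1 - x)))"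
    by (rule order_trans[OF _ norm_triangle_ineq4]) (simp add: x_def algebra_simps)
  also have "\<dots> \<le> r * \<bar>u\<bar> ^ 3 + s ^ 4 * c * \<bar>u\<bar> ^ 3"
    using approx[of u] d2 by (intro add_mono) (auto simp only: norm_of_real)
  finally have d: "cmod (\<phi> u - of_real (exp (- x))) \<le> (r + s ^ 4 * c) * \<bar>u\<bar> ^ 3" by (simp add: algebra_simps)
  have "cmod (\<phi> u ^ n - of_real (exp (- x)) ^ n) \<le> n * ?q ^ (n - 1) * cmod (\<phi> u - of_real (exp (- x)))"
    using q1 q2 n by (intro norm_power_diff_le) (auto simp: x_def)
  also have "\<dots> \<le> n * exp (- (s\<^sup>2 * u\<^sup>2 / 8 * n)) * ((r + s ^ 4 * c) * \<bar>u\<bar> ^ 3)"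
  proof (intro mult_mono d mult_left_mono)
    have "?q ^ (n - 1) = exp (- (s\<^sup>2 * u\<^sup>2 / 4 * (n - 1)))"
      by (simp flip: exp_of_nat_mult add: mult_ac)
    also have "\<dots> \<le> exp (- (s\<^sup>2 * u\<^sup>2 / 4 * (n / 2)))"
      using n by (subst exp_le_cancel_iff, subst neg_le_iff_le) (intro mult_left_mono, auto simp: of_nat_diff)
    finally show "?q ^ (n - 1) \<le> exp (- (s\<^sup>2 * u\<^sup>2 / 8 * n))" by simp
  qed (auto)
  finally show ?thesis by (simp add: x_def)
qed


lemma berry_esseen_smoothed:
  fixes \<phi> :: "real \<Rightarrow> complex"
  assumes approx: "\<And>t. cmod (\<phi> t - of_real (1 - s\<^sup>2 * t\<^sup>2 / 2)) \<le> r * \<bar>t\<bar> ^ 3" and s: "s > 0"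
    and le1: "\<And>t. cmod (\<phi> t) \<le> 1"
  obtains C K where "C > 0" "K > 0"
    "\<And>(n :: nat) M x. n \<ge> 2 \<Longrightarrow> real_distribution M \<Longrightarrow> (\<And>x. measure M {x} = 0) \<Longrightarrow>
      (\<And>t. char M t = \<phi> (t / sqrt n) ^ n * exp (- (K * ln n / n * t\<^sup>2 / 2))) \<Longrightarrow>
      \<bar>cdf M x - cdf (density lborel (normal_density 0 s)) x\<bar> \<le> C * sqrt (ln n) / sqrt n"
proof -
  have r: "r \<ge> 0" using order_trans[OF norm_ge_zero approx[of 1]] by simp
  define c where "c = min (1 / s) (s\<^sup>2 / (4 * (r + 1)))"
  have c: "c > 0" "s * c \<le> 1" "r * c \<le> s\<^sup>2 / 4"
  proof -
    show "c > 0" using s r by (simp add: c_def)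
    have "s * c \<le> s * (1 / s)" using s by (intro mult_left_mono) (auto simp: c_def)
    then show "s * c \<le> 1" using s by simp
    have "r * c \<le> (r + 1) * (s\<^sup>2 / (4 * (r + 1)))" using r \<open>c > 0\<close> by (intro mult_mono) (auto simp: c_def)
    also have "(r + 1) * (s\<^sup>2 / (4 * (r + 1))) = s\<^sup>2 / 4" using r by (simp add: divide_simps)
    finally show "r * c \<le> s\<^sup>2 / 4" .
  qed
  define K where "K = 4 / c\<^sup>2"
  have K: "K > 0" using c by (simp add: K_def)
  define r' where "r' = r + s ^ 4 * c"
  have r': "r' \<ge> 0" using r s c by (simp add: r'_def)
  define I1 where "I1 = (\<integral>t. exp (- (s\<^sup>2 / 8) * t\<^sup>2) * \<bar>t\<bar> ^ 2 \<partial>lborel)"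
  define I2 where "I2 = (\<integral>t. exp (- (s\<^sup>2 / 2) * t\<^sup>2) * \<bar>t\<bar> ^ 1 \<partial>lborel)"
  have I: "I1 \<ge> 0" "I2 \<ge> 0" by (auto simp: I1_def I2_def intro!: integral_nonneg_AE)
  define C where "C = r' * I1 / sqrt (ln 2) + K * I2 + 2 / c * sqrt (4 * pi / K) / ln 2 + 1"
  have ln2: "ln 2 > (0::real)" by simp
  have "C > 0" using r' I K c by (simp add: C_def add_nonneg_pos)
  show ?thesis
  proof (rule that[OF \<open>C > 0\<close> K])
    fix n :: nat and M x
    assume n: "n \<ge> 2" and M: "real_distribution M" and na: "\<And>x. measure M {x} = 0"
      and ch: "\<And>t. char M t = \<phi> (t / sqrt n) ^ n * exp (- (K * ln n / n * t\<^sup>2 / 2))"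
    let ?N = "density lborel (normal_density 0 s)"
    have N: "real_distribution ?N"
      using prob_space_normal_density[OF s] by (auto simp: real_distribution_def real_distribution_axioms_def)
    have naN: "measure ?N {x} = 0" for x
    proof -
      have "emeasure ?N {x} = 0" by (subst emeasure_density) (auto simp: nn_integral_cmult_indicator intro!: nn_integral_0_iff_AE[THEN iffD2] AE_I[of _ _ "{x}"] split: split_indicator)
      then show ?thesis by (simp add: measure_def)
    qed
    define a where "a = K * ln n / n"
    have lnn: "ln n > 0" "ln n \<ge> ln 2" using n by auto
    have a: "a > 0" using K n lnn by (simp add: a_def)
    define B1 where "B1 t = r' / sqrt n * (exp (- (s\<^sup>2 / 8) * t\<^sup>2) * \<bar>t\<bar> ^ 2)" for t
    define B2 where "B2 t = a / 2 * (exp (- (s\<^sup>2 / 2) * t\<^sup>2) * \<bar>t\<bar> ^ 1)" for t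
    define B3 where "B3 t = 2 / (c * sqrt n) / n * (exp (- (a / 4) * t\<^sup>2) * \<bar>t\<bar> ^ 0)" for t
    have int: "integrable lborel B1" "integrable lborel B2" "integrable lborel B3"
      unfolding B1_def B2_def B3_def
      by (rule integrable_mult_right, rule exp_square_integral(1), use s a in simp)+
    have nn: "B1 t \<ge> 0" "B2 t \<ge> 0" "B3 t \<ge> 0" for t
      using r' a c by (auto simp: B1_def B2_def B3_def)
    have "\<bar>cdf M x - cdf ?N x\<bar> \<le> (\<integral>t. B1 t + B2 t + B3 t \<partial>lborel)"
    proof (rule cdf_diff_le_char[OF M N na naN])
      show "integrable lborel (\<lambda>t. B1 t + B2 t + B3 t)" using int by auto
      fix t :: real
      define u where "u = t / sqrt n"
      have su: "s\<^sup>2 * u\<^sup>2 * n = s\<^sup>2 * t\<^sup>2" using n by (simp add: u_def power_divide)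
      let ?e = "exp (- (a * t\<^sup>2 / 2))" and ?w = "exp (- (s\<^sup>2 * u\<^sup>2 / 2))"
      have e: "?e \<le> 1" "?e > 0" using a by auto
      have wn: "?w ^ n = exp (- (s\<^sup>2 * t\<^sup>2 / 2))"
        using su by (simp flip: exp_of_nat_mult) (simp add: algebra_simps)
      have "cmod (char M t - char ?N t) = cmod ((\<phi> u ^ n - ?w ^ n) * ?e - of_real (?w ^ n * (1 - ?e)))"
      proof -
        have "char M t = \<phi> u ^ n * ?e" by (simp add: ch a_def u_def)
        moreover have "char ?N t = of_real (?w ^ n)" by (simp only: char_normal_density[OF s] wn)
        ultimately show ?thesis by (simp add: algebra_simps)
      qed
      also have "\<dots> \<le> cmod (\<phi> u ^ n - ?w ^ n) * ?e + ?w ^ n * (1 - ?e)"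
      proof -
        have "0 \<le> ?w ^ n * (1 - ?e)" using e by simp
        then have "cmod (of_real (?w ^ n * (1 - ?e))) = ?w ^ n * (1 - ?e)" by (simp only: norm_of_real abs_of_nonneg)
        moreover have "cmod ((\<phi> u ^ n - ?w ^ n) * ?e) = cmod (\<phi> u ^ n - ?w ^ n) * ?e" by (simp add: norm_mult)
        ultimately show ?thesis using norm_triangle_ineq4 by metis
      qed
      also have "\<dots> \<le> \<bar>t\<bar> * (B1 t + B3 t) + \<bar>t\<bar> * B2 t"
      proof (rule add_mono)
        have "1 - ?e \<le> a * t\<^sup>2 / 2" using exp_ge_add_one_self[of "- (a * t\<^sup>2 / 2)"] by simp
        then have "?w ^ n * (1 - ?e) \<le> ?w ^ n * (a * t\<^sup>2 / 2)" by (intro mult_left_mono) auto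
        also have "\<dots> = \<bar>t\<bar> * B2 t" unfolding wn by (simp add: B2_def power2_eq_square abs_mult_self_eq)
        finally show "?w ^ n * (1 - ?e) \<le> \<bar>t\<bar> * B2 t" .
        show "cmod (\<phi> u ^ n - ?w ^ n) * ?e \<le> \<bar>t\<bar> * (B1 t + B3 t)"
        proof (cases "\<bar>u\<bar> \<le> c")
          case True
          have "cmod (\<phi> u ^ n - ?w ^ n) * ?e \<le> cmod (\<phi> u ^ n - ?w ^ n) * 1"
            using e by (intro mult_left_mono) auto
          also have "\<dots> \<le> n * exp (- (s\<^sup>2 * u\<^sup>2 / 8 * n)) * (r' * \<bar>u\<bar> ^ 3)"
            using power_char_diff_le[OF approx s r c True n] by (simp add: r'_def)
          also have "exp (- (s\<^sup>2 * u\<^sup>2 / 8 * n)) = exp (- (s\<^sup>2 / 8) * t\<^sup>2)" using su by simp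
          also have "n * exp (- (s\<^sup>2 / 8) * t\<^sup>2) * (r' * \<bar>u\<bar> ^ 3) = \<bar>t\<bar> * B1 t"
          proof -
            have "n * \<bar>u\<bar> ^ 3 = \<bar>t\<bar> ^ 3 / sqrt n"
              using n by (simp add: u_def power3_eq_cube field_simps)
            moreover have "n * exp (- (s\<^sup>2 / 8) * t\<^sup>2) * (r' * \<bar>u\<bar> ^ 3) = exp (- (s\<^sup>2 / 8) * t\<^sup>2) * r' * (n * \<bar>u\<bar> ^ 3)"
              by (simp only: mult_ac)
            ultimately show ?thesis by (simp add: B1_def power3_eq_cube power2_eq_square)
          qed
          also have "\<dots> \<le> \<bar>t\<bar> * (B1 t + B3 t)" using nn by (intro mult_left_mono) auto
          finally show ?thesis .
        next
          case False
          have "cmod (\<phi> u ^ n - ?w ^ n) \<le> 1 + 1"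
            by (intro order_trans[OF norm_triangle_ineq4] add_mono) (auto simp: norm_power power_le_one le1 simp flip: of_real_power)
          then have "cmod (\<phi> u ^ n - ?w ^ n) * ?e \<le> 2 * ?e" using e by (intro mult_right_mono) auto
          also have "2 * ?e \<le> 2 * (exp (- (a / 4) * t\<^sup>2) * (1 / n))"
          proof -
            have "?e = exp (- (a / 4) * t\<^sup>2 + - (a * t\<^sup>2 / 4))"
              by (rule arg_cong[where f=exp]) (simp add: field_simps)
            also have "\<dots> = exp (- (a / 4) * t\<^sup>2) * exp (- (a * t\<^sup>2 / 4))"
              by (rule exp_add)
            also have "exp (- (a * t\<^sup>2 / 4)) \<le> 1 / n"
            proof -
              have "a * t\<^sup>2 / 4 = ln n * (u\<^sup>2 / c\<^sup>2)" using n by (simp add: a_def K_def u_def power_divide)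
              also have "\<dots> \<ge> ln n * 1"
                using False c lnn power_mono[of c "\<bar>u\<bar>" 2] by (intro mult_left_mono) auto
              finally have "exp (- (a * t\<^sup>2 / 4)) \<le> exp (- ln n)" by simp
              then show ?thesis using n by (simp add: exp_minus field_simps)
            qed
            finally show ?thesis by simp
          qed
          also have "\<dots> \<le> 2 * (exp (- (a / 4) * t\<^sup>2) * (1 / n)) * (\<bar>t\<bar> / (c * sqrt n))"
          proof -
            have "c < \<bar>t\<bar> / sqrt n" using False n by (simp add: u_def abs_divide)
            then have "1 \<le> \<bar>t\<bar> / (c * sqrt n)" using c n by (simp add: less_divide_eq le_divide_eq)
            from mult_left_mono[OF this, of "2 * (exp (- (a / 4) * t\<^sup>2) * (1 / n))"] show ?thesis by simp
          qed
          also have "\<dots> = \<bar>t\<bar> * B3 t" by (simp add: B3_def mult_ac)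
          also have "\<dots> \<le> \<bar>t\<bar> * (B1 t + B3 t)" using nn by (intro mult_left_mono) auto
          finally show ?thesis .
        qed
      qed
      also have "\<dots> = \<bar>t\<bar> * (B1 t + B2 t + B3 t)" by (simp add: algebra_simps)
      finally show "cmod (char M t - char ?N t) \<le> \<bar>t\<bar> * (B1 t + B2 t + B3 t)" .
    qed
    also have "\<dots> = (\<integral>t. B1 t \<partial>lborel) + (\<integral>t. B2 t \<partial>lborel) + (\<integral>t. B3 t \<partial>lborel)"
      using int by simp
    also have "(\<integral>t. B1 t \<partial>lborel) = r' / sqrt n * I1" unfolding B1_def I1_def by (rule integral_mult_right_zero)
    also have "(\<integral>t. B2 t \<partial>lborel) = a / 2 * I2" unfolding B2_def I2_def by (rule integral_mult_right_zero)
    also have "(\<integral>t. B3 t \<partial>lborel) = 2 / (c * sqrt n) / n * sqrt (pi / (a / 4))"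
      using exp_square_integral(2)[of "a / 4"] a unfolding B3_def by simp
    finally have *: "\<bar>cdf M x - cdf ?N x\<bar> \<le> r' / sqrt n * I1 + a / 2 * I2 + 2 / (c * sqrt n) / n * sqrt (pi / (a / 4))" .
    define b where "b = sqrt (ln n) / sqrt n"
    have b: "0 \<le> b" "b \<le> 1" "b\<^sup>2 = ln n / n"
      using lnn n ln_le_minus_one[of "real n"] by (auto simp: b_def power_divide)
    have ib: "1 / sqrt n \<le> b / sqrt (ln 2)"
      using n lnn by (simp add: b_def field_simps)
    have t1: "r' / sqrt n * I1 \<le> r' * I1 / sqrt (ln 2) * b"
      using mult_left_mono[OF ib, of "r' * I1"] r' I by (simp add: mult_ac)
    have t2: "a / 2 * I2 \<le> K * I2 * b"
    proof -
      have "a / 2 * I2 = K * I2 * (b\<^sup>2 / 2)" by (simp add: a_def b)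
      also have "\<dots> \<le> K * I2 * b"
      proof (rule mult_left_mono)
        have "b\<^sup>2 \<le> b" using b(1,2) by (simp add: power2_eq_square mult_left_le)
        then show "b\<^sup>2 / 2 \<le> b" using b(1) by linarith
      qed (use K I in simp)
      finally show ?thesis .
    qed
    have t3: "2 / (c * sqrt n) / n * sqrt (pi / (a / 4)) \<le> 2 / c * sqrt (4 * pi / K) / ln 2 * b"
    proof -
      have cancel: "2 / (c * x) / n * (y * (x / z)) = 2 / c * y * (1 / (n * z))" if "x > 0" for x y z :: real
        using that by simp
      have "pi / (a / 4) = 4 * pi / K * (n / ln n)" by (simp add: a_def)
      then have "sqrt (pi / (a / 4)) = sqrt (4 * pi / K) * (sqrt n / sqrt (ln n))"
        by (simp only: real_sqrt_mult real_sqrt_divide)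
      then have "2 / (c * sqrt n) / n * sqrt (pi / (a / 4)) = 2 / (c * sqrt n) / n * (sqrt (4 * pi / K) * (sqrt n / sqrt (ln n)))"
        by (rule arg_cong)
      also have "\<dots> = 2 / c * sqrt (4 * pi / K) * (1 / (n * sqrt (ln n)))"
        by (rule cancel) (use n in simp)
      also have "\<dots> \<le> 2 / c * sqrt (4 * pi / K) * (b / ln 2)"
      proof (intro mult_left_mono)
        have "1 / (n * sqrt (ln n)) \<le> 1 / (sqrt n * sqrt (ln n))"
        proof (intro divide_left_mono mult_right_mono)
          show "sqrt n \<le> n" using n by (intro real_le_lsqrt) (auto simp: power2_eq_square)
        qed (use n lnn in auto)
        also have "\<dots> = b / ln n"
        proof -
          have "1 / (x * y) = y / x / (y * y)" if "y > 0" for x y :: real using that by simp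
          from this[of "sqrt (ln n)" "sqrt n"] lnn show ?thesis by (simp only: b_def real_sqrt_gt_0_iff real_sqrt_mult_self abs_of_pos)
        qed
        also have "\<dots> \<le> b / ln 2" using lnn b by (intro divide_left_mono) auto
        finally show "1 / (n * sqrt (ln n)) \<le> b / ln 2" .
      qed (use c K in auto)
      finally show ?thesis by simp
    qed
    have "\<bar>cdf M x - cdf ?N x\<bar> \<le> C * b"
      unfolding C_def distrib_right using * t1 t2 t3 b(1) by linarith
    then show "\<bar>cdf M x - cdf ?N x\<bar> \<le> C * sqrt (ln n) / sqrt n" by (simp add: b_def)
  qed
qed

lemma kolmogorov_deconvolution:
  fixes \<Phi> :: "real \<Rightarrow> real"
  assumes V: "real_distribution V" and W: "real_distribution W"
    and \<Phi>: "mono \<Phi>" "\<And>t. 0 \<le> \<Phi> t" "\<And>t. \<Phi> t \<le> 1"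
    and lip: "\<And>s t. s \<le> t \<Longrightarrow> \<Phi> t - \<Phi> s \<le> L * (t - s)" and L: "L > 0"
    and conv: "\<And>t. \<bar>(\<integral>w. cdf V (t - w) \<partial>W) - \<Phi> t\<bar> \<le> \<epsilon>"
    and \<kappa>: "(\<integral>w. min 1 (L * \<bar>w\<bar>) \<partial>W) \<le> \<kappa>" "\<kappa> > 0"
  shows "\<bar>cdf V t - \<Phi> t\<bar> \<le> 2 * \<epsilon> + 14 * \<kappa>"
proof (cases "\<kappa> \<ge> 1 / 4")
  case True
  interpret V: real_distribution V by fact
  have "\<bar>cdf V t - \<Phi> t\<bar> \<le> 1"
    using \<Phi>(2,3)[of t] V.cdf_nonneg[of t] V.cdf_bounded_prob[of t] by linarith
  moreover have "\<epsilon> \<ge> 0" using conv[of 0] by linarith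
  ultimately show ?thesis using True by linarith
next
  case False
  interpret V: real_distribution V by fact
  interpret W: real_distribution W by fact
  have [measurable]: "cdf V \<in> borel_measurable borel" "\<Phi> \<in> borel_measurable borel"
    using \<Phi>(1) V.cdf_nondecreasing by (auto intro!: borel_measurable_mono monoI)
  define f where "f t = cdf V t - \<Phi> t" for t
  have [measurable]: "f \<in> borel_measurable borel" unfolding f_def by measurable
  have f1: "\<bar>f t\<bar> \<le> 1" for t
    unfolding f_def using \<Phi>(2,3)[of t] V.cdf_nonneg[of t] V.cdf_bounded_prob[of t] by linarith
  define \<Delta> where "\<Delta> = (SUP t. \<bar>f t\<bar>)"
  have f\<Delta>: "\<bar>f t\<bar> \<le> \<Delta>" for t
    unfolding \<Delta>_def by (rule cSUP_upper) (use f1 in \<open>auto intro!: bdd_aboveI2[where M=1]\<close>)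
  have int1: "integrable W (\<lambda>w. cdf V (t - w))" "integrable W (\<lambda>w. \<Phi> (t - w))" for t
    using \<Phi>(2,3) V.cdf_nonneg V.cdf_bounded_prob
    by (auto intro!: W.integrable_const_bound[where B=1] AE_I2)
  have intm: "integrable W (\<lambda>w. min 1 (L * \<bar>w\<bar>))"
    using L by (auto intro!: W.integrable_const_bound[where B=1] AE_I2)
  have lip': "\<bar>\<Phi> (t - w) - \<Phi> t\<bar> \<le> min 1 (L * \<bar>w\<bar>)" for t w
    using lip[of "t - w" t] lip[of t "t - w"] monoD[OF \<Phi>(1), of t "t - w"] monoD[OF \<Phi>(1), of "t - w" t]
      \<Phi>(2,3)[of t] \<Phi>(2,3)[of "t - w"]
    by (cases "w \<ge> 0") (auto simp: abs_if)
  have Ef: "\<bar>\<integral>w. f (t - w) \<partial>W\<bar> \<le> \<epsilon> + \<kappa>" for t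
  proof -
    have "(\<integral>w. f (t - w) \<partial>W) = (\<integral>w. cdf V (t - w) \<partial>W) - \<Phi> t - (\<integral>w. \<Phi> (t - w) - \<Phi> t \<partial>W)"
      unfolding f_def using int1[of t] by (simp add: W.prob_space[unfolded W.space_eq_univ])
    moreover have "\<bar>\<integral>w. \<Phi> (t - w) - \<Phi> t \<partial>W\<bar> \<le> (\<integral>w. min 1 (L * \<bar>w\<bar>) \<partial>W)"
      using int1 intm lip' by (intro order_trans[OF integral_abs_bound] integral_mono) auto
    ultimately show ?thesis using conv[of t] \<kappa>(1) by linarith
  qed
  let ?bad = "{w \<in> space W. 4 * \<kappa> \<le> min 1 (L * \<bar>w\<bar>)}"
  have bad: "W.prob ?bad \<le> 1 / 4"
  proof -
    have "W.prob ?bad \<le> (\<integral>w. min 1 (L * \<bar>w\<bar>) \<partial>W) / (4 * \<kappa>)"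
      using L \<kappa>(2) by (intro integral_Markov_inequality_measure[OF intm, of UNIV]) auto
    also have "\<dots> \<le> \<kappa> / (4 * \<kappa>)" using \<kappa> by (intro divide_right_mono) auto
    finally show ?thesis using \<kappa> by simp
  qed
  have [measurable]: "?bad \<in> sets W" by measurable
  have le: "3 / 4 * \<bar>f t\<bar> \<le> \<epsilon> + 7 * \<kappa> + \<Delta> / 4" for t
  proof (cases "\<bar>f t\<bar> - 8 * \<kappa> + \<Delta> \<ge> 0")
    case False
    with f\<Delta>[of t] conv[of 0] \<kappa> show ?thesis by linarith
  next
    case True
    define a where "a = 4 * \<kappa> / L"
    have La: "L * a = 4 * \<kappa>" "a > 0" using L \<kappa> by (auto simp: a_def)
    have good: "\<bar>w\<bar> \<le> a" if "w \<notin> ?bad" for w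
      using that L \<open>\<not> 1 / 4 \<le> \<kappa>\<close> by (auto simp: a_def field_simps)
    have ib: "integrable W (\<lambda>w. c - d * indicator ?bad w :: real)" for c d
      by (intro W.integrable_const_bound[where B="\<bar>c\<bar> + \<bar>d\<bar>"] AE_I2) (auto split: split_indicator)
    define b where "b = (\<bar>f t\<bar> - 8 * \<kappa> + \<Delta>)"
    have key: "(\<bar>f t\<bar> - 8 * \<kappa>) - b / 4 \<le> (\<integral>w. (\<bar>f t\<bar> - 8 * \<kappa>) - b * indicator ?bad w \<partial>W)"
    proof -
      have "(\<integral>w. (\<bar>f t\<bar> - 8 * \<kappa>) - b * indicator ?bad w \<partial>W) = (\<bar>f t\<bar> - 8 * \<kappa>) - b * W.prob ?bad"
      proof -
        have "integrable W (\<lambda>w. indicator ?bad w :: real)"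
          by (intro W.integrable_const_bound[where B=1] AE_I2) (auto split: split_indicator)
        then show ?thesis
          by (subst Bochner_Integration.integral_diff) (auto simp: W.prob_space[unfolded W.space_eq_univ])
      qed
      moreover have "b * W.prob ?bad \<le> b * (1 / 4)"
        using bad True by (intro mult_left_mono) (auto simp: b_def)
      ultimately show ?thesis by linarith
    qed
    have arith: "3 / 4 * x \<le> e + 7 * k + D / 4"
      if "(x - 8 * k) - (x - 8 * k + D) / 4 \<le> I" "I \<le> J" "\<bar>J\<bar> \<le> e + k" for x e k D I J :: real
      using that by argo
    show ?thesis
    proof (cases "f t \<ge> 0")
      case True
      have "(\<integral>w. (\<bar>f t\<bar> - 8 * \<kappa>) - b * indicator ?bad w \<partial>W) \<le> (\<integral>w. f (t + a - w) \<partial>W)"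
      proof (rule integral_mono)
        fix w
        show "(\<bar>f t\<bar> - 8 * \<kappa>) - b * indicator ?bad w \<le> f (t + a - w)"
        proof (cases "w \<in> ?bad")
          case True
          then show ?thesis using f\<Delta>[of "t + a - w"] by (simp add: b_def)
        next
          case False
          from good[OF False] have w: "t \<le> t + a - w" "t + a - w \<le> t + 2 * a" by auto
          have "\<Phi> (t + a - w) - \<Phi> t \<le> L * (2 * a)"
            using lip[OF w(1)] w(2) L by (elim order_trans) (intro mult_left_mono, auto)
          with False show ?thesis
            using V.cdf_nondecreasing[OF w(1)] La \<open>f t \<ge> 0\<close> by (simp add: f_def)
        qed
      qed (rule ib, auto intro!: W.integrable_const_bound[where B=1] AE_I2 f1)
      from arith[OF key[unfolded b_def] this[unfolded b_def] Ef[of "t + a"]] show ?thesis .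
    next
      case False
      have "(\<integral>w. (\<bar>f t\<bar> - 8 * \<kappa>) - b * indicator ?bad w \<partial>W) \<le> (\<integral>w. - f (t - a - w) \<partial>W)"
      proof (rule integral_mono)
        fix w
        show "(\<bar>f t\<bar> - 8 * \<kappa>) - b * indicator ?bad w \<le> - f (t - a - w)"
        proof (cases "w \<in> ?bad")
          case True
          then show ?thesis using f\<Delta>[of "t - a - w"] by (simp add: b_def)
        next
          case False
          from good[OF False] have w: "t - a - w \<le> t" "t - 2 * a \<le> t - a - w" by auto
          have "\<Phi> t - \<Phi> (t - a - w) \<le> L * (2 * a)"
            using lip[OF w(1)] w(2) L by (elim order_trans) (intro mult_left_mono, auto)
          with False show ?thesis
            using V.cdf_nondecreasing[OF w(1)] La \<open>\<not> f t \<ge> 0\<close> by (simp add: f_def)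
        qed
      qed (rule ib, auto intro!: W.integrable_const_bound[where B=1] AE_I2 f1)
      then have "(\<integral>w. (\<bar>f t\<bar> - 8 * \<kappa>) - b * indicator ?bad w \<partial>W) \<le> - (\<integral>w. f (t - a - w) \<partial>W)"
        by simp
      from arith[OF key[unfolded b_def] this[unfolded b_def]] Ef[of "t - a"] show ?thesis by simp
    qed
  qed
  have "(SUP t. \<bar>f t\<bar>) \<le> 4 / 3 * (\<epsilon> + 7 * \<kappa> + \<Delta> / 4)"
  proof (rule cSUP_least)
    fix x show "\<bar>f x\<bar> \<le> 4 / 3 * (\<epsilon> + 7 * \<kappa> + \<Delta> / 4)" using le[of x] by argo
  qed simp
  then have "\<Delta> \<le> 4 / 3 * (\<epsilon> + 7 * \<kappa> + \<Delta> / 4)" by (simp only: \<Delta>_def)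
  with f\<Delta>[of t, unfolded f_def] show ?thesis by argo
qed

section \<open>Moments of the p-Gaussian distribution\<close>

lemma generalized_gaussian_moment:
  fixes a p :: real
  assumes a: "a > 0" and p: "p > 0"
  shows "has_bochner_integral lborel (\<lambda>x. \<bar>x\<bar> powr (a - 1) * exp (- (\<bar>x\<bar> powr p) / p))
    (2 * (p powr (a / p - 1) * Gamma (a / p)))"
proof -
  define f where "f t = t powr (a / p - 1) / exp t" for t :: real
  define g where "g x = x powr p / p" for x :: real
  have ap: "a / p > 0" using assms by simp
  have img: "g ` {0<..} = {0<..}"
  proof safe
    fix y :: real assume "y > 0"
    then have "y = g ((p * y) powr (1 / p))" using p by (simp add: g_def powr_powr)
    then show "y \<in> g ` {0<..}" using \<open>y > 0\<close> p by (intro image_eqI[of _ _ "(p * y) powr (1 / p)"]) auto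
  qed (use p in \<open>auto simp: g_def\<close>)
  have inj: "inj_on g {0<..}"
  proof (rule inj_on_inverseI)
    fix x :: real assume "x \<in> {0<..}"
    then show "(p * g x) powr (1 / p) = x" using p by (simp add: g_def powr_powr)
  qed
  have der: "(g has_field_derivative x powr (p - 1)) (at x within {0<..})" if "x \<in> {0<..}" for x
    using that p unfolding g_def by (auto intro!: derivative_eq_intros)
  have "(f has_integral Gamma (a / p)) {0..}"
    unfolding f_def using Gamma_integral_real[OF ap] .
  then have G: "(f has_integral Gamma (a / p)) {0<..}"
    by (rule has_integral_spike_set_eq[THEN iffD1, rotated -1])
       (auto intro!: negligible_subset[OF negligible_sing[of 0]])
  then have "f absolutely_integrable_on {0<..}"
    by (intro nonnegative_absolutely_integrable_1) (auto simp: f_def integrable_on_def)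
  then have 1: "(\<lambda>x. \<bar>x powr (p - 1)\<bar> * f (g x)) absolutely_integrable_on {0<..} \<and>
      integral {0<..} (\<lambda>x. \<bar>x powr (p - 1)\<bar> * f (g x)) = Gamma (a / p)"
    using has_absolute_integral_change_of_variables_1'[OF _ der inj, of f "Gamma (a / p)"] G
    by (auto simp: img integral_unique)
  have eq: "\<bar>x powr (p - 1)\<bar> * f (g x) = p powr (1 - a / p) * (x powr (a - 1) * exp (- (x powr p) / p))" if "x \<in> {0<..}" for x
  proof -
    have x: "x > 0" using that by simp
    have "f (g x) = (x powr (p * (a / p - 1)) / p powr (a / p - 1)) * exp (- (x powr p) / p)"
      using p x by (simp add: f_def g_def powr_divide powr_powr exp_minus field_simps)
    moreover have "x powr (p - 1) * x powr (p * (a / p - 1)) = x powr (a - 1)"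
      using p by (simp add: powr_add[symmetric] field_simps)
    moreover have "1 / p powr (a / p - 1) = p powr (1 - a / p)"
      using powr_minus_divide[of p "a / p - 1"] by simp
    moreover have "A * (B / D * E) = (1 / D) * ((A * B) * E)" for A B D E :: real by simp
    ultimately show ?thesis by (metis abs_of_nonneg powr_ge_zero)
  qed
  define h where "h x = \<bar>x\<bar> powr (a - 1) * exp (- (\<bar>x\<bar> powr p) / p)" for x :: real
  have [measurable]: "h \<in> borel_measurable borel" unfolding h_def by measurable
  have 2: "set_integrable lborel {0<..} (\<lambda>x. p powr (1 - a / p) * h x)"
      "(LINT x:{0<..}|lborel. p powr (1 - a / p) * h x) = Gamma (a / p)"
  proof -
    have A: "(\<lambda>x. p powr (1 - a / p) * h x) absolutely_integrable_on {0<..}"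
      using 1[THEN conjunct1] by (rule set_integrable_cong[THEN iffD1, rotated -1]) (use eq in \<open>auto simp: h_def\<close>)
    have "integral {0<..} (\<lambda>x. p powr (1 - a / p) * h x) = integral {0<..} (\<lambda>x. \<bar>x powr (p - 1)\<bar> * f (g x))"
      by (rule integral_cong) (use eq in \<open>auto simp: h_def\<close>)
    also have "\<dots> = Gamma (a / p)" using 1 by simp
    finally have B: "integral {0<..} (\<lambda>x. p powr (1 - a / p) * h x) = Gamma (a / p)" .
    show "set_integrable lborel {0<..} (\<lambda>x. p powr (1 - a / p) * h x)"
      using A unfolding set_integrable_def by (subst (asm) integrable_completion) auto
    then have "(LINT x:{0<..}|lborel. p powr (1 - a / p) * h x) = integral {0<..} (\<lambda>x. p powr (1 - a / p) * h x)"
      by (rule set_borel_integral_eq_integral)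
    then show "(LINT x:{0<..}|lborel. p powr (1 - a / p) * h x) = Gamma (a / p)" by (simp only: B)
  qed
  have "has_bochner_integral lborel (\<lambda>x. p powr (a / p - 1) * (indicator {0<..} x *\<^sub>R (p powr (1 - a / p) * h x))) (p powr (a / p - 1) * Gamma (a / p))"
    using 2 unfolding set_integrable_def set_lebesgue_integral_def
    by (intro has_bochner_integral_mult_right) (auto simp: has_bochner_integral_iff)
  moreover have "p powr (a / p - 1) * p powr (1 - a / p) = 1"
    using p by (simp add: powr_add[symmetric])
  then have "(\<lambda>x. p powr (a / p - 1) * (indicator {0<..} x *\<^sub>R (p powr (1 - a / p) * h x))) = (\<lambda>x. indicator {0..} x *\<^sub>R h x)"
    by (auto simp: fun_eq_iff h_def split: split_indicator)
  ultimately have "has_bochner_integral lborel h (2 *\<^sub>R (p powr (a / p - 1) * Gamma (a / p)))"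
    by (intro has_bochner_integral_even_function) (auto simp: h_def)
  then show ?thesis by (simp add: h_def[abs_def])
qed

abbreviation p_gaussian_density :: "real \<Rightarrow> real \<Rightarrow> real" where
  "p_gaussian_density p x \<equiv> exp (- (\<bar>x\<bar> powr p) / p) / (2 * p powr (1 / p) * Gamma (1 + 1 / p))"

lemma sets_p_gaussian [measurable_cong, simp]: "sets (p_gaussian p) = sets borel"
  by (simp add: p_gaussian_def)

lemma space_p_gaussian [simp]: "space (p_gaussian p) = UNIV"
  by (simp add: p_gaussian_def)

lemma p_gaussian_moment:
  assumes p: "p \<ge> 1" and b: "b > -1"
  shows "has_bochner_integral (p_gaussian p) (\<lambda>x. \<bar>x\<bar> powr b)
    (p powr ((b + 1) / p - 1 - 1 / p) * Gamma ((b + 1) / p) / Gamma (1 + 1 / p))"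
proof -
  have G: "Gamma (1 + 1 / p) > 0" using p by (intro Gamma_real_pos) (auto intro: add_pos_nonneg)
  define C where "C = 2 * p powr (1 / p) * Gamma (1 + 1 / p)"
  have C: "C > 0" using G p by (simp add: C_def)
  have "has_bochner_integral lborel (\<lambda>x. \<bar>x\<bar> powr (b + 1 - 1) * exp (- (\<bar>x\<bar> powr p) / p) / C)
    (2 * (p powr ((b + 1) / p - 1) * Gamma ((b + 1) / p)) / C)"
    using p b by (intro has_bochner_integral_divide_zero generalized_gaussian_moment) auto
  then have "has_bochner_integral lborel (\<lambda>x. (exp (- (\<bar>x\<bar> powr p) / p) / C) *\<^sub>R \<bar>x\<bar> powr b)
    (2 * (p powr ((b + 1) / p - 1) * Gamma ((b + 1) / p)) / C)"
    by (simp add: mult_ac)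
  then have "has_bochner_integral (p_gaussian p) (\<lambda>x. \<bar>x\<bar> powr b) (2 * (p powr ((b + 1) / p - 1) * Gamma ((b + 1) / p)) / C)"
    unfolding p_gaussian_def C_def[symmetric] using C by (intro has_bochner_integral_density) auto
  also have "2 * (p powr ((b + 1) / p - 1) * Gamma ((b + 1) / p)) / C =
      p powr ((b + 1) / p - 1 - 1 / p) * Gamma ((b + 1) / p) / Gamma (1 + 1 / p)"
    unfolding C_def powr_diff[of p _ "1 / p"] by simp
  finally show ?thesis .
qed

lemma AE_p_gaussian_nonzero: "AE x in p_gaussian p. x \<noteq> 0"
  unfolding p_gaussian_def by (subst AE_density) (auto intro: AE_mp[OF AE_lborel_singleton[of 0]])

lemma p_gaussian_prob_space:
  assumes p: "p \<ge> 1"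
  shows "prob_space (p_gaussian p)"
proof
  have G: "Gamma (1 + 1 / p) > 0" using p by (intro Gamma_real_pos) (auto intro: add_pos_nonneg)
  have "p powr (- 1) * Gamma (1 / p) = Gamma (1 + 1 / p)"
  proof -
    have "1 / p \<notin> \<int>\<^sub>\<le>\<^sub>0" using p by (auto dest!: nonpos_Ints_nonpos)
    then show ?thesis using Gamma_plus1[of "1 / p"] p by (simp add: add.commute powr_minus divide_inverse)
  qed
  then have hb: "has_bochner_integral (p_gaussian p) (\<lambda>x. \<bar>x\<bar> powr 0) 1"
    using p_gaussian_moment[OF p, of 0] G by simp
  have "emeasure (p_gaussian p) (space (p_gaussian p)) = (\<integral>\<^sup>+x. 1 \<partial>p_gaussian p)"
    by simp
  also have "\<dots> = (\<integral>\<^sup>+x. ennreal (\<bar>x\<bar> powr 0) \<partial>p_gaussian p)"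
    by (intro nn_integral_cong_AE) (use AE_p_gaussian_nonzero in \<open>auto elim!: eventually_mono\<close>)
  also have "\<dots> = 1"
    using hb by (subst nn_integral_eq_integral) (auto simp: has_bochner_integral_iff)
  finally show "emeasure (p_gaussian p) (space (p_gaussian p)) = 1" .
qed

lemma p_gaussian_abs_moment_p:
  assumes p: "p \<ge> 1"
  shows "(\<integral>x. \<bar>x\<bar> powr p \<partial>p_gaussian p) = 1"
proof -
  have G: "Gamma (1 + 1 / p) > 0" using p by (intro Gamma_real_pos) (auto intro: add_pos_nonneg)
  have "(p + 1) / p = 1 + 1 / p" using p by (simp add: field_simps)
  then show ?thesis
    using p_gaussian_moment[OF p, of p] p G by (simp add: has_bochner_integral_iff)
qed

lemma p_gaussian_integrable_powr:
  assumes "p \<ge> 1" "b > -1"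
  shows "integrable (p_gaussian p) (\<lambda>x. \<bar>x\<bar> powr b)"
  using p_gaussian_moment[OF assms] by (simp add: has_bochner_integral_iff)

lemma abs_ln_le_powr:
  assumes "y > 0" "d > 0"
  shows "\<bar>ln y\<bar> \<le> (y powr d + y powr (- d)) / (d::real)"
proof -
  have "d * ln y \<le> y powr d" "- d * ln y \<le> y powr (- d)"
    using ln_le_minus_one[of "y powr d"] ln_le_minus_one[of "y powr (- d)"] assms by (auto simp: ln_powr)
  then have "d * \<bar>ln y\<bar> \<le> y powr d + y powr (- d)"
    using powr_ge_zero[of y d] powr_ge_zero[of y "- d"] by (auto simp: abs_if intro: add_increasing add_increasing2)
  then show ?thesis using assms by (simp add: field_simps)
qed

lemma cube_sum_le:
  fixes a b :: real
  assumes "a \<ge> 0" "b \<ge> 0"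
  shows "(a + b) ^ 3 \<le> 4 * (a ^ 3 + b ^ 3)"
proof -
  have "4 * (a ^ 3 + b ^ 3) - (a + b) ^ 3 = 3 * ((a + b) * (a - b)\<^sup>2)"
    by (simp add: power2_eq_square power3_eq_cube algebra_simps)
  moreover have "\<dots> \<ge> 0" using assms by simp
  ultimately show ?thesis by linarith
qed

lemma p_gaussian_integrable_ln_cube:
  assumes p: "p \<ge> 1"
  shows "integrable (p_gaussian p) (\<lambda>x. \<bar>ln \<bar>x\<bar>\<bar> ^ 3)"
proof (rule Bochner_Integration.integrable_bound)
  show "integrable (p_gaussian p) (\<lambda>x. 864 * (\<bar>x\<bar> powr (1 / 2) + \<bar>x\<bar> powr (- 1 / 2)))"
    using p by (intro integrable_mult_right Bochner_Integration.integrable_add p_gaussian_integrable_powr) auto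
  have "\<bar>ln y\<bar> ^ 3 \<le> 864 * (y powr (1 / 2) + y powr (- 1 / 2))" if "y > 0" for y :: real
  proof -
    have "\<bar>ln y\<bar> ^ 3 \<le> (6 * (y powr (1 / 6) + y powr (- 1 / 6))) ^ 3"
      using abs_ln_le_powr[OF that, of "1 / 6"] by (intro power_mono) auto
    also have "\<dots> = 216 * (y powr (1 / 6) + y powr (- 1 / 6)) ^ 3" by (subst power_mult_distrib) simp
    also have "\<dots> \<le> 216 * (4 * ((y powr (1 / 6)) ^ 3 + (y powr (- 1 / 6)) ^ 3))"
      by (intro mult_left_mono cube_sum_le) auto
    also have "\<dots> = 864 * (y powr (1 / 2) + y powr (- 1 / 2))"
      using that by (simp add: powr_power)
    finally show ?thesis .
  qed
  note ln_le = this
  show "AE x in p_gaussian p. norm (\<bar>ln \<bar>x\<bar>\<bar> ^ 3) \<le> norm (864 * (\<bar>x\<bar> powr (1 / 2) + \<bar>x\<bar> powr (- 1 / 2)))"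
    using AE_p_gaussian_nonzero[of p] by eventually_elim (use ln_le in auto)
qed (auto simp: p_gaussian_def)

lemma integrable_of_cube:
  fixes f :: "'a \<Rightarrow> real"
  assumes "finite_measure M" "f \<in> borel_measurable M" "integrable M (\<lambda>x. \<bar>f x\<bar> ^ 3)"
  shows "integrable M f" "integrable M (\<lambda>x. (f x)\<^sup>2)"
proof -
  interpret finite_measure M by fact
  have b: "\<bar>y\<bar> \<le> 1 + \<bar>y\<bar> ^ 3" "y\<^sup>2 \<le> 1 + \<bar>y\<bar> ^ 3" for y :: real
  proof -
    have "\<bar>y\<bar> \<le> 1 + \<bar>y\<bar> ^ 3 \<and> \<bar>y\<bar>\<^sup>2 \<le> 1 + \<bar>y\<bar> ^ 3"
    proof (cases "\<bar>y\<bar> \<le> 1")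
      case True
      then have "\<bar>y\<bar>\<^sup>2 \<le> 1" by (simp add: abs_square_le_1)
      then show ?thesis using True zero_le_power[of "\<bar>y\<bar>" 3] by linarith
    next
      case False
      then have "\<bar>y\<bar> ^ 1 \<le> \<bar>y\<bar> ^ 3" "\<bar>y\<bar> ^ 2 \<le> \<bar>y\<bar> ^ 3" by (intro power_increasing; simp)+
      then show ?thesis by simp
    qed
    then show "\<bar>y\<bar> \<le> 1 + \<bar>y\<bar> ^ 3" "y\<^sup>2 \<le> 1 + \<bar>y\<bar> ^ 3" by auto
  qed
  have i: "integrable M (\<lambda>x. 1 + \<bar>f x\<bar> ^ 3)" using assms by auto
  show "integrable M f"
    by (rule Bochner_Integration.integrable_bound[OF i]) (use assms b in \<open>auto simp: abs_of_nonneg\<close>)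
  show "integrable M (\<lambda>x. (f x)\<^sup>2)"
    by (rule Bochner_Integration.integrable_bound[OF i]) (use assms b in \<open>auto simp: abs_of_nonneg\<close>)
qed

text \<open>The summand of the i.i.d. sum in the central limit theorem; its variance is \<open>limit_variance p\<close>.\<close>

definition centered_score :: "real \<Rightarrow> real \<Rightarrow> real" where
  "centered_score p x = ln \<bar>x\<bar> - log_mean p - (\<bar>x\<bar> powr p - 1) / p"

lemma centered_score_measurable [measurable]: "centered_score p \<in> borel_measurable borel"
  unfolding centered_score_def by measurable

lemma p_gaussian_integrable_ln:
  assumes p: "p \<ge> 1"
  shows "integrable (p_gaussian p) (\<lambda>x. ln \<bar>x\<bar>)"
  using integrable_of_cube(1)[OF prob_space.finite_measure[OF p_gaussian_prob_space[OF p]] _ p_gaussian_integrable_ln_cube[OF p]] by simp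

lemma centered_score_moments:
  assumes p: "p \<ge> 1"
  shows "integrable (p_gaussian p) (\<lambda>x. \<bar>centered_score p x\<bar> ^ 3)"
    and "(\<integral>x. centered_score p x \<partial>p_gaussian p) = 0"
    and "(\<integral>x. (centered_score p x)\<^sup>2 \<partial>p_gaussian p) = limit_variance p"
proof -
  interpret prob_space "p_gaussian p" by (rule p_gaussian_prob_space[OF p])
  show "integrable (p_gaussian p) (\<lambda>x. \<bar>centered_score p x\<bar> ^ 3)"
  proof (rule Bochner_Integration.integrable_bound)
    show "integrable (p_gaussian p) (\<lambda>x. 4 * (\<bar>ln \<bar>x\<bar>\<bar> ^ 3 + 4 * (\<bar>log_mean p - 1 / p\<bar> ^ 3 + \<bar>x\<bar> powr (3 * p) / p ^ 3)))"
      using p by (intro integrable_mult_right Bochner_Integration.integrable_add p_gaussian_integrable_powr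
          p_gaussian_integrable_ln_cube integrable_divide integrable_const) auto
    have "\<bar>centered_score p x\<bar> ^ 3 \<le> 4 * (\<bar>ln \<bar>x\<bar>\<bar> ^ 3 + 4 * (\<bar>log_mean p - 1 / p\<bar> ^ 3 + \<bar>x\<bar> powr (3 * p) / p ^ 3))" for x
    proof -
      have q: "(\<bar>x\<bar> powr p / p) ^ 3 = \<bar>x\<bar> powr (3 * p) / p ^ 3"
        by (cases "x = 0") (auto simp: power_divide powr_power mult.commute)
      have "centered_score p x = ln \<bar>x\<bar> - (log_mean p - 1 / p) - \<bar>x\<bar> powr p / p"
        by (simp add: centered_score_def diff_divide_distrib)
      then have "\<bar>centered_score p x\<bar> \<le> \<bar>ln \<bar>x\<bar>\<bar> + (\<bar>log_mean p - 1 / p\<bar> + \<bar>x\<bar> powr p / p)"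
      proof -
        have "\<bar>a - b - c\<bar> \<le> \<bar>a\<bar> + (\<bar>b\<bar> + c)" if "c \<ge> 0" for a b c :: real
          using that by linarith
        then show ?thesis using \<open>centered_score p x = _\<close> p by simp
      qed
      then have "\<bar>centered_score p x\<bar> ^ 3 \<le> (\<bar>ln \<bar>x\<bar>\<bar> + (\<bar>log_mean p - 1 / p\<bar> + \<bar>x\<bar> powr p / p)) ^ 3"
        by (intro power_mono) auto
      also have "\<dots> \<le> 4 * (\<bar>ln \<bar>x\<bar>\<bar> ^ 3 + (\<bar>log_mean p - 1 / p\<bar> + \<bar>x\<bar> powr p / p) ^ 3)"
        using p by (intro cube_sum_le) auto
      also have "\<dots> \<le> 4 * (\<bar>ln \<bar>x\<bar>\<bar> ^ 3 + 4 * (\<bar>log_mean p - 1 / p\<bar> ^ 3 + (\<bar>x\<bar> powr p / p) ^ 3))"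
        using p by (intro mult_left_mono add_left_mono cube_sum_le) auto
      finally show ?thesis unfolding q .
    qed
    then show "AE x in p_gaussian p. norm (\<bar>centered_score p x\<bar> ^ 3)
        \<le> norm (4 * (\<bar>ln \<bar>x\<bar>\<bar> ^ 3 + 4 * (\<bar>log_mean p - 1 / p\<bar> ^ 3 + \<bar>x\<bar> powr (3 * p) / p ^ 3)))"
      by (intro AE_I2) (auto intro: order_trans[OF _ abs_ge_self])
  qed measurable
  have i: "integrable (p_gaussian p) (\<lambda>x. \<bar>x\<bar> powr p)" using p by (intro p_gaussian_integrable_powr) auto
  note i2 = p_gaussian_integrable_ln[OF p]
  show z: "(\<integral>x. centered_score p x \<partial>p_gaussian p) = 0"
    unfolding centered_score_def using i i2 p_gaussian_abs_moment_p[OF p] prob_space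
    by (simp add: log_mean_def)
  have "(\<integral>x. ln \<bar>x\<bar> - \<bar>x\<bar> powr p / p \<partial>p_gaussian p) = log_mean p - 1 / p"
    using i i2 p_gaussian_abs_moment_p[OF p] by (simp add: log_mean_def)
  note eq = this
  show "(\<integral>x. (centered_score p x)\<^sup>2 \<partial>p_gaussian p) = limit_variance p"
    unfolding limit_variance_def centered_score_def eq
    by (intro Bochner_Integration.integral_cong) (auto simp: diff_divide_distrib algebra_simps)
qed

section \<open>Homogeneous functions and the cone measure\<close>

interpretation lborel_prod: product_sigma_finite "\<lambda>_::nat. lborel :: real measure"
  by standard

lemma space_lebesgue_n: "space (lebesgue_n n) = extensional {..<n}"
  by (auto simp: lebesgue_n_def space_PiM PiE_def)

lemma sigma_finite_lebesgue_n: "sigma_finite_measure (lebesgue_n n)"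
  unfolding lebesgue_n_def by (rule lborel_prod.sigma_finite) simp

lemma measurable_lebesgue_n_component [measurable]:
  "i < n \<Longrightarrow> (\<lambda>x. x i) \<in> borel_measurable (lebesgue_n n)"
  unfolding lebesgue_n_def by measurable

lemma measurable_into_lebesgue_n:
  assumes "\<And>i. i < n \<Longrightarrow> (\<lambda>x. f x i) \<in> borel_measurable M"
  shows "(\<lambda>x. \<lambda>i\<in>{..<n}. f x i) \<in> measurable M (lebesgue_n n)"
  unfolding lebesgue_n_def using assms by (intro measurable_restrict) auto

lemma measurable_lp_norm [measurable]: "lp_norm n p \<in> borel_measurable (lebesgue_n n)"
  unfolding lp_norm_def by measurable

lemma measurable_scale_n [measurable]: "scale_n n r \<in> measurable (lebesgue_n n) (lebesgue_n n)"
  unfolding scale_n_def by (intro measurable_into_lebesgue_n) measurable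

lemma emeasure_lebesgue_n_box:
  "(\<And>i. i < n \<Longrightarrow> A i \<in> sets borel) \<Longrightarrow> emeasure (lebesgue_n n) (Pi\<^sub>E {..<n} A) = (\<Prod>i<n. emeasure lborel (A i))"
  unfolding lebesgue_n_def by (subst lborel_prod.emeasure_PiM) auto

lemma lebesgue_n_eqI:
  assumes "sets M = sets (lebesgue_n n)"
    and "\<And>A. (\<And>i. i < n \<Longrightarrow> A i \<in> sets borel) \<Longrightarrow> emeasure M (Pi\<^sub>E {..<n} A) = (\<Prod>i<n. emeasure lborel (A i))"
  shows "M = lebesgue_n n"
  unfolding lebesgue_n_def using assms by (intro lborel_prod.PiM_eqI) (auto simp: lebesgue_n_def)

lemma box_in_sets: "(\<And>i. i < n \<Longrightarrow> A i \<in> sets borel) \<Longrightarrow> Pi\<^sub>E {..<n} A \<in> sets (lebesgue_n n)"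
  unfolding lebesgue_n_def by (intro sets_PiM_I_finite) auto

definition shift_n :: "nat \<Rightarrow> (nat \<Rightarrow> real) \<Rightarrow> (nat \<Rightarrow> real) \<Rightarrow> (nat \<Rightarrow> real)" where
  "shift_n n v x = (\<lambda>i\<in>{..<n}. x i + v i)"

lemma measurable_shift_n [measurable]: "shift_n n v \<in> measurable (lebesgue_n n) (lebesgue_n n)"
  unfolding shift_n_def by (intro measurable_into_lebesgue_n) measurable

lemma distr_shift_n: "distr (lebesgue_n n) (lebesgue_n n) (shift_n n v) = lebesgue_n n"
proof (rule lebesgue_n_eqI)
  fix A :: "nat \<Rightarrow> real set" assume A: "\<And>i. i < n \<Longrightarrow> A i \<in> sets borel"
  have eq: "shift_n n v -` Pi\<^sub>E {..<n} A \<inter> space (lebesgue_n n) = Pi\<^sub>E {..<n} (\<lambda>i. (\<lambda>x. x + v i) -` A i)"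
    by (auto simp: shift_n_def space_lebesgue_n PiE_iff restrict_def extensional_def)
  have m: "(\<lambda>x. x + v i) -` A i \<in> sets borel" if "i < n" for i
    using measurable_sets_borel[OF _ A[OF that], of "\<lambda>x. x + v i"] by simp
  have "emeasure lborel ((\<lambda>x. x + v i) -` A i) = emeasure lborel (A i)" if "i < n" for i
  proof -
    have "emeasure lborel (A i) = emeasure (distr lborel borel ((+) (v i))) (A i)"
      by (simp add: lborel_distr_plus)
    also have "\<dots> = emeasure lborel ((\<lambda>x. x + v i) -` A i)"
      using A[OF that] by (subst emeasure_distr) (auto intro!: arg_cong[where f="emeasure lborel"] simp: add.commute)
    finally show ?thesis by simp
  qed
  then show "emeasure (distr (lebesgue_n n) (lebesgue_n n) (shift_n n v)) (Pi\<^sub>E {..<n} A) = (\<Prod>i<n. emeasure lborel (A i))"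
    using A m by (subst emeasure_distr) (auto simp: eq emeasure_lebesgue_n_box intro: box_in_sets)
qed simp

lemma density_distr_scale_n:
  assumes r: "r > 0"
  shows "density (distr (lebesgue_n n) (lebesgue_n n) (scale_n n r)) (\<lambda>_. ennreal (r ^ n)) = lebesgue_n n"
proof (rule lebesgue_n_eqI)
  fix A :: "nat \<Rightarrow> real set" assume A: "\<And>i. i < n \<Longrightarrow> A i \<in> sets borel"
  have eq: "scale_n n r -` Pi\<^sub>E {..<n} A \<inter> space (lebesgue_n n) = Pi\<^sub>E {..<n} (\<lambda>i. (*) r -` A i)"
    by (auto simp: scale_n_def space_lebesgue_n PiE_iff restrict_def extensional_def)
  have m: "(*) r -` A i \<in> sets borel" if "i < n" for i
    using measurable_sets_borel[OF _ A[OF that], of "(*) r"] by simp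
  have *: "ennreal r * emeasure lborel ((*) r -` A i) = emeasure lborel (A i)" if "i < n" for i
  proof -
    have "emeasure lborel ((*) r -` A i) = emeasure (distr lborel borel ((*) r)) (A i)"
      using A[OF that] by (subst emeasure_distr) auto
    also have "\<dots> = emeasure (density lborel (\<lambda>_. ennreal (inverse \<bar>r\<bar>))) (A i)"
      using r by (subst lborel_distr_mult) auto
    also have "\<dots> = ennreal (inverse r) * emeasure lborel (A i)"
      using A[OF that] r by (simp add: emeasure_density nn_integral_cmult_indicator)
    finally show ?thesis
      using r by (simp add: mult.assoc[symmetric] ennreal_mult[symmetric])
  qed
  have "emeasure (density (distr (lebesgue_n n) (lebesgue_n n) (scale_n n r)) (\<lambda>_. ennreal (r ^ n))) (Pi\<^sub>E {..<n} A)
     = ennreal (r ^ n) * emeasure (distr (lebesgue_n n) (lebesgue_n n) (scale_n n r)) (Pi\<^sub>E {..<n} A)"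
    using box_in_sets[OF A] by (subst emeasure_density) (simp_all add: nn_integral_cmult_indicator)
  also have "\<dots> = ennreal (r ^ n) * (\<Prod>i<n. emeasure lborel ((*) r -` A i))"
    using A m by (subst emeasure_distr) (auto simp: eq emeasure_lebesgue_n_box intro: box_in_sets)
  also have "\<dots> = (\<Prod>i<n. ennreal r * emeasure lborel ((*) r -` A i))"
    using r by (simp add: prod.distrib ennreal_power)
  also have "\<dots> = (\<Prod>i<n. emeasure lborel (A i))"
    using * by (intro prod.cong) auto
  finally show "emeasure (density (distr (lebesgue_n n) (lebesgue_n n) (scale_n n r)) (\<lambda>_. ennreal (r ^ n))) (Pi\<^sub>E {..<n} A) = (\<Prod>i<n. emeasure lborel (A i))" .
qed simp

lemma nn_integral_scale_n:
  assumes r: "r > 0" and [measurable]: "H \<in> borel_measurable (lebesgue_n n)"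
  shows "(\<integral>\<^sup>+x. H x \<partial>lebesgue_n n) = ennreal (r ^ n) * (\<integral>\<^sup>+x. H (scale_n n r x) \<partial>lebesgue_n n)"
proof -
  have "(\<integral>\<^sup>+x. H x \<partial>lebesgue_n n) = (\<integral>\<^sup>+x. H x \<partial>density (distr (lebesgue_n n) (lebesgue_n n) (scale_n n r)) (\<lambda>_. ennreal (r ^ n)))"
    by (simp only: density_distr_scale_n[OF r])
  also have "\<dots> = (\<integral>\<^sup>+x. ennreal (r ^ n) * H x \<partial>distr (lebesgue_n n) (lebesgue_n n) (scale_n n r))"
    by (rule nn_integral_density) auto
  also have "\<dots> = (\<integral>\<^sup>+x. ennreal (r ^ n) * H (scale_n n r x) \<partial>lebesgue_n n)"
    by (rule nn_integral_distr) auto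
  also have "\<dots> = ennreal (r ^ n) * (\<integral>\<^sup>+x. H (scale_n n r x) \<partial>lebesgue_n n)"
    by (rule nn_integral_cmult) measurable
  finally show ?thesis .
qed

lemma AE_lebesgue_n_nonzero: "AE x in lebesgue_n n. \<forall>i<n. x i \<noteq> 0"
proof -
  have "AE x in lebesgue_n n. x i \<noteq> 0" if "i < n" for i
  proof (rule AE_I)
    let ?A = "Pi\<^sub>E {..<n} (\<lambda>j. if j = i then {0::real} else UNIV)"
    show "{x \<in> space (lebesgue_n n). \<not> x i \<noteq> 0} \<subseteq> ?A"
      by (auto simp: space_lebesgue_n PiE_iff extensional_def)
    show "emeasure (lebesgue_n n) ?A = 0"
      using that by (subst emeasure_lebesgue_n_box) auto
  qed (auto intro!: box_in_sets)
  then have "AE x in lebesgue_n n. \<forall>i\<in>{..<n}. x i \<noteq> 0"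
    by (subst AE_finite_all) auto
  then show ?thesis by (simp add: Ball_def)
qed

lemma lp_norm_nonneg: "lp_norm n p x \<ge> 0"
  by (simp add: lp_norm_def)

lemma lp_norm_powr: "p > 0 \<Longrightarrow> lp_norm n p x powr p = (\<Sum>i<n. \<bar>x i\<bar> powr p)"
  by (simp add: lp_norm_def powr_powr sum_nonneg)

lemma lp_norm_eq_0: "lp_norm n p x = 0 \<longleftrightarrow> (\<forall>i<n. x i = 0)"
  by (simp add: lp_norm_def sum_nonneg_eq_0_iff) (auto simp: Ball_def)

lemma lp_norm_scale_n:
  assumes "p > 0" "r \<ge> 0"
  shows "lp_norm n p (scale_n n r x) = r * lp_norm n p x"
proof -
  have "(\<Sum>i<n. \<bar>scale_n n r x i\<bar> powr p) = r powr p * (\<Sum>i<n. \<bar>x i\<bar> powr p)"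
    unfolding sum_distrib_left by (rule sum.cong) (use assms in \<open>auto simp: scale_n_def abs_mult powr_mult\<close>)
  then show ?thesis
    using assms by (simp add: lp_norm_def powr_mult sum_nonneg powr_powr)
qed

lemma AE_lp_norm_pos: "n \<ge> 1 \<Longrightarrow> AE x in lebesgue_n n. lp_norm n p x > 0"
  using AE_lebesgue_n_nonzero[of n]
proof eventually_elim
  case (elim x)
  then have "x 0 \<noteq> 0" by simp
  then have "lp_norm n p x \<noteq> 0" unfolding lp_norm_eq_0 using elim(1) by force
  then show ?case using lp_norm_nonneg[of n p x] by simp
qed

lemma lp_ball_measurable [measurable]: "lp_ball n p \<in> sets (lebesgue_n n)"
  unfolding lp_ball_def by measurable

lemma lp_sphere_measurable [measurable]: "lp_sphere n p \<in> sets (lebesgue_n n)"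
  unfolding lp_sphere_def by measurable

lemma abs_le_lp_norm:
  assumes "i < n" "p > 0"
  shows "\<bar>x i\<bar> \<le> lp_norm n p x"
proof -
  have "\<bar>x i\<bar> powr p \<le> (\<Sum>i<n. \<bar>x i\<bar> powr p)"
    using assms by (intro member_le_sum) auto
  then have "(\<bar>x i\<bar> powr p) powr (1 / p) \<le> (\<Sum>i<n. \<bar>x i\<bar> powr p) powr (1 / p)"
    using assms by (intro powr_mono2) auto
  then show ?thesis using assms by (simp add: lp_norm_def powr_powr)
qed

lemma emeasure_lp_ball:
  assumes p: "p \<ge> 1"
  shows "emeasure (lebesgue_n n) (lp_ball n p) > 0" "emeasure (lebesgue_n n) (lp_ball n p) < \<infinity>"
proof -
  have "lp_ball n p \<subseteq> Pi\<^sub>E {..<n} (\<lambda>_. {-1..1})"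
  proof
    fix x assume x: "x \<in> lp_ball n p"
    have "\<bar>x i\<bar> \<le> 1" if "i < n" for i
      using abs_le_lp_norm[OF that, of p x] x p by (simp add: lp_ball_def)
    then show "x \<in> Pi\<^sub>E {..<n} (\<lambda>_. {-1..1})"
      using x by (auto simp: lp_ball_def space_lebesgue_n PiE_iff abs_le_iff)
  qed
  then have "emeasure (lebesgue_n n) (lp_ball n p) \<le> emeasure (lebesgue_n n) (Pi\<^sub>E {..<n} (\<lambda>_. {-1..1}))"
    by (intro emeasure_mono box_in_sets) auto
  also have "\<dots> = (\<Prod>i<n. ennreal 2)" by (subst emeasure_lebesgue_n_box) auto
  also have "\<dots> < \<infinity>" by (simp add: less_top[symmetric] power_eq_top_ennreal)
  finally show "emeasure (lebesgue_n n) (lp_ball n p) < \<infinity>" .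
  define a where "a = 1 / (real n + 1)"
  have a: "a > 0" "a \<le> 1" "n * a \<le> 1" by (auto simp: a_def field_simps)
  have "Pi\<^sub>E {..<n} (\<lambda>_. {0..a}) \<subseteq> lp_ball n p"
  proof
    fix x assume x: "x \<in> Pi\<^sub>E {..<n} (\<lambda>_. {0..a})"
    have "\<bar>x i\<bar> powr p \<le> a" if "i < n" for i
    proof -
      have "0 \<le> x i" "x i \<le> a" using x that by (auto simp: PiE_iff)
      then have "\<bar>x i\<bar> powr p \<le> a powr p" using p by (intro powr_mono2) auto
      also have "\<dots> \<le> a powr 1" using a p by (intro powr_mono') auto
      finally show ?thesis using a by simp
    qed
    then have "(\<Sum>i<n. \<bar>x i\<bar> powr p) \<le> (\<Sum>i<n. a)" by (intro sum_mono) auto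
    also have "\<dots> \<le> 1" using a by simp
    finally have "(\<Sum>i<n. \<bar>x i\<bar> powr p) powr (1 / p) \<le> 1 powr (1 / p)" using p by (intro powr_mono2 sum_nonneg) auto
    then show "x \<in> lp_ball n p" using x by (auto simp: lp_ball_def lp_norm_def space_lebesgue_n PiE_iff)
  qed
  then have "emeasure (lebesgue_n n) (Pi\<^sub>E {..<n} (\<lambda>_. {0..a})) \<le> emeasure (lebesgue_n n) (lp_ball n p)"
    by (intro emeasure_mono) auto
  moreover have "emeasure (lebesgue_n n) (Pi\<^sub>E {..<n} (\<lambda>_. {0..a})) = ennreal (a ^ n)"
    using a by (subst emeasure_lebesgue_n_box) (auto simp: ennreal_power)
  ultimately show "emeasure (lebesgue_n n) (lp_ball n p) > 0"
    using a by (metis ennreal_eq_0_iff linorder_not_less not_gr_zero order_trans zero_less_power order_refl)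
qed

text \<open>In the double integral of \<open>1\<^sub>A(x) 1\<^sub>B(y)\<close> translate \<open>x\<close> by \<open>y\<close>, then \<open>y\<close> by \<open>-x\<close>; the symmetry of \<open>B\<close>
  replaces \<open>y - x\<close> by \<open>x - y\<close>, and a last translation of \<open>x\<close> exchanges the roles of the measures.\<close>

lemma translation_invariant_unique:
  assumes sets: "sets M = sets (lebesgue_n n)" and sf: "sigma_finite_measure M"
    and inv: "\<And>v. v \<in> space (lebesgue_n n) \<Longrightarrow> distr M (lebesgue_n n) (shift_n n v) = M"
    and A: "A \<in> sets (lebesgue_n n)" and B: "B \<in> sets (lebesgue_n n)"
    and sym: "\<And>x. x \<in> B \<Longrightarrow> scale_n n (-1) x \<in> B"
  shows "emeasure M A * emeasure (lebesgue_n n) B = emeasure (lebesgue_n n) A * emeasure M B"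
proof -
  let ?L = "lebesgue_n n"
  interpret M: sigma_finite_measure M by fact
  interpret L: sigma_finite_measure ?L by (rule sigma_finite_lebesgue_n)
  interpret P: pair_sigma_finite M ?L ..
  note sets[measurable_cong] A[measurable] B[measurable]
  have space: "space M = space ?L" using sets by (rule sets_eq_imp_space_eq)
  define add where "add x y = (\<lambda>i\<in>{..<n}. x i + y i)" for x y :: "nat \<Rightarrow> real"
  have add: "add x y = shift_n n y x" "add x y = shift_n n x y" for x y
    by (auto simp: add_def shift_n_def restrict_def add.commute)
  have madd [measurable]: "(\<lambda>(x, y). add x y) \<in> measurable (M \<Otimes>\<^sub>M ?L) ?L"
  proof -
    have "(\<lambda>z. \<lambda>i\<in>{..<n}. fst z i + snd z i) \<in> measurable (M \<Otimes>\<^sub>M ?L) ?L"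
    proof (rule measurable_into_lebesgue_n)
      fix i assume "i < n"
      then have [measurable]: "(\<lambda>x. x i) \<in> borel_measurable ?L" "(\<lambda>x. x i) \<in> borel_measurable M" by measurable
      show "(\<lambda>z. fst z i + snd z i) \<in> borel_measurable (M \<Otimes>\<^sub>M ?L)" by measurable
    qed
    then show ?thesis by (simp add: add_def split_beta')
  qed
  define neg where "neg x = scale_n n (-1) x" for x
  have mneg [measurable]: "neg \<in> measurable ?L ?L" unfolding neg_def[abs_def] by measurable
  have neg_neg: "neg (neg x) = x" if "x \<in> space ?L" for x
    using that by (auto simp: neg_def scale_n_def space_lebesgue_n extensional_def)
  have B_neg: "neg x \<in> B \<longleftrightarrow> x \<in> B" if "x \<in> space ?L" for x
    using sym neg_neg[OF that] unfolding neg_def by metis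
  have neg_space: "neg x \<in> space ?L" for x by (auto simp: neg_def scale_n_def space_lebesgue_n)
  have "emeasure M A * emeasure ?L B = (\<integral>\<^sup>+y. (\<integral>\<^sup>+x. indicator A x * indicator B y \<partial>M) \<partial>?L)"
    by (simp add: nn_integral_multc nn_integral_cmult)
  also have "\<dots> = (\<integral>\<^sup>+y. (\<integral>\<^sup>+x. indicator A (add x y) * indicator B y \<partial>M) \<partial>?L)"
  proof (rule nn_integral_cong)
    fix y assume y: "y \<in> space ?L"
    have [measurable]: "shift_n n y \<in> measurable M ?L" by measurable
    have "(\<integral>\<^sup>+x. indicator A x * indicator B y \<partial>M) = (\<integral>\<^sup>+x. indicator A x * indicator B y \<partial>distr M ?L (shift_n n y))"
      by (simp only: inv[OF y])
    also have "\<dots> = (\<integral>\<^sup>+x. indicator A (add x y) * indicator B y \<partial>M)"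
      by (subst nn_integral_distr) (auto simp: add(1))
    finally show "(\<integral>\<^sup>+x. indicator A x * indicator B y \<partial>M) = (\<integral>\<^sup>+x. indicator A (add x y) * indicator B y \<partial>M)" .
  qed
  also have "\<dots> = (\<integral>\<^sup>+x. (\<integral>\<^sup>+y. indicator A (add x y) * indicator B y \<partial>?L) \<partial>M)"
    by (rule P.Fubini') measurable
  also have "\<dots> = (\<integral>\<^sup>+x. (\<integral>\<^sup>+y. indicator A y * indicator B (add (neg x) y) \<partial>?L) \<partial>M)"
  proof (rule nn_integral_cong)
    fix x assume "x \<in> space M"
    have *: "add x (add (neg x) y) = y" if "y \<in> space ?L" for y
      using that by (auto simp: add_def neg_def scale_n_def space_lebesgue_n extensional_def)
    have "(\<integral>\<^sup>+y. indicator A (add x y) * indicator B y \<partial>?L) = (\<integral>\<^sup>+y. indicator A (add x y) * indicator B y \<partial>distr ?L ?L (shift_n n (neg x)))"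
      by (simp only: distr_shift_n)
    also have "\<dots> = (\<integral>\<^sup>+y. indicator A (add x (add (neg x) y)) * indicator B (add (neg x) y) \<partial>?L)"
      by (subst nn_integral_distr) (auto simp: add(2))
    also have "\<dots> = (\<integral>\<^sup>+y. indicator A y * indicator B (add (neg x) y) \<partial>?L)"
      by (rule nn_integral_cong) (simp add: *)
    finally show "(\<integral>\<^sup>+y. indicator A (add x y) * indicator B y \<partial>?L) = (\<integral>\<^sup>+y. indicator A y * indicator B (add (neg x) y) \<partial>?L)" .
  qed
  also have "\<dots> = (\<integral>\<^sup>+y. (\<integral>\<^sup>+x. indicator A y * indicator B (add (neg x) y) \<partial>M) \<partial>?L)"
    by (rule P.Fubini'[symmetric]) measurable
  also have "\<dots> = (\<integral>\<^sup>+y. indicator A y * emeasure M B \<partial>?L)"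
  proof (rule nn_integral_cong)
    fix y assume y: "y \<in> space ?L"
    have ns: "neg y \<in> space ?L" by (rule neg_space)
    have [measurable]: "shift_n n (neg y) \<in> measurable M ?L" by measurable
    have eq: "add (neg x) y = neg (shift_n n (neg y) x)" for x
      by (auto simp: add_def neg_def scale_n_def shift_n_def restrict_def)
    have "indicator B (add (neg x) y) = (indicator B (shift_n n (neg y) x) :: ennreal)" for x
    proof -
      have "shift_n n (neg y) x \<in> space ?L" by (auto simp: shift_n_def space_lebesgue_n)
      from B_neg[OF this] show ?thesis unfolding eq by (auto split: split_indicator)
    qed
    then have "(\<integral>\<^sup>+x. indicator A y * indicator B (add (neg x) y) \<partial>M) = indicator A y * (\<integral>\<^sup>+x. indicator B (shift_n n (neg y) x) \<partial>M)"
      by (simp add: nn_integral_cmult)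
    also have "(\<integral>\<^sup>+x. indicator B (shift_n n (neg y) x) \<partial>M) = (\<integral>\<^sup>+x. indicator B x \<partial>distr M ?L (shift_n n (neg y)))"
      by (subst nn_integral_distr) auto
    also have "\<dots> = emeasure M B" by (simp add: inv[OF ns])
    finally show "(\<integral>\<^sup>+x. indicator A y * indicator B (add (neg x) y) \<partial>M) = indicator A y * emeasure M B" .
  qed
  also have "\<dots> = emeasure ?L A * emeasure M B" by (simp add: nn_integral_multc)
  finally show ?thesis .
qed

lemma distr_lp_norm_homogeneous:
  assumes n: "n \<ge> 1" and p: "p \<ge> 1" and [measurable]: "F \<in> borel_measurable (lebesgue_n n)"
    and hom: "\<And>r x. r > 0 \<Longrightarrow> x \<in> space (lebesgue_n n) \<Longrightarrow> F (scale_n n r x) = F x"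
    and r: "r > 0"
  shows "(\<integral>\<^sup>+x. F x * indicator {x. lp_norm n p x \<le> r} x \<partial>lebesgue_n n)
    = ennreal (r ^ n) * (\<integral>\<^sup>+x. F x * indicator (lp_ball n p) x \<partial>lebesgue_n n)"
proof -
  have [measurable]: "Measurable.pred (lebesgue_n n) (\<lambda>x. lp_norm n p x \<le> r)" by measurable
  have "(\<integral>\<^sup>+x. F x * indicator {x. lp_norm n p x \<le> r} x \<partial>lebesgue_n n)
     = (\<integral>\<^sup>+x. F x * (if lp_norm n p x \<le> r then 1 else 0) \<partial>lebesgue_n n)"
    by (rule nn_integral_cong) auto
  also have "\<dots> = ennreal (r ^ n) * (\<integral>\<^sup>+x. F (scale_n n r x) * (if lp_norm n p (scale_n n r x) \<le> r then 1 else 0) \<partial>lebesgue_n n)"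
    by (rule nn_integral_scale_n[OF r]) measurable
  also have "(\<integral>\<^sup>+x. F (scale_n n r x) * (if lp_norm n p (scale_n n r x) \<le> r then 1 else 0) \<partial>lebesgue_n n)
      = (\<integral>\<^sup>+x. F x * indicator (lp_ball n p) x \<partial>lebesgue_n n)"
    by (rule nn_integral_cong)
       (use r p in \<open>auto simp: hom lp_norm_scale_n lp_ball_def mult_le_cancel_left1 split: split_indicator\<close>)
  finally show ?thesis .
qed

lemma nn_integral_lp_norm_homogeneous:
  assumes n: "n \<ge> 1" and p: "p \<ge> 1" and F[measurable]: "F \<in> borel_measurable (lebesgue_n n)"
    and hom: "\<And>r x. r > 0 \<Longrightarrow> x \<in> space (lebesgue_n n) \<Longrightarrow> F (scale_n n r x) = F x"
    and fin: "(\<integral>\<^sup>+x. F x * indicator (lp_ball n p) x \<partial>lebesgue_n n) < \<infinity>"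
    and G[measurable]: "G \<in> borel_measurable borel"
  shows "emeasure (lebesgue_n n) (lp_ball n p) * (\<integral>\<^sup>+x. F x * G (lp_norm n p x) \<partial>lebesgue_n n)
    = (\<integral>\<^sup>+x. F x * indicator (lp_ball n p) x \<partial>lebesgue_n n) * (\<integral>\<^sup>+x. G (lp_norm n p x) \<partial>lebesgue_n n)"
proof -
  let ?L = "lebesgue_n n"
  define b where "b = emeasure ?L (lp_ball n p)"
  define a where "a = (\<integral>\<^sup>+x. F x * indicator (lp_ball n p) x \<partial>?L)"
  have ba: "b < \<infinity>" "a < \<infinity>" using emeasure_lp_ball[OF p, of n] fin by (auto simp: a_def b_def)
  define M1 where "M1 = distr (density ?L (\<lambda>x. b * F x)) borel (lp_norm n p)"
  define M2 where "M2 = distr (density ?L (\<lambda>x. a)) borel (lp_norm n p)"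
  have m [measurable]: "Measurable.pred (lebesgue_n n) (\<lambda>x. lp_norm n p x \<le> r)" for r by measurable
  have E1: "emeasure M1 {..r} = b * (\<integral>\<^sup>+x. F x * indicator {x. lp_norm n p x \<le> r} x \<partial>?L)" for r
  proof -
    have "emeasure M1 {..r} = emeasure (density ?L (\<lambda>x. b * F x)) (lp_norm n p -` {..r} \<inter> space ?L)"
      unfolding M1_def by (subst emeasure_distr) auto
    also have "\<dots> = (\<integral>\<^sup>+x. b * F x * indicator (lp_norm n p -` {..r} \<inter> space ?L) x \<partial>?L)"
      by (subst emeasure_density) auto
    also have "\<dots> = (\<integral>\<^sup>+x. b * (F x * (if lp_norm n p x \<le> r then 1 else 0)) \<partial>?L)"
      by (rule nn_integral_cong) (auto split: split_indicator)
    also have "\<dots> = b * (\<integral>\<^sup>+x. F x * (if lp_norm n p x \<le> r then 1 else 0) \<partial>?L)"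
      by (rule nn_integral_cmult) measurable
    also have "(\<integral>\<^sup>+x. F x * (if lp_norm n p x \<le> r then 1 else 0) \<partial>?L) = (\<integral>\<^sup>+x. F x * indicator {x. lp_norm n p x \<le> r} x \<partial>?L)"
      by (rule nn_integral_cong) auto
    finally show ?thesis .
  qed
  have E2: "emeasure M2 {..r} = a * (\<integral>\<^sup>+x. 1 * indicator {x. lp_norm n p x \<le> r} x \<partial>?L)" for r
  proof -
    have "emeasure M2 {..r} = emeasure (density ?L (\<lambda>x. a)) (lp_norm n p -` {..r} \<inter> space ?L)"
      unfolding M2_def by (subst emeasure_distr) auto
    also have "\<dots> = (\<integral>\<^sup>+x. a * indicator (lp_norm n p -` {..r} \<inter> space ?L) x \<partial>?L)"
      by (subst emeasure_density) auto
    also have "\<dots> = a * (\<integral>\<^sup>+x. indicator (lp_norm n p -` {..r} \<inter> space ?L) x \<partial>?L)"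
      by (rule nn_integral_cmult) measurable
    also have "(\<integral>\<^sup>+x. indicator (lp_norm n p -` {..r} \<inter> space ?L) x \<partial>?L) = (\<integral>\<^sup>+x. 1 * indicator {x. lp_norm n p x \<le> r} x \<partial>?L)"
      by (rule nn_integral_cong) (auto split: split_indicator)
    finally show ?thesis .
  qed
  have pos: "emeasure M1 {..r} = emeasure M2 {..r} \<and> emeasure M1 {..r} < \<infinity>" if "r > 0" for r
  proof -
    have "emeasure M1 {..r} = b * (ennreal (r ^ n) * a)"
      unfolding E1 a_def by (subst distr_lp_norm_homogeneous[OF n p F hom that]) auto
    moreover have "emeasure M2 {..r} = a * (ennreal (r ^ n) * b)"
      unfolding E2 by (subst distr_lp_norm_homogeneous[OF n p _ _ that]) (auto simp: b_def)
    ultimately show ?thesis using ba by (simp add: mult_ac ennreal_mult_less_top)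
  qed
  have neg: "emeasure M1 {..r} = emeasure M2 {..r}" if "r \<le> 0" for r
  proof -
    have nz: "AE x in ?L. \<not> lp_norm n p x \<le> r"
      using AE_lp_norm_pos[OF n, of p] by eventually_elim (use that in auto)
    have "(\<integral>\<^sup>+x. H x * indicator {x. lp_norm n p x \<le> r} x \<partial>?L) = 0" for H
      using nz by (subst nn_integral_cong_AE[where v="\<lambda>_. 0"]) (auto elim!: eventually_mono)
    then show ?thesis unfolding E1 E2 by (simp only: mult_zero_right)
  qed
  have "M1 = M2"
  proof (rule measure_eqI_generator_eq)
    let ?E = "range (\<lambda>r::real. {..r})"
    show "Int_stable ?E" by (auto simp: Int_stable_def)
    show "?E \<subseteq> Pow UNIV" by auto
    show "emeasure M1 X = emeasure M2 X" if "X \<in> ?E" for X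
      using that pos neg by (metis imageE linorder_not_le)
    show "sets M1 = sigma_sets UNIV ?E" "sets M2 = sigma_sets UNIV ?E"
      by (simp_all add: M1_def M2_def borel_eq_atMost)
    show "range (\<lambda>i::nat. {..real i + 1}) \<subseteq> ?E" by auto
    show "(\<Union>i::nat. {..real i + 1}) = UNIV"
    proof -
      have "\<exists>i::nat. x \<le> real i + 1" for x
        using real_arch_simple[of x] by (meson add_increasing2 zero_le_one)
      then show ?thesis by auto
    qed
    show "emeasure M1 {..real i + 1} \<noteq> \<infinity>" for i :: nat using pos[of "real i + 1"] by auto
  qed
  then have "(\<integral>\<^sup>+r. G r \<partial>M1) = (\<integral>\<^sup>+r. G r \<partial>M2)" by simp
  moreover have "(\<integral>\<^sup>+r. G r \<partial>M1) = b * (\<integral>\<^sup>+x. F x * G (lp_norm n p x) \<partial>?L)"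
    unfolding M1_def by (subst nn_integral_distr, simp, simp, subst nn_integral_density)
      (auto simp: mult.assoc intro: nn_integral_cmult)
  moreover have "(\<integral>\<^sup>+r. G r \<partial>M2) = a * (\<integral>\<^sup>+x. G (lp_norm n p x) \<partial>?L)"
    unfolding M2_def by (subst nn_integral_distr, simp, simp, subst nn_integral_density)
      (auto simp: mult.assoc intro: nn_integral_cmult)
  ultimately show ?thesis by (simp add: a_def b_def)
qed

definition gaussian_n :: "nat \<Rightarrow> real \<Rightarrow> (nat \<Rightarrow> real) measure" where
  "gaussian_n n p = (\<Pi>\<^sub>M i\<in>{..<n}. p_gaussian p)"

lemma sets_gaussian_n [measurable_cong, simp]: "sets (gaussian_n n p) = sets (lebesgue_n n)"
  unfolding gaussian_n_def lebesgue_n_def by (intro sets_PiM_cong) auto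

lemma space_gaussian_n: "space (gaussian_n n p) = space (lebesgue_n n)"
  by (rule sets_eq_imp_space_eq) simp

lemma gaussian_n_prob_space: "p \<ge> 1 \<Longrightarrow> prob_space (gaussian_n n p)"
  unfolding gaussian_n_def by (intro prob_space_PiM p_gaussian_prob_space)

lemma gaussian_n_density:
  assumes p: "p \<ge> 1"
  obtains G where "G \<in> borel_measurable borel" "gaussian_n n p = density (lebesgue_n n) (\<lambda>x. G (lp_norm n p x))"
proof -
  interpret prob_space "p_gaussian p" using p by (rule p_gaussian_prob_space)
  interpret PS: product_sigma_finite "\<lambda>_::nat. p_gaussian p" by standard
  define C where "C = 2 * p powr (1 / p) * Gamma (1 + 1 / p)"
  have "Gamma (1 + 1 / p) > 0" using p by (intro Gamma_real_pos) (auto intro: add_pos_nonneg)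
  then have C: "C > 0" using p by (simp add: C_def)
  define G where "G r = ennreal (exp (- (r powr p) / p) / C ^ n)" for r
  have [measurable]: "G \<in> borel_measurable borel" unfolding G_def by measurable
  have Geq: "G (lp_norm n p x) = (\<Prod>i<n. ennreal (p_gaussian_density p (x i)))" for x
  proof -
    have "(\<Prod>i<n. ennreal (p_gaussian_density p (x i))) = ennreal (\<Prod>i<n. p_gaussian_density p (x i))"
      using C by (intro prod_ennreal) (auto simp: C_def[symmetric])
    also have "(\<Prod>i<n. p_gaussian_density p (x i)) = (\<Prod>i<n. exp (- (\<bar>x i\<bar> powr p) / p)) / C ^ n"
      unfolding C_def[symmetric] by (simp add: prod_dividef)
    also have "(\<Prod>i<n. exp (- (\<bar>x i\<bar> powr p) / p)) = exp (- (\<Sum>i<n. \<bar>x i\<bar> powr p) / p)"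
      by (simp add: exp_sum[symmetric] sum_divide_distrib sum_negf)
    finally show ?thesis using p by (simp add: G_def lp_norm_powr)
  qed
  have "density (lebesgue_n n) (\<lambda>x. G (lp_norm n p x)) = gaussian_n n p"
    unfolding gaussian_n_def
  proof (rule PS.PiM_eqI)
    show "sets (density (lebesgue_n n) (\<lambda>x. G (lp_norm n p x))) = sets (\<Pi>\<^sub>M i\<in>{..<n}. p_gaussian p)"
      using sets_gaussian_n[of n p] by (simp add: gaussian_n_def)
    fix A :: "nat \<Rightarrow> real set" assume A': "\<And>i. i \<in> {..<n} \<Longrightarrow> A i \<in> sets (p_gaussian p)"
    then have A: "A i \<in> sets borel" if "i < n" for i using that by simp
    have "emeasure (density (lebesgue_n n) (\<lambda>x. G (lp_norm n p x))) (Pi\<^sub>E {..<n} A)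
       = (\<integral>\<^sup>+x. G (lp_norm n p x) * indicator (Pi\<^sub>E {..<n} A) x \<partial>lebesgue_n n)"
      using box_in_sets[of n A] A by (intro emeasure_density) auto
    also have "\<dots> = (\<integral>\<^sup>+x. (\<Prod>i<n. ennreal (p_gaussian_density p (x i)) * indicator (A i) (x i)) \<partial>lebesgue_n n)"
    proof (rule nn_integral_cong)
      fix x assume x: "x \<in> space (lebesgue_n n)"
      have "(\<Prod>i<n. indicator (A i) (x i) :: ennreal) = indicator (Pi\<^sub>E {..<n} A) x"
      proof (cases "\<forall>i<n. x i \<in> A i")
        case True
        then show ?thesis using x by (auto simp: space_lebesgue_n PiE_iff indicator_def)
      next
        case False
        then obtain i where "i < n" "x i \<notin> A i" by auto
        then show ?thesis by (auto simp: PiE_iff indicator_def intro!: prod_zero)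
      qed
      then show "G (lp_norm n p x) * indicator (Pi\<^sub>E {..<n} A) x
        = (\<Prod>i<n. ennreal (p_gaussian_density p (x i)) * indicator (A i) (x i))"
        by (simp add: Geq prod.distrib)
    qed
    also have "\<dots> = (\<Prod>i<n. \<integral>\<^sup>+y. ennreal (p_gaussian_density p y) * indicator (A i) y \<partial>lborel)"
      unfolding lebesgue_n_def using A by (subst lborel_prod.product_nn_integral_prod) auto
    also have "\<dots> = (\<Prod>i<n. emeasure (p_gaussian p) (A i))"
      unfolding p_gaussian_def using A by (intro prod.cong refl) (simp add: emeasure_density)
    finally show "emeasure (density (lebesgue_n n) (\<lambda>x. G (lp_norm n p x))) (Pi\<^sub>E {..<n} A) = (\<Prod>i<n. emeasure (p_gaussian p) (A i))" .
  qed simp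
  with that[of G] show thesis by simp
qed

text \<open>The density of the product measure depends only on the norm, so a 0-homogeneous function
  has the same mean under it as under the uniform distribution on the ball, and it is
  independent of the norm.\<close>

lemma gaussian_n_homogeneous:
  assumes n: "n \<ge> 1" and p: "p \<ge> 1" and F[measurable]: "F \<in> borel_measurable (lebesgue_n n)"
    and hom: "\<And>r x. r > 0 \<Longrightarrow> x \<in> space (lebesgue_n n) \<Longrightarrow> F (scale_n n r x) = F x"
    and fin: "(\<integral>\<^sup>+x. F x * indicator (lp_ball n p) x \<partial>lebesgue_n n) < \<infinity>"
  shows "emeasure (lebesgue_n n) (lp_ball n p) * (\<integral>\<^sup>+x. F x \<partial>gaussian_n n p)
      = (\<integral>\<^sup>+x. F x * indicator (lp_ball n p) x \<partial>lebesgue_n n)" (is "?b * _ = ?a")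
    and "B \<in> sets borel \<Longrightarrow> (\<integral>\<^sup>+x. F x * indicator B (lp_norm n p x) \<partial>gaussian_n n p)
      = (\<integral>\<^sup>+x. F x \<partial>gaussian_n n p) * emeasure (gaussian_n n p) {x \<in> space (lebesgue_n n). lp_norm n p x \<in> B}"
proof -
  let ?L = "lebesgue_n n"
  interpret prob_space "gaussian_n n p" using p by (rule gaussian_n_prob_space)
  obtain G where G[measurable]: "G \<in> borel_measurable borel" and dens: "gaussian_n n p = density ?L (\<lambda>x. G (lp_norm n p x))"
    using gaussian_n_density[OF p] by blast
  have key: "?b * (\<integral>\<^sup>+x. F x * indicator B (lp_norm n p x) \<partial>gaussian_n n p)
      = ?a * emeasure (gaussian_n n p) {x \<in> space ?L. lp_norm n p x \<in> B}" if [measurable]: "B \<in> sets borel" for B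
  proof -
    have "(\<integral>\<^sup>+x. F x * indicator B (lp_norm n p x) \<partial>gaussian_n n p) = (\<integral>\<^sup>+x. F x * (G (lp_norm n p x) * indicator B (lp_norm n p x)) \<partial>?L)"
      unfolding dens by (subst nn_integral_density) (auto simp: mult_ac)
    moreover have "emeasure (gaussian_n n p) {x \<in> space ?L. lp_norm n p x \<in> B} = (\<integral>\<^sup>+x. G (lp_norm n p x) * indicator B (lp_norm n p x) \<partial>?L)"
      unfolding dens by (subst emeasure_density) (auto intro!: nn_integral_cong split: split_indicator)
    ultimately show ?thesis
      using nn_integral_lp_norm_homogeneous[OF n p F hom fin, of "\<lambda>r. G r * indicator B r"] by simp
  qed
  have "emeasure (gaussian_n n p) {x \<in> space ?L. lp_norm n p x \<in> UNIV} = 1"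
    using emeasure_space_1 by (simp add: space_gaussian_n)
  with key[of UNIV] show 1: "?b * (\<integral>\<^sup>+x. F x \<partial>gaussian_n n p) = ?a" by simp
  assume "B \<in> sets borel"
  from key[OF this] show "(\<integral>\<^sup>+x. F x * indicator B (lp_norm n p x) \<partial>gaussian_n n p)
      = (\<integral>\<^sup>+x. F x \<partial>gaussian_n n p) * emeasure (gaussian_n n p) {x \<in> space ?L. lp_norm n p x \<in> B}"
    unfolding 1[symmetric] mult.assoc
    using emeasure_lp_ball[OF p, of n] by (subst (asm) ennreal_mult_cancel_left) auto
qed

definition sphere_proj :: "nat \<Rightarrow> real \<Rightarrow> (nat \<Rightarrow> real) \<Rightarrow> (nat \<Rightarrow> real)" where
  "sphere_proj n p x = scale_n n (1 / lp_norm n p x) x"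

lemma measurable_sphere_proj [measurable]: "sphere_proj n p \<in> measurable (lebesgue_n n) (lebesgue_n n)"
  unfolding sphere_proj_def scale_n_def by (intro measurable_into_lebesgue_n) measurable

lemma scale_n_scale_n: "scale_n n r (scale_n n s x) = scale_n n (r * s) x"
  by (auto simp: scale_n_def restrict_def)

lemma scale_n_one: "x \<in> space (lebesgue_n n) \<Longrightarrow> scale_n n 1 x = x"
  by (auto simp: scale_n_def space_lebesgue_n extensional_def)

lemma scale_n_in_space [simp]: "scale_n n r x \<in> space (lebesgue_n n)"
  by (auto simp: scale_n_def space_lebesgue_n)

lemma sphere_proj_scale_n:
  assumes "p > 0" "r > 0"
  shows "sphere_proj n p (scale_n n r x) = sphere_proj n p x"
  using assms by (simp add: sphere_proj_def lp_norm_scale_n scale_n_scale_n)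

lemma lp_norm_sphere_proj:
  assumes "p > 0" "lp_norm n p x > 0"
  shows "lp_norm n p (sphere_proj n p x) = 1"
  using assms by (simp add: sphere_proj_def lp_norm_scale_n)

lemma sphere_proj_on_sphere: "x \<in> space (lebesgue_n n) \<Longrightarrow> lp_norm n p x = 1 \<Longrightarrow> sphere_proj n p x = x"
  by (simp add: sphere_proj_def scale_n_one)

lemma cone_eq:
  assumes p: "p > 0" and A: "A \<subseteq> lp_sphere n p" "A \<noteq> {}"
  shows "{scale_n n r a | r a. r \<in> {0..1} \<and> a \<in> A}
    = {x \<in> lp_ball n p. lp_norm n p x > 0 \<and> sphere_proj n p x \<in> A} \<union> {scale_n n 0 undefined}"
proof (intro set_eqI iffI)
  fix x assume "x \<in> {scale_n n r a | r a. r \<in> {0..1} \<and> a \<in> A}"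
  then obtain r a where x: "x = scale_n n r a" "0 \<le> r" "r \<le> 1" "a \<in> A" by auto
  then have a: "a \<in> space (lebesgue_n n)" "lp_norm n p a = 1" using A by (auto simp: lp_sphere_def)
  show "x \<in> {x \<in> lp_ball n p. lp_norm n p x > 0 \<and> sphere_proj n p x \<in> A} \<union> {scale_n n 0 undefined}"
  proof (cases "r = 0")
    case True
    then show ?thesis using x by (simp add: scale_n_def)
  next
    case False
    then show ?thesis using x a p sphere_proj_on_sphere[OF a]
      by (auto simp: lp_ball_def lp_norm_scale_n sphere_proj_scale_n)
  qed
next
  fix x assume "x \<in> {x \<in> lp_ball n p. lp_norm n p x > 0 \<and> sphere_proj n p x \<in> A} \<union> {scale_n n 0 undefined}"
  then show "x \<in> {scale_n n r a | r a. r \<in> {0..1} \<and> a \<in> A}"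
  proof
    assume x: "x \<in> {x \<in> lp_ball n p. lp_norm n p x > 0 \<and> sphere_proj n p x \<in> A}"
    then have "x = scale_n n (lp_norm n p x) (sphere_proj n p x)"
      by (auto simp: sphere_proj_def scale_n_scale_n scale_n_one lp_ball_def)
    with x show ?thesis by (auto simp: lp_ball_def intro!: exI[of _ "lp_norm n p x"] exI[of _ "sphere_proj n p x"])
  next
    obtain a where "a \<in> A" using A by auto
    moreover assume "x \<in> {scale_n n 0 undefined}"
    ultimately show ?thesis by (auto simp: scale_n_def intro!: exI[of _ 0])
  qed
qed

lemma origin_null:
  assumes "n \<ge> 1"
  shows "{scale_n n 0 undefined} \<in> null_sets (lebesgue_n n)"
proof -
  have eq: "{scale_n n 0 undefined} = Pi\<^sub>E {..<n} (\<lambda>_. {0::real})"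
    by (auto simp: scale_n_def PiE_iff extensional_def restrict_def)
  have "emeasure (lebesgue_n n) (Pi\<^sub>E {..<n} (\<lambda>_. {0::real})) = (\<Prod>i<n. emeasure lborel {0::real})"
    by (rule emeasure_lebesgue_n_box) simp
  also have "\<dots> = 0" using assms by simp
  finally have "Pi\<^sub>E {..<n} (\<lambda>_. {0::real}) \<in> null_sets (lebesgue_n n)"
    by (intro null_setsI box_in_sets) simp_all
  then show ?thesis unfolding eq .
qed

definition cone_volume :: "nat \<Rightarrow> real \<Rightarrow> (nat \<Rightarrow> real) set \<Rightarrow> ennreal" where
  "cone_volume n p A = emeasure (lebesgue_n n) {x \<in> lp_ball n p. sphere_proj n p x \<in> A}"

lemma AE_sphere_proj_in_sphere:
  assumes "n \<ge> 1" "p > 0"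
  shows "AE x in lebesgue_n n. sphere_proj n p x \<in> lp_sphere n p"
  using AE_lp_norm_pos[OF assms(1), of p] assms(2)
  by (auto elim!: eventually_mono simp: lp_sphere_def lp_norm_sphere_proj sphere_proj_def[of n p] simp flip: )
     (simp flip: sphere_proj_def add: lp_norm_sphere_proj)

lemma emeasure_cone:
  assumes n: "n \<ge> 1" and p: "p > 0" and A: "A \<in> sets (lebesgue_n n)"
  shows "emeasure (lebesgue_n n) {scale_n n r a | r a. r \<in> {0..1} \<and> a \<in> A \<inter> lp_sphere n p} = cone_volume n p A"
proof -
  let ?L = "lebesgue_n n"
  note A[measurable]
  have AE: "AE x in ?L. (x \<in> {x \<in> lp_ball n p. lp_norm n p x > 0 \<and> sphere_proj n p x \<in> A \<inter> lp_sphere n p}) =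
      (x \<in> {x \<in> lp_ball n p. sphere_proj n p x \<in> A})"
    using AE_lp_norm_pos[OF n, of p] AE_sphere_proj_in_sphere[OF n p] by eventually_elim auto
  have m: "{x \<in> lp_ball n p. lp_norm n p x > 0 \<and> sphere_proj n p x \<in> A \<inter> lp_sphere n p} \<in> sets ?L"
    "{x \<in> lp_ball n p. sphere_proj n p x \<in> A} \<in> sets ?L"
  proof -
    have "{x \<in> space ?L. x \<in> lp_ball n p \<and> lp_norm n p x > 0 \<and> sphere_proj n p x \<in> A \<inter> lp_sphere n p} \<in> sets ?L"
      "{x \<in> space ?L. x \<in> lp_ball n p \<and> sphere_proj n p x \<in> A} \<in> sets ?L" by measurable
    moreover have "{x \<in> space ?L. x \<in> lp_ball n p \<and> lp_norm n p x > 0 \<and> sphere_proj n p x \<in> A \<inter> lp_sphere n p}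
      = {x \<in> lp_ball n p. lp_norm n p x > 0 \<and> sphere_proj n p x \<in> A \<inter> lp_sphere n p}"
      "{x \<in> space ?L. x \<in> lp_ball n p \<and> sphere_proj n p x \<in> A} = {x \<in> lp_ball n p. sphere_proj n p x \<in> A}"
      by (auto simp: lp_ball_def)
    ultimately show "{x \<in> lp_ball n p. lp_norm n p x > 0 \<and> sphere_proj n p x \<in> A \<inter> lp_sphere n p} \<in> sets ?L"
      "{x \<in> lp_ball n p. sphere_proj n p x \<in> A} \<in> sets ?L" by simp_all
  qed
  have "emeasure ?L {x \<in> lp_ball n p. lp_norm n p x > 0 \<and> sphere_proj n p x \<in> A \<inter> lp_sphere n p} = cone_volume n p A"
    unfolding cone_volume_def by (rule emeasure_eq_AE[OF AE m])
  then show ?thesis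
  proof (cases "A \<inter> lp_sphere n p = {}")
    case False
    have "{scale_n n r a | r a. r \<in> {0..1} \<and> a \<in> A \<inter> lp_sphere n p}
      = {x \<in> lp_ball n p. lp_norm n p x > 0 \<and> sphere_proj n p x \<in> A \<inter> lp_sphere n p} \<union> {scale_n n 0 undefined}"
      by (rule cone_eq[OF p _ False]) auto
    then show ?thesis
      using emeasure_Un_null_set[OF m(1) origin_null[OF n]] \<open>_ = cone_volume n p A\<close> by simp
  qed auto
qed

lemma cone_measure_eq:
  assumes n: "n \<ge> 1" and p: "p \<ge> 1"
  shows "cone_measure n p = distr (uniform_measure (lebesgue_n n) (lp_ball n p)) (lebesgue_n n) (sphere_proj n p)"
    (is "_ = ?D")
proof -
  let ?L = "lebesgue_n n"
  have "emeasure ?D A = emeasure ?L {scale_n n r a | r a. r \<in> {0..1} \<and> a \<in> A \<inter> lp_sphere n p} / emeasure ?L (lp_ball n p)"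
    if A[measurable]: "A \<in> sets ?L" for A
  proof -
    have "emeasure ?D A = emeasure (uniform_measure ?L (lp_ball n p)) (sphere_proj n p -` A \<inter> space ?L)"
      by (subst emeasure_distr) auto
    also have "\<dots> = emeasure ?L (lp_ball n p \<inter> (sphere_proj n p -` A \<inter> space ?L)) / emeasure ?L (lp_ball n p)"
      by (rule emeasure_uniform_measure) auto
    also have "lp_ball n p \<inter> (sphere_proj n p -` A \<inter> space ?L) = {x \<in> lp_ball n p. sphere_proj n p x \<in> A}"
      by (auto simp: lp_ball_def)
    finally show ?thesis
      using emeasure_cone[OF n _ A, of p] p by (simp add: cone_volume_def)
  qed
  then have "cone_measure n p = measure_of (space ?L) (sets ?L) (emeasure ?D)"
    unfolding cone_measure_def by (intro measure_of_eq) (auto simp: sets.space_closed sets.sigma_sets_eq)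
  also have "\<dots> = ?D"
    using measure_of_of_measure[of ?D] by simp
  finally show ?thesis .
qed

lemma cone_measure_cone:
  assumes n: "n \<ge> 1" and p: "p \<ge> 1" and C[measurable]: "C \<in> sets (lebesgue_n n)"
    and hom: "\<And>r x. r > 0 \<Longrightarrow> x \<in> space (lebesgue_n n) \<Longrightarrow> scale_n n r x \<in> C \<longleftrightarrow> x \<in> C"
  shows "measure (cone_measure n p) C = measure (gaussian_n n p) C"
    and "prob_space (cone_measure n p)"
proof -
  let ?L = "lebesgue_n n"
  let ?b = "emeasure ?L (lp_ball n p)"
  note b = emeasure_lp_ball[OF p, of n]
  have hom': "indicator C (scale_n n r x) = (indicator C x :: ennreal)" if "r > 0" "x \<in> space ?L" for r x
    using hom[OF that] by (simp add: indicator_def)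
  have le: "(\<integral>\<^sup>+x. indicator C x * indicator (lp_ball n p) x \<partial>?L) \<le> (\<integral>\<^sup>+x. indicator (lp_ball n p) x \<partial>?L)"
    by (intro nn_integral_mono) (auto split: split_indicator)
  have "?b * (\<integral>\<^sup>+x. indicator C x \<partial>gaussian_n n p) = (\<integral>\<^sup>+x. indicator C x * indicator (lp_ball n p) x \<partial>?L)"
    by (rule gaussian_n_homogeneous(1)[OF n p _ hom']) (use le b in auto)
  then have 1: "?b * emeasure (gaussian_n n p) C = emeasure ?L (lp_ball n p \<inter> C)"
    by (simp add: mult.commute nn_integral_indicator[symmetric] indicator_inter_arith[symmetric] Int_commute del: nn_integral_indicator)
  interpret U: prob_space "uniform_measure ?L (lp_ball n p)"
    using b by (intro prob_space_uniform_measure) auto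
  show "prob_space (cone_measure n p)"
    unfolding cone_measure_eq[OF n p] by (rule U.prob_space_distr) measurable
  have AE: "AE x in ?L. x \<in> {x \<in> lp_ball n p. sphere_proj n p x \<in> C} \<longleftrightarrow> x \<in> lp_ball n p \<inter> C"
    using AE_lp_norm_pos[OF n, of p] AE_space
  proof eventually_elim
    case (elim x)
    have "sphere_proj n p x \<in> C \<longleftrightarrow> x \<in> C"
      using elim hom[of "1 / lp_norm n p x" x] by (simp add: sphere_proj_def)
    then show ?case by auto
  qed
  have "emeasure (cone_measure n p) C = emeasure ?L (lp_ball n p \<inter> (sphere_proj n p -` C \<inter> space ?L)) / ?b"
    unfolding cone_measure_eq[OF n p] by (subst emeasure_distr) (auto simp: emeasure_uniform_measure)
  also have "emeasure ?L (lp_ball n p \<inter> (sphere_proj n p -` C \<inter> space ?L)) = emeasure ?L (lp_ball n p \<inter> C)"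
    by (rule emeasure_eq_AE) (use AE_space AE in \<open>auto elim!: eventually_elim2\<close>)
  also have "\<dots> / ?b = emeasure (gaussian_n n p) C"
    unfolding 1[symmetric] using b by (subst mult.commute, subst ennreal_mult_divide_eq) auto
  finally show "measure (cone_measure n p) C = measure (gaussian_n n p) C"
    by (simp add: measure_def)
qed

lemma radial_law_cone:
  assumes n: "n \<ge> 1" and p: "p \<ge> 1" and C[measurable]: "C \<in> sets (lebesgue_n n)"
    and hom: "\<And>r x. r > 0 \<Longrightarrow> x \<in> space (lebesgue_n n) \<Longrightarrow> scale_n n r x \<in> C \<longleftrightarrow> x \<in> C"
    and \<rho>: "real_distribution \<rho>" "AE r in \<rho>. 0 < r"
  shows "measure (radial_law n p \<rho>) C = measure (gaussian_n n p) C"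
proof -
  let ?L = "lebesgue_n n"
  interpret \<rho>: real_distribution \<rho> by fact
  interpret C: prob_space "cone_measure n p" by (rule cone_measure_cone(2)[OF n p C hom])
  have sets [measurable_cong]: "sets (cone_measure n p) = sets ?L" by (simp add: cone_measure_eq[OF n p])
  then have space: "space (cone_measure n p) = space ?L" by (rule sets_eq_imp_space_eq)
  interpret P: pair_prob_space \<rho> "cone_measure n p" ..
  have [measurable]: "(\<lambda>(r, \<theta>). scale_n n r \<theta>) \<in> measurable (\<rho> \<Otimes>\<^sub>M cone_measure n p) ?L"
  proof -
    have "(\<lambda>z. \<lambda>i\<in>{..<n}. fst z * snd z i) \<in> measurable (\<rho> \<Otimes>\<^sub>M cone_measure n p) ?L"
    proof (rule measurable_into_lebesgue_n)
      fix i assume "i < n"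
      then have [measurable]: "(\<lambda>x. x i) \<in> borel_measurable (cone_measure n p)" by measurable
      show "(\<lambda>z. fst z * snd z i) \<in> borel_measurable (\<rho> \<Otimes>\<^sub>M cone_measure n p)" by measurable
    qed
    then show ?thesis by (simp add: scale_n_def split_beta')
  qed
  have "emeasure (radial_law n p \<rho>) C = emeasure (\<rho> \<Otimes>\<^sub>M cone_measure n p) ((\<lambda>(r, \<theta>). scale_n n r \<theta>) -` C \<inter> space (\<rho> \<Otimes>\<^sub>M cone_measure n p))"
    unfolding radial_law_def by (rule emeasure_distr) auto
  also have "\<dots> = (\<integral>\<^sup>+r. emeasure (cone_measure n p) (Pair r -` ((\<lambda>(r, \<theta>). scale_n n r \<theta>) -` C \<inter> space (\<rho> \<Otimes>\<^sub>M cone_measure n p))) \<partial>\<rho>)"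
    by (rule C.emeasure_pair_measure_alt) measurable
  also have "\<dots> = (\<integral>\<^sup>+r. emeasure (cone_measure n p) C \<partial>\<rho>)"
  proof (rule nn_integral_cong_AE)
    show "AE r in \<rho>. emeasure (cone_measure n p) (Pair r -` ((\<lambda>(r, \<theta>). scale_n n r \<theta>) -` C \<inter> space (\<rho> \<Otimes>\<^sub>M cone_measure n p)))
        = emeasure (cone_measure n p) C"
      using \<rho>(2)
    proof eventually_elim
      case (elim r)
      have "Pair r -` ((\<lambda>(r, \<theta>). scale_n n r \<theta>) -` C \<inter> space (\<rho> \<Otimes>\<^sub>M cone_measure n p)) = C"
        using hom[OF elim] sets.sets_into_space[OF C] by (auto simp: space_pair_measure space)
      then show ?case by simp
    qed
  qed
  also have "\<dots> = emeasure (cone_measure n p) C" by (simp add: \<rho>.emeasure_space_1[unfolded \<rho>.space_eq_univ])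
  finally show ?thesis using cone_measure_cone(1)[OF n p C hom] by (simp add: measure_def)
qed

section \<open>A central limit theorem on the sphere\<close>

lemma gaussian_n_sum_square:
  assumes p: "p \<ge> 1" and g[measurable]: "g \<in> borel_measurable borel"
    and i1: "integrable (p_gaussian p) g" and i2: "integrable (p_gaussian p) (\<lambda>x. (g x)\<^sup>2)"
    and z: "(\<integral>x. g x \<partial>p_gaussian p) = 0"
  shows "integrable (gaussian_n n p) (\<lambda>y. (\<Sum>i<n. g (y i))\<^sup>2)"
    and "(\<integral>y. (\<Sum>i<n. g (y i))\<^sup>2 \<partial>gaussian_n n p) = n * (\<integral>x. (g x)\<^sup>2 \<partial>p_gaussian p)"
proof -
  interpret prob_space "p_gaussian p" using p by (rule p_gaussian_prob_space)
  interpret PS: product_sigma_finite "\<lambda>_::nat. p_gaussian p" by standard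
  define h where "h i j l x = (if l = i then g x else 1) * (if l = j then g x else (1::real))" for i j l :: nat and x
  have h_int: "integrable (p_gaussian p) (h i j l)" for i j l
    using i1 i2 by (cases "l = i"; cases "l = j") (simp_all add: h_def[abs_def] power2_eq_square)
  have h_val: "(\<integral>x. h i j l x \<partial>p_gaussian p) = (if l = i \<and> l = j then \<integral>x. (g x)\<^sup>2 \<partial>p_gaussian p else if l = i \<or> l = j then 0 else 1)" for i j l
    using z prob_space by (cases "l = i"; cases "l = j") (simp_all add: h_def[abs_def] power2_eq_square)
  have prod: "(\<Prod>l<n. h i j l (y l)) = g (y i) * g (y j)" if "i < n" "j < n" for i j y
    unfolding h_def prod.distrib using that by (simp add: prod.delta)
  have int: "integrable (gaussian_n n p) (\<lambda>y. g (y i) * g (y j))" if "i < n" "j < n" for i j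
    unfolding prod[OF that, symmetric] gaussian_n_def using h_int
    by (intro PS.product_integrable_prod) auto
  have val: "(\<integral>y. g (y i) * g (y j) \<partial>gaussian_n n p) = (if i = j then \<integral>x. (g x)\<^sup>2 \<partial>p_gaussian p else 0)" if "i < n" "j < n" for i j
  proof -
    have "(\<integral>y. g (y i) * g (y j) \<partial>gaussian_n n p) = (\<Prod>l<n. \<integral>x. h i j l x \<partial>p_gaussian p)"
      unfolding prod[OF that, symmetric] gaussian_n_def using h_int by (intro PS.product_integral_prod) auto
    also have "\<dots> = (if i = j then \<integral>x. (g x)\<^sup>2 \<partial>p_gaussian p else 0)"
    proof (cases "i = j")
      case True
      then have "(\<Prod>l<n. \<integral>x. h i j l x \<partial>p_gaussian p) = (\<Prod>l<n. if l = i then \<integral>x. (g x)\<^sup>2 \<partial>p_gaussian p else 1)"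
        unfolding h_val by (intro prod.cong) auto
      then show ?thesis using True that by (simp add: prod.delta)
    next
      case False
      have "(\<Prod>l<n. \<integral>x. h i j l x \<partial>p_gaussian p) = 0"
        using that False by (intro prod_zero bexI[of _ i]) (auto simp: h_val)
      then show ?thesis using False by simp
    qed
    finally show ?thesis .
  qed
  have sq: "(\<Sum>i<n. g (y i))\<^sup>2 = (\<Sum>i<n. \<Sum>j<n. g (y i) * g (y j))" for y
    by (simp add: power2_eq_square sum_product)
  show "integrable (gaussian_n n p) (\<lambda>y. (\<Sum>i<n. g (y i))\<^sup>2)"
    unfolding sq using int by (intro Bochner_Integration.integrable_sum) auto
  have "(\<integral>y. (\<Sum>i<n. g (y i))\<^sup>2 \<partial>gaussian_n n p) = (\<Sum>i<n. \<Sum>j<n. \<integral>y. g (y i) * g (y j) \<partial>gaussian_n n p)"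
    unfolding sq using int
    by (subst Bochner_Integration.integral_sum) (auto intro!: Bochner_Integration.integrable_sum Bochner_Integration.integral_sum sum.cong)
  also have "\<dots> = (\<Sum>i<n. \<integral>x. (g x)\<^sup>2 \<partial>p_gaussian p)"
    by (intro sum.cong refl) (simp add: val)
  finally show "(\<integral>y. (\<Sum>i<n. g (y i))\<^sup>2 \<partial>gaussian_n n p) = n * (\<integral>x. (g x)\<^sup>2 \<partial>p_gaussian p)" by simp
qed

lemma gaussian_n_mean_deviation:
  assumes p: "p \<ge> 1" and f[measurable]: "f \<in> borel_measurable borel"
    and i1: "integrable (p_gaussian p) f" and i2: "integrable (p_gaussian p) (\<lambda>x. (f x)\<^sup>2)"
  obtains v where "v \<ge> 0" "\<And>n. n \<ge> 1 \<Longrightarrow> integrable (gaussian_n n p) (\<lambda>y. ((\<Sum>i<n. f (y i)) / n - (\<integral>x. f x \<partial>p_gaussian p))\<^sup>2)"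
    "\<And>n. n \<ge> 1 \<Longrightarrow> (\<integral>y. ((\<Sum>i<n. f (y i)) / n - (\<integral>x. f x \<partial>p_gaussian p))\<^sup>2 \<partial>gaussian_n n p) = v / n"
proof -
  interpret prob_space "p_gaussian p" using p by (rule p_gaussian_prob_space)
  define a where "a = (\<integral>x. f x \<partial>p_gaussian p)"
  define g where "g x = f x - a" for x
  have [measurable]: "g \<in> borel_measurable borel" unfolding g_def by measurable
  have g1: "integrable (p_gaussian p) g" unfolding g_def using i1 by auto
  have z: "(\<integral>x. g x \<partial>p_gaussian p) = 0" unfolding g_def using i1 prob_space by (simp add: a_def)
  have g2: "integrable (p_gaussian p) (\<lambda>x. (g x)\<^sup>2)"
    unfolding g_def power2_diff using i1 i2 by auto
  define v where "v = (\<integral>x. (g x)\<^sup>2 \<partial>p_gaussian p)"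
  have eq: "((\<Sum>i<n. f (y i)) / n - a)\<^sup>2 = (\<Sum>i<n. g (y i))\<^sup>2 / (real n)\<^sup>2" if "n \<ge> 1" for n y
  proof -
    have "(\<Sum>i<n. f (y i)) / n - a = (\<Sum>i<n. g (y i)) / n"
      using that by (simp add: g_def sum_subtractf field_simps)
    then show ?thesis by (simp add: power_divide)
  qed
  note sq = gaussian_n_sum_square[OF p \<open>g \<in> borel_measurable borel\<close> g1 g2 z]
  show ?thesis
  proof (rule that[of v])
    show "v \<ge> 0" by (simp add: v_def)
    fix n :: nat assume n: "n \<ge> 1"
    show "integrable (gaussian_n n p) (\<lambda>y. ((\<Sum>i<n. f (y i)) / n - (\<integral>x. f x \<partial>p_gaussian p))\<^sup>2)"
      unfolding a_def[symmetric] eq[OF n] using sq by simp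
    show "(\<integral>y. ((\<Sum>i<n. f (y i)) / n - (\<integral>x. f x \<partial>p_gaussian p))\<^sup>2 \<partial>gaussian_n n p) = v / n"
      unfolding a_def[symmetric] eq[OF n] using sq n by (simp add: v_def power2_eq_square)
  qed
qed

lemma abs_le_square_average:
  fixes x s :: real
  assumes "s > 0"
  shows "\<bar>x\<bar> \<le> (x\<^sup>2 / s + s) / 2"
proof -
  have "0 \<le> (\<bar>x\<bar> - s)\<^sup>2" by simp
  then have "2 * s * \<bar>x\<bar> \<le> x\<^sup>2 + s\<^sup>2" by (simp add: power2_diff mult_ac)
  then show ?thesis using assms by (simp add: field_simps power2_eq_square)
qed

lemma normal_abs_moment_le:
  assumes "t > 0"
  shows "integrable (density lborel (normal_density 0 t)) (\<lambda>x. \<bar>x\<bar>)"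
    and "(\<integral>x. \<bar>x\<bar> \<partial>density lborel (normal_density 0 t)) \<le> t"
proof -
  interpret prob_space "density lborel (normal_density 0 t)" using assms by (rule prob_space_normal_density)
  let ?N = "density lborel (normal_density 0 t)"
  have i: "integrable ?N (\<lambda>x. x\<^sup>2)" "(\<integral>x. x\<^sup>2 \<partial>?N) = t\<^sup>2"
    using integrable_normal_moment[OF assms, of 0 2] integral_normal_moment_even[OF assms, of 0 1] assms
    by (auto simp: integrable_density integral_density fact_numeral)
  show j: "integrable ?N (\<lambda>x. \<bar>x\<bar>)"
    using integrable_normal_moment_abs[OF assms, of 0 1] by (auto simp: integrable_density)
  have "(\<integral>x. \<bar>x\<bar> \<partial>?N) \<le> (\<integral>x. (x\<^sup>2 / t + t) / 2 \<partial>?N)"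
    using i j by (intro integral_mono abs_le_square_average assms) auto
  also have "\<dots> = (t\<^sup>2 / t + prob (space ?N) * t) / 2"
    using i by simp
  also have "\<dots> = t" unfolding prob_space using assms by (simp add: power2_eq_square)
  finally show "(\<integral>x. \<bar>x\<bar> \<partial>?N) \<le> t" .
qed

lemma real_distribution_normal: "s > 0 \<Longrightarrow> real_distribution (density lborel (normal_density 0 s))"
  using prob_space_normal_density[of s 0] by (auto simp: real_distribution_def real_distribution_axioms_def)

lemma normal_cdf_diff:
  assumes "s > 0" "a \<le> b"
  shows "cdf (density lborel (normal_density 0 s)) b - cdf (density lborel (normal_density 0 s)) a
    = (\<integral>x. normal_density 0 s x * indicator {a<..b} x \<partial>lborel)"
proof -
  interpret real_distribution "density lborel (normal_density 0 s)" using assms(1) by (rule real_distribution_normal)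
  show ?thesis
  proof (cases "a = b")
    case False
    then have "cdf (density lborel (normal_density 0 s)) b - cdf (density lborel (normal_density 0 s)) a
       = prob {a<..b}" using assms by (subst cdf_diff_eq) auto
    also have "\<dots> = (\<integral>x. indicator {a<..b} x \<partial>density lborel (normal_density 0 s))" by simp
    also have "\<dots> = (\<integral>x. normal_density 0 s x * indicator {a<..b} x \<partial>lborel)"
      by (subst integral_density) auto
    finally show ?thesis .
  qed simp
qed

lemma normal_cdf_diff_le:
  assumes "s > 0" "a \<le> b" and le: "\<And>x. a < x \<Longrightarrow> x \<le> b \<Longrightarrow> normal_density 0 s x \<le> c"
  shows "cdf (density lborel (normal_density 0 s)) b - cdf (density lborel (normal_density 0 s)) a \<le> c * (b - a)"
proof -
  have "(\<integral>x. normal_density 0 s x * indicator {a<..b} x \<partial>lborel) \<le> (\<integral>x. c * indicator {a<..b} x \<partial>lborel)"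
  proof (rule integral_mono)
    show "integrable lborel (\<lambda>x. normal_density 0 s x * indicator {a<..b} x)"
      using assms(1) by (intro integrable_real_mult_indicator) auto
    show "integrable lborel (\<lambda>x. c * indicator {a<..b} x)"
      using assms(2) by (intro integrable_mult_right integrable_real_indicator) auto
  qed (use le in \<open>auto split: split_indicator\<close>)
  also have "\<dots> = c * (b - a)" using assms(2) by simp
  finally show ?thesis unfolding normal_cdf_diff[OF assms(1,2)] .
qed

lemma normal_density_le: "s > 0 \<Longrightarrow> normal_density 0 s x \<le> 1 / s"
proof -
  assume s: "s > 0"
  have "s \<le> sqrt (2 * pi * s\<^sup>2)"
    using s pi_gt3 by (intro real_le_rsqrt) (simp add: mult_le_cancel_right1)
  then have "1 / sqrt (2 * pi * s\<^sup>2) \<le> 1 / s" using s by (intro divide_left_mono) auto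
  moreover have "exp (- (x - 0)\<^sup>2 / (2 * s\<^sup>2)) \<le> 1" by simp
  ultimately have "1 / sqrt (2 * pi * s\<^sup>2) * exp (- (x - 0)\<^sup>2 / (2 * s\<^sup>2)) \<le> 1 / s * 1"
    using s by (intro mult_mono) simp_all
  then show ?thesis unfolding normal_density_def by simp
qed

lemma cdf_noisy_independent_sum:
  fixes V N :: "'a \<Rightarrow> real" and g :: "real \<Rightarrow> real"
  assumes \<Omega>: "prob_space \<Omega>" and E: "real_distribution E"
    and V[measurable]: "V \<in> borel_measurable \<Omega>" and N[measurable]: "N \<in> borel_measurable \<Omega>"
    and g[measurable]: "g \<in> borel_measurable borel"
    and indep: "\<And>A B. A \<in> sets borel \<Longrightarrow> B \<in> sets borel \<Longrightarrow>
      emeasure \<Omega> {y \<in> space \<Omega>. V y \<in> A \<and> N y \<in> B} = emeasure \<Omega> {y \<in> space \<Omega>. V y \<in> A} * emeasure \<Omega> {y \<in> space \<Omega>. N y \<in> B}"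
  shows "cdf (distr (\<Omega> \<Otimes>\<^sub>M E) borel (\<lambda>(y, e). V y + g (N y) + e)) t
    = (\<integral>w. cdf (distr \<Omega> borel V) (t - w) \<partial>distr (distr \<Omega> borel N \<Otimes>\<^sub>M E) borel (\<lambda>(r, e). g r + e))"
proof -
  interpret \<Omega>: prob_space \<Omega> by fact
  interpret E: real_distribution E by fact
  define LV LN where "LV = distr \<Omega> borel V" and "LN = distr \<Omega> borel N"
  interpret LV: real_distribution LV unfolding LV_def by (rule \<Omega>.real_distribution_distr) simp
  interpret LN: real_distribution LN unfolding LN_def by (rule \<Omega>.real_distribution_distr) simp
  interpret P: pair_prob_space \<Omega> E ..
  interpret PN: pair_prob_space LN E ..
  interpret PVN: pair_prob_space LV LN ..
  have J: "distr \<Omega> (borel \<Otimes>\<^sub>M borel) (\<lambda>y. (V y, N y)) = LV \<Otimes>\<^sub>M LN"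
  proof (rule pair_measure_eqI[symmetric])
    show "sigma_finite_measure LV" "sigma_finite_measure LN" by unfold_locales
    show "sets (LV \<Otimes>\<^sub>M LN) = sets (distr \<Omega> (borel \<Otimes>\<^sub>M borel) (\<lambda>y. (V y, N y)))"
      by (simp add: sets_pair_measure_cong[OF LV.events_eq_borel LN.events_eq_borel])
    fix A B assume "A \<in> sets LV" "B \<in> sets LN"
    then have [measurable]: "A \<in> sets borel" "B \<in> sets borel" by auto
    have "emeasure (distr \<Omega> (borel \<Otimes>\<^sub>M borel) (\<lambda>y. (V y, N y))) (A \<times> B) = emeasure \<Omega> {y \<in> space \<Omega>. V y \<in> A \<and> N y \<in> B}"
      by (subst emeasure_distr) (auto intro!: arg_cong[where f="emeasure \<Omega>"])
    also have "\<dots> = emeasure LV A * emeasure LN B"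
      unfolding LV_def LN_def by (subst indep) (auto simp: emeasure_distr vimage_def Int_def conj_commute)
    finally show "emeasure LV A * emeasure LN B = emeasure (distr \<Omega> (borel \<Otimes>\<^sub>M borel) (\<lambda>y. (V y, N y))) (A \<times> B)" ..
  qed
  have cm [measurable]: "cdf LV \<in> borel_measurable borel"
    using LV.cdf_nondecreasing by (auto intro!: borel_measurable_mono monoI)
  have bnd: "0 \<le> cdf LV x" "cdf LV x \<le> 1" for x
    by (auto intro: LV.cdf_nonneg LV.cdf_bounded_prob)
  have inner: "emeasure \<Omega> {y \<in> space \<Omega>. V y + g (N y) + e \<le> t} = (\<integral>\<^sup>+r. ennreal (cdf LV (t - (g r + e))) \<partial>LN)" for e
  proof -
    have "emeasure \<Omega> {y \<in> space \<Omega>. V y + g (N y) + e \<le> t} = emeasure (distr \<Omega> (borel \<Otimes>\<^sub>M borel) (\<lambda>y. (V y, N y))) {z. fst z + g (snd z) + e \<le> t}"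
    proof (subst emeasure_distr)
      have "{z \<in> space (borel \<Otimes>\<^sub>M borel). fst z + g (snd z) + e \<le> t} \<in> sets (borel \<Otimes>\<^sub>M borel)" by measurable
      then show "{z. fst z + g (snd z) + e \<le> t} \<in> sets (borel \<Otimes>\<^sub>M borel)" by (simp add: space_pair_measure)
    qed (auto intro!: arg_cong[where f="emeasure \<Omega>"])
    also have "\<dots> = (\<integral>\<^sup>+r. emeasure LV ((\<lambda>v. (v, r)) -` {z. fst z + g (snd z) + e \<le> t}) \<partial>LN)"
      unfolding J
    proof (rule PVN.emeasure_pair_measure_alt2)
      have "{z \<in> space (LV \<Otimes>\<^sub>M LN). fst z + g (snd z) + e \<le> t} \<in> sets (LV \<Otimes>\<^sub>M LN)" by measurable
      then show "{z. fst z + g (snd z) + e \<le> t} \<in> sets (LV \<Otimes>\<^sub>M LN)" by (simp add: space_pair_measure)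
    qed
    also have "\<dots> = (\<integral>\<^sup>+r. ennreal (cdf LV (t - (g r + e))) \<partial>LN)"
    proof (rule nn_integral_cong)
      fix r
      have "(\<lambda>v. (v, r)) -` {z. fst z + g (snd z) + e \<le> t} = {..t - (g r + e)}" by auto
      then show "emeasure LV ((\<lambda>v. (v, r)) -` {z. fst z + g (snd z) + e \<le> t}) = ennreal (cdf LV (t - (g r + e)))"
        by (simp add: cdf_def LV.emeasure_eq_measure)
    qed
    finally show ?thesis .
  qed
  have "emeasure (distr (\<Omega> \<Otimes>\<^sub>M E) borel (\<lambda>(y, e). V y + g (N y) + e)) {..t}
     = emeasure (\<Omega> \<Otimes>\<^sub>M E) {z \<in> space (\<Omega> \<Otimes>\<^sub>M E). V (fst z) + g (N (fst z)) + snd z \<le> t}"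
    by (subst emeasure_distr) (auto intro!: arg_cong[where f="emeasure (\<Omega> \<Otimes>\<^sub>M E)"] simp: split_beta')
  also have "\<dots> = (\<integral>\<^sup>+e. emeasure \<Omega> ((\<lambda>y. (y, e)) -` {z \<in> space (\<Omega> \<Otimes>\<^sub>M E). V (fst z) + g (N (fst z)) + snd z \<le> t}) \<partial>E)"
    by (rule P.emeasure_pair_measure_alt2) measurable
  also have "\<dots> = (\<integral>\<^sup>+e. (\<integral>\<^sup>+r. ennreal (cdf LV (t - (g r + e))) \<partial>LN) \<partial>E)"
    unfolding inner[symmetric] by (intro nn_integral_cong arg_cong[where f="emeasure \<Omega>"]) (auto simp: space_pair_measure)
  also have "\<dots> = (\<integral>\<^sup>+z. ennreal (cdf LV (t - (g (fst z) + snd z))) \<partial>(LN \<Otimes>\<^sub>M E))"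
    by (subst PN.nn_integral_snd[symmetric]) auto
  also have "\<dots> = (\<integral>\<^sup>+w. ennreal (cdf LV (t - w)) \<partial>distr (LN \<Otimes>\<^sub>M E) borel (\<lambda>(r, e). g r + e))"
    by (subst nn_integral_distr) (auto simp: split_beta')
  also have "\<dots> = ennreal (\<integral>w. cdf LV (t - w) \<partial>distr (LN \<Otimes>\<^sub>M E) borel (\<lambda>(r, e). g r + e))"
  proof -
    interpret W: prob_space "distr (LN \<Otimes>\<^sub>M E) borel (\<lambda>(r, e). g r + e)"
      by (rule PN.prob_space_distr) measurable
    show ?thesis
      using bnd by (intro nn_integral_eq_integral W.integrable_const_bound[where B=1]) auto
  qed
  finally show ?thesis
    using bnd by (simp add: cdf_def measure_def LV_def LN_def)
qed

lemma noisy_sum_distribution: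
  fixes T :: "'a \<Rightarrow> real"
  assumes \<Omega>: "prob_space \<Omega>" and T[measurable]: "T \<in> borel_measurable \<Omega>" and \<tau>: "\<tau> > 0"
  defines "E \<equiv> density lborel (normal_density 0 \<tau>)"
  defines "M \<equiv> distr (\<Omega> \<Otimes>\<^sub>M E) borel (\<lambda>(y, e). T y + e)"
  shows "real_distribution M" and "measure M {x} = 0"
    and "char M t = (\<integral>y. iexp (t * T y) \<partial>\<Omega>) * exp (- (\<tau>\<^sup>2 * t\<^sup>2 / 2))"
proof -
  interpret \<Omega>: prob_space \<Omega> by fact
  interpret E: real_distribution E unfolding E_def using \<tau> by (rule real_distribution_normal)
  interpret P: pair_prob_space \<Omega> E ..
  show "real_distribution M" unfolding M_def by (rule P.real_distribution_distr) measurable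
  have "emeasure M {x} = emeasure (\<Omega> \<Otimes>\<^sub>M E) {z \<in> space (\<Omega> \<Otimes>\<^sub>M E). T (fst z) + snd z = x}"
    unfolding M_def by (subst emeasure_distr) (auto intro!: arg_cong[where f="emeasure (\<Omega> \<Otimes>\<^sub>M E)"] simp: split_beta')
  also have "\<dots> = (\<integral>\<^sup>+y. emeasure E (Pair y -` {z \<in> space (\<Omega> \<Otimes>\<^sub>M E). T (fst z) + snd z = x}) \<partial>\<Omega>)"
    by (rule E.emeasure_pair_measure_alt) measurable
  also have "\<dots> = (\<integral>\<^sup>+y. 0 \<partial>\<Omega>)"
  proof (rule nn_integral_cong)
    fix y assume "y \<in> space \<Omega>"
    then have "Pair y -` {z \<in> space (\<Omega> \<Otimes>\<^sub>M E). T (fst z) + snd z = x} = {x - T y}"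
      by (auto simp: space_pair_measure)
    moreover have "emeasure E {x - T y} = 0"
      unfolding E_def by (subst emeasure_density)
        (auto intro!: nn_integral_0_iff_AE[THEN iffD2] AE_I[of _ _ "{x - T y}"] split: split_indicator)
    ultimately show "emeasure E (Pair y -` {z \<in> space (\<Omega> \<Otimes>\<^sub>M E). T (fst z) + snd z = x}) = 0" by simp
  qed
  finally show "measure M {x} = 0" by (simp add: measure_def)
  have int: "integrable (\<Omega> \<Otimes>\<^sub>M E) (\<lambda>(y, e). iexp (t * T y) * iexp (t * e))"
    by (rule P.integrable_const_bound[where B=1]) (auto simp: norm_mult)
  have "char M t = (\<integral>z. iexp (t * (T (fst z) + snd z)) \<partial>(\<Omega> \<Otimes>\<^sub>M E))"
    unfolding M_def char_def by (subst integral_distr) (auto simp: split_beta')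
  also have "\<dots> = (\<integral>z. (case z of (y, e) \<Rightarrow> iexp (t * T y) * iexp (t * e)) \<partial>(\<Omega> \<Otimes>\<^sub>M E))"
    by (intro Bochner_Integration.integral_cong) (auto simp: exp_add[symmetric] algebra_simps)
  also have "\<dots> = (\<integral>y. (\<integral>e. iexp (t * T y) * iexp (t * e) \<partial>E) \<partial>\<Omega>)"
    using P.integral_fst'[OF int] by simp
  also have "\<dots> = (\<integral>y. iexp (t * T y) * char E t \<partial>\<Omega>)"
    unfolding char_def by simp
  also have "\<dots> = (\<integral>y. iexp (t * T y) \<partial>\<Omega>) * char E t" by simp
  finally show "char M t = (\<integral>y. iexp (t * T y) \<partial>\<Omega>) * exp (- (\<tau>\<^sup>2 * t\<^sup>2 / 2))"
    by (simp add: E_def char_normal_density[OF \<tau>])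
qed

definition log_deviation :: "nat \<Rightarrow> real \<Rightarrow> (nat \<Rightarrow> real) \<Rightarrow> real" where
  "log_deviation n p y = (if \<forall>i<n. y i \<noteq> 0
     then sqrt n * ((\<Sum>i<n. ln \<bar>y i\<bar>) / n - log_mean p - ln ((\<Sum>i<n. \<bar>y i\<bar> powr p) / n) / p) else 0)"

lemma measurable_log_deviation [measurable]: "log_deviation n p \<in> borel_measurable (lebesgue_n n)"
  unfolding log_deviation_def by measurable

lemma sum_abs_powr_pos:
  fixes n :: nat
  assumes "n \<ge> 1" "\<forall>i<n. (y i :: real) \<noteq> 0"
  shows "(\<Sum>i<n. \<bar>y i\<bar> powr p) > 0"
  using assms by (intro sum_pos) (auto simp: lessThan_empty_iff)

lemma log_deviation_scale_n:
  assumes n: "n \<ge> 1" and p: "p \<ge> 1" and r: "r > 0"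
  shows "log_deviation n p (scale_n n r y) = log_deviation n p y"
proof (cases "\<forall>i<n. y i \<noteq> 0")
  case True
  then have nz: "\<forall>i<n. scale_n n r y i \<noteq> 0" using r by (auto simp: scale_n_def)
  have "(\<Sum>i<n. ln \<bar>scale_n n r y i\<bar>) = (\<Sum>i<n. ln r + ln \<bar>y i\<bar>)"
    using True r by (intro sum.cong) (auto simp: scale_n_def abs_mult ln_mult)
  then have 1: "(\<Sum>i<n. ln \<bar>scale_n n r y i\<bar>) / n = ln r + (\<Sum>i<n. ln \<bar>y i\<bar>) / n"
    using n by (simp add: sum.distrib field_simps)
  have "(\<Sum>i<n. \<bar>scale_n n r y i\<bar> powr p) = r powr p * (\<Sum>i<n. \<bar>y i\<bar> powr p)"
    unfolding sum_distrib_left using r by (intro sum.cong) (auto simp: scale_n_def abs_mult powr_mult)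
  then have 2: "ln ((\<Sum>i<n. \<bar>scale_n n r y i\<bar> powr p) / n) / p = ln r + ln ((\<Sum>i<n. \<bar>y i\<bar> powr p) / n) / p"
    using n p r sum_abs_powr_pos[OF n True, of p] by (simp add: ln_mult ln_div ln_powr field_simps)
  show ?thesis unfolding log_deviation_def 1 2 using nz True by simp
next
  case False
  then show ?thesis using r by (auto simp: log_deviation_def scale_n_def)
qed

lemma AE_gaussian_n_nonzero:
  assumes "p \<ge> 1"
  shows "AE y in gaussian_n n p. \<forall>i<n. y i \<noteq> 0"
proof -
  obtain G where [measurable]: "G \<in> borel_measurable borel" and eq: "gaussian_n n p = density (lebesgue_n n) (\<lambda>x. G (lp_norm n p x))"
    using gaussian_n_density[OF assms] by blast
  show ?thesis
    unfolding eq using AE_lebesgue_n_nonzero[of n] by (subst AE_density) (auto elim: eventually_mono)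
qed

lemma log_deviation_independent:
  assumes n: "n \<ge> 1" and p: "p \<ge> 1" and [measurable]: "A \<in> sets borel" and B[measurable]: "B \<in> sets borel"
  shows "emeasure (gaussian_n n p) {y \<in> space (gaussian_n n p). log_deviation n p y \<in> A \<and> lp_norm n p y \<in> B}
    = emeasure (gaussian_n n p) {y \<in> space (gaussian_n n p). log_deviation n p y \<in> A}
      * emeasure (gaussian_n n p) {y \<in> space (gaussian_n n p). lp_norm n p y \<in> B}"
proof -
  define F where "F y = (indicator A (log_deviation n p y) :: ennreal)" for y
  have F [measurable]: "F \<in> borel_measurable (lebesgue_n n)" unfolding F_def by measurable
  have hom: "F (scale_n n r x) = F x" if "r > 0" for r x
    using n p that by (simp add: F_def log_deviation_scale_n)
  have "(\<integral>\<^sup>+x. F x * indicator (lp_ball n p) x \<partial>lebesgue_n n) \<le> (\<integral>\<^sup>+x. indicator (lp_ball n p) x \<partial>lebesgue_n n)"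
    by (intro nn_integral_mono) (auto simp: F_def split: split_indicator)
  also have "\<dots> < \<infinity>" using emeasure_lp_ball[OF p, of n] by simp
  finally have fin: "(\<integral>\<^sup>+x. F x * indicator (lp_ball n p) x \<partial>lebesgue_n n) < \<infinity>" .
  have S1: "{y \<in> space (gaussian_n n p). log_deviation n p y \<in> A \<and> lp_norm n p y \<in> B} \<in> sets (gaussian_n n p)"
    by measurable
  have S2: "{y \<in> space (gaussian_n n p). log_deviation n p y \<in> A} \<in> sets (gaussian_n n p)"
    by measurable
  have "(\<integral>\<^sup>+x. F x * indicator B (lp_norm n p x) \<partial>gaussian_n n p) = emeasure (gaussian_n n p) {y \<in> space (gaussian_n n p). log_deviation n p y \<in> A \<and> lp_norm n p y \<in> B}"
    by (subst nn_integral_indicator[OF S1, symmetric]) (auto simp: F_def intro!: nn_integral_cong split: split_indicator)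
  moreover have "(\<integral>\<^sup>+x. F x \<partial>gaussian_n n p) = emeasure (gaussian_n n p) {y \<in> space (gaussian_n n p). log_deviation n p y \<in> A}"
    by (subst nn_integral_indicator[OF S2, symmetric]) (auto simp: F_def intro!: nn_integral_cong split: split_indicator)
  ultimately show ?thesis
    using gaussian_n_homogeneous(2)[OF n p F hom fin B] by (simp add: space_gaussian_n)
qed

lemma centered_score_sum:
  assumes n: "n \<ge> 1" and p: "p \<ge> 1" and nz: "\<forall>i<n. y i \<noteq> 0"
  defines "d \<equiv> lp_norm n p y powr p / n"
  shows "log_deviation n p y + sqrt n / p * (ln d - d + 1) = (\<Sum>i<n. centered_score p (y i)) / sqrt n"
proof -
  have d: "d = (\<Sum>i<n. \<bar>y i\<bar> powr p) / n" using p by (simp add: d_def lp_norm_powr)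
  have "(\<Sum>i<n. centered_score p (y i)) = n * ((\<Sum>i<n. ln \<bar>y i\<bar>) / n - log_mean p - (d - 1) / p)"
  proof -
    have "(\<Sum>i<n. centered_score p (y i)) = (\<Sum>i<n. ln \<bar>y i\<bar>) - n * log_mean p - ((\<Sum>i<n. \<bar>y i\<bar> powr p) - n) / p"
      unfolding centered_score_def by (simp add: sum_subtractf sum_divide_distrib[symmetric])
    also have "\<dots> = n * ((\<Sum>i<n. ln \<bar>y i\<bar>) / n - log_mean p - (d - 1) / p)"
      using n p by (simp add: d field_simps)
    finally show ?thesis .
  qed
  then have "(\<Sum>i<n. centered_score p (y i)) / sqrt n = sqrt n * ((\<Sum>i<n. ln \<bar>y i\<bar>) / n - log_mean p - (d - 1) / p)"
  proof -
    have "n * X / sqrt n = sqrt n * X" for X :: real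
    proof -
      have "n * X / sqrt n = (n / sqrt n) * X" by simp
      then show ?thesis by (simp only: real_div_sqrt of_nat_0_le_iff)
    qed
    then show ?thesis using \<open>(\<Sum>i<n. centered_score p (y i)) = _\<close> by simp
  qed
  also have "\<dots> = log_deviation n p y + sqrt n / p * (ln d - d + 1)"
  proof -
    have "(d - 1) / p = ln d / p - 1 / p * (ln d - d + 1)" by (simp add: diff_divide_distrib add_divide_distrib)
    then show ?thesis unfolding log_deviation_def d[symmetric] using nz by (simp add: algebra_simps diff_divide_distrib add_divide_distrib)
  qed
  finally show ?thesis ..
qed

lemma centered_score_measurable': "centered_score p \<in> borel_measurable (p_gaussian p)"
  using centered_score_measurable[of p] by (simp only: measurable_cong_sets[OF sets_p_gaussian refl])

lemma char_centered_score_approx: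
  assumes p: "p \<ge> 1"
  defines "\<phi> \<equiv> char (distr (p_gaussian p) borel (centered_score p))"
  shows "cmod (\<phi> t - of_real (1 - (sqrt (limit_variance p))\<^sup>2 * t\<^sup>2 / 2)) \<le> (\<integral>x. \<bar>centered_score p x\<bar> ^ 3 \<partial>p_gaussian p) / 6 * \<bar>t\<bar> ^ 3"
    and "cmod (\<phi> t) \<le> 1"
proof -
  interpret prob_space "p_gaussian p" using p by (rule p_gaussian_prob_space)
  note m = centered_score_moments[OF p]
  have i: "integrable (p_gaussian p) (centered_score p)" "integrable (p_gaussian p) (\<lambda>x. (centered_score p x)\<^sup>2)"
  proof -
    from integrable_of_cube[OF finite_measure_axioms centered_score_measurable' m(1)]
    show "integrable (p_gaussian p) (centered_score p)" "integrable (p_gaussian p) (\<lambda>x. (centered_score p x)\<^sup>2)" .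
  qed
  have lv: "limit_variance p \<ge> 0" unfolding m(3)[symmetric] by simp
  have "cmod (\<phi> t - (1 - t\<^sup>2 * limit_variance p / 2)) \<le> t\<^sup>2 / 6 * expectation (\<lambda>x. min (6 * (centered_score p x)\<^sup>2) (\<bar>t\<bar> * \<bar>centered_score p x\<bar> ^ 3))"
  proof -
    note centered_score_measurable'
    moreover have "variance (centered_score p) = limit_variance p" unfolding m(2) using m(3) by simp
    ultimately show ?thesis unfolding \<phi>_def by (intro char_approx3' i m(2) refl)
  qed
  also have "\<dots> \<le> t\<^sup>2 / 6 * expectation (\<lambda>x. \<bar>t\<bar> * \<bar>centered_score p x\<bar> ^ 3)"
  proof (rule mult_left_mono)
    have j: "integrable (p_gaussian p) (\<lambda>x. \<bar>t\<bar> * \<bar>centered_score p x\<bar> ^ 3)"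
      by (rule integrable_mult_right[OF m(1)])
    note [measurable] = centered_score_measurable'
    have i3: "integrable (p_gaussian p) (\<lambda>x. min (6 * (centered_score p x)\<^sup>2) (\<bar>t\<bar> * \<bar>centered_score p x\<bar> ^ 3))"
    proof (rule Bochner_Integration.integrable_bound[OF j])
      show "AE x in p_gaussian p. norm (min (6 * (centered_score p x)\<^sup>2) (\<bar>t\<bar> * \<bar>centered_score p x\<bar> ^ 3)) \<le> norm (\<bar>t\<bar> * \<bar>centered_score p x\<bar> ^ 3)"
        by (intro AE_I2) (simp add: min_def)
    qed measurable
    show "expectation (\<lambda>x. min (6 * (centered_score p x)\<^sup>2) (\<bar>t\<bar> * \<bar>centered_score p x\<bar> ^ 3)) \<le> expectation (\<lambda>x. \<bar>t\<bar> * \<bar>centered_score p x\<bar> ^ 3)"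
      by (rule integral_mono[OF i3 j]) (rule min.cobounded2)
  qed simp
  also have "\<dots> = expectation (\<lambda>x. \<bar>centered_score p x\<bar> ^ 3) / 6 * \<bar>t\<bar> ^ 3"
    by (simp add: power3_eq_cube power2_eq_square)
  finally show "cmod (\<phi> t - of_real (1 - (sqrt (limit_variance p))\<^sup>2 * t\<^sup>2 / 2)) \<le> expectation (\<lambda>x. \<bar>centered_score p x\<bar> ^ 3) / 6 * \<bar>t\<bar> ^ 3"
    using lv by (simp add: mult.commute)
  show "cmod (\<phi> t) \<le> 1"
    unfolding \<phi>_def by (intro real_distribution.cmod_char_le_1 real_distribution_distr centered_score_measurable')
qed

lemma char_score_sum:
  assumes p: "p \<ge> 1"
  shows "(\<integral>y. iexp (t * ((\<Sum>i<n. centered_score p (y i)) / sqrt n)) \<partial>gaussian_n n p)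
    = char (distr (p_gaussian p) borel (centered_score p)) (t / sqrt n) ^ n"
proof -
  interpret prob_space "p_gaussian p" using p by (rule p_gaussian_prob_space)
  interpret PS: product_sigma_finite "\<lambda>_::nat. p_gaussian p" by standard
  have "(\<integral>y. iexp (t * ((\<Sum>i<n. centered_score p (y i)) / sqrt n)) \<partial>gaussian_n n p)
     = (\<integral>y. (\<Prod>i<n. iexp (t / sqrt n * centered_score p (y i))) \<partial>gaussian_n n p)"
    by (intro Bochner_Integration.integral_cong refl)
       (simp add: exp_sum[symmetric] sum_distrib_left sum_divide_distrib)
  also have "\<dots> = (\<Prod>i<n. \<integral>x. iexp (t / sqrt n * centered_score p x) \<partial>p_gaussian p)"
    unfolding gaussian_n_def
  proof (rule PS.product_integral_prod)
    have "(\<lambda>u. iexp (t / sqrt n * u)) \<in> borel_measurable borel" by measurable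
    from measurable_compose[OF centered_score_measurable' this]
    show "integrable (p_gaussian p) (\<lambda>x. iexp (t / sqrt n * centered_score p x))"
      by (intro integrable_const_bound[where B=1] AE_I2) (simp_all only: norm_exp_i_times order_refl)
  qed simp
  also have "\<dots> = char (distr (p_gaussian p) borel (centered_score p)) (t / sqrt n) ^ n"
  proof -
    have "(\<lambda>u. iexp (t / sqrt n * u)) \<in> borel_measurable borel" by measurable
    then have "char (distr (p_gaussian p) borel (centered_score p)) (t / sqrt n) = (\<integral>x. iexp (t / sqrt n * centered_score p x) \<partial>p_gaussian p)"
      unfolding char_def by (intro integral_distr centered_score_measurable')
    then show ?thesis by (simp only: prod_constant card_lessThan)
  qed
  finally show ?thesis .
qed

definition norm_correction :: "nat \<Rightarrow> real \<Rightarrow> real \<Rightarrow> real" where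
  "norm_correction n p r = sqrt n / p * (ln (r powr p / n) - r powr p / n + 1)"

lemma measurable_norm_correction [measurable]: "norm_correction n p \<in> borel_measurable borel"
  unfolding norm_correction_def by measurable

lemma norm_correction_bound:
  assumes p: "p \<ge> 1" and L: "L \<ge> 0"
  shows "min 1 (L * \<bar>norm_correction n p r\<bar>) \<le> (2 * L * sqrt n + 4) * (r powr p / n - 1)\<^sup>2"
proof -
  define x where "x = r powr p / n - 1"
  have g: "norm_correction n p r = sqrt n / p * (ln (1 + x) - x)" by (simp add: norm_correction_def x_def)
  show ?thesis
  proof (cases "\<bar>x\<bar> \<le> 1 / 2")
    case True
    have "\<bar>norm_correction n p r\<bar> = sqrt n / p * \<bar>ln (1 + x) - x\<bar>"
      unfolding g using p by (simp add: abs_mult)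
    also have "\<dots> \<le> sqrt n / 1 * (2 * x\<^sup>2)"
      using p abs_ln_one_plus_x_minus_x_bound[OF True] by (intro mult_mono divide_left_mono) auto
    finally have "L * \<bar>norm_correction n p r\<bar> \<le> L * (sqrt n * (2 * x\<^sup>2))" using L by (intro mult_left_mono) auto
    also have "\<dots> \<le> (2 * L * sqrt n + 4) * x\<^sup>2" by (simp add: algebra_simps)
    finally show ?thesis by (simp add: x_def)
  next
    case False
    have "1 / 4 \<le> x\<^sup>2" using power_mono[of "1/2" "\<bar>x\<bar>" 2] False by (simp add: power_divide)
    then have "1 \<le> 4 * x\<^sup>2" by simp
    also have "\<dots> \<le> (2 * L * sqrt n + 4) * x\<^sup>2" using L by (intro mult_right_mono) auto
    finally show ?thesis by (simp add: x_def)
  qed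
qed

lemma correction_moment:
  assumes p: "p \<ge> 1" and L: "L > 0" and \<tau>: "\<tau> > 0" and n: "n \<ge> 1" and v: "v \<ge> 0"
    and dev: "integrable (gaussian_n n p) (\<lambda>y. ((\<Sum>i<n. \<bar>y i\<bar> powr p) / n - 1)\<^sup>2)"
      "(\<integral>y. ((\<Sum>i<n. \<bar>y i\<bar> powr p) / n - 1)\<^sup>2 \<partial>gaussian_n n p) = v / n"
  defines "E \<equiv> density lborel (normal_density 0 \<tau>)"
  shows "(\<integral>w. min 1 (L * \<bar>w\<bar>) \<partial>distr (distr (gaussian_n n p) borel (lp_norm n p) \<Otimes>\<^sub>M E) borel (\<lambda>(r, e). norm_correction n p r + e))
    \<le> (2 * L + 4) * v / sqrt n + L * \<tau>"
proof -
  interpret PG: prob_space "gaussian_n n p" using p by (rule gaussian_n_prob_space)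
  interpret E: real_distribution E unfolding E_def using \<tau> by (rule real_distribution_normal)
  define LN where "LN = distr (gaussian_n n p) borel (lp_norm n p)"
  interpret LN: real_distribution LN unfolding LN_def by (rule PG.real_distribution_distr) measurable
  interpret P: pair_prob_space LN E ..
  have iE: "integrable E (\<lambda>e. L * \<bar>e\<bar>)" "(\<integral>e. \<bar>e\<bar> \<partial>E) \<le> \<tau>"
    using normal_abs_moment_le[OF \<tau>] by (auto simp: E_def)
  have sq: "((\<Sum>i<n. \<bar>y i\<bar> powr p) / n - 1)\<^sup>2 = (lp_norm n p y powr p / n - 1)\<^sup>2" for y
    using p by (simp add: lp_norm_powr)
  have iN: "integrable LN (\<lambda>r. (r powr p / n - 1)\<^sup>2)" "(\<integral>r. (r powr p / n - 1)\<^sup>2 \<partial>LN) = v / n"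
    using dev unfolding LN_def sq by (auto simp: integrable_distr_eq integral_distr)
  have min_int: "integrable LN (\<lambda>r. min 1 (L * \<bar>norm_correction n p r\<bar>))"
    using L by (intro LN.integrable_const_bound[where B=1]) auto
  have f1: "integrable (LN \<Otimes>\<^sub>M E) (\<lambda>z. min 1 (L * \<bar>norm_correction n p (fst z)\<bar>))"
    using L by (intro P.integrable_const_bound[where B=1]) auto
  have f2: "integrable (LN \<Otimes>\<^sub>M E) (\<lambda>z. L * \<bar>snd z\<bar>)"
    using iE(1) by (intro P.Fubini_integrable) auto
  have "(\<integral>w. min 1 (L * \<bar>w\<bar>) \<partial>distr (LN \<Otimes>\<^sub>M E) borel (\<lambda>(r, e). norm_correction n p r + e))
      = (\<integral>z. min 1 (L * \<bar>norm_correction n p (fst z) + snd z\<bar>) \<partial>(LN \<Otimes>\<^sub>M E))"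
    by (subst integral_distr) (auto simp: split_beta')
  also have "\<dots> \<le> (\<integral>z. min 1 (L * \<bar>norm_correction n p (fst z)\<bar>) + L * \<bar>snd z\<bar> \<partial>(LN \<Otimes>\<^sub>M E))"
  proof (rule integral_mono)
    show "integrable (LN \<Otimes>\<^sub>M E) (\<lambda>z. min 1 (L * \<bar>norm_correction n p (fst z) + snd z\<bar>))"
      using L by (intro P.integrable_const_bound[where B=1]) auto
    fix z :: "real \<times> real"
    have "L * \<bar>norm_correction n p (fst z) + snd z\<bar> \<le> L * (\<bar>norm_correction n p (fst z)\<bar> + \<bar>snd z\<bar>)"
      using L by (intro mult_left_mono) auto
    moreover have "L * \<bar>snd z\<bar> \<ge> 0" using L by simp
    ultimately show "min 1 (L * \<bar>norm_correction n p (fst z) + snd z\<bar>) \<le> min 1 (L * \<bar>norm_correction n p (fst z)\<bar>) + L * \<bar>snd z\<bar>"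
      by (auto simp: min_def distrib_left)
  qed (use f1 f2 in auto)
  also have "\<dots> = (\<integral>z. min 1 (L * \<bar>norm_correction n p (fst z)\<bar>) \<partial>(LN \<Otimes>\<^sub>M E)) + (\<integral>z. L * \<bar>snd z\<bar> \<partial>(LN \<Otimes>\<^sub>M E))"
    using f1 f2 by (rule Bochner_Integration.integral_add)
  also have "(\<integral>z. min 1 (L * \<bar>norm_correction n p (fst z)\<bar>) \<partial>(LN \<Otimes>\<^sub>M E)) = (\<integral>r. min 1 (L * \<bar>norm_correction n p r\<bar>) \<partial>LN)"
    using P.integral_fst'[OF f1, symmetric] by (simp add: E.prob_space[unfolded E.space_eq_univ])
  also have "(\<integral>z. L * \<bar>snd z\<bar> \<partial>(LN \<Otimes>\<^sub>M E)) = L * (\<integral>e. \<bar>e\<bar> \<partial>E)"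
    using P.integral_fst'[OF f2, symmetric] by (simp add: LN.prob_space[unfolded LN.space_eq_univ])
  also have "(\<integral>r. min 1 (L * \<bar>norm_correction n p r\<bar>) \<partial>LN) \<le> (\<integral>r. (2 * L * sqrt n + 4) * (r powr p / n - 1)\<^sup>2 \<partial>LN)"
    using min_int iN norm_correction_bound[OF p] L by (intro integral_mono) auto
  also have "\<dots> = (2 * L * sqrt n + 4) * (v / n)" using iN by simp
  also have "\<dots> \<le> (2 * L + 4) * v / sqrt n"
  proof -
    have sn: "sqrt n \<ge> 1" "real n = sqrt n * sqrt n" using n by auto
    have "(2 * L * x + 4) * (v / (x * x)) \<le> (2 * L + 4) * v / x" if "x \<ge> 1" for x :: real
    proof -
      have "(2 * L * x + 4) * (v / (x * x)) = 2 * L * v / x + 4 * v / (x * x)" using that by (simp add: field_simps)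
      also have "4 * v / (x * x) \<le> 4 * v / (x * 1)" using that v by (intro divide_left_mono mult_left_mono) auto
      finally show ?thesis by (simp add: add_divide_distrib[symmetric] algebra_simps)
    qed
    from this[OF sn(1)] show ?thesis by (simp flip: sn(2))
  qed
  finally have "(\<integral>w. min 1 (L * \<bar>w\<bar>) \<partial>distr (LN \<Otimes>\<^sub>M E) borel (\<lambda>(r, e). norm_correction n p r + e))
    \<le> (2 * L + 4) * v / sqrt n + L * (\<integral>e. \<bar>e\<bar> \<partial>E)" by simp
  moreover have "L * (\<integral>e. \<bar>e\<bar> \<partial>E) \<le> L * \<tau>" using iE(2) L by (intro mult_left_mono) auto
  ultimately show ?thesis unfolding LN_def by (rule order_trans[OF _ add_left_mono])
qed

theorem log_deviation_clt:
  assumes p: "p \<ge> 1" and lv: "limit_variance p > 0"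
  defines "\<Phi> \<equiv> cdf (density lborel (normal_density 0 (sqrt (limit_variance p))))"
  obtains C where "C > 0" "\<And>n t. n \<ge> 2 \<Longrightarrow>
    \<bar>measure (gaussian_n n p) {y \<in> space (gaussian_n n p). log_deviation n p y \<le> t} - \<Phi> t\<bar> \<le> C * (sqrt (ln n) / sqrt n)"
proof -
  define s where "s = sqrt (limit_variance p)"
  have s: "s > 0" using lv by (simp add: s_def)
  interpret p: prob_space "p_gaussian p" using p by (rule p_gaussian_prob_space)
  interpret Z: real_distribution "density lborel (normal_density 0 s)" using s by (rule real_distribution_normal)
  define \<phi> where "\<phi> = char (distr (p_gaussian p) borel (centered_score p))"
  obtain C0 K where C0: "C0 > 0" and K: "K > 0" and BE:
    "\<And>(n :: nat) M x. n \<ge> 2 \<Longrightarrow> real_distribution M \<Longrightarrow> (\<And>x. measure M {x} = 0) \<Longrightarrow>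
      (\<And>t. char M t = \<phi> (t / sqrt n) ^ n * exp (- (K * ln n / n * t\<^sup>2 / 2))) \<Longrightarrow>
      \<bar>cdf M x - \<Phi> x\<bar> \<le> C0 * sqrt (ln n) / sqrt n"
    using berry_esseen_smoothed[OF char_centered_score_approx(1)[OF p] s[unfolded s_def] char_centered_score_approx(2)[OF p]]
    unfolding \<phi>_def \<Phi>_def s_def by metis
  have ip: "integrable (p_gaussian p) (\<lambda>x. \<bar>x\<bar> powr p)" "integrable (p_gaussian p) (\<lambda>x. (\<bar>x\<bar> powr p)\<^sup>2)"
  proof -
    show "integrable (p_gaussian p) (\<lambda>x. \<bar>x\<bar> powr p)" using p by (intro p_gaussian_integrable_powr) auto
    have "(\<lambda>x::real. (\<bar>x\<bar> powr p)\<^sup>2) = (\<lambda>x. \<bar>x\<bar> powr (2 * p))"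
      using powr_add[of _ p p] by (simp add: power2_eq_square fun_eq_iff)
    then show "integrable (p_gaussian p) (\<lambda>x. (\<bar>x\<bar> powr p)\<^sup>2)" using p by (simp add: p_gaussian_integrable_powr)
  qed
  obtain v where v: "v \<ge> 0" "\<And>n. n \<ge> 1 \<Longrightarrow> integrable (gaussian_n n p) (\<lambda>y. ((\<Sum>i<n. \<bar>y i\<bar> powr p) / n - 1)\<^sup>2)"
    "\<And>n. n \<ge> 1 \<Longrightarrow> (\<integral>y. ((\<Sum>i<n. \<bar>y i\<bar> powr p) / n - 1)\<^sup>2 \<partial>gaussian_n n p) = v / n"
    using gaussian_n_mean_deviation[OF p _ ip] unfolding p_gaussian_abs_moment_p[OF p] by auto
  define L where "L = 1 / s"
  have L: "L > 0" using s by (simp add: L_def)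
  define C1 where "C1 = ((2 * L + 4) * v + 1) / sqrt (ln 2) + L * sqrt K"
  have C1: "C1 > 0" using L v(1) K by (auto simp: C1_def intro!: add_pos_nonneg divide_pos_pos add_nonneg_pos mult_nonneg_nonneg)
  show ?thesis
  proof (rule that[of "2 * C0 + 14 * C1"])
    show "2 * C0 + 14 * C1 > 0" using C0 C1 by simp
    fix n :: nat and t assume n: "n \<ge> 2"
    then have n1: "n \<ge> 1" by simp
    interpret PG: prob_space "gaussian_n n p" using p by (rule gaussian_n_prob_space)
    define b where "b = sqrt (ln n) / sqrt n"
    have lnn: "ln n \<ge> ln 2" "ln n > 0" using n by auto
    have ib: "1 / sqrt n \<le> b / sqrt (ln 2)"
    proof -
      have "1 / sqrt n = sqrt (ln 2) / sqrt n / sqrt (ln 2)" by simp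
      also have "\<dots> \<le> b / sqrt (ln 2)" unfolding b_def using lnn by (intro divide_right_mono) auto
      finally show ?thesis .
    qed
    define \<tau> where "\<tau> = sqrt (K * ln n / n)"
    have \<tau>: "\<tau> > 0" "\<tau>\<^sup>2 = K * ln n / n" "\<tau> = sqrt K * b"
    proof -
      have "K * ln n / n > 0" using K lnn n by simp
      then show "\<tau> > 0" "\<tau>\<^sup>2 = K * ln n / n" unfolding \<tau>_def by simp_all
      show "\<tau> = sqrt K * b" by (simp add: \<tau>_def b_def real_sqrt_mult real_sqrt_divide)
    qed
    define E where "E = density lborel (normal_density 0 \<tau>)"
    interpret E: real_distribution E unfolding E_def using \<tau>(1) by (rule real_distribution_normal)
    define V where "V = distr (gaussian_n n p) borel (log_deviation n p)"
    define LN where "LN = distr (gaussian_n n p) borel (lp_norm n p)"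
    interpret V: real_distribution V unfolding V_def by (rule PG.real_distribution_distr) measurable
    interpret LN: real_distribution LN unfolding LN_def by (rule PG.real_distribution_distr) measurable
    interpret P: pair_prob_space LN E ..
    define W where "W = distr (LN \<Otimes>\<^sub>M E) borel (\<lambda>(r, e). norm_correction n p r + e)"
    have W: "real_distribution W" unfolding W_def by (rule P.real_distribution_distr) measurable
    define M where "M = distr (gaussian_n n p \<Otimes>\<^sub>M E) borel (\<lambda>(y, e). log_deviation n p y + norm_correction n p (lp_norm n p y) + e)"
    define T where "T y = log_deviation n p y + norm_correction n p (lp_norm n p y)" for y
    have [measurable]: "T \<in> borel_measurable (gaussian_n n p)" unfolding T_def by measurable
    note noisy = noisy_sum_distribution[OF PG.prob_space_axioms \<open>T \<in> _\<close> \<tau>(1), folded E_def, folded M_def[folded T_def]]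
    have conv: "\<bar>(\<integral>w. cdf V (t - w) \<partial>W) - \<Phi> t\<bar> \<le> C0 * b" for t
    proof -
      have "(\<integral>w. cdf V (t - w) \<partial>W) = cdf M t"
        unfolding V_def W_def M_def LN_def
        by (rule cdf_noisy_independent_sum[symmetric]) (use PG.prob_space_axioms E.real_distribution_axioms log_deviation_independent[OF n1 p] in auto)
      moreover have "\<bar>cdf M t - \<Phi> t\<bar> \<le> C0 * sqrt (ln n) / sqrt n"
      proof (rule BE[OF n noisy(1,2)])
        fix t
        have "(\<integral>y. iexp (t * T y) \<partial>gaussian_n n p) = (\<integral>y. iexp (t * ((\<Sum>i<n. centered_score p (y i)) / sqrt n)) \<partial>gaussian_n n p)"
        proof (rule integral_cong_AE)
          show "AE y in gaussian_n n p. iexp (t * T y) = iexp (t * ((\<Sum>i<n. centered_score p (y i)) / sqrt n))"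
            using AE_gaussian_n_nonzero[OF p]
          proof eventually_elim
            case (elim y)
            have "T y = (\<Sum>i<n. centered_score p (y i)) / sqrt n"
              using centered_score_sum[OF n1 p elim] by (simp only: T_def norm_correction_def)
            then show ?case by (simp only:)
          qed
        qed measurable
        then show "char M t = \<phi> (t / sqrt n) ^ n * exp (- (K * ln n / n * t\<^sup>2 / 2))"
          unfolding noisy(3) char_score_sum[OF p] \<phi>_def[symmetric] by (simp add: \<tau>(2))
      qed
      ultimately show ?thesis by (simp add: b_def)
    qed
    have "(\<integral>w. min 1 (L * \<bar>w\<bar>) \<partial>W) \<le> (2 * L + 4) * v / sqrt n + L * \<tau>"
      unfolding W_def LN_def E_def by (rule correction_moment[OF p L \<tau>(1) n1 v(1) v(2)[OF n1] v(3)[OF n1]])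
    also have "\<dots> \<le> C1 * b"
    proof -
      have "(2 * L + 4) * v / sqrt n \<le> ((2 * L + 4) * v + 1) * (1 / sqrt n)"
        by (simp add: divide_right_mono)
      also have "\<dots> \<le> ((2 * L + 4) * v + 1) * (b / sqrt (ln 2))"
        using ib v(1) L by (intro mult_left_mono) auto
      finally have "(2 * L + 4) * v / sqrt n \<le> ((2 * L + 4) * v + 1) * (b / sqrt (ln 2))" .
      moreover have "C1 * b = ((2 * L + 4) * v + 1) * (b / sqrt (ln 2)) + L * (sqrt K * b)"
        by (simp add: C1_def distrib_right)
      ultimately show ?thesis unfolding \<tau>(3) by linarith
    qed
    finally have \<kappa>: "(\<integral>w. min 1 (L * \<bar>w\<bar>) \<partial>W) \<le> C1 * b" .
    have "\<bar>cdf V t - \<Phi> t\<bar> \<le> 2 * (C0 * b) + 14 * (C1 * b)"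
    proof (rule kolmogorov_deconvolution[OF V.real_distribution_axioms W _ _ _ _ L conv \<kappa>])
      show "mono \<Phi>" unfolding \<Phi>_def s_def[symmetric] by (intro monoI Z.cdf_nondecreasing)
      show "0 \<le> \<Phi> t" "\<Phi> t \<le> 1" for t
        unfolding \<Phi>_def s_def[symmetric] by (auto intro: Z.cdf_nonneg Z.cdf_bounded_prob)
      show "\<Phi> t - \<Phi> s' \<le> L * (t - s')" if "s' \<le> t" for s' t
        unfolding \<Phi>_def s_def[symmetric] L_def using s that by (intro normal_cdf_diff_le normal_density_le)
      show "C1 * b > 0" using C1 lnn n by (simp add: b_def)
    qed
    moreover have "cdf V t = measure (gaussian_n n p) {y \<in> space (gaussian_n n p). log_deviation n p y \<le> t}"
      unfolding cdf_def V_def by (subst measure_distr) (auto intro!: arg_cong[where f="measure (gaussian_n n p)"])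
    ultimately show "\<bar>measure (gaussian_n n p) {y \<in> space (gaussian_n n p). log_deviation n p y \<le> t} - \<Phi> t\<bar>
        \<le> (2 * C0 + 14 * C1) * (sqrt (ln n) / sqrt n)"
      by (simp add: b_def algebra_simps)
  qed
qed

section \<open>Symmetric means\<close>

fun elem_sym :: "(nat \<Rightarrow> real) \<Rightarrow> nat \<Rightarrow> nat \<Rightarrow> real" where
  "elem_sym a n 0 = 1"
| "elem_sym a 0 (Suc k) = 0"
| "elem_sym a (Suc n) (Suc k) = elem_sym a n (Suc k) + a n * elem_sym a n k"

lemma sum_prod_subsets_eq_elem_sym:
  "(\<Sum>I | I \<subseteq> {..<n} \<and> card I = k. \<Prod>i\<in>I. a i) = elem_sym a n k"
proof (induction a n k rule: elem_sym.induct)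
  case (1 a n)
  have "{I. I \<subseteq> {..<n} \<and> card I = 0} = {{}}" by (auto dest: finite_subset)
  then show ?case by simp
next
  case (2 a k)
  have "{I. I \<subseteq> {..<0::nat} \<and> card I = Suc k} = {}" by auto
  then show ?case by (simp only: sum.empty elem_sym.simps)
next
  case (3 a n k)
  let ?S = "\<lambda>n k. {I. I \<subseteq> {..<n} \<and> card I = k}"
  have fin: "finite (?S n k)" for n k :: nat by (rule finite_subset[of _ "Pow {..<n}"]) auto
  have ni: "n \<notin> I \<and> finite I" if "I \<in> ?S n j" for I j
    using that by (auto intro: finite_subset)
  have eq: "?S (Suc n) (Suc k) = ?S n (Suc k) \<union> insert n ` ?S n k"
  proof (intro set_eqI iffI)
    fix I assume I: "I \<in> ?S (Suc n) (Suc k)"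
    then have finI: "finite I" by (auto intro: finite_subset)
    show "I \<in> ?S n (Suc k) \<union> insert n ` ?S n k"
    proof (cases "n \<in> I")
      case True
      have "I - {n} \<in> ?S n k" using I True finI by (auto simp: lessThan_Suc)
      moreover have "I = insert n (I - {n})" using True by auto
      ultimately show ?thesis by blast
    next
      case False
      then show ?thesis using I by (auto simp: lessThan_Suc)
    qed
  next
    fix I assume "I \<in> ?S n (Suc k) \<union> insert n ` ?S n k"
    then show "I \<in> ?S (Suc n) (Suc k)" using ni by (fastforce simp: lessThan_Suc)
  qed
  have disj: "?S n (Suc k) \<inter> insert n ` ?S n k = {}" using ni by blast
  have inj: "inj_on (insert n) (?S n k)" using ni by (auto simp: inj_on_def insert_ident)
  have "(\<Sum>I\<in>insert n ` ?S n k. \<Prod>i\<in>I. a i) = (\<Sum>I\<in>?S n k. a n * (\<Prod>i\<in>I. a i))"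
    using ni by (subst sum.reindex[OF inj]) (auto intro!: sum.cong)
  also have "\<dots> = a n * elem_sym a n k" unfolding sum_distrib_left[symmetric] 3 ..
  finally have 4: "(\<Sum>I\<in>insert n ` ?S n k. \<Prod>i\<in>I. a i) = a n * elem_sym a n k" .
  show ?case
    unfolding eq sum.union_disjoint[OF fin finite_imageI[OF fin] disj] 4 3 by simp
qed

lemma elem_sym_nonneg: "(\<And>i. a i \<ge> 0) \<Longrightarrow> elem_sym a n k \<ge> 0"
  by (induction a n k rule: elem_sym.induct) auto

lemma elem_sym_one: "elem_sym (\<lambda>_. 1) n k = n choose k"
  by (induction "\<lambda>_::nat. 1::real" n k rule: elem_sym.induct) auto

lemma elem_sym_recursion:
  assumes a: "\<And>i. a i \<ge> 0"
  shows "Suc k * elem_sym a n (Suc k) \<le> (\<Sum>i<n. a i) * elem_sym a n k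
    \<and> Suc k * elem_sym a n (Suc k) \<ge> (\<Sum>i<n. a i) * elem_sym a n k
        - (\<Sum>i<n. (a i)\<^sup>2) * (if k = 0 then 0 else elem_sym a n (k - 1))"
proof (induction n arbitrary: k)
  case 0
  then show ?case by simp
next
  case (Suc n)
  let ?P = "\<Sum>i<n. a i" and ?Q = "\<Sum>i<n. (a i)\<^sup>2"
  note e = elem_sym_nonneg[of a, OF a]
  show ?case
  proof (cases k)
    case 0
    have "elem_sym a l (Suc 0) = (\<Sum>i<l. a i)" for l
      by (induction l) auto
    then show ?thesis using 0 by simp
  next
    case (Suc j)
    note IHk = Suc.IH[of k] and IHj = Suc.IH[of j]
    define x where "x = a n"
    have x: "x \<ge> 0" using a by (simp add: x_def)
    define e0 e1 e2 where "e0 = elem_sym a n j" and "e1 = elem_sym a n k" and "e2 = elem_sym a n (Suc k)"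
    define e' where "e' = (if j = 0 then 0 else elem_sym a n (j - 1))"
    have en: "e0 \<ge> 0" "e1 \<ge> 0" "e2 \<ge> 0" "e' \<ge> 0" using e by (auto simp: e0_def e1_def e2_def e'_def)
    have Q: "?Q \<ge> 0" by (intro sum_nonneg) auto
    have 1: "real (Suc k) * e2 \<le> ?P * e1" "real (Suc k) * e2 \<ge> ?P * e1 - ?Q * e0"
      using IHk Suc by (auto simp: e0_def e1_def e2_def)
    have 2: "real k * e1 \<le> ?P * e0" "real k * e1 \<ge> ?P * e0 - ?Q * e'"
      using IHj Suc by (auto simp: e0_def e1_def e'_def)
    have 3: "x * (real k * e1) \<le> x * (?P * e0)" "x * (real k * e1) \<ge> x * (?P * e0 - ?Q * e')"
      using 2 x by (auto intro: mult_left_mono)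
    have s: "elem_sym a (Suc n) (Suc k) = e2 + x * e1" "elem_sym a (Suc n) k = e1 + x * e0"
      "(\<Sum>i<Suc n. a i) = ?P + x" "(\<Sum>i<Suc n. (a i)\<^sup>2) = ?Q + x\<^sup>2"
      by (auto simp: e0_def e1_def e2_def x_def Suc)
    have s': "elem_sym a (Suc n) (k - 1) = e0 + x * e'"
      using Suc by (cases j) (auto simp: e0_def e'_def x_def)
    have u: "real (Suc k) * (e2 + x * e1) \<le> (?P + x) * (e1 + x * e0)"
    proof -
      have "real (Suc k) * (e2 + x * e1) = real (Suc k) * e2 + x * (real k * e1) + x * e1" by (simp add: algebra_simps)
      also have "\<dots> \<le> ?P * e1 + x * (?P * e0) + x * e1 + x * x * e0" using 1 3 x en by (intro add_mono add_increasing2) auto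
      also have "\<dots> = (?P + x) * (e1 + x * e0)" by (simp add: algebra_simps)
      finally show ?thesis .
    qed
    have l: "real (Suc k) * (e2 + x * e1) \<ge> (?P + x) * (e1 + x * e0) - (?Q + x\<^sup>2) * (e0 + x * e')"
    proof -
      have "0 \<le> x ^ 3 * e'" using x en by simp
      then have "(?P + x) * (e1 + x * e0) - (?Q + x\<^sup>2) * (e0 + x * e') \<le>
         (?P * e1 - ?Q * e0) + x * (?P * e0 - ?Q * e') + x * e1"
        by (simp add: algebra_simps power2_eq_square power3_eq_cube)
      also have "\<dots> \<le> real (Suc k) * e2 + x * (real k * e1) + x * e1" using 1 3 by (intro add_mono) auto
      also have "\<dots> = real (Suc k) * (e2 + x * e1)" by (simp add: algebra_simps)
      finally show ?thesis .
    qed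
    show ?thesis using u l Suc unfolding s s' by simp
  qed
qed

lemma elem_sym_bounds:
  assumes a: "\<And>i. a i \<ge> 0" and P: "(\<Sum>i<n. a i) > 0"
  shows "fact k * elem_sym a n k \<le> (\<Sum>i<n. a i) ^ k
    \<and> fact k * elem_sym a n k \<ge> (\<Sum>i<n. a i) ^ k * (1 - (real k)\<^sup>2 * ((\<Sum>i<n. (a i)\<^sup>2) / (\<Sum>i<n. a i)\<^sup>2))"
proof (induction k rule: nat_less_induct)
  case (1 k)
  let ?P = "\<Sum>i<n. a i" and ?Q = "\<Sum>i<n. (a i)\<^sup>2"
  have Q: "?Q \<ge> 0" by (intro sum_nonneg) auto
  show ?case
  proof (cases k)
    case 0
    then show ?thesis by simp
  next
    case (Suc j)
    have u: "fact j * elem_sym a n j \<le> ?P ^ j" "fact j * elem_sym a n j \<ge> ?P ^ j * (1 - (real j)\<^sup>2 * (?Q / ?P\<^sup>2))"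
      using 1 Suc by auto
    have eq: "fact k * elem_sym a n k = fact j * (real (Suc j) * elem_sym a n (Suc j))" by (simp add: Suc algebra_simps)
    have "fact j * (real (Suc j) * elem_sym a n (Suc j)) \<le> fact j * (?P * elem_sym a n j)"
      using elem_sym_recursion[where a=a and k=j and n=n, OF a] by (intro mult_left_mono) auto
    also have "\<dots> = ?P * (fact j * elem_sym a n j)" by simp
    also have "\<dots> \<le> ?P * ?P ^ j" using u P by (intro mult_left_mono) auto
    finally have up: "fact k * elem_sym a n k \<le> ?P ^ k" unfolding eq by (simp add: Suc)
    define e' where "e' = (if j = 0 then 0 else elem_sym a n (j - 1))"
    have e': "fact j * e' \<le> real j * ?P ^ j / ?P"
    proof (cases j)
      case (Suc i)
      have "fact i * elem_sym a n i \<le> ?P ^ i" using 1 Suc \<open>k = Suc j\<close> by auto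
      then have "real j * (fact i * elem_sym a n i) \<le> real j * ?P ^ i" by (intro mult_left_mono) auto
      then show ?thesis using Suc P by (simp add: e'_def mult.assoc)
    qed (simp add: e'_def)
    have "?P * (?P ^ j * (1 - (real j)\<^sup>2 * (?Q / ?P\<^sup>2))) - ?Q * (real j * ?P ^ j / ?P) \<le> ?P * (fact j * elem_sym a n j) - ?Q * (fact j * e')"
      using u e' P Q by (intro diff_mono mult_left_mono) auto
    also have "\<dots> = fact j * (?P * elem_sym a n j - ?Q * e')" by (simp add: algebra_simps)
    also have "\<dots> \<le> fact j * (real (Suc j) * elem_sym a n (Suc j))"
      using elem_sym_recursion[where a=a and k=j and n=n, OF a] by (intro mult_left_mono) (auto simp: e'_def)
    finally have low: "?P * (?P ^ j * (1 - (real j)\<^sup>2 * (?Q / ?P\<^sup>2))) - ?Q * (real j * ?P ^ j / ?P) \<le> fact k * elem_sym a n k"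
      unfolding eq .
    have "?P ^ k * (1 - (real k)\<^sup>2 * (?Q / ?P\<^sup>2)) \<le> ?P ^ k * (1 - ((real j)\<^sup>2 + real j) * (?Q / ?P\<^sup>2))"
      using P Q Suc by (intro mult_left_mono diff_left_mono mult_right_mono) (auto simp: power2_eq_square algebra_simps)
    also have "\<dots> = ?P * (?P ^ j * (1 - (real j)\<^sup>2 * (?Q / ?P\<^sup>2))) - ?Q * (real j * ?P ^ j / ?P)"
    proof -
      have "X ^ k * (1 - (j2 + j1) * (q / X\<^sup>2)) = X * (X ^ j * (1 - j2 * (q / X\<^sup>2))) - q * (j1 * X ^ j / X)" if "X > 0" for X j2 j1 q :: real
        using that by (simp add: Suc power2_eq_square field_simps)
      from this[OF P] show ?thesis .
    qed
    finally show ?thesis using up low by linarith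
  qed
qed

lemma neg_ln_one_minus_le:
  fixes x :: real
  assumes "0 \<le> x" "x \<le> 1 / 2"
  shows "- ln (1 - x) \<le> 2 * x"
proof -
  have "- x - 2 * x\<^sup>2 \<le> ln (1 - x)" using ln_one_minus_pos_lower_bound[OF assms] .
  moreover have "2 * x\<^sup>2 \<le> x" using assms mult_right_mono[of x "1/2" x] by (simp add: power2_eq_square)
  ultimately show ?thesis by linarith
qed

lemma ln_mean_elem_sym:
  assumes a: "\<And>i. a i \<ge> 0" and P: "(\<Sum>i<n. a i) > 0" and k: "k \<ge> 1" "k \<le> n"
    and c: "c \<ge> 1" "(\<Sum>i<n. (a i)\<^sup>2) / (\<Sum>i<n. a i)\<^sup>2 \<le> c / n" "(real k)\<^sup>2 * c / n \<le> 1 / 2"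
  shows "elem_sym a n k > 0" and "\<bar>ln (elem_sym a n k / (n choose k)) - k * ln ((\<Sum>i<n. a i) / n)\<bar> \<le> 2 * ((real k)\<^sup>2 * c / n)"
proof -
  let ?P = "\<Sum>i<n. a i"
  define x where "x = (real k)\<^sup>2 * c / n"
  have n: "n \<ge> 1" using k by simp
  have x: "0 \<le> x" "x \<le> 1 / 2" using c by (auto simp: x_def)
  have Pk: "?P ^ k > 0" using P by simp
  have main: "fact k * elem_sym a n k \<le> ?P ^ k" "fact k * elem_sym a n k \<ge> ?P ^ k * (1 - x)"
  proof -
    show "fact k * elem_sym a n k \<le> ?P ^ k" using elem_sym_bounds[where k=k, OF a P] by simp
    have "(real k)\<^sup>2 * ((\<Sum>i<n. (a i)\<^sup>2) / ?P\<^sup>2) \<le> (real k)\<^sup>2 * (c / n)" using c by (intro mult_left_mono) auto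
    then have "?P ^ k * (1 - x) \<le> ?P ^ k * (1 - (real k)\<^sup>2 * ((\<Sum>i<n. (a i)\<^sup>2) / ?P\<^sup>2))"
      using Pk by (intro mult_left_mono) (auto simp: x_def)
    also have "\<dots> \<le> fact k * elem_sym a n k" using elem_sym_bounds[where k=k, OF a P] by simp
    finally show "fact k * elem_sym a n k \<ge> ?P ^ k * (1 - x)" .
  qed
  have P1: "(\<Sum>i<n. (1::real)) > 0" using n by simp
  have chs: "fact k * real (n choose k) \<le> real n ^ k" "fact k * real (n choose k) \<ge> real n ^ k * (1 - x)"
  proof -
    show "fact k * real (n choose k) \<le> real n ^ k" using elem_sym_bounds[where a="\<lambda>_. 1" and n=n and k=k, OF _ P1] by (simp add: elem_sym_one)
    have "(real k)\<^sup>2 * (1 / n) \<le> x" using c n by (simp add: x_def divide_right_mono mult_le_cancel_left1)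
    moreover have "real n / (real n)\<^sup>2 = 1 / n" by (simp add: power2_eq_square)
    ultimately have "real n ^ k * (1 - x) \<le> real n ^ k * (1 - (real k)\<^sup>2 * (real n / (real n)\<^sup>2))"
      by (intro mult_left_mono) (auto simp only: diff_left_mono zero_le_power of_nat_0_le_iff)
    also have "\<dots> \<le> fact k * real (n choose k)" using elem_sym_bounds[where a="\<lambda>_. 1" and n=n and k=k, OF _ P1] by (simp add: elem_sym_one)
    finally show "fact k * real (n choose k) \<ge> real n ^ k * (1 - x)" .
  qed
  have pos: "fact k * elem_sym a n k > 0"
    by (rule less_le_trans[OF _ main(2)]) (use Pk x in simp)
  then show e: "elem_sym a n k > 0" by (simp add: zero_less_mult_iff)
  have ch0: "real (n choose k) > 0" using k by simp
  have xl: "- ln (1 - x) \<le> 2 * x" using neg_ln_one_minus_le[OF x] .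
  have A: "\<bar>ln (fact k * elem_sym a n k) - k * ln ?P\<bar> \<le> 2 * x" "ln (fact k * elem_sym a n k) - k * ln ?P \<le> 0"
  proof -
    have "ln (fact k * elem_sym a n k) \<le> ln (?P ^ k)" using main pos Pk by (subst ln_le_cancel_iff) auto
    moreover have "ln (?P ^ k * (1 - x)) \<le> ln (fact k * elem_sym a n k)" using main pos Pk x by (subst ln_le_cancel_iff) auto
    moreover have "ln (?P ^ k * (1 - x)) = k * ln ?P + ln (1 - x)" using P x by (simp add: ln_mult ln_realpow)
    moreover have "ln (?P ^ k) = k * ln ?P" using P by (simp add: ln_realpow)
    ultimately show "\<bar>ln (fact k * elem_sym a n k) - k * ln ?P\<bar> \<le> 2 * x" "ln (fact k * elem_sym a n k) - k * ln ?P \<le> 0" using xl by linarith+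
  qed
  have B: "\<bar>ln (fact k * real (n choose k)) - k * ln n\<bar> \<le> 2 * x" "ln (fact k * real (n choose k)) - k * ln n \<le> 0"
  proof -
    have pc: "fact k * real (n choose k) > 0" using ch0 by simp
    have "ln (fact k * real (n choose k)) \<le> ln (real n ^ k)" using chs pc n by (subst ln_le_cancel_iff) auto
    moreover have "ln (real n ^ k * (1 - x)) \<le> ln (fact k * real (n choose k))" using chs pc n x by (subst ln_le_cancel_iff) auto
    moreover have "ln (real n ^ k * (1 - x)) = k * ln n + ln (1 - x)" using n x by (simp add: ln_mult ln_realpow)
    moreover have "ln (real n ^ k) = k * ln n" using n by (simp add: ln_realpow)
    ultimately show "\<bar>ln (fact k * real (n choose k)) - k * ln n\<bar> \<le> 2 * x" "ln (fact k * real (n choose k)) - k * ln n \<le> 0" using xl by linarith+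
  qed
  have "ln (elem_sym a n k / (n choose k)) = ln (fact k * elem_sym a n k) - ln (fact k * real (n choose k))"
    using e ch0 by (simp add: ln_div ln_mult)
  moreover have "k * ln (?P / n) = k * ln ?P - k * ln n" using P n by (simp add: ln_div right_diff_distrib)
  ultimately show "\<bar>ln (elem_sym a n k / (n choose k)) - k * ln (?P / n)\<bar> \<le> 2 * ((real k)\<^sup>2 * c / n)"
    using A B unfolding x_def[symmetric] by linarith
qed

lemma mean_ratio_log_deviation:
  assumes p: "p \<ge> 1" and k: "k \<ge> 1" "k \<le> n" and nz: "\<forall>i<n. y i \<noteq> 0"
    and c: "c \<ge> 1" "(\<Sum>i<n. (\<bar>y i\<bar> powr p)\<^sup>2) / (\<Sum>i<n. \<bar>y i\<bar> powr p)\<^sup>2 \<le> c / n" "(real k)\<^sup>2 * c / n \<le> 1 / 2"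
  shows "mean_ratio n k n p y > 0"
    and "\<bar>sqrt n * (ln (mean_ratio n k n p y) - log_mean p) - log_deviation n p y\<bar> \<le> 2 * real k * c / sqrt n"
proof -
  define a where "a i = \<bar>y i\<bar> powr p" for i
  have n: "n \<ge> 1" using k by simp
  have P: "(\<Sum>i<n. a i) > 0" unfolding a_def using sum_abs_powr_pos[OF n nz] .
  have a: "a i \<ge> 0" for i by (simp add: a_def)
  note L = ln_mean_elem_sym[OF a P k c(1) c(2)[folded a_def] c(3)]
  have ch0: "real (n choose k) > 0" using k by simp
  have sk: "sym_mean n k p y = (elem_sym a n k / (n choose k)) powr (1 / (k * p))"
    unfolding sym_mean_def a_def[symmetric] sum_prod_subsets_eq_elem_sym ..
  have sk_pos: "sym_mean n k p y > 0" unfolding sk using L(1) ch0 by simp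
  have lk: "ln (sym_mean n k p y) = ln (elem_sym a n k / (n choose k)) / (k * p)"
    unfolding sk using L(1) ch0 by (subst ln_powr) auto
  have an: "a i > 0" if "i < n" for i using nz that by (simp add: a_def)
  have "{I. I \<subseteq> {..<n} \<and> card I = n} = {{..<n}}"
  proof (intro set_eqI iffI)
    fix I assume "I \<in> {I. I \<subseteq> {..<n} \<and> card I = n}"
    then show "I \<in> {{..<n}}" using card_subset_eq[of "{..<n}" I] by simp
  qed simp
  then have sn: "sym_mean n n p y = (\<Prod>i<n. a i) powr (1 / (n * p))"
    unfolding sym_mean_def a_def[symmetric] by simp
  have pp: "(\<Prod>i<n. a i) > 0" using an by (intro prod_pos) auto
  have sn_pos: "sym_mean n n p y > 0" unfolding sn powr_gt_zero using pp by linarith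
  have "ln (\<Prod>i<n. a i) = (\<Sum>i<n. p * ln \<bar>y i\<bar>)"
    using an nz by (subst ln_prod) (auto simp: a_def ln_powr intro!: sum.cong)
  then have ln_n: "ln (sym_mean n n p y) = (\<Sum>i<n. ln \<bar>y i\<bar>) / n"
  proof -
    have lp: "ln (x powr c) = c * ln x" if "x > 0" for x c :: real using that by (simp add: ln_powr)
    have "ln (sym_mean n n p y) = 1 / (n * p) * (\<Sum>i<n. p * ln \<bar>y i\<bar>)"
      unfolding sn lp[OF pp] \<open>ln (\<Prod>i<n. a i) = _\<close> ..
    then show ?thesis using p n by (simp add: sum_distrib_left[symmetric])
  qed
  show pos: "mean_ratio n k n p y > 0" using sk_pos sn_pos by (simp add: mean_ratio_def)
  have lr: "ln (mean_ratio n k n p y) = (\<Sum>i<n. ln \<bar>y i\<bar>) / n - ln (elem_sym a n k / (n choose k)) / (k * p)"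
    unfolding mean_ratio_def using sk_pos sn_pos by (simp add: ln_div ln_n lk)
  define \<delta> where "\<delta> = ln (elem_sym a n k / (n choose k)) - k * ln ((\<Sum>i<n. a i) / n)"
  have "ln (elem_sym a n k / (n choose k)) / (k * p) = ln ((\<Sum>i<n. a i) / n) / p + \<delta> / (k * p)"
    using k p by (simp add: \<delta>_def field_simps)
  then have "sqrt n * (ln (mean_ratio n k n p y) - log_mean p) - log_deviation n p y = - (sqrt n * (\<delta> / (k * p)))"
    unfolding lr log_deviation_def a_def[symmetric] using nz by (simp add: algebra_simps)
  then have "\<bar>sqrt n * (ln (mean_ratio n k n p y) - log_mean p) - log_deviation n p y\<bar> = sqrt n * (\<bar>\<delta>\<bar> / (k * p))"
    using p by (simp add: abs_mult)
  also have "\<dots> \<le> sqrt n * (2 * ((real k)\<^sup>2 * c / n) / k)"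
  proof (intro mult_left_mono frac_le)
    show "\<bar>\<delta>\<bar> \<le> 2 * ((real k)\<^sup>2 * c / n)" using L(2) by (simp add: \<delta>_def)
    show "real k \<le> real k * p" using p by (simp add: mult_le_cancel_left1)
  qed (use k c in auto)
  also have "\<dots> = 2 * real k * c * (sqrt n / n)" using k by (simp add: power2_eq_square)
  also have "sqrt n / n = 1 / sqrt n"
  proof -
    have "x / (x * x) = 1 / x" for x :: real by (cases "x = 0") auto
    from this[of "sqrt n"] show ?thesis by simp
  qed
  finally show "\<bar>sqrt n * (ln (mean_ratio n k n p y) - log_mean p) - log_deviation n p y\<bar> \<le> 2 * real k * c / sqrt n" by simp
qed

context
  fixes s :: real
  assumes s: "s > 0"
begin

interpretation Z: real_distribution "density lborel (normal_density 0 s)"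
  using s by (rule real_distribution_normal)

lemma normal_tail_le:
  assumes c: "c > 0"
  shows "cdf (density lborel (normal_density 0 s)) (- c) \<le> s / c"
    and "1 - cdf (density lborel (normal_density 0 s)) c \<le> s / c"
proof -
  let ?N = "density lborel (normal_density 0 s)"
  have M: "Z.prob {x \<in> space ?N. c \<le> \<bar>x\<bar>} \<le> s / c"
  proof -
    have "Z.prob {x \<in> space ?N. c \<le> \<bar>x\<bar>} \<le> (\<integral>x. \<bar>x\<bar> \<partial>?N) / c"
      using normal_abs_moment_le(1)[OF s] c by (intro integral_Markov_inequality_measure[where A=UNIV]) auto
    also have "\<dots> \<le> s / c" using normal_abs_moment_le(2)[OF s] c by (intro divide_right_mono) auto
    finally show ?thesis .
  qed
  have "{x \<in> space ?N. c \<le> \<bar>x\<bar>} = {..- c} \<union> {c..}" by auto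
  then have "{x \<in> space ?N. c \<le> \<bar>x\<bar>} \<in> sets ?N" by simp
  then have m: "Z.prob A \<le> s / c" if "A \<subseteq> {x \<in> space ?N. c \<le> \<bar>x\<bar>}" for A
    using Z.finite_measure_mono[OF that] M by linarith
  show "cdf ?N (- c) \<le> s / c" unfolding cdf_def by (rule m) auto
  have "1 - cdf ?N c = Z.prob {c<..}"
  proof -
    have "Z.prob (space ?N - {..c}) = 1 - Z.prob {..c}" by (rule Z.prob_compl) simp
    moreover have "space ?N - {..c} = {c<..}" by auto
    ultimately show ?thesis by (simp add: cdf_def)
  qed
  also have "\<dots> \<le> s / c" by (rule m) (use c in auto)
  finally show "1 - cdf ?N c \<le> s / c" .
qed

lemma normal_density_le_inverse_square:
  assumes "u \<noteq> 0"
  shows "normal_density 0 s u \<le> 2 * s / u\<^sup>2"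
proof -
  define z where "z = u\<^sup>2 / (2 * s\<^sup>2)"
  have z: "z > 0" using s assms by (simp add: z_def)
  have "exp (- z) \<le> 1 / z"
  proof -
    have "z \<le> exp z" using exp_ge_add_one_self[of z] by linarith
    then show ?thesis using z by (simp add: exp_minus field_simps)
  qed
  moreover have "1 / sqrt (2 * pi * s\<^sup>2) \<le> 1 / s"
  proof -
    have "s \<le> sqrt (2 * pi * s\<^sup>2)"
      using s pi_gt3 by (intro real_le_rsqrt) (simp add: mult_le_cancel_right1)
    then show ?thesis using s by (intro divide_left_mono) auto
  qed
  ultimately have "1 / sqrt (2 * pi * s\<^sup>2) * exp (- z) \<le> 1 / s * (1 / z)"
    using s z by (intro mult_mono) auto
  also have "\<dots> = 2 * s / u\<^sup>2" using s by (simp add: z_def power2_eq_square)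
  finally show ?thesis by (simp add: normal_density_def z_def)
qed

lemma normal_cdf_log_transform:
  assumes n: "n \<ge> 1" and t: "t > - sqrt (real n)"
  defines "w \<equiv> sqrt n * ln (1 + t / sqrt n)"
  shows "\<bar>cdf (density lborel (normal_density 0 s)) t - cdf (density lborel (normal_density 0 s)) w\<bar> \<le> 16 * s / sqrt n"
proof -
  let ?F = "cdf (density lborel (normal_density 0 s))"
  define q where "q = sqrt n"
  have q: "q \<ge> 1" using n by (simp add: q_def)
  define x where "x = t / q"
  have tx: "t = q * x" using q by (simp add: x_def)
  have x1: "x > -1" using t q by (simp add: x_def q_def[symmetric] less_divide_eq)
  have w: "w = q * ln (1 + x)" by (simp add: w_def x_def q_def)
  have "ln (1 + x) \<le> x" using ln_add_one_self_le_self2[OF x1] .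
  then have wt: "w \<le> t" using q by (simp add: w tx mult_left_mono)
  have F: "?F w \<le> ?F t" using Z.cdf_nondecreasing[OF wt] .
  have b: "0 \<le> ?F y" "?F y \<le> 1" for y by (auto intro: Z.cdf_nonneg Z.cdf_bounded_prob)
  have "?F t - ?F w \<le> 16 * s / q"
  proof -
    consider "x > 1 / 2" | "x < - 1 / 2" | "x = 0" | "\<bar>x\<bar> \<le> 1 / 2" "x \<noteq> 0" by linarith
    then show ?thesis
    proof cases
      case 1
      have "ln (1 + x) \<ge> ln (1 + 1 / 2)" using 1 by (subst ln_le_cancel_iff) auto
      moreover have "ln (1 + 1 / 2 :: real) \<ge> 1 / 2 - (1 / 2)\<^sup>2" by (rule ln_one_plus_pos_lower_bound) auto
      ultimately have "ln (1 + x) \<ge> 1 / 4" by (simp add: power2_eq_square)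
      then have "w \<ge> q * (1 / 4)" unfolding w using q by (intro mult_left_mono) auto
      then have "?F (q / 4) \<le> ?F w" by (intro Z.cdf_nondecreasing) simp
      then have "?F t - ?F w \<le> 1 - ?F (q / 4)" using b[of t] by linarith
      also have "\<dots> \<le> s / (q / 4)" using q by (intro normal_tail_le(2)) auto
      also have "\<dots> \<le> 16 * s / q" using s q by (simp add: field_simps)
      finally show ?thesis .
    next
      case 2
      have "t \<le> q * (- 1 / 2)" unfolding tx using 2 q by (intro mult_left_mono) auto
      then have "?F t \<le> ?F (- (q / 2))" by (intro Z.cdf_nondecreasing) simp
      then have "?F t - ?F w \<le> ?F (- (q / 2))" using b[of w] by linarith
      also have "\<dots> \<le> s / (q / 2)" using q by (intro normal_tail_le(1)) auto
      also have "\<dots> \<le> 16 * s / q" using s q by (simp add: field_simps)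
      finally show ?thesis .
    next
      case 3
      then show ?thesis using s q by (simp add: w tx)
    next
      case 4
      have far: "\<bar>u\<bar> \<ge> \<bar>t\<bar> / 2" if "w < u" "u \<le> t" for u
      proof (cases "x > 0")
        case True
        have "x - x\<^sup>2 \<le> ln (1 + x)" using 4 True by (intro ln_one_plus_pos_lower_bound) auto
        moreover have "x\<^sup>2 \<le> x * (1 / 2)" unfolding power2_eq_square using 4 True by (intro mult_left_mono) auto
        ultimately have "x / 2 \<le> ln (1 + x)" by linarith
        then have "q * (x / 2) \<le> w" unfolding w using q by (intro mult_left_mono) auto
        then have "t / 2 \<le> u" using that by (simp add: tx)
        then show ?thesis using that True q by (simp add: tx abs_mult)
      next
        case False
        then have "t \<le> 0" using q by (simp add: tx mult_nonneg_nonpos)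
        then show ?thesis using that by simp
      qed
      have t0: "t \<noteq> 0" using 4 q by (simp add: tx)
      have "?F t - ?F w \<le> 8 * s / t\<^sup>2 * (t - w)"
      proof (rule normal_cdf_diff_le[OF s wt])
        fix u assume "w < u" "u \<le> t"
        note fu = far[OF this]
        then have u0: "u \<noteq> 0" using t0 by auto
        have "(\<bar>t\<bar> / 2)\<^sup>2 \<le> \<bar>u\<bar>\<^sup>2" using fu by (intro power_mono) auto
        then have "t\<^sup>2 / 4 \<le> u\<^sup>2" by (simp add: power_divide)
        have "normal_density 0 s u \<le> 2 * s / u\<^sup>2" using u0 by (rule normal_density_le_inverse_square)
        also have "\<dots> \<le> 2 * s / (t\<^sup>2 / 4)" using \<open>t\<^sup>2 / 4 \<le> u\<^sup>2\<close> s t0 u0 by (intro divide_left_mono) auto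
        finally show "normal_density 0 s u \<le> 8 * s / t\<^sup>2" by simp
      qed
      also have "\<dots> \<le> 8 * s / t\<^sup>2 * (q * (2 * x\<^sup>2))"
      proof (rule mult_left_mono)
        have "t - w = q * (x - ln (1 + x))" by (simp add: tx w algebra_simps)
        also have "\<dots> \<le> q * (2 * x\<^sup>2)" using abs_ln_one_plus_x_minus_x_bound[OF 4(1)] q by (intro mult_left_mono) auto
        finally show "t - w \<le> q * (2 * x\<^sup>2)" .
      qed (use s in simp)
      also have "\<dots> = 16 * s / q" using 4 q by (simp add: tx power2_eq_square)
      finally show ?thesis .
    qed
  qed
  then show ?thesis using F by (simp add: q_def)
qed

end

lemma gaussian_n_mean_prob:
  assumes p: "p \<ge> 1" and f[measurable]: "f \<in> borel_measurable borel"
    and i1: "integrable (p_gaussian p) f" and i2: "integrable (p_gaussian p) (\<lambda>x. (f x)\<^sup>2)" and \<delta>: "\<delta> > 0"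
  obtains v where "v \<ge> 0" "\<And>n. n \<ge> 1 \<Longrightarrow>
    measure (gaussian_n n p) {y \<in> space (gaussian_n n p). \<bar>(\<Sum>i<n. f (y i)) / n - (\<integral>x. f x \<partial>p_gaussian p)\<bar> \<ge> \<delta>} \<le> v / n"
proof -
  define a where "a = (\<integral>x. f x \<partial>p_gaussian p)"
  obtain v where v: "v \<ge> 0" "\<And>n. n \<ge> 1 \<Longrightarrow> integrable (gaussian_n n p) (\<lambda>y. ((\<Sum>i<n. f (y i)) / n - a)\<^sup>2)"
    "\<And>n. n \<ge> 1 \<Longrightarrow> (\<integral>y. ((\<Sum>i<n. f (y i)) / n - a)\<^sup>2 \<partial>gaussian_n n p) = v / n"
    using gaussian_n_mean_deviation[OF p f i1 i2] unfolding a_def by metis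
  show ?thesis
  proof (rule that[of "v / \<delta>\<^sup>2"])
    show "v / \<delta>\<^sup>2 \<ge> 0" using v by simp
    fix n :: nat assume n: "n \<ge> 1"
    interpret prob_space "gaussian_n n p" using p by (rule gaussian_n_prob_space)
    have "{y \<in> space (gaussian_n n p). \<bar>(\<Sum>i<n. f (y i)) / n - a\<bar> \<ge> \<delta>} = {y \<in> space (gaussian_n n p). \<delta>\<^sup>2 \<le> ((\<Sum>i<n. f (y i)) / n - a)\<^sup>2}"
      using \<delta> by (auto simp: abs_le_square_iff[symmetric])
    also have "prob \<dots> \<le> (\<integral>y. ((\<Sum>i<n. f (y i)) / n - a)\<^sup>2 \<partial>gaussian_n n p) / \<delta>\<^sup>2"
      using \<delta> v(2)[OF n] by (intro integral_Markov_inequality_measure[where A="{}"]) auto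
    also have "\<dots> = v / \<delta>\<^sup>2 / n" using v(3)[OF n] by simp
    finally show "prob {y \<in> space (gaussian_n n p). \<bar>(\<Sum>i<n. f (y i)) / n - (\<integral>x. f x \<partial>p_gaussian p)\<bar> \<ge> \<delta>} \<le> v / \<delta>\<^sup>2 / n"
      by (simp add: a_def)
  qed
qed

lemma measurable_sym_mean [measurable]: "sym_mean n k p \<in> borel_measurable (lebesgue_n n)"
proof -
  have "(\<lambda>x. elem_sym (\<lambda>i. \<bar>x i\<bar> powr p) l j) \<in> borel_measurable (lebesgue_n n)" if "l \<le> n" for l j
    using that
  proof (induction "\<lambda>_::nat. 0::real" l j rule: elem_sym.induct)
    case (3 l j)
    then have [measurable]: "(\<lambda>x. elem_sym (\<lambda>i. \<bar>x i\<bar> powr p) l (Suc j)) \<in> borel_measurable (lebesgue_n n)"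
      "(\<lambda>x. elem_sym (\<lambda>i. \<bar>x i\<bar> powr p) l j) \<in> borel_measurable (lebesgue_n n)"
      "(\<lambda>x. x l) \<in> borel_measurable (lebesgue_n n)"
      by auto
    show ?case by simp
  qed auto
  from this[OF order_refl, measurable] show ?thesis
    unfolding sym_mean_def sum_prod_subsets_eq_elem_sym by measurable
qed

lemma measurable_mean_ratio [measurable]: "mean_ratio n k l p \<in> borel_measurable (lebesgue_n n)"
  unfolding mean_ratio_def by measurable

theorem mean_ratio_clt:
  assumes k: "k \<ge> 1" and p: "p \<ge> 1" and lv: "limit_variance p > 0"
  defines "\<Phi> \<equiv> cdf (density lborel (normal_density 0 (sqrt (limit_variance p))))"
  obtains C where "C > 0" "\<And>n t. n \<ge> max k 2 \<Longrightarrow>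
    \<bar>measure (gaussian_n n p) {y \<in> space (gaussian_n n p). sqrt n * (exp (- log_mean p) * mean_ratio n k n p y - 1) \<le> t} - \<Phi> t\<bar>
      \<le> C * (sqrt (ln n) / sqrt n)"
proof -
  define s where "s = sqrt (limit_variance p)"
  have s: "s > 0" using lv by (simp add: s_def)
  interpret Z: real_distribution "density lborel (normal_density 0 s)" using s by (rule real_distribution_normal)
  have \<Phi>: "\<Phi> = cdf (density lborel (normal_density 0 s))" by (simp add: \<Phi>_def s_def)
  have \<Phi>01: "0 \<le> \<Phi> x" "\<Phi> x \<le> 1" for x unfolding \<Phi> by (auto intro: Z.cdf_nonneg Z.cdf_bounded_prob)
  obtain C0 where C0: "C0 > 0" and V: "\<And>n t. n \<ge> 2 \<Longrightarrow>
    \<bar>measure (gaussian_n n p) {y \<in> space (gaussian_n n p). log_deviation n p y \<le> t} - \<Phi> t\<bar> \<le> C0 * (sqrt (ln n) / sqrt n)"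
    using log_deviation_clt[OF p lv] unfolding \<Phi>_def by blast
  have powr2: "(\<bar>x\<bar> powr q)\<^sup>2 = \<bar>x\<bar> powr (2 * q)" for x q :: real
    using powr_add[of "\<bar>x\<bar>" q q] by (simp add: power2_eq_square)
  have ip: "integrable (p_gaussian p) (\<lambda>x. \<bar>x\<bar> powr p)" "integrable (p_gaussian p) (\<lambda>x. (\<bar>x\<bar> powr p)\<^sup>2)"
    "integrable (p_gaussian p) (\<lambda>x. (\<bar>x\<bar> powr (2 * p))\<^sup>2)" "integrable (p_gaussian p) (\<lambda>x. \<bar>x\<bar> powr (2 * p))"
    unfolding powr2 using p by (auto intro!: p_gaussian_integrable_powr)
  define q2 where "q2 = (\<integral>x. \<bar>x\<bar> powr (2 * p) \<partial>p_gaussian p)"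
  have q2: "q2 \<ge> 0" by (simp add: q2_def)
  obtain v1 where v1: "v1 \<ge> 0" "\<And>n. n \<ge> 1 \<Longrightarrow>
    measure (gaussian_n n p) {y \<in> space (gaussian_n n p). \<bar>(\<Sum>i<n. \<bar>y i\<bar> powr p) / n - 1\<bar> \<ge> 1 / 2} \<le> v1 / n"
    using gaussian_n_mean_prob[OF p _ ip(1,2), of "1/2"] unfolding p_gaussian_abs_moment_p[OF p] by auto
  obtain v2 where v2: "v2 \<ge> 0" "\<And>n. n \<ge> 1 \<Longrightarrow>
    measure (gaussian_n n p) {y \<in> space (gaussian_n n p). \<bar>(\<Sum>i<n. \<bar>y i\<bar> powr (2 * p)) / n - q2\<bar> \<ge> 1} \<le> v2 / n"
    using gaussian_n_mean_prob[OF p _ ip(4,3), of 1] unfolding q2_def by auto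
  define c where "c = 4 * (q2 + 1)"
  have c: "c \<ge> 1" using q2 by (simp add: c_def)
  define A where "A = 2 * real k * c / s + (v1 + v2) + 16 * s"
  have A: "A \<ge> 0" using c s v1(1) v2(1) by (simp add: A_def)
  define C where "C = C0 + A / sqrt (ln 2) + sqrt (2 * (real k)\<^sup>2 * c) / sqrt (ln 2)"
  have C: "C > 0" using C0 A c by (auto simp: C_def intro!: add_pos_nonneg)
  show ?thesis
  proof (rule that[OF C])
    fix n :: nat and t :: real
    assume "n \<ge> max k 2"
    then have n: "n \<ge> 2" "k \<le> n" "n \<ge> 1" by auto
    interpret PG: prob_space "gaussian_n n p" using p by (rule gaussian_n_prob_space)
    let ?S = "space (gaussian_n n p)"
    define b where "b = sqrt (ln n) / sqrt n"
    have lnn: "ln n \<ge> ln 2" "ln n > 0" using n by auto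
    have ib: "1 / sqrt n \<le> b / sqrt (ln 2)"
    proof -
      have "1 / sqrt n = sqrt (ln 2) / sqrt n / sqrt (ln 2)" by simp
      also have "\<dots> \<le> b / sqrt (ln 2)" unfolding b_def using lnn by (intro divide_right_mono) auto
      finally show ?thesis .
    qed
    have b0: "b \<ge> 0" using lnn by (simp add: b_def)
    define Q where "Q y = sqrt n * (exp (- log_mean p) * mean_ratio n k n p y - 1)" for y
    have [measurable]: "Q \<in> borel_measurable (gaussian_n n p)" unfolding Q_def by measurable
    have pr01: "0 \<le> PG.prob {y \<in> ?S. Q y \<le> t}" "PG.prob {y \<in> ?S. Q y \<le> t} \<le> 1" by auto
    have "\<bar>PG.prob {y \<in> ?S. Q y \<le> t} - \<Phi> t\<bar> \<le> C * b"
    proof (cases "(real k)\<^sup>2 * c / n \<le> 1 / 2")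
      case False
      have "\<bar>PG.prob {y \<in> ?S. Q y \<le> t} - \<Phi> t\<bar> \<le> 1" using pr01 \<Phi>01[of t] by linarith
      also have "1 \<le> sqrt (2 * (real k)\<^sup>2 * c) * (1 / sqrt n)"
      proof -
        have "real n \<le> 2 * (real k)\<^sup>2 * c" using False n by (simp add: field_simps)
        then have "sqrt n \<le> sqrt (2 * (real k)\<^sup>2 * c)" by simp
        then show ?thesis using n by simp
      qed
      also have "\<dots> \<le> sqrt (2 * (real k)\<^sup>2 * c) * (b / sqrt (ln 2))" using ib c by (intro mult_left_mono) auto
      also have "\<dots> \<le> C * b"
      proof -
        have "C * b = C0 * b + A / sqrt (ln 2) * b + sqrt (2 * (real k)\<^sup>2 * c) * (b / sqrt (ln 2))"
          by (simp add: C_def distrib_right)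
        moreover have "C0 * b \<ge> 0" "A / sqrt (ln 2) * b \<ge> 0" using C0 A b0 by auto
        ultimately show ?thesis by linarith
      qed
      finally show ?thesis .
    next
      case True
      define B0 where "B0 = {y \<in> ?S. \<not> (\<forall>i<n. y i \<noteq> 0)}"
      define B1 where "B1 = {y \<in> ?S. \<bar>(\<Sum>i<n. \<bar>y i\<bar> powr p) / n - 1\<bar> \<ge> 1 / 2}"
      define B2 where "B2 = {y \<in> ?S. \<bar>(\<Sum>i<n. \<bar>y i\<bar> powr (2 * p)) / n - q2\<bar> \<ge> 1}"
      define B where "B = B0 \<union> B1 \<union> B2"
      have B0m: "B0 \<in> PG.events" unfolding B0_def by measurable
      have B1m: "B1 \<in> PG.events" unfolding B1_def by measurable
      have B2m: "B2 \<in> PG.events" unfolding B2_def by measurable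
      have Bm: "B \<in> PG.events" unfolding B_def using B0m B1m B2m by (intro sets.Un)
      have "PG.prob B0 = 0"
      proof -
        have "AE y in gaussian_n n p. y \<notin> B0"
          using AE_gaussian_n_nonzero[OF p, of n] by eventually_elim (simp add: B0_def)
        then show ?thesis by (simp only: PG.prob_eq_0[OF B0m])
      qed
      moreover have "PG.prob B \<le> PG.prob B0 + PG.prob B1 + PG.prob B2"
        unfolding B_def using measure_Un_le[OF B0m B1m]
          measure_Un_le[OF sets.Un[OF B0m B1m] B2m] by linarith
      ultimately have "PG.prob B \<le> v1 / n + v2 / n"
        using v1(2)[OF n(3)] v2(2)[OF n(3)] unfolding B1_def B2_def by linarith
      also have "\<dots> = (v1 + v2) / n" by (simp add: add_divide_distrib)
      also have "\<dots> \<le> (v1 + v2) / sqrt n"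
      proof (rule divide_left_mono)
        show "sqrt n \<le> n" using n by (intro real_le_lsqrt) (auto simp: power2_eq_square)
      qed (use v1(1) v2(1) n in auto)
      finally have PB: "PG.prob B \<le> (v1 + v2) * (1 / sqrt n)" by simp
      define e where "e = 2 * real k * c / sqrt n"
      have good: "mean_ratio n k n p y > 0 \<and> \<bar>sqrt n * (ln (mean_ratio n k n p y) - log_mean p) - log_deviation n p y\<bar> \<le> e"
        if "y \<in> ?S" "y \<notin> B" for y
      proof -
        have nz: "\<forall>i<n. y i \<noteq> 0" using that by (auto simp: B_def B0_def)
        define D where "D = (\<Sum>i<n. \<bar>y i\<bar> powr p) / n"
        have "\<not> 1 / 2 \<le> \<bar>D - 1\<bar>" using that unfolding B_def B1_def D_def by blast
        then have D: "D \<ge> 1 / 2" by linarith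
        have m2: "(\<Sum>i<n. \<bar>y i\<bar> powr (2 * p)) / n \<le> q2 + 1"
        proof -
          have "\<not> 1 \<le> \<bar>(\<Sum>i<n. \<bar>y i\<bar> powr (2 * p)) / n - q2\<bar>" using that unfolding B_def B2_def by blast
          then show ?thesis by linarith
        qed
        have "(\<Sum>i<n. (\<bar>y i\<bar> powr p)\<^sup>2) / (\<Sum>i<n. \<bar>y i\<bar> powr p)\<^sup>2 = ((\<Sum>i<n. \<bar>y i\<bar> powr (2 * p)) / n) / D\<^sup>2 / n"
          using n unfolding powr2 D_def by (simp add: power2_eq_square)
        also have "\<dots> \<le> (q2 + 1) / (1 / 2)\<^sup>2 / n"
        proof (intro divide_right_mono frac_le)
          show "(1 / 2)\<^sup>2 \<le> D\<^sup>2" using D by (intro power_mono) auto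
        qed (use m2 q2 in auto)
        also have "\<dots> = c / n" by (simp add: c_def power2_eq_square)
        finally have cc: "(\<Sum>i<n. (\<bar>y i\<bar> powr p)\<^sup>2) / (\<Sum>i<n. \<bar>y i\<bar> powr p)\<^sup>2 \<le> c / n" .
        show ?thesis using mean_ratio_log_deviation[OF p k n(2) nz c cc True] by (simp add: e_def)
      qed
      have Pe: "\<bar>PG.prob {y \<in> ?S. Q y \<le> t} - \<Phi> t\<bar> \<le> C0 * b + A * (1 / sqrt n)"
      proof (cases "t > - sqrt n")
        case False
        have "PG.prob {y \<in> ?S. Q y \<le> t} \<le> PG.prob B"
        proof (rule PG.finite_measure_mono[OF _ Bm], rule subsetI, rule ccontr)
          fix y assume y: "y \<in> {y \<in> ?S. Q y \<le> t}" "y \<notin> B"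
          then have "exp (- log_mean p) * mean_ratio n k n p y > 0" using good by simp
          then have "sqrt n * (exp (- log_mean p) * mean_ratio n k n p y) > 0" using n by simp
          then have "Q y > - sqrt n" by (simp add: Q_def algebra_simps)
          with y False show False by auto
        qed
        moreover have "\<Phi> t \<le> s * (1 / sqrt n)"
        proof -
          have "\<Phi> t \<le> \<Phi> (- sqrt n)" unfolding \<Phi> using False by (intro Z.cdf_nondecreasing) auto
          also have "\<dots> \<le> s / sqrt n" unfolding \<Phi> using n by (intro normal_tail_le(1)[OF s]) auto
          finally show ?thesis by simp
        qed
        ultimately have "\<bar>PG.prob {y \<in> ?S. Q y \<le> t} - \<Phi> t\<bar> \<le> (v1 + v2) * (1 / sqrt n) + s * (1 / sqrt n)"
          using PB pr01 \<Phi>01[of t] by linarith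
        also have "\<dots> = (v1 + v2 + s) * (1 / sqrt n)" by (simp only: distrib_right)
        also have "\<dots> \<le> A * (1 / sqrt n)" using s c by (intro mult_right_mono) (auto simp: A_def)
        also have "\<dots> \<le> C0 * b + A * (1 / sqrt n)" using C0 b0 by simp
        finally show ?thesis .
      next
        case t: True
        define x where "x = 1 + t / sqrt n"
        have x: "x > 0"
        proof -
          have "- 1 < t / sqrt n" using t n by (simp add: less_divide_eq)
          then show ?thesis by (simp add: x_def)
        qed
        define w where "w = sqrt n * ln x"
        have iff: "Q y \<le> t \<longleftrightarrow> sqrt n * (ln (mean_ratio n k n p y) - log_mean p) \<le> w" if y: "y \<in> ?S" "y \<notin> B" for y
        proof -
          define R where "R = mean_ratio n k n p y"
          have R: "R > 0" using good[OF y] by (simp add: R_def)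
          have "Q y \<le> t \<longleftrightarrow> exp (- log_mean p) * R - 1 \<le> t / sqrt n"
            using n by (simp add: Q_def R_def le_divide_eq mult.commute)
          also have "\<dots> \<longleftrightarrow> exp (- log_mean p) * R \<le> x" by (auto simp: x_def)
          also have "\<dots> \<longleftrightarrow> ln (exp (- log_mean p) * R) \<le> ln x" using R x by (subst ln_le_cancel_iff) auto
          also have "ln (exp (- log_mean p) * R) = ln R - log_mean p" using R by (simp add: ln_mult)
          also have "ln R - log_mean p \<le> ln x \<longleftrightarrow> sqrt n * (ln R - log_mean p) \<le> w"
            unfolding w_def using n by (simp add: mult_le_cancel_left_pos)
          finally show ?thesis by (simp add: R_def)
        qed
        have m [measurable]: "{y \<in> ?S. log_deviation n p y \<le> u} \<in> PG.events" for u by measurable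
        have mQ: "{y \<in> ?S. Q y \<le> t} \<in> PG.events" by measurable
        have up: "PG.prob {y \<in> ?S. Q y \<le> t} \<le> PG.prob {y \<in> ?S. log_deviation n p y \<le> w + e} + PG.prob B"
        proof -
          have "{y \<in> ?S. Q y \<le> t} \<subseteq> {y \<in> ?S. log_deviation n p y \<le> w + e} \<union> B"
          proof
            fix y assume y: "y \<in> {y \<in> ?S. Q y \<le> t}"
            show "y \<in> {y \<in> ?S. log_deviation n p y \<le> w + e} \<union> B"
              using y iff[of y] good[of y] by (cases "y \<in> B") auto
          qed
          then have "PG.prob {y \<in> ?S. Q y \<le> t} \<le> PG.prob ({y \<in> ?S. log_deviation n p y \<le> w + e} \<union> B)"
            by (intro PG.finite_measure_mono sets.Un m Bm)
          also have "\<dots> \<le> PG.prob {y \<in> ?S. log_deviation n p y \<le> w + e} + PG.prob B"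
            by (rule measure_Un_le[OF m Bm])
          finally show ?thesis .
        qed
        have lo: "PG.prob {y \<in> ?S. log_deviation n p y \<le> w - e} \<le> PG.prob {y \<in> ?S. Q y \<le> t} + PG.prob B"
        proof -
          have "{y \<in> ?S. log_deviation n p y \<le> w - e} \<subseteq> {y \<in> ?S. Q y \<le> t} \<union> B"
          proof
            fix y assume y: "y \<in> {y \<in> ?S. log_deviation n p y \<le> w - e}"
            show "y \<in> {y \<in> ?S. Q y \<le> t} \<union> B"
              using y iff[of y] good[of y] by (cases "y \<in> B") auto
          qed
          then have "PG.prob {y \<in> ?S. log_deviation n p y \<le> w - e} \<le> PG.prob ({y \<in> ?S. Q y \<le> t} \<union> B)"
            by (intro PG.finite_measure_mono sets.Un mQ Bm)
          also have "\<dots> \<le> PG.prob {y \<in> ?S. Q y \<le> t} + PG.prob B"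
            by (rule measure_Un_le[OF mQ Bm])
          finally show ?thesis .
        qed
        have e0: "e \<ge> 0" using c by (simp add: e_def)
        have lip: "\<Phi> v - \<Phi> u \<le> 1 / s * (v - u)" if "u \<le> v" for u v
          unfolding \<Phi> using s that by (intro normal_cdf_diff_le normal_density_le)
        have "\<Phi> (w + e) \<le> \<Phi> w + 1 / s * e" "\<Phi> (w - e) \<ge> \<Phi> w - 1 / s * e"
          using lip[of w "w + e"] lip[of "w - e" w] e0 by auto
        moreover have "\<bar>\<Phi> t - \<Phi> w\<bar> \<le> 16 * s * (1 / sqrt n)"
          unfolding \<Phi> w_def x_def using normal_cdf_log_transform[OF s n(3) t] by simp
        moreover have "1 / s * e = 2 * real k * c / s * (1 / sqrt n)" by (simp add: e_def)
        ultimately have "\<bar>PG.prob {y \<in> ?S. Q y \<le> t} - \<Phi> t\<bar> \<le> C0 * b + (2 * real k * c / s * (1 / sqrt n) + (v1 + v2) * (1 / sqrt n) + 16 * s * (1 / sqrt n))"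
          using up lo PB V[OF n(1), of "w + e", folded b_def] V[OF n(1), of "w - e", folded b_def] by linarith
        also have "\<dots> = C0 * b + A * (1 / sqrt n)" by (simp only: A_def distrib_right)
        finally show ?thesis .
      qed
      also have "C0 * b + A * (1 / sqrt n) \<le> C0 * b + A * (b / sqrt (ln 2))"
        using A ib by (intro add_left_mono mult_left_mono) auto
      also have "\<dots> \<le> C * b"
      proof -
        have "C * b = C0 * b + A * (b / sqrt (ln 2)) + sqrt (2 * (real k)\<^sup>2 * c) / sqrt (ln 2) * b"
          by (simp add: C_def distrib_right)
        moreover have "sqrt (2 * (real k)\<^sup>2 * c) / sqrt (ln 2) * b \<ge> 0" using b0 c by auto
        ultimately show ?thesis by linarith
      qed
      finally show ?thesis .
    qed
    then show "\<bar>PG.prob {y \<in> ?S. sqrt n * (exp (- log_mean p) * mean_ratio n k n p y - 1) \<le> t} - \<Phi> t\<bar> \<le> C * (sqrt (ln n) / sqrt n)"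
      by (simp add: b_def Q_def)
  qed
qed

section \<open>Hausdorff measure\<close>

definition hausdorff_weight :: "nat \<Rightarrow> nat \<Rightarrow> (nat \<Rightarrow> real) set \<Rightarrow> ennreal" where
  "hausdorff_weight n m U = (if U = {} then 0 else ediam_n n U ^ m)"

definition fine_cover :: "nat \<Rightarrow> real \<Rightarrow> (nat \<Rightarrow> real) set \<Rightarrow> (nat \<Rightarrow> (nat \<Rightarrow> real) set) \<Rightarrow> bool" where
  "fine_cover n \<delta> A U \<longleftrightarrow> (\<forall>i. U i \<subseteq> space (lebesgue_n n) \<and> ediam_n n (U i) \<le> ennreal \<delta>) \<and> A \<subseteq> (\<Union>i. U i)"

definition hausdorff_content :: "nat \<Rightarrow> nat \<Rightarrow> real \<Rightarrow> (nat \<Rightarrow> real) set \<Rightarrow> ennreal" where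
  "hausdorff_content n m \<delta> A = (INF U\<in>{U. fine_cover n \<delta> A U}. \<Sum>i. hausdorff_weight n m (U i))"

lemma hausdorff_outer_eq: "hausdorff_outer n m A = (SUP \<delta>\<in>{0<..}. hausdorff_content n m \<delta> A)"
  by (simp add: hausdorff_outer_def hausdorff_content_def fine_cover_def hausdorff_weight_def)

lemma ediam_n_mono: "U \<subseteq> V \<Longrightarrow> ediam_n n U \<le> ediam_n n V"
  unfolding ediam_n_def by (intro SUP_subset_mono) auto

lemma ediam_n_empty [simp]: "ediam_n n {} = 0"
  by (simp add: ediam_n_def bot_ennreal)

lemma ediam_n_upper: "x \<in> U \<Longrightarrow> y \<in> U \<Longrightarrow> ennreal (L2_set (\<lambda>i. x i - y i) {..<n}) \<le> ediam_n n U"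
  unfolding ediam_n_def by (rule SUP_upper2[of "(x, y)"]) auto

lemma hausdorff_weight_mono: "U \<subseteq> V \<Longrightarrow> hausdorff_weight n m U \<le> hausdorff_weight n m V"
  by (auto simp: hausdorff_weight_def intro!: power_mono ediam_n_mono)

lemma hausdorff_content_le: "fine_cover n \<delta> A U \<Longrightarrow> hausdorff_content n m \<delta> A \<le> (\<Sum>i. hausdorff_weight n m (U i))"
  unfolding hausdorff_content_def by (rule INF_lower) simp

lemma hausdorff_content_greatest:
  "(\<And>U. fine_cover n \<delta> A U \<Longrightarrow> b \<le> (\<Sum>i. hausdorff_weight n m (U i))) \<Longrightarrow> b \<le> hausdorff_content n m \<delta> A"
  unfolding hausdorff_content_def by (rule INF_greatest) simp

lemma hausdorff_content_antimono: "\<delta> \<le> \<delta>' \<Longrightarrow> hausdorff_content n m \<delta>' A \<le> hausdorff_content n m \<delta> A"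
  by (rule hausdorff_content_greatest, rule hausdorff_content_le)
     (auto simp: fine_cover_def intro: order_trans[OF _ ennreal_leI])

lemma hausdorff_content_le_outer: "\<delta> > 0 \<Longrightarrow> hausdorff_content n m \<delta> A \<le> hausdorff_outer n m A"
  unfolding hausdorff_outer_eq by (rule SUP_upper) simp

lemma hausdorff_outer_least: "(\<And>\<delta>. \<delta> > 0 \<Longrightarrow> hausdorff_content n m \<delta> A \<le> b) \<Longrightarrow> hausdorff_outer n m A \<le> b"
  unfolding hausdorff_outer_eq by (rule SUP_least) simp

lemma hausdorff_outer_empty [simp]: "hausdorff_outer n m {} = 0"
proof -
  have "hausdorff_content n m \<delta> {} \<le> 0" for \<delta>
    by (rule order_trans[OF hausdorff_content_le[where U="\<lambda>_. {}"]]) (auto simp: fine_cover_def hausdorff_weight_def)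
  then have "hausdorff_outer n m {} \<le> 0" by (intro hausdorff_outer_least)
  then show ?thesis by simp
qed

lemma hausdorff_outer_mono:
  assumes "A \<subseteq> B"
  shows "hausdorff_outer n m A \<le> hausdorff_outer n m B"
proof (rule hausdorff_outer_least)
  fix \<delta> :: real assume "\<delta> > 0"
  have "hausdorff_content n m \<delta> A \<le> hausdorff_content n m \<delta> B"
    by (rule hausdorff_content_greatest, rule hausdorff_content_le) (use assms in \<open>auto simp: fine_cover_def\<close>)
  also have "\<dots> \<le> hausdorff_outer n m B" using \<open>\<delta> > 0\<close> by (rule hausdorff_content_le_outer)
  finally show "hausdorff_content n m \<delta> A \<le> hausdorff_outer n m B" .
qed

lemma hausdorff_content_countably_subadditive:
  "hausdorff_content n m \<delta> (\<Union>j. A j) \<le> (\<Sum>j. hausdorff_content n m \<delta> (A j))"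
proof (cases "(\<Sum>j. hausdorff_content n m \<delta> (A j)) = top")
  case False
  have fin: "hausdorff_content n m \<delta> (A j) < top" for j
    using False ennreal_suminf_lessD[of "\<lambda>j. hausdorff_content n m \<delta> (A j)" top j] by (simp add: less_top)
  show ?thesis
  proof (rule ennreal_le_epsilon)
    fix e :: real assume e: "0 < e"
    have lt: "x < x + ennreal c" if "x < top" "c > 0" for x c
      using that by (cases x) (auto simp: ennreal_plus[symmetric] ennreal_less_iff simp del: ennreal_plus)
    have "\<exists>U. fine_cover n \<delta> (A j) U \<and> (\<Sum>i. hausdorff_weight n m (U i)) < hausdorff_content n m \<delta> (A j) + ennreal (e * (1/2) ^ Suc j)" for j
    proof -
      have "hausdorff_content n m \<delta> (A j) < hausdorff_content n m \<delta> (A j) + ennreal (e * (1/2) ^ Suc j)"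
        using fin[of j] e by (intro lt) auto
      then show ?thesis
        unfolding hausdorff_content_def[of n m \<delta> "A j"] by (subst (asm) INF_less_iff) auto
    qed
    then obtain U where U: "\<And>j. fine_cover n \<delta> (A j) (U j)"
      "\<And>j. (\<Sum>i. hausdorff_weight n m (U j i)) < hausdorff_content n m \<delta> (A j) + ennreal (e * (1/2) ^ Suc j)" by metis
    define W where "W k = (case prod_decode k of (j, i) \<Rightarrow> U j i)" for k
    have "fine_cover n \<delta> (\<Union>j. A j) W"
      unfolding fine_cover_def
    proof (intro conjI allI)
      show "W k \<subseteq> space (lebesgue_n n)" "ediam_n n (W k) \<le> ennreal \<delta>" for k
        using U(1) by (auto simp: W_def fine_cover_def split: prod.split)
      show "(\<Union>j. A j) \<subseteq> (\<Union>k. W k)"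
      proof
        fix x assume "x \<in> (\<Union>j. A j)"
        then obtain j i where "x \<in> U j i" using U(1) unfolding fine_cover_def by blast
        then have "x \<in> W (prod_encode (j, i))" by (simp add: W_def)
        then show "x \<in> (\<Union>k. W k)" by blast
      qed
    qed
    then have "hausdorff_content n m \<delta> (\<Union>j. A j) \<le> (\<Sum>k. hausdorff_weight n m (W k))" by (rule hausdorff_content_le)
    also have "\<dots> = (\<Sum>k. (\<lambda>(j, i). hausdorff_weight n m (U j i)) (prod_decode k))"
      by (simp add: W_def split_beta')
    also have "\<dots> = (\<Sum>j. \<Sum>i. hausdorff_weight n m (U j i))"
      by (rule suminf_ennreal_2dimen) simp
    also have "\<dots> \<le> (\<Sum>j. hausdorff_content n m \<delta> (A j) + ennreal (e * (1/2) ^ Suc j))"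
      using U(2) by (intro suminf_le) (auto intro: less_imp_le)
    also have "\<dots> = (\<Sum>j. hausdorff_content n m \<delta> (A j)) + (\<Sum>j. ennreal e * ennreal ((1/2) ^ Suc j))"
      using e by (subst suminf_add[symmetric]) (auto simp del: ennreal_suminf_cmult simp add: ennreal_mult[symmetric])
    also have "\<dots> = (\<Sum>j. hausdorff_content n m \<delta> (A j)) + ennreal e"
      unfolding ennreal_suminf_cmult
      by (subst suminf_ennreal_eq[OF zero_le_power power_half_series]) auto
    finally show "hausdorff_content n m \<delta> (\<Union>j. A j) \<le> (\<Sum>j. hausdorff_content n m \<delta> (A j)) + ennreal e" .
  qed
qed simp

lemma hausdorff_outer_countably_subadditive:
  "hausdorff_outer n m (\<Union>j. A j) \<le> (\<Sum>j. hausdorff_outer n m (A j))"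
proof (rule hausdorff_outer_least)
  fix \<delta> :: real assume "\<delta> > 0"
  have "hausdorff_content n m \<delta> (\<Union>j. A j) \<le> (\<Sum>j. hausdorff_content n m \<delta> (A j))"
    by (rule hausdorff_content_countably_subadditive)
  also have "\<dots> \<le> (\<Sum>j. hausdorff_outer n m (A j))"
    using \<open>\<delta> > 0\<close> by (intro suminf_le hausdorff_content_le_outer) auto
  finally show "hausdorff_content n m \<delta> (\<Union>j. A j) \<le> (\<Sum>j. hausdorff_outer n m (A j))" .
qed

lemma hausdorff_outer_subadditive: "hausdorff_outer n m (A \<union> B) \<le> hausdorff_outer n m A + hausdorff_outer n m B"
proof -
  have eq: "A \<union> B = (\<Union>j. if j = 0 then A else if j = Suc 0 then B else {})" by (auto split: if_splits)
  have "hausdorff_outer n m (A \<union> B) \<le> (\<Sum>j. hausdorff_outer n m (if j = 0 then A else if j = Suc 0 then B else {}))"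
    unfolding eq by (rule hausdorff_outer_countably_subadditive)
  also have "\<dots> = (\<Sum>j\<in>{0, Suc 0}. hausdorff_outer n m (if j = 0 then A else if j = Suc 0 then B else {}))"
    by (rule suminf_finite) auto
  finally show ?thesis by simp
qed

lemma abs_diff_le_L2: "i < (n :: nat) \<Longrightarrow> \<bar>x i - y i\<bar> \<le> L2_set (\<lambda>i. x i - y i) {..<n}"
  using member_le_L2_set[of "{..<n}" i "\<lambda>i. \<bar>x i - y i\<bar>"] by (simp add: L2_set_def)

lemma hausdorff_outer_separated:
  assumes i: "i < n" and d: "d > 0" and sep: "\<And>x y. x \<in> A \<Longrightarrow> y \<in> B \<Longrightarrow> \<bar>x i - y i\<bar> \<ge> d"
  shows "hausdorff_outer n m A + hausdorff_outer n m B \<le> hausdorff_outer n m (A \<union> B)"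
proof -
  have content: "hausdorff_content n m \<delta> A + hausdorff_content n m \<delta> B \<le> hausdorff_content n m \<delta> (A \<union> B)" if "\<delta> < d" for \<delta>
  proof (rule hausdorff_content_greatest)
    fix U assume U: "fine_cover n \<delta> (A \<union> B) U"
    define UA where "UA j = (if U j \<inter> A = {} then {} else U j)" for j
    define UB where "UB j = (if U j \<inter> B = {} then {} else U j)" for j
    have one: "UA j = {} \<or> UB j = {}" for j
    proof (rule ccontr)
      assume "\<not> ?thesis"
      then obtain x y where xy: "x \<in> U j" "x \<in> A" "y \<in> U j" "y \<in> B" by (auto simp: UA_def UB_def split: if_splits)
      have "ennreal d \<le> ennreal (L2_set (\<lambda>i. x i - y i) {..<n})"
        using sep[OF xy(2,4)] abs_diff_le_L2[OF i, of x y] by (intro ennreal_leI) linarith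
      also have "\<dots> \<le> ediam_n n (U j)" using xy by (intro ediam_n_upper)
      also have "\<dots> \<le> ennreal \<delta>" using U by (simp add: fine_cover_def)
      finally show False using d that by (cases "\<delta> \<ge> 0") (auto simp: ennreal_neg ennreal_eq_0_iff)
    qed
    have sub: "UA j \<subseteq> U j" "UB j \<subseteq> U j" for j by (auto simp: UA_def UB_def)
    have "fine_cover n \<delta> A UA" "fine_cover n \<delta> B UB"
    proof -
      have e: "ediam_n n (UA j) \<le> ennreal \<delta>" "ediam_n n (UB j) \<le> ennreal \<delta>" for j
        using U order_trans[OF ediam_n_mono[OF sub(1)]] order_trans[OF ediam_n_mono[OF sub(2)]]
        unfolding fine_cover_def by blast+
      have "A \<subseteq> (\<Union>j. UA j)"
      proof
        fix x assume "x \<in> A"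
        then obtain j where "x \<in> U j" using U by (auto simp: fine_cover_def)
        then have "x \<in> UA j" using \<open>x \<in> A\<close> by (auto simp: UA_def)
        then show "x \<in> (\<Union>j. UA j)" by blast
      qed
      moreover have "B \<subseteq> (\<Union>j. UB j)"
      proof
        fix x assume "x \<in> B"
        then obtain j where "x \<in> U j" using U by (auto simp: fine_cover_def)
        then have "x \<in> UB j" using \<open>x \<in> B\<close> by (auto simp: UB_def)
        then show "x \<in> (\<Union>j. UB j)" by blast
      qed
      ultimately show "fine_cover n \<delta> A UA" "fine_cover n \<delta> B UB"
        using U e sub unfolding fine_cover_def by blast+
    qed
    then have "hausdorff_content n m \<delta> A + hausdorff_content n m \<delta> B \<le> (\<Sum>j. hausdorff_weight n m (UA j)) + (\<Sum>j. hausdorff_weight n m (UB j))"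
      by (intro add_mono hausdorff_content_le)
    also have "\<dots> = (\<Sum>j. hausdorff_weight n m (UA j) + hausdorff_weight n m (UB j))"
      by (rule suminf_add) auto
    also have "\<dots> \<le> (\<Sum>j. hausdorff_weight n m (U j))"
    proof (intro suminf_le)
      fix j
      show "hausdorff_weight n m (UA j) + hausdorff_weight n m (UB j) \<le> hausdorff_weight n m (U j)"
        using one[of j] hausdorff_weight_mono[OF sub(1)] hausdorff_weight_mono[OF sub(2)]
        by (auto simp: hausdorff_weight_def[of n m "{}"])
    qed auto
    finally show "hausdorff_content n m \<delta> A + hausdorff_content n m \<delta> B \<le> (\<Sum>j. hausdorff_weight n m (U j))" .
  qed
  have pair: "hausdorff_content n m \<delta>1 A + hausdorff_content n m \<delta>2 B \<le> hausdorff_outer n m (A \<union> B)" if "\<delta>1 > 0" "\<delta>2 > 0" for \<delta>1 \<delta>2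
  proof -
    define \<delta> where "\<delta> = min (min \<delta>1 \<delta>2) (d / 2)"
    have \<delta>: "\<delta> > 0" "\<delta> < d" using that d by (auto simp: \<delta>_def)
    have "hausdorff_content n m \<delta>1 A + hausdorff_content n m \<delta>2 B \<le> hausdorff_content n m \<delta> A + hausdorff_content n m \<delta> B"
      by (intro add_mono hausdorff_content_antimono) (auto simp: \<delta>_def)
    also have "\<dots> \<le> hausdorff_content n m \<delta> (A \<union> B)" using \<delta>(2) by (rule content)
    also have "\<dots> \<le> hausdorff_outer n m (A \<union> B)" using \<delta>(1) by (rule hausdorff_content_le_outer)
    finally show ?thesis .
  qed
  have ne: "{0::real<..} \<noteq> {}" using zero_less_one by blast
  have "hausdorff_outer n m A + hausdorff_outer n m B = (SUP \<delta>1\<in>{0<..}. hausdorff_content n m \<delta>1 A + hausdorff_outer n m B)"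
    unfolding hausdorff_outer_eq[of n m A] using ne by (simp add: ennreal_SUP_add_left)
  also have "\<dots> \<le> hausdorff_outer n m (A \<union> B)"
  proof (rule SUP_least)
    fix \<delta>1 :: real assume "\<delta>1 \<in> {0<..}"
    have "hausdorff_content n m \<delta>1 A + hausdorff_outer n m B = (SUP \<delta>2\<in>{0<..}. hausdorff_content n m \<delta>1 A + hausdorff_content n m \<delta>2 B)"
      unfolding hausdorff_outer_eq[of n m B] using ne by (simp add: ennreal_SUP_add_right)
    also have "\<dots> \<le> hausdorff_outer n m (A \<union> B)"
      using \<open>\<delta>1 \<in> _\<close> pair by (intro SUP_least) auto
    finally show "hausdorff_content n m \<delta>1 A + hausdorff_outer n m B \<le> hausdorff_outer n m (A \<union> B)" .
  qed
  finally show ?thesis .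
qed

lemma hausdorff_outer_separated_sum:
  fixes R :: "nat \<Rightarrow> (nat \<Rightarrow> real) set"
  assumes i: "i < n" and d: "\<And>N. d N > 0"
    and sep: "\<And>l N x y. l < N \<Longrightarrow> x \<in> R l \<Longrightarrow> y \<in> R N \<Longrightarrow> \<bar>x i - y i\<bar> \<ge> d N"
  shows "(\<Sum>l<N. hausdorff_outer n m (R l)) \<le> hausdorff_outer n m (\<Union>l<N. R l)"
proof (induction N)
  case (Suc N)
  have "(\<Sum>l<Suc N. hausdorff_outer n m (R l)) \<le> hausdorff_outer n m (\<Union>l<N. R l) + hausdorff_outer n m (R N)"
    using Suc by (simp add: add_right_mono)
  also have "\<dots> \<le> hausdorff_outer n m ((\<Union>l<N. R l) \<union> R N)"
    by (rule hausdorff_outer_separated[OF i d[of N]]) (use sep in auto)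
  finally show ?case by (simp add: lessThan_Suc Un_commute)
qed simp

text \<open>The slices \<open>c + 1/(l+2) \<le> x i < c + 1/(l+1)\<close> of the same parity are separated, so the sum of
  their measures converges; hence the part of \<open>T\<close> close to the hyperplane is negligible.\<close>

lemma halfspace_caratheodory:
  assumes i: "i < n"
  shows "hausdorff_outer n m (T \<inter> {x. x i \<le> c}) + hausdorff_outer n m (T - {x. x i \<le> c}) \<le> hausdorff_outer n m T"
proof (cases "hausdorff_outer n m T = top")
  case False
  let ?H = "hausdorff_outer n m"
  define q where "q l = 1 / (real l + 1)" for l :: nat
  have q: "q l > 0" "q (Suc l) < q l" "k \<le> l \<Longrightarrow> q l \<le> q k" for l k by (auto simp: q_def field_simps)
  define R where "R l = {x \<in> T. c + q (Suc l) \<le> x i \<and> x i < c + q l}" for l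
  define B where "B j = {x \<in> T. c + q j \<le> x i}" for j
  have sumR: "(\<Sum>l<N. ?H (R (2 * l + z))) \<le> ?H T" for N z
  proof -
    have "(\<Sum>l<N. ?H (R (2 * l + z))) \<le> ?H (\<Union>l<N. R (2 * l + z))"
    proof (rule hausdorff_outer_separated_sum[OF i, where d="\<lambda>N. q (2 * N + z - 1) - q (2 * N + z) + (if N = 0 then 1 else 0)"])
      show "q (2 * N + z - 1) - q (2 * N + z) + (if N = 0 then 1 else 0) > 0" for N
      proof (cases N)
        case (Suc M)
        then show ?thesis using q(2)[of "2 * N + z - 1"] by simp
      qed (use q(3)[of "z - 1" z] in auto)
      fix l N x y assume lN: "l < N" and x: "x \<in> R (2 * l + z)" and y: "y \<in> R (2 * N + z)"
      have "q (2 * N + z - 1) \<le> q (Suc (2 * l + z))" using lN by (intro q(3)) auto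
      then show "\<bar>x i - y i\<bar> \<ge> q (2 * N + z - 1) - q (2 * N + z) + (if N = 0 then 1 else 0)"
        using x y lN by (auto simp: R_def)
    qed
    also have "\<dots> \<le> ?H T" by (intro hausdorff_outer_mono) (auto simp: R_def)
    finally show ?thesis .
  qed
  have sum2: "(\<Sum>l<2 * N. ?H (R l)) \<le> 2 * ?H T" for N
  proof -
    have "(\<Sum>l<2 * N. ?H (R l)) = (\<Sum>l<N. ?H (R (2 * l + 0))) + (\<Sum>l<N. ?H (R (2 * l + 1)))"
      by (induction N) (auto simp: algebra_simps)
    also have "\<dots> \<le> ?H T + ?H T" by (intro add_mono sumR)
    finally show ?thesis by (simp add: mult_2)
  qed
  have sumfin: "(\<Sum>l. ?H (R l)) \<le> 2 * ?H T"
  proof (rule suminf_le_const[OF summableI])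
    fix N
    have "(\<Sum>l<N. ?H (R l)) \<le> (\<Sum>l<2 * N. ?H (R l))" by (intro sum_mono2) auto
    then show "(\<Sum>l<N. ?H (R l)) \<le> 2 * ?H T" using sum2[of N] by (rule order_trans)
  qed
  also have "\<dots> < top" using False by (auto simp: ennreal_mult_eq_top_iff less_top[symmetric])
  finally have fin: "(\<Sum>l. ?H (R l)) \<noteq> top" by simp
  define g where "g l = enn2real (?H (R l))" for l
  have g: "?H (R l) = ennreal (g l)" for l
    using ennreal_suminf_lessD[of "\<lambda>l. ?H (R l)" top l] fin by (simp add: g_def less_top)
  have g0: "g l \<ge> 0" for l by (simp add: g_def)
  have sg: "summable g" using fin unfolding g by (intro summable_suminf_not_top g0)
  show ?thesis
  proof (rule ennreal_le_epsilon)
    fix e :: real assume e: "0 < e"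
    obtain j where j: "norm (\<Sum>l. g (l + j)) < e" using suminf_exist_split[OF e sg] by blast
    have sub: "T - {x. x i \<le> c} \<subseteq> B j \<union> (\<Union>l. R (l + j))"
    proof
      fix x assume x: "x \<in> T - {x. x i \<le> c}"
      show "x \<in> B j \<union> (\<Union>l. R (l + j))"
      proof (cases "c + q j \<le> x i")
        case False
        define P where "P l \<longleftrightarrow> c + q (Suc (l + j)) \<le> x i" for l
        have "\<exists>l. P l"
        proof -
          have "x i - c > 0" using x by auto
          then obtain N where N: "inverse (real (Suc N)) < x i - c" using reals_Archimedean by blast
          have "q (Suc (N + j)) \<le> q N" by (intro q(3)) auto
          also have "q N < x i - c" using N by (simp add: q_def field_simps)
          finally show ?thesis by (intro exI[of _ N]) (simp add: P_def)
        qed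
        define l where "l = (LEAST l. P l)"
        have Pl: "P l" unfolding l_def using \<open>\<exists>l. P l\<close> by (rule LeastI_ex)
        have "x i < c + q (l + j)"
        proof (cases l)
          case (Suc l')
          then have "\<not> P l'" using not_less_Least[of l' P] by (simp add: l_def)
          then show ?thesis using Suc by (simp add: P_def)
        qed (use False in auto)
        then have "x \<in> R (l + j)" using x Pl by (simp add: R_def P_def)
        then show ?thesis by blast
      qed (use x in \<open>auto simp: B_def\<close>)
    qed
    have "?H (T - {x. x i \<le> c}) \<le> ?H (B j) + ?H (\<Union>l. R (l + j))"
      using hausdorff_outer_mono[OF sub] hausdorff_outer_subadditive by (rule order_trans)
    also have "?H (\<Union>l. R (l + j)) \<le> (\<Sum>l. ?H (R (l + j)))" by (rule hausdorff_outer_countably_subadditive)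
    also have "\<dots> = ennreal (\<Sum>l. g (l + j))"
      unfolding g using g0 sg by (intro suminf_ennreal2) (auto simp: summable_iff_shift)
    also have "\<dots> \<le> ennreal e" using j by (intro ennreal_leI) auto
    finally have "?H (T - {x. x i \<le> c}) \<le> ?H (B j) + ennreal e" by (simp add: add_left_mono)
    then have "?H (T \<inter> {x. x i \<le> c}) + ?H (T - {x. x i \<le> c}) \<le> (?H (T \<inter> {x. x i \<le> c}) + ?H (B j)) + ennreal e"
      by (simp add: add_left_mono add.assoc)
    also have "?H (T \<inter> {x. x i \<le> c}) + ?H (B j) \<le> ?H (T \<inter> {x. x i \<le> c} \<union> B j)"
      by (rule hausdorff_outer_separated[OF i q(1)[of j]]) (auto simp: B_def)
    also have "\<dots> \<le> ?H T" by (intro hausdorff_outer_mono) (auto simp: B_def)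
    finally show "?H (T \<inter> {x. x i \<le> c}) + ?H (T - {x. x i \<le> c}) \<le> ?H T + ennreal e"
      by (simp add: add_right_mono)
  qed
qed simp

lemma hausdorff_measure_sets [measurable_cong, simp]: "sets (hausdorff_measure n m) = sets (lebesgue_n n)"
  by (simp add: hausdorff_measure_def)

lemma hausdorff_measure_space: "space (hausdorff_measure n m) = space (lebesgue_n n)"
  by (rule sets_eq_imp_space_eq) simp

lemma emeasure_hausdorff_measure:
  assumes A: "A \<in> sets (lebesgue_n n)"
  shows "emeasure (hausdorff_measure n m) A = hausdorff_outer n m A"
proof -
  let ?\<Omega> = "space (lebesgue_n n)" and ?H = "hausdorff_outer n m"
  interpret S: sigma_algebra ?\<Omega> "Pow ?\<Omega>" by (rule sigma_algebra_Pow)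
  define L where "L = lambda_system ?\<Omega> (Pow ?\<Omega>) ?H"
  have "outer_measure_space (Pow ?\<Omega>) ?H"
    unfolding outer_measure_space_def positive_def increasing_def countably_subadditive_def
    using hausdorff_outer_mono hausdorff_outer_countably_subadditive by auto
  then have ms: "measure_space ?\<Omega> L ?H" unfolding L_def by (rule S.caratheodory_lemma)
  then interpret L: sigma_algebra ?\<Omega> L by (simp add: measure_space_def)
  define N where "N = measure_of ?\<Omega> L ?H"
  have setsN: "sets N = L" "space N = ?\<Omega>"
    unfolding N_def using L.space_closed by (auto simp: L.sigma_sets_eq)
  have half: "{x \<in> ?\<Omega>. x i \<le> c} \<in> L" if "i < n" for i c
    unfolding L_def S.lambda_system_eq
  proof (intro CollectI conjI ballI antisym)
    fix T assume T: "T \<in> Pow ?\<Omega>"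
    have eq: "T \<inter> {x \<in> ?\<Omega>. x i \<le> c} = T \<inter> {x. x i \<le> c}" "T - {x \<in> ?\<Omega>. x i \<le> c} = T - {x. x i \<le> c}" using T by auto
    show "?H (T \<inter> {x \<in> ?\<Omega>. x i \<le> c}) + ?H (T - {x \<in> ?\<Omega>. x i \<le> c}) \<le> ?H T"
      unfolding eq by (rule halfspace_caratheodory[OF that])
    have "?H T \<le> ?H ((T \<inter> {x \<in> ?\<Omega>. x i \<le> c}) \<union> (T - {x \<in> ?\<Omega>. x i \<le> c}))"
      by (intro hausdorff_outer_mono) auto
    also have "\<dots> \<le> ?H (T \<inter> {x \<in> ?\<Omega>. x i \<le> c}) + ?H (T - {x \<in> ?\<Omega>. x i \<le> c})" by (rule hausdorff_outer_subadditive)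
    finally show "?H T \<le> ?H (T \<inter> {x \<in> ?\<Omega>. x i \<le> c}) + ?H (T - {x \<in> ?\<Omega>. x i \<le> c})" .
  qed auto
  have sub: "sets (lebesgue_n n) \<subseteq> L"
  proof -
    have "sets (\<Pi>\<^sub>M i\<in>{..<n}. (lborel :: real measure)) \<subseteq> sets N"
    proof (rule sets_PiM_in_sets)
      show "space N = (\<Pi>\<^sub>E i\<in>{..<n}. space lborel)" by (simp add: setsN lebesgue_n_def space_PiM)
      fix i and B :: "real set" assume i: "i \<in> {..<n}" and B: "B \<in> sets lborel"
      have "(\<lambda>x. x i) \<in> borel_measurable N"
        unfolding borel_measurable_iff_le using half[of i] i by (simp add: setsN)
      then have "(\<lambda>x. x i) -` B \<inter> space N \<in> sets N" using B by (intro measurable_sets) auto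
      moreover have "(\<lambda>x. x i) -` B \<inter> space N = {x \<in> space N. x i \<in> B}" by auto
      ultimately show "{x \<in> space N. x i \<in> B} \<in> sets N" by simp
    qed
    then show ?thesis by (simp add: lebesgue_n_def setsN)
  qed
  have ca: "countably_additive L ?H" using ms by (simp add: measure_space_def)
  show ?thesis
  proof (rule emeasure_measure_of[OF hausdorff_measure_def])
    show "sets (lebesgue_n n) \<subseteq> Pow ?\<Omega>" by (rule sets.space_closed)
    show "positive (sets (hausdorff_measure n m)) ?H" by (simp add: positive_def)
    show "countably_additive (sets (hausdorff_measure n m)) ?H"
      unfolding countably_additive_def hausdorff_measure_sets
    proof (intro allI impI)
      fix F :: "nat \<Rightarrow> (nat \<Rightarrow> real) set"
      assume "range F \<subseteq> sets (lebesgue_n n)" "disjoint_family F" "\<Union> (range F) \<in> sets (lebesgue_n n)"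
      then show "(\<Sum>i. ?H (F i)) = ?H (\<Union> (range F))"
        using ca sub unfolding countably_additive_def by blast
    qed
    show "A \<in> sets (hausdorff_measure n m)" using A by simp
  qed
qed

lemma hausdorff_outer_lipschitz:
  assumes L: "L > 0" and f: "\<And>x. x \<in> A \<Longrightarrow> f x \<in> space (lebesgue_n n)"
    and lip: "\<And>x y. x \<in> A \<Longrightarrow> y \<in> A \<Longrightarrow> L2_set (\<lambda>i. f x i - f y i) {..<n} \<le> L * L2_set (\<lambda>i. x i - y i) {..<k}"
  shows "hausdorff_outer n m (f ` A) \<le> ennreal (L ^ m) * hausdorff_outer k m A"
proof (rule hausdorff_outer_least)
  fix \<delta> :: real assume \<delta>: "\<delta> > 0"
  have diam: "ediam_n n (f ` (U \<inter> A)) \<le> ennreal L * ediam_n k U" for U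
    unfolding ediam_n_def[of n]
  proof (rule SUP_least, clarsimp)
    fix x y assume xy: "x \<in> U" "x \<in> A" "y \<in> U" "y \<in> A"
    have "ennreal (L2_set (\<lambda>i. f x i - f y i) {..<n}) \<le> ennreal (L * L2_set (\<lambda>i. x i - y i) {..<k})"
      using lip xy by (intro ennreal_leI) auto
    also have "\<dots> = ennreal L * ennreal (L2_set (\<lambda>i. x i - y i) {..<k})" using L by (simp add: ennreal_mult)
    also have "\<dots> \<le> ennreal L * ediam_n k U" using xy by (intro mult_left_mono ediam_n_upper) auto
    finally show "ennreal (L2_set (\<lambda>i. f x i - f y i) {..<n}) \<le> ennreal L * ediam_n k U" .
  qed
  have "hausdorff_content n m \<delta> (f ` A) \<le> ennreal (L ^ m) * hausdorff_content k m (\<delta> / L) A"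
  proof -
    have *: "hausdorff_content n m \<delta> (f ` A) \<le> ennreal (L ^ m) * (\<Sum>i. hausdorff_weight k m (U i))"
      if U: "fine_cover k (\<delta> / L) A U" for U
    proof -
      have "fine_cover n \<delta> (f ` A) (\<lambda>i. f ` (U i \<inter> A))"
        unfolding fine_cover_def
      proof (intro conjI allI)
        fix i
        show "f ` (U i \<inter> A) \<subseteq> space (lebesgue_n n)" using f by auto
        have "ediam_n n (f ` (U i \<inter> A)) \<le> ennreal L * ennreal (\<delta> / L)"
          using U by (intro order_trans[OF diam] mult_left_mono) (auto simp: fine_cover_def)
        also have "\<dots> = ennreal \<delta>" using L \<delta> by (simp add: ennreal_mult[symmetric])
        finally show "ediam_n n (f ` (U i \<inter> A)) \<le> ennreal \<delta>" .
      next
        show "f ` A \<subseteq> (\<Union>i. f ` (U i \<inter> A))" using U unfolding fine_cover_def by blast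
      qed
      then have "hausdorff_content n m \<delta> (f ` A) \<le> (\<Sum>i. hausdorff_weight n m (f ` (U i \<inter> A)))" by (rule hausdorff_content_le)
      also have "\<dots> \<le> (\<Sum>i. ennreal (L ^ m) * hausdorff_weight k m (U i))"
      proof (intro suminf_le)
        fix i
        show "hausdorff_weight n m (f ` (U i \<inter> A)) \<le> ennreal (L ^ m) * hausdorff_weight k m (U i)"
        proof (cases "U i \<inter> A = {}")
          case False
          then have "hausdorff_weight n m (f ` (U i \<inter> A)) \<le> (ennreal L * ediam_n k (U i)) ^ m"
            unfolding hausdorff_weight_def using diam by (auto intro: power_mono)
          also have "\<dots> = ennreal (L ^ m) * hausdorff_weight k m (U i)"
            using False L by (auto simp: hausdorff_weight_def power_mult_distrib ennreal_power)
          finally show ?thesis .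
        qed (simp add: hausdorff_weight_def[of n])
      qed auto
      finally show ?thesis by simp
    qed
    have Lm: "ennreal (L ^ m) \<noteq> 0" "ennreal (L ^ m) \<noteq> top" using L by auto
    have "hausdorff_content n m \<delta> (f ` A) / ennreal (L ^ m) \<le> hausdorff_content k m (\<delta> / L) A"
    proof (rule hausdorff_content_greatest)
      fix U assume "fine_cover k (\<delta> / L) A U"
      from *[OF this] show "hausdorff_content n m \<delta> (f ` A) / ennreal (L ^ m) \<le> (\<Sum>i. hausdorff_weight k m (U i))"
        using Lm by (simp add: divide_le_posI_ennreal zero_less_iff_neq_zero)
    qed
    then have "ennreal (L ^ m) * (hausdorff_content n m \<delta> (f ` A) / ennreal (L ^ m)) \<le> ennreal (L ^ m) * hausdorff_content k m (\<delta> / L) A"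
      by (rule mult_left_mono) simp
    then show ?thesis using Lm by (simp add: ennreal_times_divide mult.commute[of "ennreal (L ^ m)"] ennreal_mult_divide_eq)
  qed
  also have "\<dots> \<le> ennreal (L ^ m) * hausdorff_outer k m A"
    using \<delta> L by (intro mult_left_mono hausdorff_content_le_outer) auto
  finally show "hausdorff_content n m \<delta> (f ` A) \<le> ennreal (L ^ m) * hausdorff_outer k m A" .
qed

lemma lp_norm_2: "lp_norm n 2 x = L2_set x {..<n}"
proof -
  have "(\<Sum>i<n. \<bar>x i\<bar> powr 2) = (\<Sum>i<n. (x i)\<^sup>2)" by (intro sum.cong) auto
  then show ?thesis by (simp add: lp_norm_def L2_set_def powr_half_sqrt sum_nonneg)
qed

lemma sigma_finite_of_finite_on_balls:
  assumes sets: "sets M = sets (lebesgue_n n)"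
    and fin: "\<And>j :: nat. emeasure M {x \<in> space (lebesgue_n n). L2_set x {..<n} \<le> real j} \<noteq> \<infinity>"
  shows "sigma_finite_measure M"
proof
  let ?B = "\<lambda>j::nat. {x \<in> space (lebesgue_n n). L2_set x {..<n} \<le> real j}"
  have space: "space M = space (lebesgue_n n)" using sets by (rule sets_eq_imp_space_eq)
  have "?B j \<in> sets M" for j
  proof -
    have "{x \<in> space (lebesgue_n n). lp_norm n 2 x \<le> real j} \<in> sets (lebesgue_n n)" by measurable
    then show ?thesis by (simp add: sets lp_norm_2)
  qed
  moreover have "(\<Union>j. ?B j) = space M"
    using real_arch_simple by (auto simp: space)
  ultimately show "\<exists>A. countable A \<and> A \<subseteq> sets M \<and> \<Union> A = space M \<and> (\<forall>a\<in>A. emeasure M a \<noteq> \<infinity>)"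
    using fin by (intro exI[of _ "range ?B"]) auto
qed

lemma hausdorff_content_finite_cover:
  assumes F: "finite F" and cov: "A \<subseteq> \<Union> F"
    and U: "\<And>U. U \<in> F \<Longrightarrow> U \<subseteq> space (lebesgue_n n)" "\<And>U. U \<in> F \<Longrightarrow> ediam_n n U \<le> ennreal \<delta>"
  shows "hausdorff_content n m \<delta> A \<le> (\<Sum>U\<in>F. hausdorff_weight n m U)"
proof -
  obtain h where h: "bij_betw h {0..<card F} F" using ex_bij_betw_nat_finite[OF F] by blast
  define W where "W i = (if i < card F then h i else {})" for i
  have hF: "h i \<in> F" if "i < card F" for i using h that by (auto simp: bij_betw_def)
  have "fine_cover n \<delta> A W"
    unfolding fine_cover_def
  proof (intro conjI allI)
    show "W i \<subseteq> space (lebesgue_n n)" "ediam_n n (W i) \<le> ennreal \<delta>" for i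
      using U hF by (auto simp: W_def)
    show "A \<subseteq> (\<Union>i. W i)"
    proof
      fix x assume "x \<in> A"
      then obtain V where V: "V \<in> F" "x \<in> V" using cov by blast
      then have "V \<in> h ` {0..<card F}" using h by (simp add: bij_betw_def)
      then obtain i where "i < card F" "h i = V" by auto
      then have "x \<in> W i" using V by (simp add: W_def)
      then show "x \<in> (\<Union>i. W i)" by blast
    qed
  qed
  then have "hausdorff_content n m \<delta> A \<le> (\<Sum>i. hausdorff_weight n m (W i))" by (rule hausdorff_content_le)
  also have "\<dots> = (\<Sum>i\<in>{0..<card F}. hausdorff_weight n m (W i))"
    by (rule suminf_finite) (auto simp: W_def hausdorff_weight_def)
  also have "\<dots> = (\<Sum>i\<in>{0..<card F}. hausdorff_weight n m (h i))"
    by (intro sum.cong) (auto simp: W_def)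
  also have "\<dots> = (\<Sum>U\<in>F. hausdorff_weight n m U)"
    by (rule sum.reindex_bij_betw[OF h])
  finally show ?thesis .
qed

lemma hausdorff_cube_finite:
  assumes m: "m \<ge> 1"
  shows "hausdorff_outer m m (Pi\<^sub>E {..<m} (\<lambda>_. {0..1})) \<le> ennreal (real m ^ m)"
proof (rule hausdorff_outer_least)
  fix \<delta> :: real assume \<delta>: "\<delta> > 0"
  obtain N :: nat where N: "real N > m / \<delta>" using reals_Archimedean2 by blast
  have N0: "real N > 0" using N \<delta> by (meson divide_nonneg_pos le_less_trans of_nat_0_le_iff)
  have N\<delta>: "m / N \<le> \<delta>" using N N0 \<delta> by (simp add: field_simps)
  define cell where "cell f = Pi\<^sub>E {..<m} (\<lambda>i. {real (f i) / N .. (real (f i) + 1) / N})" for f :: "nat \<Rightarrow> nat"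
  define F where "F = cell ` Pi\<^sub>E {..<m} (\<lambda>_. {..<N})"
  have diam: "ediam_n m (cell f) \<le> ennreal (m / N)" for f
    unfolding ediam_n_def
  proof (rule SUP_least)
    fix z assume "z \<in> cell f \<times> cell f"
    then obtain x y where z: "z = (x, y)" and xy: "x \<in> cell f" "y \<in> cell f" by auto
    have "\<bar>x i - y i\<bar> \<le> 1 / N" if "i < m" for i
    proof -
      have "real (f i) / N \<le> x i" "x i \<le> (real (f i) + 1) / N" "real (f i) / N \<le> y i" "y i \<le> (real (f i) + 1) / N"
        using xy that by (auto simp: cell_def PiE_iff)
      then show ?thesis unfolding add_divide_distrib by linarith
    qed
    then have "L2_set (\<lambda>i. x i - y i) {..<m} \<le> (\<Sum>i<m. 1 / N)"
      by (intro order_trans[OF L2_set_le_sum_abs] sum_mono) auto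
    then show "(case z of (x, y) \<Rightarrow> ennreal (L2_set (\<lambda>i. x i - y i) {..<m})) \<le> ennreal (m / N)"
      unfolding z by (auto intro!: ennreal_leI)
  qed
  have "hausdorff_content m m \<delta> (Pi\<^sub>E {..<m} (\<lambda>_. {0..1})) \<le> (\<Sum>U\<in>F. hausdorff_weight m m U)"
  proof (rule hausdorff_content_finite_cover)
    show "finite F" by (simp add: F_def finite_PiE)
    show "Pi\<^sub>E {..<m} (\<lambda>_. {0..1}) \<subseteq> \<Union> F"
    proof
      fix x :: "nat \<Rightarrow> real" assume x: "x \<in> Pi\<^sub>E {..<m} (\<lambda>_. {0..1})"
      define f where "f = (\<lambda>i\<in>{..<m}. min (N - 1) (nat \<lfloor>x i * N\<rfloor>))"
      have f: "f \<in> Pi\<^sub>E {..<m} (\<lambda>_. {..<N})" using N0 by (auto simp: f_def)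
      have "real (f i) / N \<le> x i \<and> x i \<le> (real (f i) + 1) / N" if "i < m" for i
      proof -
        have xi: "0 \<le> x i" "x i \<le> 1" using x that by (auto simp: PiE_iff)
        have k: "real (nat \<lfloor>x i * N\<rfloor>) \<le> x i * N" "x i * N < real (nat \<lfloor>x i * N\<rfloor>) + 1"
          using xi N0 by (auto simp: of_nat_nat)
        have l: "real (f i) \<le> x i * N" using k that by (auto simp: f_def min_def)
        have u: "x i * N \<le> real (f i) + 1"
        proof (cases "nat \<lfloor>x i * N\<rfloor> \<le> N - 1")
          case True
          then show ?thesis using k that by (simp add: f_def)
        next
          case False
          then have "real (f i) + 1 = N" using that N0 by (simp add: f_def of_nat_diff)
          then show ?thesis using xi N0 by (simp add: mult_left_le_one_le)
        qed
        show ?thesis using l u N0 by (simp add: divide_le_eq le_divide_eq)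
      qed
      then have "x \<in> cell f" using x by (auto simp: cell_def PiE_iff)
      then show "x \<in> \<Union> F" using f by (auto simp: F_def)
    qed
    fix U assume "U \<in> F"
    then obtain f where U: "U = cell f" by (auto simp: F_def)
    show "U \<subseteq> space (lebesgue_n m)" unfolding U cell_def space_lebesgue_n PiE_def by blast
    show "ediam_n m U \<le> ennreal \<delta>" unfolding U using diam[of f] ennreal_leI[OF N\<delta>] by (rule order_trans)
  qed
  also have "\<dots> \<le> (\<Sum>U\<in>F. ennreal (m / N) ^ m)"
  proof (rule sum_mono)
    fix U assume "U \<in> F"
    then obtain f where U: "U = cell f" by (auto simp: F_def)
    show "hausdorff_weight m m U \<le> ennreal (m / N) ^ m"
      unfolding U hausdorff_weight_def using diam[of f] by (auto intro: power_mono)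
  qed
  also have "\<dots> = of_nat (card F) * ennreal (m / N) ^ m" by simp
  also have "\<dots> \<le> of_nat (N ^ m) * ennreal (m / N) ^ m"
  proof (rule mult_right_mono)
    have "card F \<le> card (Pi\<^sub>E {..<m} (\<lambda>_. {..<N}))" unfolding F_def by (intro card_image_le finite_PiE) auto
    then have "card F \<le> N ^ m" by (simp add: card_PiE)
    then show "(of_nat (card F) :: ennreal) \<le> of_nat (N ^ m)" by (rule of_nat_mono)
  qed simp
  also have "\<dots> = ennreal (real N ^ m * (m / N) ^ m)"
  proof -
    have "of_nat (N ^ m) = ennreal (real N ^ m)" by (simp only: ennreal_of_nat_eq_real_of_nat of_nat_power)
    moreover have "ennreal (m / N) ^ m = ennreal ((m / N) ^ m)" by (rule ennreal_power) simp
    ultimately show ?thesis by (simp only: ennreal_mult[OF zero_le_power zero_le_power] of_nat_0_le_iff divide_nonneg_nonneg)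
  qed
  also have "real N ^ m * (m / N) ^ m = real m ^ m" using N0 by (simp add: power_mult_distrib[symmetric])
  finally show "hausdorff_content m m \<delta> (Pi\<^sub>E {..<m} (\<lambda>_. {0..1})) \<le> ennreal (real m ^ m)" .
qed

lemma lebesgue_le_hausdorff:
  assumes m: "m \<ge> 1" and A: "A \<in> sets (lebesgue_n m)"
  shows "emeasure (lebesgue_n m) A \<le> ennreal (2 ^ m) * hausdorff_outer m m A"
proof -
  have "emeasure (lebesgue_n m) A / ennreal (2 ^ m) \<le> hausdorff_content m m 1 A"
  proof (rule hausdorff_content_greatest)
    fix U assume U: "fine_cover m 1 A U"
    define d where "d j = enn2real (ediam_n m (U j))" for j
    have d: "ediam_n m (U j) = ennreal (d j)" "d j \<ge> 0" for j
    proof -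
      have "ediam_n m (U j) \<le> 1" using U by (simp add: fine_cover_def)
      then have "ediam_n m (U j) < top" using ennreal_one_less_top by (rule le_less_trans)
      then show "ediam_n m (U j) = ennreal (d j)" "d j \<ge> 0" by (auto simp: d_def)
    qed
    define c where "c j = (if U j = {} then {} else Pi\<^sub>E {..<m} (\<lambda>i. {(SOME x. x \<in> U j) i - d j .. (SOME x. x \<in> U j) i + d j}))" for j
    have cm: "c j \<in> sets (lebesgue_n m)" for j by (auto simp: c_def intro!: box_in_sets)
    have cU: "U j \<subseteq> c j" for j
    proof
      fix y assume y: "y \<in> U j"
      define x where "x = (SOME x. x \<in> U j)"
      have x: "x \<in> U j" unfolding x_def by (rule someI[of "\<lambda>x. x \<in> U j", OF y])
      have "\<bar>y i - x i\<bar> \<le> d j" if "i < m" for i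
      proof -
        have "ennreal (L2_set (\<lambda>i. y i - x i) {..<m}) \<le> ennreal (d j)"
          using ediam_n_upper[OF y x, of m] by (simp add: d)
        then have "L2_set (\<lambda>i. y i - x i) {..<m} \<le> d j" using d by (simp add: ennreal_le_iff)
        then show ?thesis using abs_diff_le_L2[OF that, of y x] by linarith
      qed
      moreover have "y \<in> space (lebesgue_n m)" using U y by (auto simp: fine_cover_def)
      ultimately show "y \<in> c j"
        using y unfolding c_def x_def[symmetric] by (force simp: space_lebesgue_n PiE_iff abs_le_iff)
    qed
    have cw: "emeasure (lebesgue_n m) (c j) \<le> ennreal (2 ^ m) * hausdorff_weight m m (U j)" for j
    proof (cases "U j = {}")
      case False
      then have "emeasure (lebesgue_n m) (c j) = (\<Prod>i<m. ennreal (2 * d j))"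
        unfolding c_def using d(2)[of j] by (simp add: emeasure_lebesgue_n_box)
      also have "\<dots> = ennreal (2 ^ m) * hausdorff_weight m m (U j)"
        using False d[of j] by (simp add: hausdorff_weight_def ennreal_power power_mult_distrib ennreal_mult[symmetric])
      finally show ?thesis by simp
    qed (simp add: c_def)
    have "A \<subseteq> (\<Union>j. c j)" using U cU unfolding fine_cover_def by blast
    then have "emeasure (lebesgue_n m) A \<le> emeasure (lebesgue_n m) (\<Union>j. c j)"
      using cm by (intro emeasure_mono) auto
    also have "\<dots> \<le> (\<Sum>j. emeasure (lebesgue_n m) (c j))"
      using cm by (intro emeasure_subadditive_countably) auto
    also have "\<dots> \<le> (\<Sum>j. ennreal (2 ^ m) * hausdorff_weight m m (U j))" using cw by (intro suminf_le) auto
    also have "\<dots> = ennreal (2 ^ m) * (\<Sum>j. hausdorff_weight m m (U j))" by simp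
    finally show "emeasure (lebesgue_n m) A / ennreal (2 ^ m) \<le> (\<Sum>j. hausdorff_weight m m (U j))"
      by (subst divide_le_posI_ennreal) (auto simp: mult.commute)
  qed
  also have "\<dots> \<le> hausdorff_outer m m A" by (rule hausdorff_content_le_outer) simp
  finally have "ennreal (2 ^ m) * (emeasure (lebesgue_n m) A / ennreal (2 ^ m)) \<le> ennreal (2 ^ m) * hausdorff_outer m m A"
    by (rule mult_left_mono) simp
  then show ?thesis by (simp add: ennreal_times_divide mult.commute[of "ennreal (2 ^ m)"] ennreal_mult_divide_eq)
qed

lemma hausdorff_outer_isometry:
  assumes "\<And>x. x \<in> A \<Longrightarrow> f x \<in> space (lebesgue_n n)" and A: "A \<subseteq> space (lebesgue_n k)" and L: "L > 0"
    and iso: "\<And>x y. x \<in> A \<Longrightarrow> y \<in> A \<Longrightarrow> L2_set (\<lambda>i. f x i - f y i) {..<n} = L * L2_set (\<lambda>i. x i - y i) {..<k}"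
    and inj: "inj_on f A"
  shows "hausdorff_outer n m (f ` A) = ennreal (L ^ m) * hausdorff_outer k m A"
proof (rule antisym)
  show "hausdorff_outer n m (f ` A) \<le> ennreal (L ^ m) * hausdorff_outer k m A"
    using assms by (intro hausdorff_outer_lipschitz) auto
  have "hausdorff_outer k m (inv_into A f ` (f ` A)) \<le> ennreal ((1 / L) ^ m) * hausdorff_outer n m (f ` A)"
  proof (rule hausdorff_outer_lipschitz)
    fix x y assume xy: "x \<in> f ` A" "y \<in> f ` A"
    then have "inv_into A f x \<in> A" "inv_into A f y \<in> A" by (auto simp: inv_into_into)
    from iso[OF this] show "L2_set (\<lambda>i. inv_into A f x i - inv_into A f y i) {..<k} \<le> 1 / L * L2_set (\<lambda>i. x i - y i) {..<n}"
      using xy L by (simp add: f_inv_into_f)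
  qed (use L A in \<open>auto simp: inv_into_into inj\<close>)
  also have "inv_into A f ` (f ` A) = A" using inj by (auto simp: image_comp)
  finally have "ennreal (L ^ m) * hausdorff_outer k m A \<le> ennreal (L ^ m) * (ennreal ((1 / L) ^ m) * hausdorff_outer n m (f ` A))"
    by (rule mult_left_mono) simp
  also have "\<dots> = ennreal (L ^ m * (1 / L) ^ m) * hausdorff_outer n m (f ` A)"
    using L by (simp add: mult.assoc[symmetric] ennreal_mult[symmetric])
  also have "L ^ m * (1 / L) ^ m = 1" using L by (simp add: power_mult_distrib[symmetric])
  finally show "ennreal (L ^ m) * hausdorff_outer k m A \<le> hausdorff_outer n m (f ` A)" by simp
qed

lemma hausdorff_measure_eq_lebesgue:
  assumes m: "m \<ge> 1"
  obtains \<kappa> where "\<kappa> > 0" "\<And>A. A \<in> sets (lebesgue_n m) \<Longrightarrow> hausdorff_outer m m A = ennreal \<kappa> * emeasure (lebesgue_n m) A"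
proof -
  let ?L = "lebesgue_n m" and ?H = "hausdorff_measure m m"
  let ?Q = "Pi\<^sub>E {..<m} (\<lambda>_. {-1..1::real})"
  have Qm: "?Q \<in> sets ?L" by (intro box_in_sets) auto
  have ball_fin: "hausdorff_outer m m (Pi\<^sub>E {..<m} (\<lambda>_. {- real j..real j})) < top" for j :: nat
  proof -
    define f where "f x = (\<lambda>i\<in>{..<m}. (2 * real j) * x i - real j)" for x :: "nat \<Rightarrow> real"
    have "Pi\<^sub>E {..<m} (\<lambda>_. {- real j..real j}) \<subseteq> f ` Pi\<^sub>E {..<m} (\<lambda>_. {0..1})"
    proof
      fix y assume y: "y \<in> Pi\<^sub>E {..<m} (\<lambda>_. {- real j..real j})"
      define x where "x = (\<lambda>i\<in>{..<m}. (y i + real j) / (2 * real j))"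
      have "x \<in> Pi\<^sub>E {..<m} (\<lambda>_. {0..1})"
      proof -
        have "0 \<le> (y i + real j) / (2 * real j) \<and> (y i + real j) / (2 * real j) \<le> 1" if "i < m" for i
        proof -
          have yi: "- real j \<le> y i" "y i \<le> real j" using y that by (auto simp: PiE_iff)
          then show ?thesis by (cases "j = 0") (auto intro!: divide_nonneg_nonneg simp: divide_le_eq_1)
        qed
        then show ?thesis by (auto simp: x_def PiE_iff)
      qed
      moreover have "y = f x"
      proof
        fix i
        show "y i = f x i"
          using y by (cases "i < m"; cases "j = 0") (auto simp: f_def x_def PiE_iff extensional_def)
      qed
      ultimately show "y \<in> f ` Pi\<^sub>E {..<m} (\<lambda>_. {0..1})" by blast
    qed
    then have "hausdorff_outer m m (Pi\<^sub>E {..<m} (\<lambda>_. {- real j..real j})) \<le> hausdorff_outer m m (f ` Pi\<^sub>E {..<m} (\<lambda>_. {0..1}))"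
      by (rule hausdorff_outer_mono)
    also have "\<dots> \<le> ennreal ((2 * real j + 1) ^ m) * hausdorff_outer m m (Pi\<^sub>E {..<m} (\<lambda>_. {0..1}))"
    proof (rule hausdorff_outer_lipschitz)
      fix x y :: "nat \<Rightarrow> real"
      have "L2_set (\<lambda>i. f x i - f y i) {..<m} = L2_set (\<lambda>i. (2 * real j) * (x i - y i)) {..<m}"
        by (intro L2_set_cong) (auto simp: f_def algebra_simps)
      also have "\<dots> = (2 * real j) * L2_set (\<lambda>i. x i - y i) {..<m}" by (rule L2_set_right_distrib[symmetric]) simp
      also have "\<dots> \<le> (2 * real j + 1) * L2_set (\<lambda>i. x i - y i) {..<m}" by (intro mult_right_mono) (auto simp: L2_set_nonneg)
      finally show "L2_set (\<lambda>i. f x i - f y i) {..<m} \<le> (2 * real j + 1) * L2_set (\<lambda>i. x i - y i) {..<m}" .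
    qed (auto simp: f_def space_lebesgue_n)
    also have "\<dots> < top"
      using le_less_trans[OF hausdorff_cube_finite[OF m]] by (auto simp: ennreal_mult_less_top)
    finally show ?thesis .
  qed
  have sf: "sigma_finite_measure ?H"
  proof (rule sigma_finite_of_finite_on_balls)
    fix j :: nat
    have bm: "{x \<in> space ?L. L2_set x {..<m} \<le> real j} \<in> sets ?L"
    proof -
      have "{x \<in> space ?L. lp_norm m 2 x \<le> real j} \<in> sets ?L" by measurable
      then show ?thesis by (simp add: lp_norm_2)
    qed
    have "{x \<in> space ?L. L2_set x {..<m} \<le> real j} \<subseteq> Pi\<^sub>E {..<m} (\<lambda>_. {- real j..real j})"
    proof
      fix x assume x: "x \<in> {x \<in> space ?L. L2_set x {..<m} \<le> real j}"
      have "\<bar>x i\<bar> \<le> real j" if "i < m" for i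
        using abs_diff_le_L2[OF that, of x "\<lambda>_. 0"] x by simp
      then show "x \<in> Pi\<^sub>E {..<m} (\<lambda>_. {- real j..real j})"
        using x by (force simp: space_lebesgue_n PiE_iff abs_le_iff)
    qed
    from hausdorff_outer_mono[OF this, of m m] ball_fin[of j]
    show "emeasure ?H {x \<in> space ?L. L2_set x {..<m} \<le> real j} \<noteq> \<infinity>"
      by (auto simp: emeasure_hausdorff_measure[OF bm])
  qed simp
  have inv: "distr ?H ?L (shift_n m v) = ?H" for v
  proof (rule measure_eqI)
    fix A assume "A \<in> sets (distr ?H ?L (shift_n m v))"
    then have A: "A \<in> sets ?L" by simp
    let ?A' = "shift_n m v -` A \<inter> space ?L"
    have A'm: "?A' \<in> sets ?L" using A by (rule measurable_sets[OF measurable_shift_n])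
    have img: "shift_n m v ` ?A' = A"
    proof (intro set_eqI iffI)
      fix y assume y: "y \<in> A"
      then have ys: "y \<in> space ?L" using A sets.sets_into_space by auto
      define x where "x = (\<lambda>i\<in>{..<m}. y i - v i)"
      have "shift_n m v x = y" using ys by (auto simp: shift_n_def x_def space_lebesgue_n extensional_def)
      moreover have "x \<in> space ?L" by (simp add: x_def space_lebesgue_n)
      ultimately show "y \<in> shift_n m v ` ?A'" using y by (intro image_eqI[of _ _ x]) auto
    qed auto
    have "hausdorff_outer m m (shift_n m v ` ?A') = ennreal (1 ^ m) * hausdorff_outer m m ?A'"
    proof (rule hausdorff_outer_isometry)
      show "inj_on (shift_n m v) ?A'"
      proof (rule inj_onI)
        fix x y assume xy: "x \<in> ?A'" "y \<in> ?A'" "shift_n m v x = shift_n m v y"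
        show "x = y"
        proof
          fix i
          have "shift_n m v x i = shift_n m v y i" by (simp only: xy(3))
          then show "x i = y i"
            using xy(1,2) by (cases "i < m") (simp_all add: shift_n_def space_lebesgue_n extensional_def)
        qed
      qed
      fix x y :: "nat \<Rightarrow> real"
      show "L2_set (\<lambda>i. shift_n m v x i - shift_n m v y i) {..<m} = 1 * L2_set (\<lambda>i. x i - y i) {..<m}"
        by (simp, intro L2_set_cong) (auto simp: shift_n_def)
    qed (auto simp: shift_n_def space_lebesgue_n)
    then have "hausdorff_outer m m A = hausdorff_outer m m ?A'" unfolding img by simp
    moreover have "emeasure (distr ?H ?L (shift_n m v)) A = emeasure ?H ?A'"
      using A by (subst emeasure_distr) (auto simp: hausdorff_measure_space)
    ultimately show "emeasure (distr ?H ?L (shift_n m v)) A = emeasure ?H A"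
      by (simp add: emeasure_hausdorff_measure[OF A] emeasure_hausdorff_measure[OF A'm])
  qed simp
  have LQ: "emeasure ?L ?Q = ennreal (2 ^ m)"
  proof -
    have "emeasure ?L ?Q = (\<Prod>i<m. emeasure lborel {-1..1::real})" by (rule emeasure_lebesgue_n_box) simp
    also have "emeasure lborel {-1..1::real} = ennreal 2" by (subst emeasure_lborel_Icc) simp_all
    also have "(\<Prod>i<m. ennreal 2) = ennreal (2 ^ m)" by (simp only: prod_constant card_lessThan ennreal_power zero_le_numeral)
    finally show ?thesis .
  qed
  have "hausdorff_outer m m ?Q < top" using ball_fin[of 1] by simp
  then obtain h where h: "hausdorff_outer m m ?Q = ennreal h" "h \<ge> 0" by (cases "hausdorff_outer m m ?Q") auto
  have "ennreal (2 ^ m) \<le> ennreal (2 ^ m) * ennreal h"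
    using lebesgue_le_hausdorff[OF m Qm] by (simp add: LQ h)
  then have hpos: "h > 0" using h by (cases "h = 0") auto
  show ?thesis
  proof (rule that[of "h / 2 ^ m"])
    show "h / 2 ^ m > 0" using hpos by simp
    fix A assume A: "A \<in> sets ?L"
    have "emeasure ?H A * emeasure ?L ?Q = emeasure ?L A * emeasure ?H ?Q"
      by (rule translation_invariant_unique[OF _ sf inv A Qm]) (auto simp: scale_n_def PiE_iff extensional_def)
    then have "hausdorff_outer m m A * ennreal (2 ^ m) = emeasure ?L A * ennreal h"
      by (simp add: LQ emeasure_hausdorff_measure A Qm h)
    then have "hausdorff_outer m m A * ennreal (2 ^ m) / ennreal (2 ^ m) = emeasure ?L A * ennreal h / ennreal (2 ^ m)" by simp
    then have "hausdorff_outer m m A = emeasure ?L A * (ennreal h / ennreal (2 ^ m))"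
      by (simp add: ennreal_mult_divide_eq ennreal_times_divide)
    also have "ennreal h / ennreal (2 ^ m) = ennreal (h / 2 ^ m)" using h by (intro divide_ennreal) auto
    finally show "hausdorff_outer m m A = ennreal (h / 2 ^ m) * emeasure ?L A" by (simp add: mult.commute)
  qed
qed

section \<open>Hausdorff measure on the p-sphere\<close>

definition ip_n :: "nat \<Rightarrow> (nat \<Rightarrow> real) \<Rightarrow> (nat \<Rightarrow> real) \<Rightarrow> real" where
  "ip_n n x y = (\<Sum>i<n. x i * y i)"

lemma measurable_ip_n [measurable]: "ip_n n g \<in> borel_measurable (lebesgue_n n)"
  unfolding ip_n_def by measurable

lemma ip_n_scale_n: "ip_n n g (scale_n n r x) = r * ip_n n g x"
  unfolding ip_n_def sum_distrib_left by (rule sum.cong) (auto simp: scale_n_def)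

lemma L2_set_ip: "L2_set x {..<n} = sqrt (ip_n n x x)"
  by (simp add: L2_set_def ip_n_def power2_eq_square)

definition pcone :: "nat \<Rightarrow> (nat \<Rightarrow> real) \<Rightarrow> (nat \<Rightarrow> real) set \<Rightarrow> (nat \<Rightarrow> real) set" where
  "pcone n g E = {x \<in> space (lebesgue_n n). 0 < ip_n n g x \<and> ip_n n g x \<le> 1 \<and> scale_n n (1 / ip_n n g x) x \<in> E}"

lemma pcone_measurable:
  assumes [measurable]: "E \<in> sets (lebesgue_n n)"
  shows "pcone n g E \<in> sets (lebesgue_n n)"
proof -
  have [measurable]: "(\<lambda>x. scale_n n (1 / ip_n n g x) x) \<in> measurable (lebesgue_n n) (lebesgue_n n)"
    unfolding scale_n_def by (intro measurable_into_lebesgue_n) measurable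
  show ?thesis unfolding pcone_def by measurable
qed

declare measurable_lebesgue_n_component [measurable del]

definition axis_n :: "nat \<Rightarrow> nat \<Rightarrow> real" where
  "axis_n m i = (if i = m then 1 else 0)"

lemma ip_n_axis: "m < n \<Longrightarrow> ip_n n (axis_n m) x = x m"
  by (simp add: ip_n_def axis_n_def if_distrib[of "\<lambda>c. c * _"] cong: if_cong)

lemma emeasure_pcone_axis:
  assumes B[measurable]: "B \<in> sets (lebesgue_n m)" and E: "E \<in> sets (lebesgue_n (Suc m))"
    and EB: "\<And>x. x \<in> space (lebesgue_n m) \<Longrightarrow> x(m := 1) \<in> E \<longleftrightarrow> x \<in> B"
  shows "emeasure (lebesgue_n (Suc m)) (pcone (Suc m) (axis_n m) E) = emeasure (lebesgue_n m) B * ennreal (1 / (real m + 1))"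
proof -
  let ?C = "pcone (Suc m) (axis_n m) E"
  have C: "?C \<in> sets (lebesgue_n (Suc m))" using E by (rule pcone_measurable)
  have eq: "lebesgue_n (Suc m) = (\<Pi>\<^sub>M i\<in>insert m {..<m}. lborel)" by (simp add: lebesgue_n_def lessThan_Suc)
  have ind: "(\<lambda>x. indicator ?C x :: ennreal) \<in> borel_measurable (\<Pi>\<^sub>M i\<in>insert m {..<m}. lborel)"
    using C unfolding eq by simp
  have inC: "x(m := r) \<in> ?C \<longleftrightarrow> 0 < r \<and> r \<le> 1 \<and> scale_n m (1 / r) x \<in> B" if x: "x \<in> space (lebesgue_n m)" for x r
  proof -
    have "x(m := r) \<in> space (lebesgue_n (Suc m))" using x by (auto simp: space_lebesgue_n extensional_def)
    moreover have "scale_n (Suc m) (1 / r) (x(m := r)) = (scale_n m (1 / r) x)(m := 1)" if "r > 0"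
      using that by (auto simp: scale_n_def fun_eq_iff)
    ultimately show ?thesis using EB[of "scale_n m (1 / r) x"] by (auto simp: pcone_def ip_n_axis)
  qed
  have "emeasure (lebesgue_n (Suc m)) ?C = (\<integral>\<^sup>+x. indicator ?C x \<partial>lebesgue_n (Suc m))" using C by simp
  also have "\<dots> = (\<integral>\<^sup>+r. (\<integral>\<^sup>+x. indicator ?C (x(m := r)) \<partial>lebesgue_n m) \<partial>lborel)"
    unfolding eq by (subst lborel_prod.product_nn_integral_insert_rev[OF _ _ ind]) (auto simp: lebesgue_n_def)
  also have "\<dots> = (\<integral>\<^sup>+r. ennreal (r ^ m) * indicator {0<..1} r * emeasure (lebesgue_n m) B \<partial>lborel)"
  proof (rule nn_integral_cong)
    fix r :: real
    show "(\<integral>\<^sup>+x. indicator ?C (x(m := r)) \<partial>lebesgue_n m) = ennreal (r ^ m) * indicator {0<..1} r * emeasure (lebesgue_n m) B"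
    proof (cases "0 < r \<and> r \<le> 1")
      case True
      then have r: "r > 0" "r \<le> 1" by auto
      have "(\<integral>\<^sup>+x. indicator ?C (x(m := r)) \<partial>lebesgue_n m) = (\<integral>\<^sup>+x. indicator B (scale_n m (1 / r) x) \<partial>lebesgue_n m)"
        using r by (intro nn_integral_cong) (auto simp: inC split: split_indicator)
      also have "\<dots> = ennreal (r ^ m) * (\<integral>\<^sup>+x. indicator B (scale_n m (1 / r) (scale_n m r x)) \<partial>lebesgue_n m)"
        by (rule nn_integral_scale_n[OF r(1)]) measurable
      also have "(\<integral>\<^sup>+x. indicator B (scale_n m (1 / r) (scale_n m r x)) \<partial>lebesgue_n m) = (\<integral>\<^sup>+x. indicator B x \<partial>lebesgue_n m)"
        using r by (intro nn_integral_cong) (simp add: scale_n_scale_n scale_n_one)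
      finally have "(\<integral>\<^sup>+x. indicator ?C (x(m := r)) \<partial>lebesgue_n m) = ennreal (r ^ m) * (\<integral>\<^sup>+x. indicator B x \<partial>lebesgue_n m)" .
      moreover have "ennreal (r ^ m) * indicator {0<..1} r * emeasure (lebesgue_n m) B = ennreal (r ^ m) * (\<integral>\<^sup>+x. indicator B x \<partial>lebesgue_n m)"
        using r by simp
      ultimately show ?thesis by (rule trans[OF _ sym])
    next
      case False
      have "(\<integral>\<^sup>+x. indicator ?C (x(m := r)) \<partial>lebesgue_n m) = (\<integral>\<^sup>+x. 0 \<partial>lebesgue_n m)"
        using False by (intro nn_integral_cong) (auto simp: inC split: split_indicator)
      then show ?thesis using False by (auto split: split_indicator)
    qed
  qed
  also have "\<dots> = (\<integral>\<^sup>+r. ennreal (r ^ m) * indicator {0<..1} r \<partial>lborel) * emeasure (lebesgue_n m) B"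
    by (rule nn_integral_multc) measurable
  also have "(\<integral>\<^sup>+r. ennreal (r ^ m) * indicator {0<..1} r \<partial>lborel) = (\<integral>\<^sup>+r. ennreal (r ^ m) * indicator {0..1} r \<partial>lborel)"
    by (rule nn_integral_cong_AE) (use AE_lborel_singleton[of "0::real"] in \<open>auto elim!: eventually_mono split: split_indicator\<close>)
  also have "\<dots> = ennreal (1 ^ Suc m / (real m + 1) - 0 ^ Suc m / (real m + 1))"
  proof (rule nn_integral_FTC_Icc)
    fix x :: real
    have "((\<lambda>x. x ^ Suc m / (real m + 1)) has_real_derivative x ^ m) (at x)"
      using DERIV_cdivide[OF DERIV_pow[of "Suc m" x UNIV], of "real m + 1"] by (simp add: add.commute)
    then show "((\<lambda>x. x ^ Suc m / (real m + 1)) has_real_derivative x ^ m) (at x)" .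
  qed auto
  finally show ?thesis by (simp add: mult.commute)
qed

definition reflect_n :: "nat \<Rightarrow> (nat \<Rightarrow> real) \<Rightarrow> (nat \<Rightarrow> real) \<Rightarrow> (nat \<Rightarrow> real)" where
  "reflect_n n v x = (\<lambda>i\<in>{..<n}. x i - 2 * (ip_n n v x / ip_n n v v) * v i)"

lemma measurable_reflect_n [measurable]: "reflect_n n v \<in> measurable (lebesgue_n n) (lebesgue_n n)"
  unfolding reflect_n_def
  by (intro measurable_into_lebesgue_n borel_measurable_diff borel_measurable_times borel_measurable_divide
      borel_measurable_const measurable_ip_n measurable_lebesgue_n_component)

lemma reflect_n_in_space [simp]: "reflect_n n v x \<in> space (lebesgue_n n)"
  by (auto simp: reflect_n_def space_lebesgue_n)

lemma reflection_sum_squares: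
  "(\<Sum>i<n. (d i - 2 * (ip_n n v d / ip_n n v v) * v i)\<^sup>2) = (\<Sum>i<n. (d i)\<^sup>2)"
proof -
  define c where "c = ip_n n v v"
  define a where "a = 2 * (ip_n n v d / c)"
  have "(\<Sum>i<n. (d i - a * v i)\<^sup>2) = (\<Sum>i<n. (d i)\<^sup>2 + (a\<^sup>2 * (v i * v i) - 2 * a * (v i * d i)))"
    by (rule sum.cong) (auto simp: power2_eq_square algebra_simps)
  also have "\<dots> = (\<Sum>i<n. (d i)\<^sup>2) + (a\<^sup>2 * c - 2 * a * ip_n n v d)"
    by (simp add: sum.distrib sum_subtractf sum_distrib_left[symmetric] c_def ip_n_def)
  also have "a\<^sup>2 * c - 2 * a * ip_n n v d = 0"
    by (cases "c = 0") (auto simp: a_def power2_eq_square)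
  finally show ?thesis by (simp add: a_def c_def)
qed

lemma reflect_n_isometry: "L2_set (\<lambda>i. reflect_n n v x i - reflect_n n v y i) {..<n} = L2_set (\<lambda>i. x i - y i) {..<n}"
proof -
  have ip: "ip_n n v (\<lambda>i. x i - y i) = ip_n n v x - ip_n n v y" by (simp add: ip_n_def algebra_simps sum_subtractf)
  have "(\<Sum>i<n. (reflect_n n v x i - reflect_n n v y i)\<^sup>2) = (\<Sum>i<n. ((x i - y i) - 2 * (ip_n n v (\<lambda>i. x i - y i) / ip_n n v v) * v i)\<^sup>2)"
    by (rule sum.cong) (auto simp: reflect_n_def ip diff_divide_distrib algebra_simps)
  then show ?thesis unfolding reflection_sum_squares by (simp add: L2_set_def)
qed

lemma L2_set_reflect_n: "L2_set (reflect_n n v x) {..<n} = L2_set x {..<n}"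
proof -
  have "(\<Sum>i<n. (reflect_n n v x i)\<^sup>2) = (\<Sum>i<n. (x i)\<^sup>2)"
    unfolding reflection_sum_squares[of x n v, symmetric] by (rule sum.cong) (auto simp: reflect_n_def)
  then show ?thesis by (simp add: L2_set_def)
qed

lemma ip_n_reflect_n: "ip_n n v (reflect_n n v x) = ip_n n v x - 2 * (ip_n n v x / ip_n n v v) * ip_n n v v"
proof -
  define k where "k = 2 * (ip_n n v x / ip_n n v v)"
  have "ip_n n v (reflect_n n v x) = (\<Sum>i<n. v i * x i - k * (v i * v i))"
    unfolding ip_n_def[of n v "reflect_n n v x"] by (rule sum.cong) (auto simp: reflect_n_def k_def algebra_simps)
  also have "\<dots> = ip_n n v x - k * ip_n n v v"
    by (simp only: sum_subtractf sum_distrib_left[symmetric] ip_n_def)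
  finally show ?thesis by (simp only: k_def)
qed

lemma reflect_n_involution:
  assumes x: "x \<in> space (lebesgue_n n)"
  shows "reflect_n n v (reflect_n n v x) = x"
proof
  fix i
  show "reflect_n n v (reflect_n n v x) i = x i"
  proof (cases "i < n")
    case True
    have "reflect_n n v (reflect_n n v x) i = x i - 2 * (ip_n n v x / ip_n n v v) * v i
       - 2 * ((ip_n n v x - 2 * (ip_n n v x / ip_n n v v) * ip_n n v v) / ip_n n v v) * v i"
      using True by (simp add: reflect_n_def[of n v "reflect_n n v x"] ip_n_reflect_n) (simp add: reflect_n_def)
    also have "\<dots> = x i" by (cases "ip_n n v v = 0") (auto simp: field_simps)
    finally show ?thesis .
  next
    case False
    then show ?thesis using x by (auto simp: reflect_n_def space_lebesgue_n extensional_def)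
  qed
qed

lemma reflect_n_scale_n: "reflect_n n v (scale_n n r x) = scale_n n r (reflect_n n v x)"
proof
  fix i
  have "scale_n n r y i = (if i < n then r * y i else undefined)" for y by (simp add: scale_n_def)
  then show "reflect_n n v (scale_n n r x) i = scale_n n r (reflect_n n v x) i"
    by (simp add: reflect_n_def ip_n_scale_n) (simp add: algebra_simps)
qed

lemma distr_reflect_n: "distr (lebesgue_n n) (lebesgue_n n) (reflect_n n v) = lebesgue_n n"
proof (rule measure_eqI)
  let ?L = "lebesgue_n n" and ?R = "reflect_n n v"
  define M where "M = distr ?L ?L ?R"
  have sets: "sets M = sets ?L" by (simp add: M_def)
  have emM: "emeasure M A = emeasure ?L (?R -` A \<inter> space ?L)" if "A \<in> sets ?L" for A
    unfolding M_def using that by (subst emeasure_distr) auto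
  have ball: "{x \<in> space ?L. L2_set x {..<n} \<le> r} \<in> sets ?L" for r
  proof -
    have "{x \<in> space ?L. lp_norm n 2 x \<le> r} \<in> sets ?L" by measurable
    then show ?thesis by (simp add: lp_norm_2)
  qed
  have ball_eq: "emeasure M {x \<in> space ?L. L2_set x {..<n} \<le> r} = emeasure ?L {x \<in> space ?L. L2_set x {..<n} \<le> r}" for r
    unfolding emM[OF ball] by (rule arg_cong[where f="emeasure ?L"]) (auto simp: L2_set_reflect_n)
  have ball_fin: "emeasure ?L {x \<in> space ?L. L2_set x {..<n} \<le> r} \<noteq> \<infinity>" for r
  proof -
    have "{x \<in> space ?L. L2_set x {..<n} \<le> r} \<subseteq> Pi\<^sub>E {..<n} (\<lambda>_. {- \<bar>r\<bar>..\<bar>r\<bar>})"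
    proof
      fix x assume x: "x \<in> {x \<in> space ?L. L2_set x {..<n} \<le> r}"
      have "\<bar>x i\<bar> \<le> \<bar>r\<bar>" if "i < n" for i
        using abs_diff_le_L2[OF that, of x "\<lambda>_. 0"] x by (simp, linarith)
      then show "x \<in> Pi\<^sub>E {..<n} (\<lambda>_. {- \<bar>r\<bar>..\<bar>r\<bar>})"
        using x by (force simp: space_lebesgue_n PiE_iff abs_le_iff)
    qed
    then have "emeasure ?L {x \<in> space ?L. L2_set x {..<n} \<le> r} \<le> emeasure ?L (Pi\<^sub>E {..<n} (\<lambda>_. {- \<bar>r\<bar>..\<bar>r\<bar>}))"
      by (intro emeasure_mono box_in_sets) auto
    also have "\<dots> = (\<Prod>i<n. ennreal (\<bar>r\<bar> - - \<bar>r\<bar>))" by (subst emeasure_lebesgue_n_box) auto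
    also have "\<dots> < top" by (simp add: power_less_top_ennreal)
    finally show ?thesis by simp
  qed
  have sf: "sigma_finite_measure M"
    by (rule sigma_finite_of_finite_on_balls[OF sets]) (use ball_eq ball_fin in simp)
  have inv: "distr M ?L (shift_n n w) = M" for w
  proof -
    define w' where "w' = reflect_n n v (\<lambda>i\<in>{..<n}. w i)"
    have comm: "shift_n n w (?R x) = ?R (shift_n n w' x)" for x
    proof
      fix i
      have ip: "ip_n n v (shift_n n w' x) = ip_n n v x + ip_n n v w'"
        unfolding ip_n_def sum.distrib[symmetric] by (rule sum.cong) (auto simp: shift_n_def algebra_simps)
      have "?R w' = (\<lambda>i\<in>{..<n}. w i)" unfolding w'_def by (rule reflect_n_involution) (simp add: space_lebesgue_n)
      then have "i < n \<Longrightarrow> w i = ?R w' i" by simp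
      then show "shift_n n w (?R x) i = ?R (shift_n n w' x) i"
        by (cases "i < n") (auto simp: shift_n_def[of n w] reflect_n_def ip add_divide_distrib algebra_simps, simp add: shift_n_def)
    qed
    have "distr M ?L (shift_n n w) = distr ?L ?L (shift_n n w \<circ> ?R)"
      unfolding M_def by (rule distr_distr) measurable
    also have "shift_n n w \<circ> ?R = ?R \<circ> shift_n n w'" using comm by auto
    also have "distr ?L ?L (?R \<circ> shift_n n w') = distr (distr ?L ?L (shift_n n w')) ?L ?R"
      by (rule distr_distr[symmetric]) measurable
    also have "\<dots> = M" by (simp add: distr_shift_n M_def)
    finally show ?thesis .
  qed
  fix A assume "A \<in> sets (distr ?L ?L ?R)"
  then have A: "A \<in> sets ?L" by simp
  have neg: "lp_norm n 2 (scale_n n (-1) x) = lp_norm n 2 x" for x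
    by (simp add: lp_norm_2 L2_set_def scale_n_def)
  have "emeasure M A * emeasure ?L (lp_ball n 2) = emeasure ?L A * emeasure M (lp_ball n 2)"
    by (rule translation_invariant_unique[OF sets sf inv A]) (auto simp: lp_ball_def neg)
  moreover have "emeasure M (lp_ball n 2) = emeasure ?L (lp_ball n 2)"
    using ball_eq[of 1] by (simp add: lp_ball_def lp_norm_2)
  ultimately have "emeasure ?L (lp_ball n 2) * emeasure M A = emeasure ?L (lp_ball n 2) * emeasure ?L A"
    by (simp add: mult.commute)
  moreover have "emeasure ?L (lp_ball n 2) \<noteq> 0" "emeasure ?L (lp_ball n 2) \<noteq> top"
    using emeasure_lp_ball[of 2 n] by auto
  ultimately have "emeasure M A = emeasure ?L A" by (subst (asm) ennreal_mult_cancel_left) auto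
  then show "emeasure (distr ?L ?L ?R) A = emeasure ?L A" by (simp add: M_def)
qed simp

lemma emeasure_scale_n_vimage:
  assumes r: "r > 0" and A: "A \<in> sets (lebesgue_n n)"
  shows "emeasure (lebesgue_n n) A = ennreal (r ^ n) * emeasure (lebesgue_n n) {x \<in> space (lebesgue_n n). scale_n n r x \<in> A}"
proof -
  have m: "{x \<in> space (lebesgue_n n). scale_n n r x \<in> A} \<in> sets (lebesgue_n n)"
    using measurable_sets[OF measurable_scale_n A, of r] by (simp add: vimage_def Int_def conj_commute)
  have "emeasure (lebesgue_n n) A = (\<integral>\<^sup>+x. indicator A x \<partial>lebesgue_n n)" using A by simp
  also have "\<dots> = ennreal (r ^ n) * (\<integral>\<^sup>+x. indicator A (scale_n n r x) \<partial>lebesgue_n n)"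
    using A by (intro nn_integral_scale_n[OF r]) auto
  also have "(\<integral>\<^sup>+x. indicator A (scale_n n r x) \<partial>lebesgue_n n) = (\<integral>\<^sup>+x. indicator {x \<in> space (lebesgue_n n). scale_n n r x \<in> A} x \<partial>lebesgue_n n)"
    by (intro nn_integral_cong) (auto split: split_indicator)
  also have "\<dots> = emeasure (lebesgue_n n) {x \<in> space (lebesgue_n n). scale_n n r x \<in> A}" using m by simp
  finally show ?thesis .
qed

text \<open>A Householder reflection moves any hyperplane to a coordinate hyperplane.\<close>

lemma reflect_to_axis:
  assumes u: "ip_n n u u = 1" and m: "m < n"
  shows "reflect_n n (\<lambda>i. u i - axis_n m i) x m = ip_n n u x"
proof -
  define v where "v i = u i - axis_n m i" for i
  define c where "c = ip_n n v v"
  have ipv: "ip_n n v y = ip_n n u y - y m" for y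
    using ip_n_axis[OF m, of y] by (simp add: ip_n_def v_def left_diff_distrib sum_subtractf)
  have "ip_n n u v = ip_n n u u - u m"
    using ip_n_axis[OF m, of u] by (simp add: ip_n_def v_def right_diff_distrib sum_subtractf mult.commute)
  then have c: "c = 2 - 2 * u m" unfolding c_def ipv using u by (simp add: v_def axis_n_def)
  have vm: "v m = - c / 2" unfolding c by (simp add: v_def axis_n_def field_simps)
  show ?thesis
  proof (cases "c = 0")
    case True
    then have "(\<Sum>i<n. v i * v i) = 0" by (simp add: c_def ip_n_def)
    then have "\<forall>i<n. v i = 0" by (subst (asm) sum_nonneg_eq_0_iff) auto
    then have "ip_n n v x = 0" by (simp add: ip_n_def)
    then show ?thesis using m ipv[of x] by (simp add: reflect_n_def v_def[symmetric])
  next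
    case False
    have "reflect_n n v x m = x m - 2 * (ip_n n v x / c) * (- c / 2)" using m by (simp add: reflect_n_def vm c_def)
    also have "\<dots> = ip_n n u x" using False ipv[of x] by (simp add: field_simps)
    finally show ?thesis by (simp add: v_def[abs_def])
  qed
qed

theorem hausdorff_hyperplane:
  assumes m: "m \<ge> 1"
  obtains \<kappa> where "\<kappa> > 0" "\<And>g E. ip_n (Suc m) g g > 0 \<Longrightarrow> E \<in> sets (lebesgue_n (Suc m)) \<Longrightarrow> (\<And>y. y \<in> E \<Longrightarrow> ip_n (Suc m) g y = 1) \<Longrightarrow>
    hausdorff_outer (Suc m) m E = ennreal (\<kappa> * L2_set g {..<Suc m}) * emeasure (lebesgue_n (Suc m)) (pcone (Suc m) g E)"
proof -
  let ?n = "Suc m" and ?L = "lebesgue_n (Suc m)"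
  obtain \<kappa> where \<kappa>: "\<kappa> > 0" "\<And>A. A \<in> sets (lebesgue_n m) \<Longrightarrow> hausdorff_outer m m A = ennreal \<kappa> * emeasure (lebesgue_n m) A"
    using hausdorff_measure_eq_lebesgue[OF m] by blast
  show ?thesis
  proof (rule that[of "\<kappa> * (real m + 1)"])
    show "\<kappa> * (real m + 1) > 0" using \<kappa> by simp
    fix g E assume g: "ip_n ?n g g > 0" and E: "E \<in> sets ?L" and Eg: "\<And>y. y \<in> E \<Longrightarrow> ip_n ?n g y = 1"
    define G where "G = L2_set g {..<?n}"
    have G: "G > 0" "G * G = ip_n ?n g g" using g by (auto simp: G_def L2_set_ip)
    define u where "u i = g i / G" for i
    have u: "ip_n ?n u u = 1" 
    proof -
      have "ip_n ?n u u = ip_n ?n g g / (G * G)" unfolding ip_n_def sum_divide_distrib by (rule sum.cong) (auto simp: u_def)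
      also have "\<dots> = 1" unfolding G(2)[symmetric] using G(1) by simp
      finally show ?thesis .
    qed
    have ug: "G * ip_n ?n u x = ip_n ?n g x" for x
      unfolding ip_n_def sum_distrib_left by (rule sum.cong) (use G(1) in \<open>auto simp: u_def\<close>)
    define Q where "Q = reflect_n ?n (\<lambda>i. u i - axis_n m i)"
    have Qm: "Q x m = ip_n ?n u x" for x unfolding Q_def by (rule reflect_to_axis[OF u]) simp
    have QQ: "x \<in> space ?L \<Longrightarrow> Q (Q x) = x" for x unfolding Q_def by (rule reflect_n_involution)
    have Qs: "Q (scale_n ?n r x) = scale_n ?n r (Q x)" for r x unfolding Q_def by (rule reflect_n_scale_n)
    have Qsp: "Q x \<in> space ?L" for x unfolding Q_def by simp
    have [measurable]: "Q \<in> measurable ?L ?L" unfolding Q_def by measurable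
    have Es: "E \<subseteq> space ?L" using E by (rule sets.sets_into_space)
    define T where "T x = scale_n ?n G (Q x)" for x
    define T' where "T' y = Q (scale_n ?n (1 / G) y)" for y
    have [measurable]: "T' \<in> measurable ?L ?L" unfolding T'_def by measurable
    have TT': "T (T' y) = y" "T' (T y) = y" if "y \<in> space ?L" for y
      using that G by (auto simp: T_def T'_def QQ Qs scale_n_scale_n scale_n_one)
    have Tm: "T x m = ip_n ?n g x" for x using Qm[of x] ug[of x] by (simp add: T_def scale_n_def)
    define F where "F = {y \<in> space ?L. T' y \<in> E}"
    have F: "F \<in> sets ?L" unfolding F_def using E by measurable
    have F_img: "F = T ` E"
    proof (intro set_eqI iffI)
      fix y assume "y \<in> F"
      then show "y \<in> T ` E" using TT'(1)[of y] by (auto simp: F_def intro!: image_eqI[of _ _ "T' y"])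
    next
      fix y assume "y \<in> T ` E"
      then obtain x where "x \<in> E" "y = T x" by auto
      then show "y \<in> F" using TT'(2)[of x] Es by (auto simp: F_def T_def)
    qed
    have Fm: "y m = 1" if "y \<in> F" for y using that Eg unfolding F_img by (auto simp: Tm)
    have HF: "hausdorff_outer ?n m F = ennreal (G ^ m) * hausdorff_outer ?n m E"
      unfolding F_img
    proof (rule hausdorff_outer_isometry[OF _ Es G(1)])
      show "inj_on T E" using TT'(2) Es by (intro inj_on_inverseI[of _ T']) auto
      show "T x \<in> space ?L" for x by (simp add: T_def)
      fix x y
      have "L2_set (\<lambda>i. T x i - T y i) {..<?n} = L2_set (\<lambda>i. G * (Q x i - Q y i)) {..<?n}"
        by (rule L2_set_cong) (auto simp: T_def scale_n_def right_diff_distrib)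
      also have "\<dots> = G * L2_set (\<lambda>i. x i - y i) {..<?n}"
        using G reflect_n_isometry[of ?n _ x y] by (simp add: L2_set_right_distrib[symmetric] Q_def)
      finally show "L2_set (\<lambda>i. T x i - T y i) {..<?n} = G * L2_set (\<lambda>i. x i - y i) {..<?n}" .
    qed
    define B where "B = {x \<in> space (lebesgue_n m). x(m := 1) \<in> F}"
    have lm [measurable]: "(\<lambda>x. x(m := 1)) \<in> measurable (lebesgue_n m) ?L"
    proof -
      have "(\<lambda>x. \<lambda>i\<in>{..<?n}. if i = m then 1 else x i) \<in> measurable (lebesgue_n m) ?L"
      proof (rule measurable_into_lebesgue_n)
        fix i assume "i < ?n"
        then show "(\<lambda>x. if i = m then 1 else x i) \<in> borel_measurable (lebesgue_n m)"
          using measurable_lebesgue_n_component[of i m] by (cases "i = m") auto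
      qed
      also have "(\<lambda>x. \<lambda>i\<in>{..<?n}. if i = m then 1 else x i) \<in> measurable (lebesgue_n m) ?L
         \<longleftrightarrow> (\<lambda>x. x(m := 1)) \<in> measurable (lebesgue_n m) ?L"
        by (rule measurable_cong) (auto simp: space_lebesgue_n extensional_def fun_eq_iff)
      finally show ?thesis .
    qed
    have B: "B \<in> sets (lebesgue_n m)" unfolding B_def using F by measurable
    have FB: "F = (\<lambda>x. x(m := 1)) ` B"
    proof (intro set_eqI iffI)
      fix y assume y: "y \<in> F"
      then have ys: "y \<in> space ?L" by (simp add: F_def)
      have "y = (restrict y {..<m})(m := 1)"
        using ys Fm[OF y] by (auto simp: fun_eq_iff space_lebesgue_n extensional_def restrict_def)
      moreover have "restrict y {..<m} \<in> B"
        using y calculation by (auto simp: B_def space_lebesgue_n)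
      ultimately show "y \<in> (\<lambda>x. x(m := 1)) ` B" by blast
    qed (auto simp: B_def)
    have "hausdorff_outer ?n m F = ennreal (1 ^ m) * hausdorff_outer m m B"
      unfolding FB
    proof (rule hausdorff_outer_isometry)
      show "inj_on (\<lambda>x. x(m := 1)) B"
      proof (rule inj_onI)
        fix x y assume xy: "x \<in> B" "y \<in> B" "x(m := 1) = y(m := 1)"
        show "x = y"
        proof
          fix i
          have "(x(m := 1)) i = (y(m := 1)) i" by (simp only: xy(3))
          then show "x i = y i" using xy(1,2) by (cases "i = m") (auto simp: B_def space_lebesgue_n extensional_def)
        qed
      qed
      fix x y :: "nat \<Rightarrow> real"
      show "L2_set (\<lambda>i. (x(m := 1)) i - (y(m := 1)) i) {..<?n} = 1 * L2_set (\<lambda>i. x i - y i) {..<m}"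
        by (simp add: L2_set_def)
    qed (auto simp: B_def space_lebesgue_n extensional_def)
    then have HB: "hausdorff_outer ?n m F = ennreal \<kappa> * emeasure (lebesgue_n m) B" by (simp add: \<kappa>(2)[OF B])
    have cone_F: "emeasure ?L (pcone ?n (axis_n m) F) = emeasure (lebesgue_n m) B * ennreal (1 / (real m + 1))"
      by (rule emeasure_pcone_axis[OF B F]) (auto simp: B_def)
    have C: "pcone ?n (axis_n m) F \<in> sets ?L" using F by (rule pcone_measurable)
    have C': "pcone ?n g E \<in> sets ?L" using E by (rule pcone_measurable)
    have "emeasure ?L (pcone ?n (axis_n m) F) = ennreal (G ^ ?n) * emeasure ?L {x \<in> space ?L. scale_n ?n G x \<in> pcone ?n (axis_n m) F}"
      by (rule emeasure_scale_n_vimage[OF G(1) C])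
    also have "{x \<in> space ?L. scale_n ?n G x \<in> pcone ?n (axis_n m) F} = {x \<in> space ?L. Q x \<in> pcone ?n g E}"
    proof (intro Collect_cong conj_cong refl)
      fix x assume x: "x \<in> space ?L"
      have "ip_n ?n (axis_n m) (scale_n ?n G x) = G * x m" by (simp add: ip_n_axis scale_n_def)
      also have "x m = ip_n ?n u (Q x)" using Qm[of "Q x"] x by (simp add: QQ)
      finally have 1: "ip_n ?n (axis_n m) (scale_n ?n G x) = ip_n ?n g (Q x)" by (simp add: ug)
      have 2: "scale_n ?n r (scale_n ?n G x) \<in> F \<longleftrightarrow> scale_n ?n r (Q x) \<in> E" for r
        using G x by (simp add: F_def T'_def scale_n_scale_n Qs)
      show "scale_n ?n G x \<in> pcone ?n (axis_n m) F \<longleftrightarrow> Q x \<in> pcone ?n g E"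
        by (simp add: pcone_def 1 2 Qsp)
    qed
    also have "emeasure ?L {x \<in> space ?L. Q x \<in> pcone ?n g E} = emeasure (distr ?L ?L Q) (pcone ?n g E)"
      using C' by (subst emeasure_distr) (auto intro!: arg_cong[where f="emeasure ?L"])
    also have "distr ?L ?L Q = ?L" unfolding Q_def by (rule distr_reflect_n)
    finally have cone_eq: "emeasure (lebesgue_n m) B * ennreal (1 / (real m + 1)) = ennreal (G ^ ?n) * emeasure ?L (pcone ?n g E)"
      using cone_F by simp
    have "emeasure (lebesgue_n m) B = emeasure (lebesgue_n m) B * (ennreal (1 / (real m + 1)) * ennreal (real m + 1))"
      by (subst ennreal_mult[symmetric]) auto
    also have "\<dots> = ennreal (G ^ ?n) * emeasure ?L (pcone ?n g E) * ennreal (real m + 1)"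
      using cone_eq by (simp add: mult.assoc[symmetric])
    finally have "ennreal (G ^ m) * hausdorff_outer ?n m E = ennreal \<kappa> * (ennreal (G ^ ?n) * emeasure ?L (pcone ?n g E) * ennreal (real m + 1))"
      using HF HB by simp
    also have "\<dots> = ennreal (G ^ m) * (ennreal (\<kappa> * (real m + 1) * G) * emeasure ?L (pcone ?n g E))"
    proof -
      have "ennreal (G ^ ?n) = ennreal (G ^ m) * ennreal G" "ennreal (\<kappa> * (real m + 1) * G) = ennreal \<kappa> * ennreal (real m + 1) * ennreal G"
        using G \<kappa>(1) by (auto simp: ennreal_mult mult.commute)
      then show ?thesis by (simp add: mult_ac)
    qed
    finally show "hausdorff_outer ?n m E = ennreal (\<kappa> * (real m + 1) * L2_set g {..<?n}) * emeasure ?L (pcone ?n g E)"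
      using G by (subst (asm) ennreal_mult_cancel_left) (auto simp: G_def)
  qed
qed

definition signed_powr :: "real \<Rightarrow> real \<Rightarrow> real" where
  "signed_powr q t = sgn t * \<bar>t\<bar> powr q"

definition lp_gradient :: "real \<Rightarrow> (nat \<Rightarrow> real) \<Rightarrow> (nat \<Rightarrow> real)" where
  "lp_gradient p x i = signed_powr (p - 1) (x i)"

definition gradient_norm :: "nat \<Rightarrow> real \<Rightarrow> (nat \<Rightarrow> real) \<Rightarrow> real" where
  "gradient_norm n p x = L2_set (lp_gradient p x) {..<n}"

lemma DERIV_abs_powr:
  assumes "t \<noteq> 0"
  shows "((\<lambda>t. \<bar>t\<bar> powr p) has_real_derivative p * signed_powr (p - 1) t) (at t)"
proof (cases "t > 0")
  case True
  have "((\<lambda>t. t powr p) has_real_derivative p * signed_powr (p - 1) t) (at t)"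
    using True by (auto intro!: derivative_eq_intros simp: signed_powr_def)
  then show ?thesis
    by (rule has_field_derivative_transform_within_open[where S="{0<..}"]) (use True in auto)
next
  case False
  then have t: "t < 0" using assms by simp
  have "((\<lambda>t. (- t) powr p) has_real_derivative p * signed_powr (p - 1) t) (at t)"
    using t by (auto intro!: derivative_eq_intros simp: signed_powr_def)
  then show ?thesis
    by (rule has_field_derivative_transform_within_open[where S="{..<0}"]) (use t in auto)
qed

lemma isCont_signed_powr:
  assumes "t \<noteq> 0"
  shows "isCont (signed_powr q) t"
  unfolding signed_powr_def[abs_def] using assms by (intro continuous_intros) auto

lemma ip_n_lp_gradient:
  assumes "p \<ge> 1"
  shows "ip_n n (lp_gradient p x) x = (\<Sum>i<n. \<bar>x i\<bar> powr p)"
  unfolding ip_n_def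
proof (rule sum.cong)
  fix i
  have "sgn (x i) * x i = \<bar>x i\<bar>" by (simp add: sgn_mult_self_eq abs_sgn mult.commute)
  then have "lp_gradient p x i * x i = \<bar>x i\<bar> powr (p - 1) * \<bar>x i\<bar>"
    unfolding lp_gradient_def signed_powr_def by (metis mult.assoc mult.commute)
  also have "\<dots> = \<bar>x i\<bar> powr p"
    by (cases "x i = 0") (simp_all add: powr_mult_base' powr_diff)
  finally show "lp_gradient p x i * x i = \<bar>x i\<bar> powr p" .
qed simp

lemma lp_sphere_sum: "p \<ge> 1 \<Longrightarrow> x \<in> lp_sphere n p \<Longrightarrow> (\<Sum>i<n. \<bar>x i\<bar> powr p) = 1"
  using lp_norm_powr[of p n x] by (simp add: lp_sphere_def)

lemma mean_value_abs_powr: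
  assumes p: "p \<ge> 1" and near: "\<And>t. \<bar>t - z\<bar> < d \<Longrightarrow> t \<noteq> 0" "\<And>t. \<bar>t - z\<bar> < d \<Longrightarrow> \<bar>signed_powr (p - 1) t - signed_powr (p - 1) z\<bar> \<le> e"
    and xy: "\<bar>x - z\<bar> < d" "\<bar>y - z\<bar> < d"
  shows "\<bar>(\<bar>x\<bar> powr p - \<bar>y\<bar> powr p) / p - signed_powr (p - 1) z * (x - y)\<bar> \<le> e * \<bar>x - y\<bar>"
proof -
  have main: "\<bar>(\<bar>x\<bar> powr p - \<bar>y\<bar> powr p) / p - signed_powr (p - 1) z * (x - y)\<bar> \<le> e * \<bar>x - y\<bar>"
    if "y < x" "\<bar>x - z\<bar> < d" "\<bar>y - z\<bar> < d" for x y
  proof -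
    have in_d: "\<bar>t - z\<bar> < d" if "y \<le> t" "t \<le> x" for t using that \<open>\<bar>x - z\<bar> < d\<close> \<open>\<bar>y - z\<bar> < d\<close> by linarith
    have "\<exists>w. y < w \<and> w < x \<and> \<bar>x\<bar> powr p - \<bar>y\<bar> powr p = (x - y) * (p * signed_powr (p - 1) w)"
      using that(1) by (rule MVT2) (intro DERIV_abs_powr near(1) in_d)
    then obtain w where w: "y < w" "w < x" "\<bar>x\<bar> powr p - \<bar>y\<bar> powr p = (x - y) * (p * signed_powr (p - 1) w)" by blast
    have "(\<bar>x\<bar> powr p - \<bar>y\<bar> powr p) / p - signed_powr (p - 1) z * (x - y) = (signed_powr (p - 1) w - signed_powr (p - 1) z) * (x - y)"
    proof -
      have "(x - y) * (p * signed_powr (p - 1) w) / p = (x - y) * signed_powr (p - 1) w" using p by simp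
      then show ?thesis unfolding w(3) by (simp add: algebra_simps)
    qed
    then show ?thesis using near(2)[OF in_d, of w] w by (simp add: abs_mult mult_right_mono)
  qed
  consider "y < x" | "x < y" | "x = y" by linarith
  then show ?thesis
  proof cases
    case 1
    then show ?thesis by (rule main) (use xy in auto)
  next
    case 2
    have "(\<bar>x\<bar> powr p - \<bar>y\<bar> powr p) / p - signed_powr (p - 1) z * (x - y) = - ((\<bar>y\<bar> powr p - \<bar>x\<bar> powr p) / p - signed_powr (p - 1) z * (y - x))"
      by (simp add: diff_divide_distrib algebra_simps)
    then show ?thesis using main[OF 2 xy(2,1)] by (simp add: abs_minus_commute)
  qed simp
qed

lemma L2_set_scaled_diff:
  "L2_set (\<lambda>i. c * f i + d * g i) {..<n} \<le> \<bar>c\<bar> * L2_set f {..<n} + \<bar>d\<bar> * L2_set g {..<n}"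
proof -
  have eq: "L2_set (\<lambda>i. a * h i) {..<n} = \<bar>a\<bar> * L2_set h {..<n}" for a h
  proof -
    have "L2_set (\<lambda>i. a * h i) {..<n} = L2_set (\<lambda>i. \<bar>a\<bar> * h i) {..<n}"
      by (simp add: L2_set_def power_mult_distrib)
    then show ?thesis by (simp add: L2_set_right_distrib)
  qed
  show ?thesis unfolding eq[symmetric] by (rule L2_set_triangle_ineq)
qed

lemma ip_n_diff: "ip_n n g (\<lambda>i. x i - y i) = ip_n n g x - ip_n n g y"
  by (simp add: ip_n_def right_diff_distrib sum_subtractf)

text \<open>Near \<open>x0\<close> the sphere is almost tangent to the hyperplane \<open>ip g y = 1\<close>, hence the radial
  projection to that hyperplane is almost an isometry.\<close>

lemma radial_projection_bilipschitz:
  assumes tau: "0 < \<tau>" "\<tau> \<le> 1 / 2"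
    and up: "1 / (1 - \<tau>) + n * \<tau> / (1 - \<tau>)\<^sup>2 \<le> L" and low: "1 / L \<le> 1 / (1 + \<tau>) - n * \<tau> / (1 - \<tau>)\<^sup>2" and L: "L > 0"
    and a: "\<bar>ip_n n g x - 1\<bar> \<le> \<tau>" "\<bar>ip_n n g y - 1\<bar> \<le> \<tau>"
    and t: "\<bar>ip_n n g (\<lambda>i. x i - y i)\<bar> \<le> \<tau> * L2_set (\<lambda>i. x i - y i) {..<n}"
    and y1: "\<And>i. i < n \<Longrightarrow> \<bar>y i\<bar> \<le> 1"
  defines "\<pi> \<equiv> \<lambda>x. scale_n n (1 / ip_n n g x) x"
  shows "L2_set (\<lambda>i. \<pi> x i - \<pi> y i) {..<n} \<le> L * L2_set (\<lambda>i. x i - y i) {..<n}"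
    and "L2_set (\<lambda>i. x i - y i) {..<n} \<le> L * L2_set (\<lambda>i. \<pi> x i - \<pi> y i) {..<n}"
proof -
  define D where "D = L2_set (\<lambda>i. x i - y i) {..<n}"
  define P where "P = L2_set (\<lambda>i. \<pi> x i - \<pi> y i) {..<n}"
  define \<alpha> where "\<alpha> = ip_n n g x"
  define \<beta> where "\<beta> = ip_n n g y"
  define e where "e = (\<alpha> - \<beta>) / (\<alpha> * \<beta>)"
  have D0: "D \<ge> 0" by (simp add: D_def)
  have ab: "1 - \<tau> \<le> \<alpha>" "\<alpha> \<le> 1 + \<tau>" "1 - \<tau> \<le> \<beta>" using a by (auto simp: \<alpha>_def \<beta>_def abs_le_iff)
  have pos: "1 - \<tau> > 0" "\<alpha> > 0" "\<beta> > 0" using tau ab by auto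
  have ab2: "(1 - \<tau>)\<^sup>2 \<le> \<alpha> * \<beta>" unfolding power2_eq_square using ab pos by (intro mult_mono) auto
  have Y: "L2_set y {..<n} \<le> n"
  proof -
    have "L2_set y {..<n} \<le> (\<Sum>i<n. \<bar>y i\<bar>)" by (rule L2_set_le_sum_abs)
    also have "\<dots> \<le> (\<Sum>i<n. 1)" using y1 by (intro sum_mono) auto
    finally show ?thesis by simp
  qed
  have "\<bar>\<alpha> - \<beta>\<bar> \<le> \<tau> * D" using t by (simp add: ip_n_diff \<alpha>_def \<beta>_def D_def)
  then have "\<bar>e\<bar> \<le> \<tau> * D / (1 - \<tau>)\<^sup>2"
    unfolding e_def abs_divide using ab2 pos tau D0 by (intro frac_le) (auto simp: abs_mult)
  then have eY: "\<bar>e\<bar> * L2_set y {..<n} \<le> n * \<tau> / (1 - \<tau>)\<^sup>2 * D"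
  proof -
    assume *: "\<bar>e\<bar> \<le> \<tau> * D / (1 - \<tau>)\<^sup>2"
    have "\<bar>e\<bar> * L2_set y {..<n} \<le> (\<tau> * D / (1 - \<tau>)\<^sup>2) * n"
      using * Y tau D0 by (intro mult_mono) auto
    then show ?thesis by (simp add: mult_ac)
  qed
  have P_eq: "P = L2_set (\<lambda>i. 1 / \<alpha> * (x i - y i) + (- e) * y i) {..<n}"
    unfolding P_def
  proof (rule L2_set_cong)
    fix i assume "i \<in> {..<n}"
    then have "\<pi> x i - \<pi> y i = x i / \<alpha> - y i / \<beta>" by (simp add: \<pi>_def scale_n_def \<alpha>_def \<beta>_def)
    also have "\<dots> = 1 / \<alpha> * (x i - y i) + (- e) * y i" using pos by (simp add: e_def field_simps)
    finally show "\<pi> x i - \<pi> y i = 1 / \<alpha> * (x i - y i) + (- e) * y i" .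
  qed simp
  have "P \<le> \<bar>1 / \<alpha>\<bar> * D + \<bar>- e\<bar> * L2_set y {..<n}"
    unfolding P_eq D_def by (rule L2_set_scaled_diff)
  also have "\<dots> \<le> 1 / (1 - \<tau>) * D + n * \<tau> / (1 - \<tau>)\<^sup>2 * D"
  proof (rule add_mono)
    show "\<bar>1 / \<alpha>\<bar> * D \<le> 1 / (1 - \<tau>) * D" using pos ab D0 by (intro mult_right_mono) (auto intro: divide_left_mono)
  qed (use eY in simp)
  also have "\<dots> = (1 / (1 - \<tau>) + n * \<tau> / (1 - \<tau>)\<^sup>2) * D" by (simp only: distrib_right)
  also have "\<dots> \<le> L * D" using up D0 by (rule mult_right_mono)
  finally show "P \<le> L * D" .
  have "1 / \<alpha> * D = L2_set (\<lambda>i. 1 / \<alpha> * (x i - y i)) {..<n}"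
    unfolding D_def using pos by (intro L2_set_right_distrib) auto
  also have "\<dots> = L2_set (\<lambda>i. 1 * (1 / \<alpha> * (x i - y i) + (- e) * y i) + e * y i) {..<n}"
    by (rule L2_set_cong) auto
  also have "\<dots> \<le> \<bar>1\<bar> * P + \<bar>e\<bar> * L2_set y {..<n}"
    unfolding P_eq by (rule L2_set_scaled_diff)
  also have "\<dots> \<le> P + n * \<tau> / (1 - \<tau>)\<^sup>2 * D" using eY by simp
  finally have "1 / \<alpha> * D - n * \<tau> / (1 - \<tau>)\<^sup>2 * D \<le> P" by simp
  moreover have "1 / (1 + \<tau>) * D \<le> 1 / \<alpha> * D" using pos ab D0 by (intro mult_right_mono divide_left_mono) auto
  ultimately have "(1 / (1 + \<tau>) - n * \<tau> / (1 - \<tau>)\<^sup>2) * D \<le> P" by (simp only: left_diff_distrib)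
  moreover have "1 / L * D \<le> (1 / (1 + \<tau>) - n * \<tau> / (1 - \<tau>)\<^sup>2) * D" using low D0 by (rule mult_right_mono)
  ultimately have "1 / L * D \<le> P" by linarith
  then show "D \<le> L * P" using L by (simp add: field_simps)
qed

lemma small_tau_exists:
  fixes L h :: real and n :: nat
  assumes L: "L > 1" and h: "h > 0"
  obtains \<tau> :: real where "0 < \<tau>" "\<tau> \<le> 1 / 2" "1 / (1 - \<tau>) + n * \<tau> / (1 - \<tau>)\<^sup>2 \<le> L"
    "1 / L \<le> 1 / (1 + \<tau>) - n * \<tau> / (1 - \<tau>)\<^sup>2" "1 / L \<le> 1 - \<tau>" "1 + \<tau> \<le> L" "h + \<tau> \<le> L * h" "h / L \<le> h - \<tau>"
proof -
  have 1: "((\<lambda>\<tau>. 1 / (1 - \<tau>) + n * \<tau> / (1 - \<tau>)\<^sup>2) \<longlongrightarrow> 1 / (1 - 0) + n * 0 / (1 - 0)\<^sup>2) (at_right (0::real))"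
    by (auto intro!: tendsto_eq_intros)
  have 2: "((\<lambda>\<tau>. 1 / (1 + \<tau>) - n * \<tau> / (1 - \<tau>)\<^sup>2) \<longlongrightarrow> 1 / (1 + 0) - n * 0 / (1 - 0)\<^sup>2) (at_right (0::real))"
    by (auto intro!: tendsto_eq_intros)
  have 3: "((\<lambda>\<tau>. 1 - \<tau>) \<longlongrightarrow> 1 - 0) (at_right (0::real))" by (intro tendsto_intros)
  have 4: "((\<lambda>\<tau>. 1 + \<tau>) \<longlongrightarrow> 1 + 0) (at_right (0::real))" by (intro tendsto_intros)
  have 5: "((\<lambda>\<tau>. h + \<tau>) \<longlongrightarrow> h + 0) (at_right (0::real))" by (intro tendsto_intros)
  have 6: "((\<lambda>\<tau>. h - \<tau>) \<longlongrightarrow> h - 0) (at_right (0::real))" by (intro tendsto_intros)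
  have 7: "((\<lambda>\<tau>. \<tau>) \<longlongrightarrow> 0) (at_right (0::real))" by (intro tendsto_intros)
  have iL: "1 / L < 1" using L by simp
  have hL: "h / L < h" "h < L * h" using L h by (auto simp: divide_less_eq)
  have "eventually (\<lambda>\<tau>. 1 / (1 - \<tau>) + n * \<tau> / (1 - \<tau>)\<^sup>2 < L \<and> 1 / L < 1 / (1 + \<tau>) - n * \<tau> / (1 - \<tau>)\<^sup>2 \<and> 1 / L < 1 - \<tau>
      \<and> 1 + \<tau> < L \<and> h + \<tau> < L * h \<and> h / L < h - \<tau> \<and> \<tau> < 1 / 2 \<and> 0 < \<tau>) (at_right (0::real))"
    using order_tendstoD(2)[OF 1, of L] order_tendstoD(1)[OF 2, of "1 / L"] order_tendstoD(1)[OF 3, of "1 / L"]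
      order_tendstoD(2)[OF 4, of L] order_tendstoD(2)[OF 5, of "L * h"] order_tendstoD(1)[OF 6, of "h / L"]
      order_tendstoD(2)[OF 7, of "1 / 2"] L iL hL
    by (auto intro!: eventually_conj simp: eventually_at_right_less)
  from eventually_happens'[OF trivial_limit_at_right_real this]
  obtain \<tau> :: real where "1 / (1 - \<tau>) + n * \<tau> / (1 - \<tau>)\<^sup>2 < L \<and> 1 / L < 1 / (1 + \<tau>) - n * \<tau> / (1 - \<tau>)\<^sup>2 \<and> 1 / L < 1 - \<tau>
      \<and> 1 + \<tau> < L \<and> h + \<tau> < L * h \<and> h / L < h - \<tau> \<and> \<tau> < 1 / 2 \<and> 0 < \<tau>"
    by blast
  then show ?thesis by (intro that[of \<tau>]) auto
qed

lemma sphere_local_geometry: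
  fixes n :: nat
  assumes p: "p \<ge> 1" and x0: "x0 \<in> lp_sphere n p" "\<And>i. i < n \<Longrightarrow> x0 i \<noteq> 0" and L: "L > 1" and n: "n \<ge> 1"
  defines "g \<equiv> lp_gradient p x0"
  defines "\<pi> \<equiv> \<lambda>x. scale_n n (1 / ip_n n g x) x"
  obtains d where "d > 0"
    "\<And>x. x \<in> lp_sphere n p \<Longrightarrow> (\<And>i. i < n \<Longrightarrow> \<bar>x i - x0 i\<bar> < d) \<Longrightarrow> 1 / L \<le> ip_n n g x \<and> ip_n n g x \<le> L \<and>
       gradient_norm n p x \<le> L * gradient_norm n p x0 \<and> gradient_norm n p x0 / L \<le> gradient_norm n p x"
    "\<And>x y. x \<in> lp_sphere n p \<Longrightarrow> (\<And>i. i < n \<Longrightarrow> \<bar>x i - x0 i\<bar> < d) \<Longrightarrow> y \<in> lp_sphere n p \<Longrightarrow> (\<And>i. i < n \<Longrightarrow> \<bar>y i - x0 i\<bar> < d) \<Longrightarrow>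
       L2_set (\<lambda>i. \<pi> x i - \<pi> y i) {..<n} \<le> L * L2_set (\<lambda>i. x i - y i) {..<n} \<and>
       L2_set (\<lambda>i. x i - y i) {..<n} \<le> L * L2_set (\<lambda>i. \<pi> x i - \<pi> y i) {..<n}"
    "gradient_norm n p x0 > 0"
proof -
  define h where "h = gradient_norm n p x0"
  have g0: "g i \<noteq> 0" if "i < n" for i using x0(2)[OF that] by (simp add: g_def lp_gradient_def signed_powr_def sgn_if)
  have h: "h > 0"
  proof -
    have "0 < \<bar>g 0\<bar>" using g0[of 0] n by auto
    also have "\<bar>g 0\<bar> \<le> h" using abs_diff_le_L2[of 0 n g "\<lambda>_. 0"] n by (simp add: h_def gradient_norm_def g_def)
    finally show ?thesis .
  qed
  obtain \<tau> :: real where tau: "0 < \<tau>" "\<tau> \<le> 1 / 2" "1 / (1 - \<tau>) + n * \<tau> / (1 - \<tau>)\<^sup>2 \<le> L"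
    "1 / L \<le> 1 / (1 + \<tau>) - n * \<tau> / (1 - \<tau>)\<^sup>2" "1 / L \<le> 1 - \<tau>" "1 + \<tau> \<le> L" "h + \<tau> \<le> L * h" "h / L \<le> h - \<tau>"
    using small_tau_exists[OF L h] by blast
  define e where "e = \<tau> / n"
  have e: "e > 0" "n * e = \<tau>" using tau n by (auto simp: e_def)
  have "\<exists>d>0. \<forall>t. \<bar>t - x0 i\<bar> < d \<longrightarrow> t \<noteq> 0 \<and> \<bar>signed_powr (p - 1) t - g i\<bar> \<le> e" if "i < n" for i
  proof -
    have "isCont (signed_powr (p - 1)) (x0 i)" by (rule isCont_signed_powr[OF x0(2)[OF that]])
    then obtain d where d: "d > 0" "\<And>t. \<bar>t - x0 i\<bar> < d \<Longrightarrow> \<bar>signed_powr (p - 1) t - signed_powr (p - 1) (x0 i)\<bar> < e"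
      using e unfolding continuous_at_eps_delta dist_real_def by metis
    show ?thesis
    proof (intro exI[of _ "min d \<bar>x0 i\<bar>"] conjI allI impI)
      show "0 < min d \<bar>x0 i\<bar>" using d x0(2)[OF that] by simp
      fix t assume t: "\<bar>t - x0 i\<bar> < min d \<bar>x0 i\<bar>"
      then show "t \<noteq> 0" by auto
      show "\<bar>signed_powr (p - 1) t - g i\<bar> \<le> e" using d(2)[of t] t by (simp add: g_def lp_gradient_def)
    qed
  qed
  then obtain D where D: "\<And>i. i < n \<Longrightarrow> D i > 0"
    "\<And>i t. i < n \<Longrightarrow> \<bar>t - x0 i\<bar> < D i \<Longrightarrow> t \<noteq> 0 \<and> \<bar>signed_powr (p - 1) t - g i\<bar> \<le> e" by metis
  define G1 where "G1 = (\<Sum>i<n. \<bar>g i\<bar>) + 1"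
  have G1: "G1 > 0" by (simp add: G1_def add_nonneg_pos sum_nonneg)
  define d where "d = Min (insert (\<tau> / G1) (D ` {..<n}))"
  have d: "d > 0" "d \<le> \<tau> / G1" "\<And>i. i < n \<Longrightarrow> d \<le> D i"
    using D(1) tau G1 by (auto simp: d_def)
  have ip0: "ip_n n g x0 = 1" using ip_n_lp_gradient[OF p, of n x0] lp_sphere_sum[OF p x0(1)] by (simp add: g_def)
  have ipx: "\<bar>ip_n n g x - 1\<bar> \<le> \<tau>" if "\<And>i. i < n \<Longrightarrow> \<bar>x i - x0 i\<bar> < d" for x
  proof -
    have "\<bar>ip_n n g x - 1\<bar> = \<bar>ip_n n g (\<lambda>i. x i - x0 i)\<bar>" by (simp add: ip_n_diff ip0)
    also have "\<dots> \<le> (\<Sum>i<n. \<bar>g i * (x i - x0 i)\<bar>)" unfolding ip_n_def by (rule sum_abs)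
    also have "\<dots> \<le> (\<Sum>i<n. \<bar>g i\<bar> * d)" 
    proof (rule sum_mono)
      fix i assume "i \<in> {..<n}"
      then have "\<bar>x i - x0 i\<bar> \<le> d" using that by (simp add: less_imp_le)
      then show "\<bar>g i * (x i - x0 i)\<bar> \<le> \<bar>g i\<bar> * d" by (simp add: abs_mult mult_left_mono)
    qed
    also have "\<dots> = (\<Sum>i<n. \<bar>g i\<bar>) * d" by (simp add: sum_distrib_right)
    also have "\<dots> \<le> G1 * (\<tau> / G1)" using d G1 by (intro mult_mono) (auto simp: G1_def sum_nonneg)
    finally show ?thesis using G1 by simp
  qed
  have hx: "\<bar>gradient_norm n p x - h\<bar> \<le> \<tau>" if "\<And>i. i < n \<Longrightarrow> \<bar>x i - x0 i\<bar> < d" for x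
  proof -
    define f where "f = lp_gradient p x"
    have fg: "L2_set (\<lambda>i. f i - g i) {..<n} \<le> \<tau>"
    proof -
      have "L2_set (\<lambda>i. f i - g i) {..<n} \<le> (\<Sum>i<n. \<bar>f i - g i\<bar>)" by (rule L2_set_le_sum_abs)
      also have "\<dots> \<le> (\<Sum>i<n. e)"
        using D(2) that d(3) by (intro sum_mono) (force simp: f_def lp_gradient_def)
      finally show ?thesis using e by simp
    qed
    have "L2_set f {..<n} \<le> L2_set (\<lambda>i. f i - g i) {..<n} + L2_set g {..<n}"
      using L2_set_triangle_ineq[of "\<lambda>i. f i - g i" g "{..<n}"] by simp
    moreover have "L2_set g {..<n} \<le> L2_set (\<lambda>i. f i - g i) {..<n} + L2_set f {..<n}"
    proof -
      have "L2_set (\<lambda>i. g i - f i) {..<n} = L2_set (\<lambda>i. f i - g i) {..<n}"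
        by (simp add: L2_set_def power2_commute)
      then show ?thesis using L2_set_triangle_ineq[of "\<lambda>i. g i - f i" f "{..<n}"] by simp
    qed
    ultimately show ?thesis using fg by (simp add: gradient_norm_def h_def f_def[symmetric] g_def[symmetric] abs_le_iff)
  qed
  show ?thesis
  proof (rule that[OF d(1)])
    show "gradient_norm n p x0 > 0" using h by (simp add: h_def)
    fix x assume x: "x \<in> lp_sphere n p" "\<And>i. i < n \<Longrightarrow> \<bar>x i - x0 i\<bar> < d"
    show "1 / L \<le> ip_n n g x \<and> ip_n n g x \<le> L \<and>
       gradient_norm n p x \<le> L * gradient_norm n p x0 \<and> gradient_norm n p x0 / L \<le> gradient_norm n p x"
      using ipx[OF x(2)] hx[OF x(2)] tau unfolding h_def[symmetric] by linarith
  next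
    fix x y assume x: "x \<in> lp_sphere n p" "\<And>i. i < n \<Longrightarrow> \<bar>x i - x0 i\<bar> < d"
      and y: "y \<in> lp_sphere n p" "\<And>i. i < n \<Longrightarrow> \<bar>y i - x0 i\<bar> < d"
    have y1: "\<bar>y i\<bar> \<le> 1" if "i < n" for i
      using abs_le_lp_norm[OF that, of p y] y(1) p by (simp add: lp_sphere_def)
    have t: "\<bar>ip_n n g (\<lambda>i. x i - y i)\<bar> \<le> \<tau> * L2_set (\<lambda>i. x i - y i) {..<n}"
    proof -
      have "(\<Sum>i<n. (\<bar>x i\<bar> powr p - \<bar>y i\<bar> powr p) / p) = 0"
        using lp_sphere_sum[OF p x(1)] lp_sphere_sum[OF p y(1)] by (simp add: sum_divide_distrib[symmetric] sum_subtractf)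
      then have "ip_n n g (\<lambda>i. x i - y i) = - (\<Sum>i<n. (\<bar>x i\<bar> powr p - \<bar>y i\<bar> powr p) / p - g i * (x i - y i))"
        by (simp add: sum_subtractf ip_n_def)
      then have "\<bar>ip_n n g (\<lambda>i. x i - y i)\<bar> = \<bar>\<Sum>i<n. (\<bar>x i\<bar> powr p - \<bar>y i\<bar> powr p) / p - g i * (x i - y i)\<bar>"
        by (simp only: abs_minus_cancel)
      also have "\<dots> \<le> (\<Sum>i<n. \<bar>(\<bar>x i\<bar> powr p - \<bar>y i\<bar> powr p) / p - g i * (x i - y i)\<bar>)" by (rule sum_abs)
      also have "\<dots> \<le> (\<Sum>i<n. e * L2_set (\<lambda>i. x i - y i) {..<n})"
      proof (rule sum_mono)
        fix i assume "i \<in> {..<n}"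
        then have i: "i < n" by simp
        have "\<bar>(\<bar>x i\<bar> powr p - \<bar>y i\<bar> powr p) / p - g i * (x i - y i)\<bar> \<le> e * \<bar>x i - y i\<bar>"
          unfolding g_def lp_gradient_def
        proof (rule mean_value_abs_powr[OF p, where d="D i"])
          show "\<bar>x i - x0 i\<bar> < D i" "\<bar>y i - x0 i\<bar> < D i" using x(2)[OF i] y(2)[OF i] d(3)[OF i] by auto
        qed (use D(2)[OF i] in \<open>auto simp: g_def lp_gradient_def\<close>)
        also have "\<dots> \<le> e * L2_set (\<lambda>i. x i - y i) {..<n}"
          using abs_diff_le_L2[OF i, of x y] e by (intro mult_left_mono) auto
        finally show "\<bar>(\<bar>x i\<bar> powr p - \<bar>y i\<bar> powr p) / p - g i * (x i - y i)\<bar> \<le> e * L2_set (\<lambda>i. x i - y i) {..<n}" .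
      qed
      also have "\<dots> = n * e * L2_set (\<lambda>i. x i - y i) {..<n}" by simp
      finally show ?thesis by (simp only: e(2))
    qed
    show "L2_set (\<lambda>i. \<pi> x i - \<pi> y i) {..<n} \<le> L * L2_set (\<lambda>i. x i - y i) {..<n} \<and>
       L2_set (\<lambda>i. x i - y i) {..<n} \<le> L * L2_set (\<lambda>i. \<pi> x i - \<pi> y i) {..<n}"
      unfolding \<pi>_def using radial_projection_bilipschitz[OF tau(1-4) _ ipx[OF x(2)] ipx[OF y(2)] t y1] L by simp
  qed
qed

definition surface_density_measure :: "nat \<Rightarrow> real \<Rightarrow> (nat \<Rightarrow> real) measure" where
  "surface_density_measure n p = distr
     (density (lebesgue_n n) (\<lambda>x. ennreal (gradient_norm n p (sphere_proj n p x)) * indicator (lp_ball n p) x))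
     (lebesgue_n n) (sphere_proj n p)"

lemma measurable_signed_powr [measurable]: "signed_powr q \<in> borel_measurable borel"
  unfolding signed_powr_def[abs_def] by measurable

lemma measurable_gradient_norm [measurable]: "gradient_norm n p \<in> borel_measurable (lebesgue_n n)"
proof -
  have "(\<lambda>x. lp_gradient p x i) \<in> borel_measurable (lebesgue_n n)" if "i < n" for i
    unfolding lp_gradient_def
    using measurable_compose[OF measurable_lebesgue_n_component[OF that] measurable_signed_powr] .
  then show ?thesis unfolding gradient_norm_def[abs_def] L2_set_def by measurable
qed

lemma sets_surface_density_measure [measurable_cong, simp]: "sets (surface_density_measure n p) = sets (lebesgue_n n)"
  by (simp add: surface_density_measure_def)

lemma emeasure_surface_density_measure:
  assumes [measurable]: "A \<in> sets (lebesgue_n n)"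
  shows "emeasure (surface_density_measure n p) A =
    (\<integral>\<^sup>+x. ennreal (gradient_norm n p (sphere_proj n p x)) * indicator {x \<in> lp_ball n p. sphere_proj n p x \<in> A} x \<partial>lebesgue_n n)"
proof -
  let ?f = "\<lambda>x. ennreal (gradient_norm n p (sphere_proj n p x)) * indicator (lp_ball n p) x"
  have "emeasure (surface_density_measure n p) A = emeasure (density (lebesgue_n n) ?f) (sphere_proj n p -` A \<inter> space (lebesgue_n n))"
    unfolding surface_density_measure_def by (subst emeasure_distr) auto
  also have "\<dots> = (\<integral>\<^sup>+x. ?f x * indicator (sphere_proj n p -` A \<inter> space (lebesgue_n n)) x \<partial>lebesgue_n n)"
    by (subst emeasure_density) auto
  also have "\<dots> = (\<integral>\<^sup>+x. ennreal (gradient_norm n p (sphere_proj n p x)) * indicator {x \<in> lp_ball n p. sphere_proj n p x \<in> A} x \<partial>lebesgue_n n)"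
    by (rule nn_integral_cong) (simp add: indicator_def)
  finally show ?thesis .
qed

lemma cone_section_measurable:
  assumes [measurable]: "A \<in> sets (lebesgue_n n)"
  shows "{x \<in> space (lebesgue_n n). lp_norm n p x \<le> r \<and> sphere_proj n p x \<in> A} \<in> sets (lebesgue_n n)"
  by measurable

lemma cone_section_scale:
  assumes p: "p \<ge> 1" and r: "r > 0" and A: "A \<in> sets (lebesgue_n n)"
  shows "emeasure (lebesgue_n n) {x \<in> space (lebesgue_n n). lp_norm n p x \<le> r \<and> sphere_proj n p x \<in> A}
    = ennreal (r ^ n) * cone_volume n p A"
proof -
  let ?C = "{x \<in> space (lebesgue_n n). lp_norm n p x \<le> r \<and> sphere_proj n p x \<in> A}"
  have "emeasure (lebesgue_n n) ?C = ennreal (r ^ n) * emeasure (lebesgue_n n) {x \<in> space (lebesgue_n n). scale_n n r x \<in> ?C}"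
    by (rule emeasure_scale_n_vimage[OF r cone_section_measurable[OF A]])
  also have "{x \<in> space (lebesgue_n n). scale_n n r x \<in> ?C} = {x \<in> lp_ball n p. sphere_proj n p x \<in> A}"
    using p r by (auto simp: lp_norm_scale_n sphere_proj_scale_n lp_ball_def mult_le_cancel_left1)
  finally show ?thesis by (simp add: cone_volume_def)
qed

lemma surface_density_bounds:
  assumes A: "A \<in> sets (lebesgue_n n)" and lo: "\<And>x. x \<in> A \<Longrightarrow> l \<le> gradient_norm n p x" and hi: "\<And>x. x \<in> A \<Longrightarrow> gradient_norm n p x \<le> u"
  shows "ennreal l * cone_volume n p A \<le> emeasure (surface_density_measure n p) A"
    and "emeasure (surface_density_measure n p) A \<le> ennreal u * cone_volume n p A"
proof -
  let ?C = "{x \<in> lp_ball n p. sphere_proj n p x \<in> A}"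
  have C: "?C \<in> sets (lebesgue_n n)"
    using cone_section_measurable[OF A, of p 1] by (simp add: lp_ball_def conj_assoc)
  have cv: "ennreal c * cone_volume n p A = (\<integral>\<^sup>+x. ennreal c * indicator ?C x \<partial>lebesgue_n n)" for c
    unfolding cone_volume_def using C by (simp add: nn_integral_cmult_indicator)
  show "ennreal l * cone_volume n p A \<le> emeasure (surface_density_measure n p) A"
    unfolding cv emeasure_surface_density_measure[OF A]
    by (intro nn_integral_mono) (auto split: split_indicator intro: ennreal_leI lo)
  show "emeasure (surface_density_measure n p) A \<le> ennreal u * cone_volume n p A"
    unfolding cv emeasure_surface_density_measure[OF A]
    by (intro nn_integral_mono) (auto split: split_indicator intro: ennreal_leI hi)
qed

lemma hausdorff_surface_local:
  assumes m: "m \<ge> 1" and p: "p \<ge> 1" and \<kappa>: "\<kappa> > 0"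
    and plane: "\<And>g E. ip_n (Suc m) g g > 0 \<Longrightarrow> E \<in> sets (lebesgue_n (Suc m)) \<Longrightarrow> (\<And>y. y \<in> E \<Longrightarrow> ip_n (Suc m) g y = 1) \<Longrightarrow>
      hausdorff_outer (Suc m) m E = ennreal (\<kappa> * L2_set g {..<Suc m}) * emeasure (lebesgue_n (Suc m)) (pcone (Suc m) g E)"
    and x0: "x0 \<in> lp_sphere (Suc m) p" "\<And>i. i < Suc m \<Longrightarrow> x0 i \<noteq> 0" and L: "L > 1"
  obtains d where "d > 0" "\<And>A. A \<in> sets (lebesgue_n (Suc m)) \<Longrightarrow> A \<subseteq> lp_sphere (Suc m) p \<Longrightarrow> (\<And>x i. x \<in> A \<Longrightarrow> i < Suc m \<Longrightarrow> \<bar>x i - x0 i\<bar> < d) \<Longrightarrow>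
     hausdorff_outer (Suc m) m A \<le> ennreal (L ^ (2 * m + 2)) * (ennreal \<kappa> * emeasure (surface_density_measure (Suc m) p) A) \<and>
     ennreal \<kappa> * emeasure (surface_density_measure (Suc m) p) A \<le> ennreal (L ^ (2 * m + 2)) * hausdorff_outer (Suc m) m A"
proof -
  let ?n = "Suc m" and ?S = "lp_sphere (Suc m) p" and ?La = "lebesgue_n (Suc m)"
  define g where "g = lp_gradient p x0"
  define \<pi> where "\<pi> x = scale_n ?n (1 / ip_n ?n g x) x" for x
  define h where "h = gradient_norm ?n p x0"
  obtain d where d: "d > 0" and
    b1: "\<And>x. x \<in> ?S \<Longrightarrow> (\<And>i. i < ?n \<Longrightarrow> \<bar>x i - x0 i\<bar> < d) \<Longrightarrow> 1 / L \<le> ip_n ?n g x \<and> ip_n ?n g x \<le> L \<and>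
       gradient_norm ?n p x \<le> L * h \<and> h / L \<le> gradient_norm ?n p x"
    and b2: "\<And>x y. x \<in> ?S \<Longrightarrow> (\<And>i. i < ?n \<Longrightarrow> \<bar>x i - x0 i\<bar> < d) \<Longrightarrow> y \<in> ?S \<Longrightarrow> (\<And>i. i < ?n \<Longrightarrow> \<bar>y i - x0 i\<bar> < d) \<Longrightarrow>
       L2_set (\<lambda>i. \<pi> x i - \<pi> y i) {..<?n} \<le> L * L2_set (\<lambda>i. x i - y i) {..<?n} \<and>
       L2_set (\<lambda>i. x i - y i) {..<?n} \<le> L * L2_set (\<lambda>i. \<pi> x i - \<pi> y i) {..<?n}"
    and h: "h > 0"
    using sphere_local_geometry[OF p x0 L] unfolding g_def[symmetric] \<pi>_def[symmetric] h_def[symmetric] by auto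
  have hg: "L2_set g {..<?n} = h" by (simp add: h_def gradient_norm_def g_def)
  have gg: "ip_n ?n g g > 0" using h L2_set_ip[of g ?n] by (simp add: hg)
  show ?thesis
  proof (rule that[OF d])
    fix A assume A: "A \<in> sets ?La" and AS: "A \<subseteq> ?S" and near: "\<And>x i. x \<in> A \<Longrightarrow> i < ?n \<Longrightarrow> \<bar>x i - x0 i\<bar> < d"
    note A[measurable]
    have c1: "1 / L \<le> ip_n ?n g x" "ip_n ?n g x \<le> L" "gradient_norm ?n p x \<le> L * h" "h / L \<le> gradient_norm ?n p x" "ip_n ?n g x > 0" if "x \<in> A" for x
    proof -
      have *: "1 / L \<le> ip_n ?n g x \<and> ip_n ?n g x \<le> L \<and> gradient_norm ?n p x \<le> L * h \<and> h / L \<le> gradient_norm ?n p x"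
        using b1[of x] near that AS by blast
      then show "1 / L \<le> ip_n ?n g x" "ip_n ?n g x \<le> L" "gradient_norm ?n p x \<le> L * h" "h / L \<le> gradient_norm ?n p x" by auto
      have "0 < 1 / L" using L by simp
      with * show "ip_n ?n g x > 0" by linarith
    qed
    have c2: "L2_set (\<lambda>i. \<pi> x i - \<pi> y i) {..<?n} \<le> L * L2_set (\<lambda>i. x i - y i) {..<?n}"
       "L2_set (\<lambda>i. x i - y i) {..<?n} \<le> L * L2_set (\<lambda>i. \<pi> x i - \<pi> y i) {..<?n}" if "x \<in> A" "y \<in> A" for x y
      using b2[of x y] near that AS by blast+
    have As: "x \<in> space ?La" "lp_norm ?n p x = 1" if "x \<in> A" for x using that AS by (auto simp: lp_sphere_def)
    have p0: "p > 0" using p by simp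
    define E where "E = {z \<in> space ?La. ip_n ?n g z = 1 \<and> sphere_proj ?n p z \<in> A}"
    have E: "E \<in> sets ?La" unfolding E_def by measurable
    have proj_\<pi>: "sphere_proj ?n p (\<pi> x) = x" if "x \<in> A" for x
      unfolding \<pi>_def using c1(5)[OF that] As[OF that] p0 by (simp add: sphere_proj_scale_n sphere_proj_on_sphere)
    have ip_\<pi>: "ip_n ?n g (\<pi> x) = 1" if "x \<in> A" for x
      unfolding \<pi>_def ip_n_scale_n using c1(5)[OF that] by simp
    have E_img: "E = \<pi> ` A"
    proof (intro set_eqI iffI)
      fix z assume z: "z \<in> E"
      define y where "y = sphere_proj ?n p z"
      have y: "y \<in> A" "z \<in> space ?La" "ip_n ?n g z = 1" using z by (auto simp: E_def y_def)
      define N where "N = lp_norm ?n p z"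
      have "N \<noteq> 0"
      proof
        assume "N = 0"
        then have "\<forall>i<?n. z i = 0" by (simp add: N_def lp_norm_eq_0)
        then have "ip_n ?n g z = 0" unfolding ip_n_def by (intro sum.neutral) auto
        then show False using y by simp
      qed
      then have N: "N > 0" using lp_norm_nonneg[of ?n p z] by (simp add: N_def)
      have yz: "y = scale_n ?n (1 / N) z" by (simp add: y_def sphere_proj_def N_def)
      then have "ip_n ?n g y = 1 / N" using y by (simp add: ip_n_scale_n)
      then have "\<pi> y = z" unfolding \<pi>_def using N y by (simp add: yz scale_n_scale_n scale_n_one)
      then show "z \<in> \<pi> ` A" using y(1) by blast
    next
      fix z assume "z \<in> \<pi> ` A"
      then show "z \<in> E" using ip_\<pi> proj_\<pi> by (auto simp: E_def \<pi>_def)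
    qed
    have inv: "(\<lambda>z. sphere_proj ?n p z) ` E = A" unfolding E_img using proj_\<pi> by force
    have HE: "hausdorff_outer ?n m E = ennreal (\<kappa> * h) * emeasure ?La (pcone ?n g E)"
      using plane[OF gg E] by (simp add: hg E_def)
    have H1: "hausdorff_outer ?n m E \<le> ennreal (L ^ m) * hausdorff_outer ?n m A"
      unfolding E_img using L c2 by (intro hausdorff_outer_lipschitz) (auto simp: \<pi>_def)
    have H2: "hausdorff_outer ?n m A \<le> ennreal (L ^ m) * hausdorff_outer ?n m E"
    proof -
      have "hausdorff_outer ?n m (sphere_proj ?n p ` E) \<le> ennreal (L ^ m) * hausdorff_outer ?n m E"
      proof (rule hausdorff_outer_lipschitz)
        fix x y assume "x \<in> E" "y \<in> E"
        then obtain x' y' where "x' \<in> A" "y' \<in> A" "x = \<pi> x'" "y = \<pi> y'" by (auto simp: E_img)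
        then show "L2_set (\<lambda>i. sphere_proj ?n p x i - sphere_proj ?n p y i) {..<?n} \<le> L * L2_set (\<lambda>i. x i - y i) {..<?n}"
          using c2(2) proj_\<pi> by simp
      qed (use L in \<open>auto simp: sphere_proj_def\<close>)
      then show ?thesis unfolding inv .
    qed
    let ?cv = "cone_volume ?n p A"
    have P: "pcone ?n g E \<in> sets ?La" using E by (rule pcone_measurable)
    have up: "emeasure ?La (pcone ?n g E) \<le> ennreal (L ^ ?n) * ?cv"
    proof -
      have "pcone ?n g E \<subseteq> {x \<in> space ?La. lp_norm ?n p x \<le> L \<and> sphere_proj ?n p x \<in> A}"
      proof
        fix x assume x: "x \<in> pcone ?n g E"
        define s where "s = ip_n ?n g x"
        have s: "0 < s" "s \<le> 1" "x \<in> space ?La" "scale_n ?n (1 / s) x \<in> E" using x by (auto simp: pcone_def s_def)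
        then obtain y where y: "y \<in> A" "scale_n ?n (1 / s) x = \<pi> y" by (auto simp: E_img)
        have "x = scale_n ?n s (scale_n ?n (1 / s) x)" using s by (simp add: scale_n_scale_n scale_n_one)
        also have "\<dots> = scale_n ?n (s / ip_n ?n g y) y" unfolding y(2) \<pi>_def by (simp add: scale_n_scale_n)
        finally have xy: "x = scale_n ?n (s / ip_n ?n g y) y" .
        have q: "s / ip_n ?n g y > 0" using s c1(5)[OF y(1)] by simp
        have "lp_norm ?n p x = s / ip_n ?n g y" using q p0 As[OF y(1)] unfolding xy by (subst lp_norm_scale_n) auto
        also have "\<dots> \<le> 1 / (1 / L)" using s c1(1,5)[OF y(1)] L by (intro frac_le) auto
        finally have "lp_norm ?n p x \<le> L" by simp
        moreover have "sphere_proj ?n p x = y" unfolding xy using q p0 As[OF y(1)] by (simp add: sphere_proj_scale_n sphere_proj_on_sphere)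
        ultimately show "x \<in> {x \<in> space ?La. lp_norm ?n p x \<le> L \<and> sphere_proj ?n p x \<in> A}" using s y by simp
      qed
      then have "emeasure ?La (pcone ?n g E) \<le> emeasure ?La {x \<in> space ?La. lp_norm ?n p x \<le> L \<and> sphere_proj ?n p x \<in> A}"
        by (intro emeasure_mono cone_section_measurable A)
      also have "\<dots> = ennreal (L ^ ?n) * ?cv" using L by (intro cone_section_scale p A) auto
      finally show ?thesis .
    qed
    have lo: "?cv \<le> ennreal (L ^ ?n) * emeasure ?La (pcone ?n g E)"
    proof -
      let ?C = "{x \<in> lp_ball ?n p. sphere_proj ?n p x \<in> A}"
      have C: "?C \<in> sets ?La" using cone_section_measurable[OF A, of p 1] by (simp add: lp_ball_def conj_assoc)
      have L0: "L > 0" using L by simp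
      have "?cv = ennreal (L ^ ?n) * emeasure ?La {x \<in> space ?La. scale_n ?n L x \<in> ?C}"
        unfolding cone_volume_def by (rule emeasure_scale_n_vimage[OF L0 C])
      also have "{x \<in> space ?La. scale_n ?n L x \<in> ?C} \<subseteq> pcone ?n g E"
      proof
        fix x assume x: "x \<in> {x \<in> space ?La. scale_n ?n L x \<in> ?C}"
        then have xs: "x \<in> space ?La" by simp
        define y where "y = sphere_proj ?n p x"
        define N where "N = lp_norm ?n p x"
        have y: "y \<in> A" using x L0 p0 by (simp add: y_def sphere_proj_scale_n)
        have NL: "L * N \<le> 1" using x L0 p0 by (simp add: lp_ball_def lp_norm_scale_n N_def)
        have yx: "y = scale_n ?n (1 / N) x" by (simp add: y_def sphere_proj_def N_def)
        have "N \<noteq> 0"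
        proof
          assume "N = 0"
          then have "lp_norm ?n p y = 0" using p0 by (simp add: yx lp_norm_scale_n)
          then show False using As[OF y] by simp
        qed
        then have N: "N > 0" using lp_norm_nonneg[of ?n p x] by (simp add: N_def)
        have xy: "x = scale_n ?n N y" using N xs by (simp add: yx scale_n_scale_n scale_n_one)
        have ipx: "ip_n ?n g x = N * ip_n ?n g y" unfolding xy by (rule ip_n_scale_n)
        have "N * ip_n ?n g y \<le> N * L" using N c1(2)[OF y] by (intro mult_left_mono) auto
        then have "ip_n ?n g x \<le> 1" using NL ipx by (simp add: mult.commute)
        moreover have "ip_n ?n g x > 0" using ipx N c1(5)[OF y] by simp
        moreover have "scale_n ?n (1 / ip_n ?n g x) x = \<pi> y"
        proof -
          have "scale_n ?n (1 / ip_n ?n g x) x = scale_n ?n (1 / (N * ip_n ?n g y) * N) y"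
            unfolding ipx by (subst xy) (simp only: scale_n_scale_n)
          also have "1 / (N * ip_n ?n g y) * N = 1 / ip_n ?n g y" using N by simp
          finally show ?thesis by (simp add: \<pi>_def)
        qed
        ultimately show "x \<in> pcone ?n g E" using xs y by (auto simp: pcone_def E_img)
      qed
      then have "emeasure ?La {x \<in> space ?La. scale_n ?n L x \<in> ?C} \<le> emeasure ?La (pcone ?n g E)"
        using P by (intro emeasure_mono)
      then have "ennreal (L ^ ?n) * emeasure ?La {x \<in> space ?La. scale_n ?n L x \<in> ?C} \<le> ennreal (L ^ ?n) * emeasure ?La (pcone ?n g E)"
        by (rule mult_left_mono) simp
      finally show ?thesis .
    qed
    let ?mu = "emeasure (surface_density_measure ?n p) A"
    have mu1: "ennreal (h / L) * ?cv \<le> ?mu" and mu2: "?mu \<le> ennreal (L * h) * ?cv"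
      using surface_density_bounds[OF A, of "h / L" p "L * h"] c1 by auto
    have cvmu: "ennreal h * ?cv \<le> ennreal L * ?mu"
    proof -
      have "ennreal h = ennreal L * ennreal (h / L)" using L h by (subst ennreal_mult[symmetric]) auto
      then have "ennreal h * ?cv = ennreal L * (ennreal (h / L) * ?cv)" by (simp add: mult.assoc)
      also have "\<dots> \<le> ennreal L * ?mu" using mu1 by (rule mult_left_mono) simp
      finally show ?thesis .
    qed
    have pw: "ennreal (L ^ (2 * m + 2)) = ennreal (L ^ m) * (ennreal (L ^ ?n) * ennreal L)"
    proof -
      have "L ^ (2 * m + 2) = L ^ m * (L ^ ?n * L)" by (simp add: power_add[symmetric] mult_2 flip: power_Suc2)
      then show ?thesis using L by (simp only: ennreal_mult zero_le_power zero_le_mult_iff less_imp_le) (simp add: ennreal_mult)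
    qed
    have kh: "ennreal (\<kappa> * h) = ennreal \<kappa> * ennreal h" using \<kappa> h by (simp add: ennreal_mult)
    have "hausdorff_outer ?n m A \<le> ennreal (L ^ m) * (ennreal \<kappa> * (ennreal h * (ennreal (L ^ ?n) * ?cv)))"
      using order_trans[OF H2[unfolded HE kh] mult_left_mono[OF mult_left_mono[OF up]]] by (simp add: mult.assoc)
    also have "\<dots> = ennreal (L ^ m) * (ennreal \<kappa> * (ennreal (L ^ ?n) * (ennreal h * ?cv)))" by (simp add: mult_ac)
    also have "\<dots> \<le> ennreal (L ^ m) * (ennreal \<kappa> * (ennreal (L ^ ?n) * (ennreal L * ?mu)))"
      by (intro mult_left_mono cvmu) auto
    also have "\<dots> = ennreal (L ^ (2 * m + 2)) * (ennreal \<kappa> * ?mu)" unfolding pw by (simp add: mult_ac)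
    finally have R1: "hausdorff_outer ?n m A \<le> ennreal (L ^ (2 * m + 2)) * (ennreal \<kappa> * ?mu)" .
    have "ennreal \<kappa> * ?mu \<le> ennreal \<kappa> * (ennreal (L * h) * ?cv)" using mu2 by (rule mult_left_mono) simp
    also have "\<dots> \<le> ennreal \<kappa> * (ennreal (L * h) * (ennreal (L ^ ?n) * emeasure ?La (pcone ?n g E)))"
      by (intro mult_left_mono lo) auto
    also have "\<dots> = ennreal L * ennreal (L ^ ?n) * hausdorff_outer ?n m E"
      unfolding HE kh using L h by (simp add: ennreal_mult mult_ac)
    also have "\<dots> \<le> ennreal L * ennreal (L ^ ?n) * (ennreal (L ^ m) * hausdorff_outer ?n m A)"
      by (intro mult_left_mono H1) auto
    also have "\<dots> = ennreal (L ^ (2 * m + 2)) * hausdorff_outer ?n m A" unfolding pw by (simp add: mult_ac)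
    finally show "hausdorff_outer ?n m A \<le> ennreal (L ^ (2 * m + 2)) * (ennreal \<kappa> * ?mu) \<and>
       ennreal \<kappa> * ?mu \<le> ennreal (L ^ (2 * m + 2)) * hausdorff_outer ?n m A" using R1 by simp
  qed
qed

lemma le_of_all_power_factors:
  fixes X Y :: ennreal
  assumes "\<And>L :: real. L > 1 \<Longrightarrow> X \<le> ennreal (L ^ K) * Y"
  shows "X \<le> Y"
proof (cases Y)
  case (real y)
  have "((\<lambda>L. ennreal (L ^ K * y)) \<longlongrightarrow> ennreal (1 ^ K * y)) (at_right (1::real))"
    by (intro tendsto_ennrealI tendsto_intros)
  moreover have "eventually (\<lambda>L. X \<le> ennreal (L ^ K * y)) (at_right (1::real))"
    unfolding eventually_at_right_field
    using assms real by (intro exI[of _ 2]) (auto simp: ennreal_mult)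
  ultimately have "X \<le> ennreal (1 ^ K * y)"
    using tendsto_lowerbound[OF _ _ trivial_limit_at_right_real] by blast
  then show ?thesis using real by simp
qed simp

lemma hausdorff_surface_nonzero:
  assumes m: "m \<ge> 1" and p: "p \<ge> 1" and \<kappa>: "\<kappa> > 0"
    and plane: "\<And>g E. ip_n (Suc m) g g > 0 \<Longrightarrow> E \<in> sets (lebesgue_n (Suc m)) \<Longrightarrow> (\<And>y. y \<in> E \<Longrightarrow> ip_n (Suc m) g y = 1) \<Longrightarrow>
      hausdorff_outer (Suc m) m E = ennreal (\<kappa> * L2_set g {..<Suc m}) * emeasure (lebesgue_n (Suc m)) (pcone (Suc m) g E)"
    and A: "A \<in> sets (lebesgue_n (Suc m))" "A \<subseteq> lp_sphere (Suc m) p" "\<And>x i. x \<in> A \<Longrightarrow> i < Suc m \<Longrightarrow> x i \<noteq> 0"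
  shows "hausdorff_outer (Suc m) m A = ennreal \<kappa> * emeasure (surface_density_measure (Suc m) p) A"
proof -
  let ?n = "Suc m" and ?S = "lp_sphere (Suc m) p" and ?La = "lebesgue_n (Suc m)"
  let ?mu = "surface_density_measure ?n p" and ?H = "hausdorff_outer (Suc m) m"
  have both: "?H A \<le> ennreal (L ^ (2 * m + 2)) * (ennreal \<kappa> * emeasure ?mu A) \<and>
     ennreal \<kappa> * emeasure ?mu A \<le> ennreal (L ^ (2 * m + 2)) * ?H A" if L: "L > 1" for L :: real
  proof -
    define c where "c = ennreal (L ^ (2 * m + 2))"
    define good where "good B \<longleftrightarrow> B \<in> sets ?La \<and> (\<forall>A\<in>sets ?La. A \<subseteq> ?S \<inter> B \<longrightarrow>
      ?H A \<le> c * (ennreal \<kappa> * emeasure ?mu A) \<and> ennreal \<kappa> * emeasure ?mu A \<le> c * ?H A)" for B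
    define box where "box q N = {x \<in> space ?La. \<forall>i\<in>{..<?n}. \<bar>x i - q i\<bar> < 1 / (real N + 1)}" for q :: "nat \<Rightarrow> real" and N :: nat
    have box_m: "box q N \<in> sets ?La" for q N
    proof -
      have "{x \<in> space ?La. \<bar>x i - q i\<bar> < 1 / (real N + 1)} \<in> sets ?La" if "i < ?n" for i
      proof -
        note measurable_lebesgue_n_component[OF that, measurable]
        show ?thesis by measurable
      qed
      then have "{x \<in> space ?La. \<forall>i\<in>{..<?n}. \<bar>x i - q i\<bar> < 1 / (real N + 1)} \<in> sets ?La"
        by (intro sets.sets_Collect_finite_All) simp_all
      then show ?thesis by (simp only: box_def)
    qed
    define F where "F = (\<lambda>(q, N). box q N) ` (Pi\<^sub>E {..<?n} (\<lambda>_. \<rat>) \<times> UNIV)"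
    have "countable F"
      unfolding F_def by (intro countable_image countable_SIGMA countable_PiE) (auto simp: countable_rat)
    define G where "G = insert {} {B \<in> F. good B}"
    have cG: "countable G" unfolding G_def using \<open>countable F\<close> by auto
    define B where "B = from_nat_into G"
    have ranB: "range B = G" unfolding B_def using cG by (intro range_from_nat_into) (auto simp: G_def)
    have good_empty: "good {}"
      by (auto simp: good_def)
    have goodB: "good (B j)" for j
    proof -
      have "B j \<in> G" using ranB by blast
      then show ?thesis using good_empty by (auto simp only: G_def insert_iff mem_Collect_eq)
    qed
    have cover: "x \<in> (\<Union>j. B j)" if x: "x \<in> A" for x
    proof -
      have xS: "x \<in> ?S" using x A(2) by auto
      obtain d where d: "d > 0" "\<And>A. A \<in> sets ?La \<Longrightarrow> A \<subseteq> ?S \<Longrightarrow> (\<And>y i. y \<in> A \<Longrightarrow> i < ?n \<Longrightarrow> \<bar>y i - x i\<bar> < d) \<Longrightarrow>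
         ?H A \<le> ennreal (L ^ (2 * m + 2)) * (ennreal \<kappa> * emeasure ?mu A) \<and>
         ennreal \<kappa> * emeasure ?mu A \<le> ennreal (L ^ (2 * m + 2)) * ?H A"
      proof (rule hausdorff_surface_local[of m p \<kappa> x L])
        show "\<And>i. i < ?n \<Longrightarrow> x i \<noteq> 0" by (rule A(3)[OF x])
        show "?H E = ennreal (\<kappa> * L2_set g {..<?n}) * emeasure ?La (pcone ?n g E)"
          if "ip_n ?n g g > 0" "E \<in> sets ?La" "\<And>y. y \<in> E \<Longrightarrow> ip_n ?n g y = 1" for g E
          by (rule plane) (use that in auto)
        show "1 \<le> m" "1 \<le> p" "0 < \<kappa>" "x \<in> ?S" "1 < L" by (rule m p \<kappa> xS L)+
        fix d assume d: "0 < d" and *: "\<And>A. A \<in> sets ?La \<Longrightarrow> A \<subseteq> ?S \<Longrightarrow> (\<And>y i. y \<in> A \<Longrightarrow> i < ?n \<Longrightarrow> \<bar>y i - x i\<bar> < d) \<Longrightarrow>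
         ?H A \<le> ennreal (L ^ (2 * m + 2)) * (ennreal \<kappa> * emeasure ?mu A) \<and>
         ennreal \<kappa> * emeasure ?mu A \<le> ennreal (L ^ (2 * m + 2)) * ?H A"
        show thesis by (rule that[OF d]) (rule *)
      qed
      note d = d[folded c_def]
      obtain N :: nat where N: "inverse (real (Suc N)) < d / 2" using reals_Archimedean[of "d / 2"] d(1) by auto
      define r where "r = 1 / (real N + 1)"
      have r: "r > 0" "2 * r < d" using N by (auto simp: r_def inverse_eq_divide add.commute)
      have "\<exists>q\<in>\<rat>. \<bar>x i - q\<bar> < r" for i
      proof -
        obtain q where "q \<in> \<rat>" "x i < q" "q < x i + r" using Rats_dense_in_real[of "x i" "x i + r"] r by auto
        then show ?thesis by (intro bexI[of _ q]) auto
      qed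
      then obtain q0 where q0: "\<And>i. q0 i \<in> \<rat>" "\<And>i. \<bar>x i - q0 i\<bar> < r" by metis
      define q where "q = restrict q0 {..<?n}"
      have q: "q \<in> Pi\<^sub>E {..<?n} (\<lambda>_. \<rat>)" "\<And>i. i < ?n \<Longrightarrow> \<bar>x i - q i\<bar> < r" using q0 by (auto simp: q_def)
      have xb: "x \<in> box q N" using q(2) xS by (auto simp: box_def r_def lp_sphere_def)
      have "good (box q N)"
        unfolding good_def
      proof (intro conjI box_m ballI impI)
        fix A' assume A': "A' \<in> sets ?La" "A' \<subseteq> ?S \<inter> box q N"
        have "\<bar>y i - x i\<bar> < d" if "y \<in> A'" "i < ?n" for y i
        proof -
          have "\<bar>y i - q i\<bar> < r" using that A'(2) by (auto simp: box_def r_def)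
          then show ?thesis using q(2)[OF that(2)] r by linarith
        qed
        then have "?H A' \<le> c * (ennreal \<kappa> * emeasure ?mu A') \<and> ennreal \<kappa> * emeasure ?mu A' \<le> c * ?H A'"
          using A' by (intro d(2)) auto
        then show "?H A' \<le> c * (ennreal \<kappa> * emeasure ?mu A')" "ennreal \<kappa> * emeasure ?mu A' \<le> c * ?H A'" by auto
      qed
      then have "box q N \<in> G" using q(1) by (auto simp: G_def F_def)
      then show ?thesis using xb ranB by blast
    qed
    define D where "D j = A \<inter> disjointed B j" for j
    have Bm: "range B \<subseteq> sets ?La" using goodB by (auto simp: good_def)
    have Dm: "D j \<in> sets ?La" for j
      using sets.range_disjointed_sets[OF Bm] A(1) unfolding D_def by blast
    have Dd: "disjoint_family D"
      using disjoint_family_disjointed[of B] unfolding D_def disjoint_family_on_def by blast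
    have DU: "(\<Union>j. D j) = A"
      using cover UN_disjointed_eq[of B] unfolding D_def by blast
    have DB: "D j \<subseteq> ?S \<inter> B j" for j using A(2) disjointed_subset[of B j] by (auto simp: D_def)
    have ineq: "?H (D j) \<le> c * (ennreal \<kappa> * emeasure ?mu (D j))" "ennreal \<kappa> * emeasure ?mu (D j) \<le> c * ?H (D j)" for j
      using goodB[of j] Dm[of j] DB[of j] unfolding good_def by auto
    have sH: "?H A = (\<Sum>j. ?H (D j))"
    proof -
      have "(\<Sum>j. emeasure (hausdorff_measure ?n m) (D j)) = emeasure (hausdorff_measure ?n m) (\<Union>j. D j)"
        using Dm Dd by (intro suminf_emeasure) auto
      then show ?thesis using Dm A(1) by (simp add: DU emeasure_hausdorff_measure)
    qed
    have sM: "emeasure ?mu A = (\<Sum>j. emeasure ?mu (D j))"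
    proof -
      have "(\<Sum>j. emeasure ?mu (D j)) = emeasure ?mu (\<Union>j. D j)"
        using Dm Dd by (intro suminf_emeasure) auto
      then show ?thesis by (simp add: DU)
    qed
    have "?H A \<le> (\<Sum>j. c * (ennreal \<kappa> * emeasure ?mu (D j)))" unfolding sH using ineq(1) by (intro suminf_le) auto
    moreover have "(\<Sum>j. ennreal \<kappa> * emeasure ?mu (D j)) \<le> (\<Sum>j. c * ?H (D j))" using ineq(2) by (intro suminf_le) auto
    ultimately show ?thesis by (simp add: sH sM c_def)
  qed
  show ?thesis
  proof (rule antisym)
    show "?H A \<le> ennreal \<kappa> * emeasure ?mu A" by (rule le_of_all_power_factors) (use both in blast)
    show "ennreal \<kappa> * emeasure ?mu A \<le> ?H A" by (rule le_of_all_power_factors) (use both in blast)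
  qed
qed

lemma lp_sphere_null:
  assumes m: "m \<ge> 1" and p: "p \<ge> 1"
  shows "emeasure (lebesgue_n m) (lp_sphere m p) = 0"
proof -
  let ?La = "lebesgue_n m"
  define b where "b = emeasure ?La (lp_ball m p)"
  have b: "b < top" using emeasure_lp_ball[OF p, of m] by (simp add: b_def)
  have bound: "emeasure ?La (lp_sphere m p) + ennreal (r ^ m) * b \<le> b" if r: "0 < r" "r < 1" for r
  proof -
    have inner: "emeasure ?La {x \<in> space ?La. lp_norm m p x \<le> r} = ennreal (r ^ m) * b"
      using cone_section_scale[OF p r(1), of "space ?La" m] by (simp add: b_def cone_volume_def sphere_proj_def)
    have "emeasure ?La (lp_sphere m p) + emeasure ?La {x \<in> space ?La. lp_norm m p x \<le> r}
       = emeasure ?La (lp_sphere m p \<union> {x \<in> space ?La. lp_norm m p x \<le> r})"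
      using r by (intro plus_emeasure) (auto simp: lp_sphere_def)
    also have "\<dots> \<le> b" unfolding b_def using r by (intro emeasure_mono) (auto simp: lp_sphere_def lp_ball_def)
    finally show ?thesis by (simp add: inner)
  qed
  obtain b' where b': "b = ennreal b'" "b' \<ge> 0" using b by (cases b) auto
  have "emeasure ?La (lp_sphere m p) \<le> b" using bound[of "1/2"] by (auto intro: order_trans[OF _ bound[of "1/2"]] add_increasing2)
  then obtain s where s: "emeasure ?La (lp_sphere m p) = ennreal s" "s \<ge> 0"
    using b by (cases "emeasure ?La (lp_sphere m p)") (auto simp: top_unique)
  have le: "s + r ^ m * b' \<le> b'" if "0 < r" "r < 1" for r
    using bound[OF that] that s b' by (simp add: ennreal_mult[symmetric] ennreal_plus[symmetric] ennreal_le_iff del: ennreal_plus)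
  have "((\<lambda>r. s + r ^ m * b') \<longlongrightarrow> s + 1 ^ m * b') (at_left (1::real))" by (intro tendsto_intros)
  moreover have "eventually (\<lambda>r. s + r ^ m * b' \<le> b') (at_left (1::real))"
    unfolding eventually_at_left_field using le by (intro exI[of _ 0]) auto
  ultimately have "s + 1 ^ m * b' \<le> b'"
    using tendsto_upperbound[OF _ _ trivial_limit_at_left_real] by blast
  then show ?thesis using s by simp
qed

lemma hausdorff_coordinate_section_null:
  assumes m: "m \<ge> 1" and p: "p \<ge> 1" and i: "i < Suc m"
  shows "hausdorff_outer (Suc m) m {x \<in> lp_sphere (Suc m) p. x i = 0} = 0"
proof -
  define s where "s k = (if k < i then k else Suc k)" for k
  have bij: "bij_betw s {..<m} ({..<Suc m} - {i})"
  proof (rule bij_betw_byWitness[where f'="\<lambda>k. if k < i then k else k - 1"])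
    show "s ` {..<m} \<subseteq> {..<Suc m} - {i}" using i by (auto simp: s_def)
    show "(\<lambda>k. if k < i then k else k - 1) ` ({..<Suc m} - {i}) \<subseteq> {..<m}" using i by auto
  qed (auto simp: s_def)
  have sums: "(\<Sum>k<Suc m. f k) = f i + (\<Sum>k<m. f (s k))" for f :: "nat \<Rightarrow> real"
    using i sum.reindex_bij_betw[OF bij, of f] by (subst sum.remove[of _ i]) auto
  define e where "e y = (\<lambda>k\<in>{..<Suc m}. if k = i then 0 else y (if k < i then k else k - 1))" for y :: "nat \<Rightarrow> real"
  have es: "e y (s k) = y k" if "k < m" for y k using that i by (auto simp: e_def s_def)
  have ei: "e y i = 0" for y using i by (simp add: e_def)
  have sub: "{x \<in> lp_sphere (Suc m) p. x i = 0} \<subseteq> e ` lp_sphere m p"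
  proof
    fix x assume x: "x \<in> {x \<in> lp_sphere (Suc m) p. x i = 0}"
    define y where "y = (\<lambda>k\<in>{..<m}. x (s k))"
    have "x = e y"
    proof
      fix k
      show "x k = e y k" using x i
        by (cases "k < Suc m") (auto simp: e_def y_def s_def lp_sphere_def space_lebesgue_n extensional_def)
    qed
    moreover have "y \<in> lp_sphere m p"
    proof -
      have "(\<Sum>k<Suc m. \<bar>x k\<bar> powr p) = (\<Sum>k<m. \<bar>y k\<bar> powr p)" unfolding sums using x by (simp add: y_def)
      then have "lp_norm m p y = lp_norm (Suc m) p x" by (simp add: lp_norm_def)
      then show ?thesis using x by (simp add: lp_sphere_def y_def space_lebesgue_n)
    qed
    ultimately show "x \<in> e ` lp_sphere m p" by blast
  qed
  obtain \<kappa> where \<kappa>: "\<And>A. A \<in> sets (lebesgue_n m) \<Longrightarrow> hausdorff_outer m m A = ennreal \<kappa> * emeasure (lebesgue_n m) A"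
    using hausdorff_measure_eq_lebesgue[OF m] by blast
  have "hausdorff_outer (Suc m) m {x \<in> lp_sphere (Suc m) p. x i = 0} \<le> hausdorff_outer (Suc m) m (e ` lp_sphere m p)"
    by (rule hausdorff_outer_mono[OF sub])
  also have "\<dots> \<le> ennreal (1 ^ m) * hausdorff_outer m m (lp_sphere m p)"
  proof (rule hausdorff_outer_lipschitz)
    fix x y :: "nat \<Rightarrow> real"
    have "(\<Sum>k<Suc m. (e x k - e y k)\<^sup>2) = (\<Sum>k<m. (x k - y k)\<^sup>2)" unfolding sums using es by (simp add: ei)
    then show "L2_set (\<lambda>k. e x k - e y k) {..<Suc m} \<le> 1 * L2_set (\<lambda>k. x k - y k) {..<m}"
      by (simp only: L2_set_def mult_1 order_refl)
  qed (auto simp: e_def space_lebesgue_n)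
  also have "\<dots> = 0" by (simp add: \<kappa>[OF lp_sphere_measurable] lp_sphere_null[OF m p])
  finally show ?thesis by simp
qed

theorem hausdorff_lp_sphere:
  assumes m: "m \<ge> 1" and p: "p \<ge> 1"
  obtains \<kappa> where "\<kappa> > 0" "\<And>A. A \<in> sets (lebesgue_n (Suc m)) \<Longrightarrow>
    hausdorff_outer (Suc m) m (lp_sphere (Suc m) p \<inter> A) = ennreal \<kappa> * emeasure (surface_density_measure (Suc m) p) A"
proof -
  let ?n = "Suc m" and ?S = "lp_sphere (Suc m) p" and ?La = "lebesgue_n (Suc m)"
  let ?mu = "surface_density_measure ?n p" and ?H = "hausdorff_outer (Suc m) m"
  obtain \<kappa> where \<kappa>: "\<kappa> > 0" "\<And>g E. ip_n (Suc m) g g > 0 \<Longrightarrow> E \<in> sets (lebesgue_n (Suc m)) \<Longrightarrow> (\<And>y. y \<in> E \<Longrightarrow> ip_n (Suc m) g y = 1) \<Longrightarrow>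
      hausdorff_outer (Suc m) m E = ennreal (\<kappa> * L2_set g {..<Suc m}) * emeasure (lebesgue_n (Suc m)) (pcone (Suc m) g E)"
    using hausdorff_hyperplane[OF m] by blast
  show ?thesis
  proof (rule that[OF \<kappa>(1)])
    fix A assume A: "A \<in> sets ?La"
    define Z where "Z = {x \<in> space ?La. \<forall>i\<in>{..<?n}. x i \<noteq> 0}"
    have Z: "Z \<in> sets ?La"
    proof -
      have "{x \<in> space ?La. x i \<noteq> 0} \<in> sets ?La" if "i < ?n" for i
      proof -
        note measurable_lebesgue_n_component[OF that, measurable]
        show ?thesis by measurable
      qed
      then have "{x \<in> space ?La. \<forall>i\<in>{..<?n}. x i \<noteq> 0} \<in> sets ?La"
        by (intro sets.sets_Collect_finite_All) simp_all
      then show ?thesis by (simp only: Z_def)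
    qed
    define A1 where "A1 = ?S \<inter> A \<inter> Z"
    have A1: "A1 \<in> sets ?La" unfolding A1_def using A Z by auto
    have HA1: "?H A1 = ennreal \<kappa> * emeasure ?mu A1"
      by (rule hausdorff_surface_nonzero[OF m p \<kappa> A1]) (auto simp: A1_def Z_def)
    have "?H (?S \<inter> A) \<le> ?H (A1 \<union> (\<Union>j. {x \<in> ?S. j < ?n \<and> x j = 0}))"
      using A sets.sets_into_space by (intro hausdorff_outer_mono) (auto simp: A1_def Z_def lp_sphere_def)
    also have "\<dots> \<le> ?H A1 + ?H (\<Union>j. {x \<in> ?S. j < ?n \<and> x j = 0})" by (rule hausdorff_outer_subadditive)
    also have "?H (\<Union>j. {x \<in> ?S. j < ?n \<and> x j = 0}) \<le> (\<Sum>j. ?H {x \<in> ?S. j < ?n \<and> x j = 0})"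
      by (rule hausdorff_outer_countably_subadditive)
    also have "(\<Sum>j. ?H {x \<in> ?S. j < ?n \<and> x j = 0}) = (\<Sum>j::nat. 0)"
    proof (rule suminf_cong)
      fix j
      show "?H {x \<in> ?S. j < ?n \<and> x j = 0} = 0"
        using hausdorff_coordinate_section_null[OF m p, of j] by (cases "j < ?n") auto
    qed
    finally have "?H (?S \<inter> A) \<le> ?H A1" by simp
    moreover have "?H A1 \<le> ?H (?S \<inter> A)" by (rule hausdorff_outer_mono) (auto simp: A1_def)
    ultimately have "?H (?S \<inter> A) = ?H A1" by (rule antisym)
    moreover have "emeasure ?mu A1 = emeasure ?mu A"
      unfolding emeasure_surface_density_measure[OF A1] emeasure_surface_density_measure[OF A]
    proof (rule nn_integral_cong_AE)
      have p0: "p > 0" "?n \<ge> 1" using p by auto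
      show "AE x in ?La. ennreal (gradient_norm ?n p (sphere_proj ?n p x)) * indicator {x \<in> lp_ball ?n p. sphere_proj ?n p x \<in> A1} x
         = ennreal (gradient_norm ?n p (sphere_proj ?n p x)) * indicator {x \<in> lp_ball ?n p. sphere_proj ?n p x \<in> A} x"
        using AE_sphere_proj_in_sphere[OF p0(2,1)] AE_lp_norm_pos[OF p0(2), of p] AE_lebesgue_n_nonzero[of ?n]
      proof eventually_elim
        case (elim x)
        have "sphere_proj ?n p x \<in> Z"
          using elim by (auto simp: Z_def sphere_proj_def) (auto simp: scale_n_def)
        then have "sphere_proj ?n p x \<in> A1 \<longleftrightarrow> sphere_proj ?n p x \<in> A" using elim by (auto simp: A1_def)
        then show ?case by (simp add: indicator_def)
      qed
    qed
    ultimately show "?H (?S \<inter> A) = ennreal \<kappa> * emeasure ?mu A" using HA1 by simp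
  qed
qed

section \<open>Surface measure versus cone measure\<close>

lemma weighted_prob_deviation:
  fixes q :: "'a \<Rightarrow> real"
  assumes P: "prob_space P" and q: "integrable P q" "\<And>x. q x \<ge> 0" and C: "C \<in> sets P" and a: "a > 0"
  shows "\<bar>(\<integral>x. q x * indicator C x \<partial>P) / (\<integral>x. q x \<partial>P) - measure P C\<bar> \<le> 4 / a * (\<integral>x. \<bar>q x - a\<bar> \<partial>P)"
proof -
  interpret prob_space P by fact
  define X where "X = (\<integral>x. q x * indicator C x \<partial>P)"
  define Y where "Y = (\<integral>x. q x \<partial>P)"
  define \<delta> where "\<delta> = (\<integral>x. \<bar>q x - a\<bar> \<partial>P)"
  define \<pi> where "\<pi> = measure P C"
  have i1: "integrable P (\<lambda>x. q x * indicator C x)"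
    using integrable_real_mult_indicator[OF C q(1)] by simp
  have i2: "integrable P (\<lambda>x. \<bar>q x - a\<bar>)" using q(1) by auto
  have i3: "integrable P (\<lambda>x. indicator C x :: real)" using C by (auto simp: less_top[symmetric])
  have X0: "0 \<le> X" unfolding X_def using q(2) by (intro integral_nonneg_AE) auto
  have XY: "X \<le> Y" unfolding X_def Y_def using q i1 by (intro integral_mono) (auto simp: indicator_def)
  have pi: "0 \<le> \<pi>" "\<pi> \<le> 1" by (auto simp: \<pi>_def)
  have \<delta>0: "\<delta> \<ge> 0" unfolding \<delta>_def by (intro integral_nonneg_AE) auto
  have Ya: "\<bar>Y - a\<bar> \<le> \<delta>"
  proof -
    have "Y - a = (\<integral>x. q x - a \<partial>P)" unfolding Y_def using q(1) by (simp add: prob_space)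
    then show ?thesis unfolding \<delta>_def by (simp only: integral_abs_bound)
  qed
  have Xa: "\<bar>X - a * \<pi>\<bar> \<le> \<delta>"
  proof -
    have "X - a * \<pi> = (\<integral>x. q x * indicator C x - a * indicator C x \<partial>P)"
      unfolding X_def \<pi>_def using i1 i3 C by (subst Bochner_Integration.integral_diff) auto
    also have "\<bar>\<dots>\<bar> \<le> (\<integral>x. \<bar>q x * indicator C x - a * indicator C x\<bar> \<partial>P)" by (rule integral_abs_bound)
    also have "\<dots> \<le> \<delta>" unfolding \<delta>_def
      using i1 i2 i3 by (intro integral_mono) (auto simp: indicator_def)
    finally show ?thesis .
  qed
  have "\<bar>(Y - a) * \<pi>\<bar> \<le> \<delta>" using Ya pi \<delta>0 by (auto simp: abs_mult intro: order_trans[OF mult_mono[of _ \<delta> _ 1]])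
  then have XYp: "\<bar>X - Y * \<pi>\<bar> \<le> 2 * \<delta>" using Xa unfolding left_diff_distrib by linarith
  have "\<bar>X / Y - \<pi>\<bar> \<le> 4 / a * \<delta>"
  proof (cases "\<delta> \<le> a / 2")
    case True
    then have Y: "Y \<ge> a / 2" "Y > 0" using Ya a by linarith+
    have "X / Y - \<pi> = (X - Y * \<pi>) / Y" using Y by (simp add: diff_divide_distrib)
    then have "\<bar>X / Y - \<pi>\<bar> = \<bar>X - Y * \<pi>\<bar> / Y" using Y by (simp add: abs_divide)
    also have "\<dots> \<le> 2 * \<delta> / (a / 2)" using XYp Y a \<delta>0 by (intro frac_le) auto
    finally show ?thesis by simp
  next
    case False
    have "X / Y \<le> 1" "0 \<le> X / Y" using X0 XY by (auto simp: divide_le_eq_1)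
    then have "\<bar>X / Y - \<pi>\<bar> \<le> 1" using pi by linarith
    also have "\<dots> \<le> 4 / a * \<delta>" using False a by (simp add: field_simps)
    finally show ?thesis .
  qed
  then show ?thesis by (simp add: X_def Y_def \<delta>_def \<pi>_def)
qed

lemma gradient_norm_sphere_proj:
  assumes n: "n \<ge> 1" and p: "p \<ge> 1" and x: "\<And>i. i < n \<Longrightarrow> x i \<noteq> 0"
  shows "gradient_norm n p (sphere_proj n p x) =
    n powr (1 / 2 - (p - 1) / p) *
      (((\<Sum>i<n. \<bar>x i\<bar> powr p) / n) powr (- ((p - 1) / p)) * sqrt ((\<Sum>i<n. \<bar>x i\<bar> powr (2 * p - 2)) / n))"
proof -
  define S where "S = (\<Sum>i<n. \<bar>x i\<bar> powr p)"
  define T where "T = (\<Sum>i<n. \<bar>x i\<bar> powr (2 * p - 2))"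
  have S: "S > 0" unfolding S_def using n x by (intro sum_pos) (auto simp: lessThan_empty_iff)
  have T: "T \<ge> 0" unfolding T_def by (intro sum_nonneg) auto
  define N where "N = lp_norm n p x"
  have N: "N = S powr (1 / p)" "N > 0" using S by (auto simp: N_def lp_norm_def S_def)
  have Np: "N powr (p - 1) = S powr ((p - 1) / p)" using p by (simp add: N powr_powr)
  have "(\<Sum>i<n. (lp_gradient p (sphere_proj n p x) i)\<^sup>2) = (\<Sum>i<n. \<bar>x i\<bar> powr (2 * p - 2) * (1 / N powr (p - 1))\<^sup>2)"
  proof (rule sum.cong[OF refl])
    fix i assume "i \<in> {..<n}"
    then have i: "i < n" by simp
    define z where "z = x i / N"
    have z: "sphere_proj n p x i = z" "z \<noteq> 0" using i x[OF i] N by (auto simp: sphere_proj_def scale_n_def N_def z_def)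
    have "(lp_gradient p (sphere_proj n p x) i)\<^sup>2 = (\<bar>z\<bar> powr (p - 1))\<^sup>2"
      using z by (simp add: lp_gradient_def signed_powr_def power_mult_distrib sgn_if)
    also have "\<bar>z\<bar> powr (p - 1) = \<bar>x i\<bar> powr (p - 1) * (1 / N powr (p - 1))"
      using N(2) by (simp add: z_def powr_divide)
    also have "(\<bar>x i\<bar> powr (p - 1) * (1 / N powr (p - 1)))\<^sup>2 = \<bar>x i\<bar> powr (2 * p - 2) * (1 / N powr (p - 1))\<^sup>2"
    proof -
      have "(\<bar>x i\<bar> powr (p - 1))\<^sup>2 = \<bar>x i\<bar> powr (2 * p - 2)"
        by (simp add: power2_eq_square powr_add[symmetric])
      then show ?thesis by (simp only: power_mult_distrib)
    qed
    finally show "(lp_gradient p (sphere_proj n p x) i)\<^sup>2 = \<bar>x i\<bar> powr (2 * p - 2) * (1 / N powr (p - 1))\<^sup>2" .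
  qed
  also have "\<dots> = T * (1 / N powr (p - 1))\<^sup>2" unfolding T_def by (rule sum_distrib_right[symmetric])
  finally have g: "gradient_norm n p (sphere_proj n p x) = sqrt T * (1 / N powr (p - 1))"
    by (simp add: gradient_norm_def L2_set_def real_sqrt_mult)
  have n0: "real n > 0" using n by simp
  have e1: "(S / n) powr (- ((p - 1) / p)) = (1 / N powr (p - 1)) * n powr ((p - 1) / p)"
    using S n0 by (simp only: Np powr_minus_divide powr_divide) simp
  have e2: "sqrt (T / n) = sqrt T * n powr (- 1 / 2)"
    using n0 by (simp add: real_sqrt_divide powr_minus_divide powr_half_sqrt)
  have e3: "n powr (1 / 2 - (p - 1) / p) * n powr ((p - 1) / p) * n powr (- 1 / 2) = 1"
    using n0 by (simp add: powr_add[symmetric])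
  have "n powr (1 / 2 - (p - 1) / p) * ((S / n) powr (- ((p - 1) / p)) * sqrt (T / n))
     = (sqrt T * (1 / N powr (p - 1))) * (n powr (1 / 2 - (p - 1) / p) * n powr ((p - 1) / p) * n powr (- 1 / 2))"
    unfolding e1 e2 by (simp only: mult_ac)
  then show ?thesis by (simp only: e3 mult_1_right g S_def T_def)
qed

lemma gradient_norm_sphere_proj_le:
  assumes p: "p \<ge> 1"
  shows "gradient_norm n p (sphere_proj n p x) \<le> n"
proof -
  have "\<bar>lp_gradient p (sphere_proj n p x) i\<bar> \<le> 1" if i: "i < n" for i
  proof -
    have "\<bar>x i\<bar> \<le> lp_norm n p x" using abs_le_lp_norm[OF i, of p x] p by simp
    then have "\<bar>x i / lp_norm n p x\<bar> \<le> 1" using abs_ge_zero[of "x i"] by (simp add: divide_le_eq_1; linarith)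
    then have "\<bar>sphere_proj n p x i\<bar> \<le> 1" using i by (simp add: sphere_proj_def scale_n_def)
    then have "\<bar>sphere_proj n p x i\<bar> powr (p - 1) \<le> 1" using p by (intro powr_le1) auto
    then show ?thesis by (auto simp: lp_gradient_def signed_powr_def abs_mult sgn_if)
  qed
  then have "(\<Sum>i<n. \<bar>lp_gradient p (sphere_proj n p x) i\<bar>) \<le> (\<Sum>i<n. 1)" by (intro sum_mono) auto
  then show ?thesis using L2_set_le_sum_abs[of "lp_gradient p (sphere_proj n p x)" "{..<n}"] by (simp add: gradient_norm_def)
qed

lemma surface_measure_cone:
  assumes n: "n \<ge> 2" and p: "p \<ge> 1" and C[measurable]: "C \<in> sets (lebesgue_n n)"
    and hom: "\<And>r x. r > 0 \<Longrightarrow> x \<in> space (lebesgue_n n) \<Longrightarrow> scale_n n r x \<in> C \<longleftrightarrow> x \<in> C"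
  shows "measure (surface_measure n p) C =
    (\<integral>x. gradient_norm n p (sphere_proj n p x) * indicator C x \<partial>gaussian_n n p)
      / (\<integral>x. gradient_norm n p (sphere_proj n p x) \<partial>gaussian_n n p)"
proof -
  let ?La = "lebesgue_n n" and ?G = "gaussian_n n p" and ?S = "lp_sphere n p"
  define h where "h x = gradient_norm n p (sphere_proj n p x)" for x
  have h0: "h x \<ge> 0" "h x \<le> n" for x using gradient_norm_sphere_proj_le[OF p] by (auto simp: h_def gradient_norm_def)
  have hm[measurable]: "h \<in> borel_measurable ?La" unfolding h_def by measurable
  have n1: "n \<ge> 1" and p0: "p > 0" using n p by auto
  interpret G: prob_space ?G using p by (rule gaussian_n_prob_space)
  obtain m where m: "n = Suc m" "m \<ge> 1" using n by (cases n) auto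
  obtain \<kappa> where \<kappa>: "\<kappa> > 0" "\<And>A. A \<in> sets ?La \<Longrightarrow>
      hausdorff_outer n m (?S \<inter> A) = ennreal \<kappa> * emeasure (surface_density_measure n p) A"
    using hausdorff_lp_sphere[OF m(2) p] unfolding m(1) by metis
  obtain b where b: "emeasure ?La (lp_ball n p) = ennreal b" "b > 0"
    using emeasure_lp_ball[OF p, of n] by (cases "emeasure ?La (lp_ball n p)") auto
  have key: "hausdorff_outer n m (?S \<inter> A) = ennreal (\<kappa> * b * (\<integral>x. h x * indicator A x \<partial>?G))"
    if A[measurable]: "A \<in> sets ?La"
      and homA: "\<And>r x. r > 0 \<Longrightarrow> x \<in> space ?La \<Longrightarrow> scale_n n r x \<in> A \<longleftrightarrow> x \<in> A" for A
  proof -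
    define F where "F x = ennreal (h x * indicator A x)" for x
    have Fm: "F \<in> borel_measurable ?La" unfolding F_def by measurable
    have Fhom: "F (scale_n n r x) = F x" if "r > 0" "x \<in> space ?La" for r x
      using that homA[OF that] sphere_proj_scale_n[OF p0 that(1), of n x] by (simp add: F_def h_def indicator_def)
    have Fle: "F x \<le> ennreal n" for x unfolding F_def using h0[of x] by (intro ennreal_leI) (auto simp: indicator_def)
    have "(\<integral>\<^sup>+x. F x * indicator (lp_ball n p) x \<partial>?La) \<le> (\<integral>\<^sup>+x. ennreal n * indicator (lp_ball n p) x \<partial>?La)"
      by (intro nn_integral_mono mult_right_mono Fle) auto
    also have "\<dots> = ennreal n * ennreal b" by (simp add: nn_integral_cmult_indicator b)
    finally have fin: "(\<integral>\<^sup>+x. F x * indicator (lp_ball n p) x \<partial>?La) < \<infinity>"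
      by (rule le_less_trans) (simp add: ennreal_mult_less_top)
    have "emeasure (surface_density_measure n p) A = (\<integral>\<^sup>+x. F x * indicator (lp_ball n p) x \<partial>?La)"
      unfolding emeasure_surface_density_measure[OF A]
    proof (rule nn_integral_cong_AE)
      show "AE x in ?La. ennreal (gradient_norm n p (sphere_proj n p x)) * indicator {x \<in> lp_ball n p. sphere_proj n p x \<in> A} x
          = F x * indicator (lp_ball n p) x"
        using AE_lp_norm_pos[OF n1, of p] AE_space
      proof eventually_elim
        case (elim x)
        then have "sphere_proj n p x \<in> A \<longleftrightarrow> x \<in> A" unfolding sphere_proj_def by (intro homA) auto
        then show ?case by (simp add: F_def h_def indicator_def)
      qed
    qed
    also have "\<dots> = ennreal b * (\<integral>\<^sup>+x. F x \<partial>?G)"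
      using gaussian_n_homogeneous(1)[OF n1 p Fm Fhom fin] b by simp
    also have "(\<integral>\<^sup>+x. F x \<partial>?G) = ennreal (\<integral>x. h x * indicator A x \<partial>?G)"
      unfolding F_def
    proof (rule nn_integral_eq_integral)
      show "integrable ?G (\<lambda>x. h x * indicator A x)"
        by (rule G.integrable_const_bound[where B="real n"]) (use h0 in \<open>auto simp: indicator_def\<close>)
    qed (use h0 in auto)
    finally show ?thesis
      using \<kappa> b(2) by (simp add: \<kappa>(2)[OF A] ennreal_mult' mult.assoc)
  qed
  define X where "X = (\<integral>x. h x * indicator C x \<partial>?G)"
  define Y where "Y = (\<integral>x. h x \<partial>?G)"
  have X0: "X \<ge> 0" unfolding X_def using h0 by (intro integral_nonneg_AE) auto
  have Y0: "Y \<ge> 0" unfolding Y_def using h0 by (intro integral_nonneg_AE) auto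
  have HC: "hausdorff_outer n m (?S \<inter> C) = ennreal (\<kappa> * b * X)"
    unfolding X_def by (rule key[OF C hom])
  have HS: "hausdorff_outer n m ?S = ennreal (\<kappa> * b * Y)"
  proof -
    have "hausdorff_outer n m (?S \<inter> space ?La) = ennreal (\<kappa> * b * (\<integral>x. h x * indicator (space ?La) x \<partial>?G))"
      by (rule key) (auto simp: scale_n_in_space)
    also have "(\<integral>x. h x * indicator (space ?La) x \<partial>?G) = Y"
      unfolding Y_def by (intro Bochner_Integration.integral_cong) (auto simp: indicator_def space_gaussian_n)
    also have "?S \<inter> space ?La = ?S" by (auto simp: lp_sphere_def)
    finally show ?thesis .
  qed
  have "n - 1 = m" using m(1) by simp
  then have "emeasure (surface_measure n p) C =
      emeasure (hausdorff_measure n m) (?S \<inter> C) / emeasure (hausdorff_measure n m) ?S"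
    unfolding surface_measure_def by (simp add: emeasure_uniform_measure)
  also have "\<dots> = hausdorff_outer n m (?S \<inter> C) / hausdorff_outer n m ?S"
    by (simp add: emeasure_hausdorff_measure)
  also have "\<dots> = ennreal (X / Y)"
  proof (cases "Y = 0")
    case True
    have "X \<le> Y" unfolding X_def Y_def
    proof (rule integral_mono)
      show "integrable ?G (\<lambda>x. h x * indicator C x)" "integrable ?G h"
        by (rule G.integrable_const_bound[where B="real n"]; use h0 in \<open>auto simp: indicator_def\<close>)+
    qed (use h0 in \<open>auto simp: indicator_def\<close>)
    then show ?thesis using True X0 by (simp add: HC HS)
  next
    case False
    then have "ennreal (\<kappa> * b * X) / ennreal (\<kappa> * b * Y) = ennreal ((\<kappa> * b * X) / (\<kappa> * b * Y))"
      using X0 Y0 \<kappa>(1) b(2) by (intro divide_ennreal) auto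
    then show ?thesis using \<kappa>(1) b(2) by (simp add: HC HS)
  qed
  finally show ?thesis using X0 Y0 by (simp add: measure_def X_def Y_def h_def)
qed

lemma powr_neg_deviation:
  fixes D \<theta> :: real
  assumes D: "\<bar>D - 1\<bar> \<le> 1 / 2" and \<theta>: "0 \<le> \<theta>" "\<theta> \<le> 1"
  shows "D powr (- \<theta>) \<le> 2" "\<bar>D powr (- \<theta>) - 1\<bar> \<le> 2 * \<bar>D - 1\<bar>"
proof -
  have D': "D \<ge> 1 / 2" "D > 0" using D by linarith+
  have inv: "D powr (- 1) = 1 / D" using D' by (simp add: powr_minus_divide)
  have "D powr (- \<theta>) \<le> 2 \<and> \<bar>D powr (- \<theta>) - 1\<bar> \<le> 2 * \<bar>D - 1\<bar>"
  proof (cases "D \<ge> 1")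
    case True
    have "D powr (- 1) \<le> D powr (- \<theta>)" using True \<theta> by (intro powr_mono) auto
    moreover have "D powr (- \<theta>) \<le> D powr 0" using True \<theta> by (intro powr_mono) auto
    moreover have "1 - 1 / D \<le> D - 1"
    proof -
      have "1 - 1 / D = (D - 1) / D" using D' by (simp add: diff_divide_distrib)
      also have "\<dots> \<le> (D - 1) / 1" using True by (intro divide_left_mono) auto
      finally show ?thesis by simp
    qed
    ultimately show ?thesis using True D' inv by (auto simp: abs_le_iff)
  next
    case False
    have "D powr 0 \<le> D powr (- \<theta>)" using False D' \<theta> by (intro powr_mono') auto
    moreover have "D powr (- \<theta>) \<le> D powr (- 1)" using False D' \<theta> by (intro powr_mono') auto
    moreover have "1 / D - 1 \<le> 2 * (1 - D)"
    proof -
      have "1 / D - 1 = (1 - D) / D" using D' by (simp add: diff_divide_distrib)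
      also have "\<dots> \<le> (1 - D) / (1 / 2)" using False D' by (intro divide_left_mono) auto
      finally show ?thesis by simp
    qed
    moreover have "1 / D \<le> 2" using D' by (simp add: divide_le_eq)
    ultimately show ?thesis using False D' inv by (auto simp: abs_le_iff)
  qed
  then show "D powr (- \<theta>) \<le> 2" "\<bar>D powr (- \<theta>) - 1\<bar> \<le> 2 * \<bar>D - 1\<bar>" by auto
qed

lemma weighted_root_deviation:
  fixes a D U \<theta> :: real
  assumes a: "a > 0" and D: "\<bar>D - 1\<bar> \<le> 1 / 2" and \<theta>: "0 \<le> \<theta>" "\<theta> \<le> 1" and U: "U \<ge> 0"
  shows "\<bar>D powr (- \<theta>) * sqrt U - a\<bar> \<le> 2 / a * \<bar>U - a\<^sup>2\<bar> + 2 * a * \<bar>D - 1\<bar>"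
proof -
  have "U - a\<^sup>2 = (sqrt U - a) * (sqrt U + a)"
    using U by (simp add: algebra_simps power2_eq_square)
  then have "\<bar>U - a\<^sup>2\<bar> = \<bar>sqrt U - a\<bar> * (sqrt U + a)" using U a by (simp add: abs_mult)
  also have "\<dots> \<ge> \<bar>sqrt U - a\<bar> * a" using U by (intro mult_left_mono) auto
  finally have r: "\<bar>sqrt U - a\<bar> \<le> \<bar>U - a\<^sup>2\<bar> / a" using a by (simp add: pos_le_divide_eq)
  have "D powr (- \<theta>) * sqrt U - a = D powr (- \<theta>) * (sqrt U - a) + a * (D powr (- \<theta>) - 1)"
    by (simp add: algebra_simps)
  then have "\<bar>D powr (- \<theta>) * sqrt U - a\<bar> \<le> D powr (- \<theta>) * \<bar>sqrt U - a\<bar> + a * \<bar>D powr (- \<theta>) - 1\<bar>"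
    using a by (simp add: abs_mult[symmetric] abs_triangle_ineq order_trans[OF abs_triangle_ineq] abs_mult)
  also have "\<dots> \<le> 2 * (\<bar>U - a\<^sup>2\<bar> / a) + a * (2 * \<bar>D - 1\<bar>)"
    using r a powr_neg_deviation[OF D \<theta>] by (intro add_mono mult_mono mult_left_mono) auto
  finally show ?thesis by simp
qed

theorem surface_gaussian_deviation:
  assumes p: "p \<ge> 1"
  obtains K where "K > 0" "\<And>n C. n \<ge> 2 \<Longrightarrow> C \<in> sets (lebesgue_n n) \<Longrightarrow>
      (\<And>r x. r > 0 \<Longrightarrow> x \<in> space (lebesgue_n n) \<Longrightarrow> scale_n n r x \<in> C \<longleftrightarrow> x \<in> C) \<Longrightarrow>
      \<bar>measure (surface_measure n p) C - measure (gaussian_n n p) C\<bar> \<le> K / sqrt n"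
proof -
  define f where "f x = \<bar>x\<bar> powr p" for x :: real
  define g where "g x = \<bar>x\<bar> powr (2 * p - 2)" for x :: real
  have fm[measurable]: "f \<in> borel_measurable borel" unfolding f_def by measurable
  have gm[measurable]: "g \<in> borel_measurable borel" unfolding g_def by measurable
  have fi: "integrable (p_gaussian p) f" "integrable (p_gaussian p) (\<lambda>x. (f x)\<^sup>2)"
    unfolding f_def using p p_gaussian_integrable_powr[OF p, of p] p_gaussian_integrable_powr[OF p, of "p + p"]
    by (auto simp: power2_eq_square powr_add[symmetric] simp del: mult_2)
  have gi: "integrable (p_gaussian p) g" "integrable (p_gaussian p) (\<lambda>x. (g x)\<^sup>2)"
    unfolding g_def using p p_gaussian_integrable_powr[OF p, of "2 * p - 2"] p_gaussian_integrable_powr[OF p, of "(2 * p - 2) + (2 * p - 2)"]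
    by (auto simp only: power2_eq_square powr_add[symmetric])
  have Ef: "(\<integral>x. f x \<partial>p_gaussian p) = 1" unfolding f_def by (rule p_gaussian_abs_moment_p[OF p])
  define a where "a = sqrt (\<integral>x. g x \<partial>p_gaussian p)"
  interpret pg: prob_space "p_gaussian p" using p by (rule p_gaussian_prob_space)
  have Eg: "(\<integral>x. g x \<partial>p_gaussian p) > 0"
  proof -
    have "(\<integral>x. g x \<partial>p_gaussian p) \<noteq> 0"
    proof
      assume "(\<integral>x. g x \<partial>p_gaussian p) = 0"
      then have "AE x in p_gaussian p. g x = 0"
        by (subst (asm) integral_nonneg_eq_0_iff_AE[OF gi(1)]) (auto simp: g_def)
      then have "AE x in p_gaussian p. False"
        using AE_p_gaussian_nonzero by eventually_elim (simp add: g_def)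
      then show False by simp
    qed
    moreover have "(\<integral>x. g x \<partial>p_gaussian p) \<ge> 0" by (intro integral_nonneg_AE) (auto simp: g_def)
    ultimately show ?thesis by simp
  qed
  have a: "a > 0" "a\<^sup>2 = (\<integral>x. g x \<partial>p_gaussian p)" using Eg by (auto simp: a_def)
  define \<theta> where "\<theta> = (p - 1) / p"
  have \<theta>: "0 \<le> \<theta>" "\<theta> \<le> 1" using p by (auto simp: \<theta>_def divide_le_eq_1)
  obtain v1 where v1: "v1 \<ge> 0" "\<And>n. n \<ge> 1 \<Longrightarrow> integrable (gaussian_n n p) (\<lambda>y. ((\<Sum>i<n. g (y i)) / n - a\<^sup>2)\<^sup>2)"
    "\<And>n. n \<ge> 1 \<Longrightarrow> (\<integral>y. ((\<Sum>i<n. g (y i)) / n - a\<^sup>2)\<^sup>2 \<partial>gaussian_n n p) = v1 / n"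
    using gaussian_n_mean_deviation[OF p gm gi] unfolding a(2) by blast
  obtain v2 where v2: "v2 \<ge> 0" "\<And>n. n \<ge> 1 \<Longrightarrow> integrable (gaussian_n n p) (\<lambda>y. ((\<Sum>i<n. f (y i)) / n - 1)\<^sup>2)"
    "\<And>n. n \<ge> 1 \<Longrightarrow> (\<integral>y. ((\<Sum>i<n. f (y i)) / n - 1)\<^sup>2 \<partial>gaussian_n n p) = v2 / n"
    using gaussian_n_mean_deviation[OF p fm fi] unfolding Ef by blast
  obtain v3 where v3: "v3 \<ge> 0" "\<And>n. n \<ge> 1 \<Longrightarrow>
      measure (gaussian_n n p) {y \<in> space (gaussian_n n p). \<bar>(\<Sum>i<n. f (y i)) / n - 1\<bar> \<ge> 1 / 2} \<le> v3 / n"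
    using gaussian_n_mean_prob[OF p fm fi, of "1 / 2"] unfolding Ef by auto
  define K1 where "K1 = (v1 + 1) / a + a * (v2 + 1)"
  have K1: "K1 > 0" using a v1(1) v2(1) by (auto simp: K1_def intro!: add_pos_pos)
  define K where "K = 8 / a * K1 + sqrt (2 * v3)"
  have K: "K > 0" using K1 a v3(1) by (auto simp: K_def intro!: add_pos_nonneg)
  have main: "\<bar>measure (surface_measure n p) C - measure (gaussian_n n p) C\<bar> \<le> K / sqrt n"
    if n: "n \<ge> 2" and C[measurable]: "C \<in> sets (lebesgue_n n)"
      and hom: "\<And>r x. r > 0 \<Longrightarrow> x \<in> space (lebesgue_n n) \<Longrightarrow> scale_n n r x \<in> C \<longleftrightarrow> x \<in> C" for n C
  proof -
    let ?La = "lebesgue_n n" and ?G = "gaussian_n n p"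
    interpret G: prob_space ?G using p by (rule gaussian_n_prob_space)
    have n1: "n \<ge> 1" and n0: "real n > 0" using n by auto
    have p0: "p > 0" using p by simp
    define D where "D y = (\<Sum>i<n. f (y i)) / n" for y :: "nat \<Rightarrow> real"
    define U where "U y = (\<Sum>i<n. g (y i)) / n" for y :: "nat \<Rightarrow> real"
    define c where "c = n powr (\<theta> - 1 / 2)"
    have c: "c > 0" using n0 by (simp add: c_def)
    define q where "q x = c * gradient_norm n p (sphere_proj n p x)" for x
    have qm[measurable]: "q \<in> borel_measurable ?La" unfolding q_def by measurable
    have q0: "q x \<ge> 0" "q x \<le> c * n" for x
      using c gradient_norm_sphere_proj_le[OF p, of n x] by (auto simp: q_def gradient_norm_def)
    have qi: "integrable ?G q" by (rule G.integrable_const_bound[where B="c * n"]) (use q0 in auto)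
    have q_eq: "q x = D x powr (- \<theta>) * sqrt (U x)" if "\<And>i. i < n \<Longrightarrow> x i \<noteq> 0" for x
    proof -
      have "c * n powr (1 / 2 - \<theta>) = 1" using n0 by (simp add: c_def powr_add[symmetric])
      moreover have "gradient_norm n p (sphere_proj n p x) = n powr (1 / 2 - \<theta>) * (D x powr (- \<theta>) * sqrt (U x))"
        unfolding D_def U_def f_def g_def \<theta>_def by (rule gradient_norm_sphere_proj[OF n1 p that])
      ultimately show ?thesis
        unfolding q_def by (simp only: mult.assoc[symmetric] mult_1)
    qed
    define \<delta> where "\<delta> = (\<integral>x. \<bar>q x - a\<bar> \<partial>?G)"
    have \<delta>0: "\<delta> \<ge> 0" unfolding \<delta>_def by (intro integral_nonneg_AE) auto
    have "measure (surface_measure n p) C = (\<integral>x. q x * indicator C x \<partial>?G) / (\<integral>x. q x \<partial>?G)"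
    proof -
      have "measure (surface_measure n p) C =
          (\<integral>x. gradient_norm n p (sphere_proj n p x) * indicator C x \<partial>?G)
            / (\<integral>x. gradient_norm n p (sphere_proj n p x) \<partial>?G)"
        by (rule surface_measure_cone[OF n p C]) (rule hom)
      then show ?thesis unfolding q_def using c by (simp add: mult.assoc)
    qed
    moreover have "C \<in> sets ?G" by simp
    ultimately have TV: "\<bar>measure (surface_measure n p) C - measure ?G C\<bar> \<le> 4 / a * \<delta>"
      using weighted_prob_deviation[OF G.prob_space_axioms qi q0(1) _ a(1)] unfolding \<delta>_def by simp
    have TV1: "\<bar>measure (surface_measure n p) C - measure ?G C\<bar> \<le> 1"
    proof -
      have X0: "0 \<le> (\<integral>x. q x * indicator C x \<partial>?G)" using q0 by (intro integral_nonneg_AE) auto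
      have XY: "(\<integral>x. q x * indicator C x \<partial>?G) \<le> (\<integral>x. q x \<partial>?G)"
        using q0 qi integrable_real_mult_indicator[of C ?G q] by (intro integral_mono) (auto simp: indicator_def)
      have "0 \<le> measure (surface_measure n p) C" "measure (surface_measure n p) C \<le> 1"
        unfolding \<open>measure (surface_measure n p) C = _\<close> using X0 XY by (auto simp: divide_le_eq_1)
      moreover have "0 \<le> measure ?G C" "measure ?G C \<le> 1" by auto
      ultimately show ?thesis by linarith
    qed
    define R where "R = {s :: real. \<bar>s powr p / n - 1\<bar> \<le> 1 / 2}"
    have R: "R \<in> sets borel" unfolding R_def by measurable
    have DR: "lp_norm n p x \<in> R \<longleftrightarrow> \<bar>D x - 1\<bar> \<le> 1 / 2" for x
      by (simp add: R_def D_def f_def lp_norm_powr[OF p0])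
    define P where "P = measure ?G {x \<in> space ?La. lp_norm n p x \<in> R}"
    have Pm: "{x \<in> space ?La. lp_norm n p x \<in> R} \<in> sets ?G" using R by simp
    define F where "F x = ennreal \<bar>q x - a\<bar>" for x
    have Fm: "F \<in> borel_measurable ?La" unfolding F_def by measurable
    have Fle: "F x \<le> ennreal (c * n + a)" for x
      unfolding F_def using q0[of x] a(1) by (intro ennreal_leI) (auto simp: abs_le_iff)
    have "(\<integral>\<^sup>+x. F x * indicator (lp_ball n p) x \<partial>?La) \<le> (\<integral>\<^sup>+x. ennreal (c * n + a) * indicator (lp_ball n p) x \<partial>?La)"
      by (intro nn_integral_mono mult_right_mono Fle) auto
    also have "\<dots> = ennreal (c * n + a) * emeasure ?La (lp_ball n p)" by (simp add: nn_integral_cmult_indicator)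
    also have "\<dots> < \<infinity>" using emeasure_lp_ball[OF p, of n] by (simp add: ennreal_mult_less_top)
    finally have fin: "(\<integral>\<^sup>+x. F x * indicator (lp_ball n p) x \<partial>?La) < \<infinity>" .
    have Fhom: "F (scale_n n r x) = F x" if "r > 0" "x \<in> space ?La" for r x
      using sphere_proj_scale_n[OF p0 that(1), of n x] by (simp add: F_def q_def)
    have indep: "(\<integral>\<^sup>+x. F x * indicator R (lp_norm n p x) \<partial>?G) = ennreal (\<delta> * P)"
    proof -
      have "(\<integral>\<^sup>+x. F x \<partial>?G) = ennreal \<delta>" unfolding F_def \<delta>_def
        using qi by (intro nn_integral_eq_integral) auto
      then show ?thesis
        using gaussian_n_homogeneous(2)[OF n1 p Fm Fhom fin R] \<delta>0
        by (simp add: G.emeasure_eq_measure P_def ennreal_mult)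
    qed
    define s where "s = 1 / sqrt n"
    have s: "s > 0" using n0 by (simp add: s_def)
    define W where "W y = (((U y - a\<^sup>2)\<^sup>2 / s + s) / a + a * ((D y - 1)\<^sup>2 / s + s))" for y
    have iU: "integrable ?G (\<lambda>y. (U y - a\<^sup>2)\<^sup>2)" "(\<integral>y. (U y - a\<^sup>2)\<^sup>2 \<partial>?G) = v1 / n"
      using v1(2,3)[OF n1] by (simp_all only: U_def)
    have iD: "integrable ?G (\<lambda>y. (D y - 1)\<^sup>2)" "(\<integral>y. (D y - 1)\<^sup>2 \<partial>?G) = v2 / n"
      using v2(2,3)[OF n1] by (simp_all only: D_def)
    have W0: "W y \<ge> 0" for y unfolding W_def using a s by (intro add_nonneg_nonneg mult_nonneg_nonneg divide_nonneg_nonneg) auto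
    have iW: "integrable ?G W" unfolding W_def using iU(1) iD(1) by (auto intro!: Bochner_Integration.integrable_add integrable_divide integrable_mult_right G.integrable_const)
    have EW: "(\<integral>y. W y \<partial>?G) = K1 / sqrt n"
    proof -
      have "(\<integral>y. W y \<partial>?G) = ((v1 / n) / s + s) / a + a * ((v2 / n) / s + s)"
        unfolding W_def using iU iD by (simp add: G.prob_space)
      moreover have "v / n / s = v * s" for v
        using n0 by (simp add: s_def real_div_sqrt flip: times_divide_eq_right) (simp add: field_simps flip: power2_eq_square)
      ultimately have "(\<integral>y. W y \<partial>?G) = (v1 * s + s) / a + a * (v2 * s + s)" by (simp only:)
      also have "\<dots> = K1 * s" by (simp add: K1_def distrib_right distrib_left add_divide_distrib)
      also have "\<dots> = K1 / sqrt n" by (simp add: s_def)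
      finally show ?thesis .
    qed
    have "(\<integral>\<^sup>+x. F x * indicator R (lp_norm n p x) \<partial>?G) \<le> (\<integral>\<^sup>+x. ennreal (W x) \<partial>?G)"
    proof (rule nn_integral_mono_AE)
      show "AE x in ?G. F x * indicator R (lp_norm n p x) \<le> ennreal (W x)"
        using AE_gaussian_n_nonzero[OF p, of n]
      proof eventually_elim
        case (elim x)
        show ?case
        proof (cases "lp_norm n p x \<in> R")
          case True
          have "\<bar>q x - a\<bar> \<le> 2 / a * \<bar>U x - a\<^sup>2\<bar> + 2 * a * \<bar>D x - 1\<bar>"
          proof -
            have "q x = D x powr (- \<theta>) * sqrt (U x)" using elim by (intro q_eq) auto
            moreover have "U x \<ge> 0" unfolding U_def g_def by (intro divide_nonneg_nonneg sum_nonneg) auto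
            ultimately show ?thesis using weighted_root_deviation[OF a(1) _ \<theta>] True DR by simp
          qed
          also have "\<dots> \<le> 2 / a * (((U x - a\<^sup>2)\<^sup>2 / s + s) / 2) + 2 * a * (((D x - 1)\<^sup>2 / s + s) / 2)"
            using a by (intro add_mono mult_left_mono abs_le_square_average s) auto
          also have "\<dots> = W x"
          proof -
            have "2 / a * (z / 2) = z / a" "2 * a * (z / 2) = a * z" for z by auto
            then show ?thesis by (simp only: W_def)
          qed
          finally show ?thesis using True by (simp add: F_def ennreal_leI)
        qed simp
      qed
    qed
    also have "\<dots> = ennreal (K1 / sqrt n)"
      using iW W0 by (subst nn_integral_eq_integral) (auto simp: EW)
    finally have dP: "\<delta> * P \<le> K1 / sqrt n"
      unfolding indep using K1 by (simp add: ennreal_le_iff)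
    show ?thesis
    proof (cases "2 * v3 \<le> n")
      case True
      have "1 - P = measure ?G (space ?G - {x \<in> space ?La. lp_norm n p x \<in> R})"
        unfolding P_def using G.prob_compl[OF Pm] by simp
      also have "\<dots> \<le> measure ?G {y \<in> space ?G. \<bar>(\<Sum>i<n. f (y i)) / n - 1\<bar> \<ge> 1 / 2}"
      proof (rule G.finite_measure_mono)
        show "space ?G - {x \<in> space ?La. lp_norm n p x \<in> R} \<subseteq> {y \<in> space ?G. \<bar>(\<Sum>i<n. f (y i)) / n - 1\<bar> \<ge> 1 / 2}"
          using DR unfolding D_def by (auto simp: space_gaussian_n)
        have "f \<in> borel_measurable borel" by (rule fm)
        then have fc: "(\<lambda>y. f (y i)) \<in> borel_measurable ?La" if "i < n" for i
          by (rule measurable_compose[OF measurable_lebesgue_n_component[OF that]])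
        have "(\<lambda>y. \<Sum>i<n. f (y i)) \<in> borel_measurable ?La"
          by (rule borel_measurable_sum) (auto intro: fc)
        then have "{y \<in> space ?La. \<bar>(\<Sum>i<n. f (y i)) / n - 1\<bar> \<ge> 1 / 2} \<in> sets ?La"
          by measurable
        then show "{y \<in> space ?G. \<bar>(\<Sum>i<n. f (y i)) / n - 1\<bar> \<ge> 1 / 2} \<in> sets ?G"
          by (simp only: sets_gaussian_n space_gaussian_n)
      qed
      also have "\<dots> \<le> v3 / n" by (rule v3(2)[OF n1])
      also have "\<dots> \<le> 1 / 2" using True n0 by (simp add: pos_divide_le_eq)
      finally have "P \<ge> 1 / 2" by simp
      then have "\<delta> * (1 / 2) \<le> K1 / sqrt n" using dP \<delta>0 mult_left_mono[of "1 / 2" P \<delta>] by linarith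
      then have "\<delta> \<le> 2 * (K1 / sqrt n)" by linarith
      then have "4 / a * \<delta> \<le> 4 / a * (2 * (K1 / sqrt n))" by (rule mult_left_mono) (use a in simp)
      also have "\<dots> = (8 / a * K1) / sqrt n" by simp
      also have "\<dots> \<le> K / sqrt n" unfolding K_def using v3(1) n0 by (intro divide_right_mono) auto
      finally show ?thesis using TV by linarith
    next
      case False
      have "sqrt n \<le> sqrt (2 * v3)" using False by (intro real_sqrt_le_mono) auto
      also have "\<dots> \<le> K" unfolding K_def using K1 a by simp
      finally have "1 \<le> K / sqrt n" using n0 by (simp add: pos_le_divide_eq)
      then show ?thesis using TV1 by linarith
    qed
  qed
  show thesis by (rule that[OF K main])
qed

lemma sym_mean_scale_n:
  assumes r: "r > 0" and p: "p > 0" and k: "k \<ge> 1"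
  shows "sym_mean n k p (scale_n n r x) = r * sym_mean n k p x"
proof -
  have "(\<Prod>i\<in>I. \<bar>scale_n n r x i\<bar> powr p) = r powr (real k * p) * (\<Prod>i\<in>I. \<bar>x i\<bar> powr p)"
    if I: "I \<subseteq> {..<n} \<and> card I = k" for I
  proof -
    have "(\<Prod>i\<in>I. \<bar>scale_n n r x i\<bar> powr p) = (\<Prod>i\<in>I. r powr p * \<bar>x i\<bar> powr p)"
      using I r by (intro prod.cong) (auto simp: scale_n_def abs_mult powr_mult)
    also have "\<dots> = (r powr p) ^ k * (\<Prod>i\<in>I. \<bar>x i\<bar> powr p)"
      using I by (simp add: prod.distrib)
    also have "(r powr p) ^ k = r powr (real k * p)"
      using r by (simp add: powr_realpow[symmetric] powr_powr mult.commute)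
    finally show ?thesis .
  qed
  then have "(\<Sum>I | I \<subseteq> {..<n} \<and> card I = k. \<Prod>i\<in>I. \<bar>scale_n n r x i\<bar> powr p)
      = r powr (real k * p) * (\<Sum>I | I \<subseteq> {..<n} \<and> card I = k. \<Prod>i\<in>I. \<bar>x i\<bar> powr p)"
    by (simp add: sum_distrib_left)
  moreover have "(r powr (real k * p)) powr (1 / (real k * p)) = r"
  proof -
    have "real k * p * (1 / (real k * p)) = 1" using p k by simp
    then show ?thesis using r by (simp only: powr_powr powr_one)
  qed
  ultimately show ?thesis
    by (simp only: sym_mean_def times_divide_eq_right[symmetric] powr_mult)
qed

lemma mean_ratio_scale_n:
  assumes "r > 0" "p > 0" "k \<ge> 1" "l \<ge> 1"
  shows "mean_ratio n k l p (scale_n n r x) = mean_ratio n k l p x"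
  using assms by (simp add: mean_ratio_def sym_mean_scale_n)

theorem theorem2:
  fixes k :: nat and p :: real
  assumes "1 \<le> k" and "1 \<le> p"
  shows "\<exists>c::real. 0 < c \<and>
    (\<forall>(M :: nat \<Rightarrow> 'a measure) (X :: nat \<Rightarrow> 'a \<Rightarrow> nat \<Rightarrow> real) (N :: 'b measure) (Z :: 'b \<Rightarrow> real).
      (\<forall>n\<ge>k. prob_space (M n) \<and> X n \<in> measurable (M n) (lebesgue_n n) \<and>
         ((\<exists>\<rho>. real_distribution \<rho> \<and> (AE r in \<rho>. 0 < r) \<and>
               distr (M n) (lebesgue_n n) (X n) = radial_law n p \<rho>)
          \<or> distr (M n) (lebesgue_n n) (X n) = surface_measure n p)) \<longrightarrow>
      prob_space N \<longrightarrow>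
      distributed N lborel Z (normal_density 0 (sqrt (limit_variance p))) \<longrightarrow>
      (\<forall>n\<ge>max k 2.
         kolmogorov_dist (M n)
           (\<lambda>\<omega>. sqrt (real n) * (exp (- log_mean p) * mean_ratio n k n p (X n \<omega>) - 1))
           N Z
         \<le> c * sqrt (ln (real n)) / sqrt (real n)))"
proof (cases "limit_variance p > 0")
  case False
  have "limit_variance p \<ge> 0"
    unfolding centered_score_moments(3)[OF assms(2), symmetric] by (intro integral_nonneg_AE) auto
  with False have "limit_variance p = 0" by simp
  have absurd: False
    if N: "prob_space N" and Z: "distributed N lborel Z (normal_density 0 (sqrt (limit_variance p)))"
    for N :: "'b measure" and Z
  proof -
    interpret prob_space N by fact
    have "Z \<in> measurable N lborel" using Z by (rule distributed_measurable)
    have "emeasure (distr N lborel Z) UNIV = emeasure N (space N)"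
      using \<open>Z \<in> measurable N lborel\<close> by (subst emeasure_distr) auto
    also have "distr N lborel Z = density lborel (normal_density 0 (sqrt (limit_variance p)))"
      using Z by (rule distributed_distr_eq_density)
    also have "emeasure \<dots> UNIV = 0"
      using \<open>limit_variance p = 0\<close> by (simp add: emeasure_density normal_density_def)
    finally show False by (simp add: emeasure_space_1)
  qed
  show ?thesis by (intro exI[of _ 1]) (use absurd in auto)
next
  case True
  note k = assms(1) and p = assms(2)
  define \<Phi> where "\<Phi> = cdf (density lborel (normal_density 0 (sqrt (limit_variance p))))"
  define Q where "Q n x = sqrt (real n) * (exp (- log_mean p) * mean_ratio n k n p x - 1)" for n :: nat and x
  obtain C where C: "C > 0" "\<And>n t. n \<ge> max k 2 \<Longrightarrow>
    \<bar>measure (gaussian_n n p) {y \<in> space (gaussian_n n p). Q n y \<le> t} - \<Phi> t\<bar> \<le> C * (sqrt (ln n) / sqrt n)"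
    using mean_ratio_clt[OF k p True] unfolding \<Phi>_def Q_def by blast
  obtain K where K: "K > 0" "\<And>n C. n \<ge> 2 \<Longrightarrow> C \<in> sets (lebesgue_n n) \<Longrightarrow>
      (\<And>r x. r > 0 \<Longrightarrow> x \<in> space (lebesgue_n n) \<Longrightarrow> scale_n n r x \<in> C \<longleftrightarrow> x \<in> C) \<Longrightarrow>
      \<bar>measure (surface_measure n p) C - measure (gaussian_n n p) C\<bar> \<le> K / sqrt n"
    using surface_gaussian_deviation[OF p] by blast
  define c where "c = C + K / sqrt (ln 2)"
  have c: "c > 0" using C(1) K(1) by (auto simp: c_def intro!: add_pos_pos)
  have law: "\<bar>measure (distr M (lebesgue_n n) Y) {x \<in> space (lebesgue_n n). Q n x \<le> t} - \<Phi> t\<bar>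
      \<le> c * sqrt (ln n) / sqrt n"
    if n: "n \<ge> max k 2" and Y: "(\<exists>\<rho>. real_distribution \<rho> \<and> (AE r in \<rho>. 0 < r) \<and>
               distr M (lebesgue_n n) Y = radial_law n p \<rho>) \<or> distr M (lebesgue_n n) Y = surface_measure n p"
    for n t and M :: "'a measure" and Y
  proof -
    define A where "A = {x \<in> space (lebesgue_n n). Q n x \<le> t}"
    have n2: "n \<ge> 2" "n \<ge> 1" and n0: "real n > 0" using n by auto
    have Am: "A \<in> sets (lebesgue_n n)" unfolding A_def Q_def by measurable
    have hom: "scale_n n r x \<in> A \<longleftrightarrow> x \<in> A" if "r > 0" "x \<in> space (lebesgue_n n)" for r x
      using that k p n2(2) by (simp add: A_def Q_def mean_ratio_scale_n)
    have dev: "\<bar>measure (distr M (lebesgue_n n) Y) A - measure (gaussian_n n p) A\<bar> \<le> K / sqrt n"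
      using Y
    proof
      assume "\<exists>\<rho>. real_distribution \<rho> \<and> (AE r in \<rho>. 0 < r) \<and> distr M (lebesgue_n n) Y = radial_law n p \<rho>"
      then obtain \<rho> where \<rho>: "real_distribution \<rho>" "AE r in \<rho>. 0 < r" "distr M (lebesgue_n n) Y = radial_law n p \<rho>"
        by blast
      have "measure (radial_law n p \<rho>) A = measure (gaussian_n n p) A"
        by (rule radial_law_cone[OF n2(2) p Am hom \<rho>(1,2)])
      then show ?thesis using K(1) by (simp add: \<rho>(3))
    next
      assume "distr M (lebesgue_n n) Y = surface_measure n p"
      then show ?thesis using K(2)[OF n2(1) Am hom] by simp
    qed
    have "K / sqrt n \<le> K / sqrt (ln 2) * (sqrt (ln n) / sqrt n)"
    proof -
      have "sqrt (ln 2) \<le> sqrt (ln (real n))" using n2 by simp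
      then have "1 \<le> sqrt (ln n) / sqrt (ln 2)" by (simp add: pos_le_divide_eq)
      then have "K / sqrt n * 1 \<le> K / sqrt n * (sqrt (ln n) / sqrt (ln 2))"
        using K(1) by (intro mult_left_mono) auto
      then show ?thesis by (simp add: mult.commute)
    qed
    moreover have "\<bar>measure (gaussian_n n p) A - \<Phi> t\<bar> \<le> C * (sqrt (ln n) / sqrt n)"
      using C(2)[OF n, of t] by (simp only: A_def space_gaussian_n)
    moreover have "c * sqrt (ln n) / sqrt n = C * (sqrt (ln n) / sqrt n) + K / sqrt (ln 2) * (sqrt (ln n) / sqrt n)"
      by (simp add: c_def distrib_right add_divide_distrib)
    ultimately show ?thesis using dev unfolding A_def by linarith
  qed
  show ?thesis
  proof (intro exI[of _ c] conjI allI impI c)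
    fix M :: "nat \<Rightarrow> 'a measure" and X :: "nat \<Rightarrow> 'a \<Rightarrow> nat \<Rightarrow> real" and N :: "'b measure" and Z :: "'b \<Rightarrow> real" and n :: nat
    assume X: "\<forall>n\<ge>k. prob_space (M n) \<and> X n \<in> measurable (M n) (lebesgue_n n) \<and>
         ((\<exists>\<rho>. real_distribution \<rho> \<and> (AE r in \<rho>. 0 < r) \<and>
               distr (M n) (lebesgue_n n) (X n) = radial_law n p \<rho>)
          \<or> distr (M n) (lebesgue_n n) (X n) = surface_measure n p)"
      and N: "prob_space N" and Z: "distributed N lborel Z (normal_density 0 (sqrt (limit_variance p)))"
      and n: "n \<ge> max k 2"
    have nk: "n \<ge> k" using n by simp
    have Xm: "X n \<in> measurable (M n) (lebesgue_n n)" using X nk by blast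
    show "kolmogorov_dist (M n) (\<lambda>\<omega>. sqrt (real n) * (exp (- log_mean p) * mean_ratio n k n p (X n \<omega>) - 1)) N Z
         \<le> c * sqrt (ln (real n)) / sqrt (real n)"
      unfolding kolmogorov_dist_def
    proof (rule cSUP_least)
      fix t :: real
      have Zm: "Z \<in> measurable N lborel" using Z by (rule distributed_measurable)
      have "\<Phi> t = measure (distr N lborel Z) {..t}"
        unfolding \<Phi>_def cdf_def distributed_distr_eq_density[OF Z] ..
      also have "\<dots> = measure N {\<omega> \<in> space N. Z \<omega> \<le> t}"
        using Zm by (subst measure_distr) (auto intro!: arg_cong[where f="measure N"])
      finally have eZ: "measure N {\<omega> \<in> space N. Z \<omega> \<le> t} = \<Phi> t" ..
      have "measure (distr (M n) (lebesgue_n n) (X n)) {x \<in> space (lebesgue_n n). Q n x \<le> t}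
          = measure (M n) {\<omega> \<in> space (M n). Q n (X n \<omega>) \<le> t}"
      proof (subst measure_distr[OF Xm])
        show "{x \<in> space (lebesgue_n n). Q n x \<le> t} \<in> sets (lebesgue_n n)" unfolding Q_def by measurable
        show "measure (M n) (X n -` {x \<in> space (lebesgue_n n). Q n x \<le> t} \<inter> space (M n))
            = measure (M n) {\<omega> \<in> space (M n). Q n (X n \<omega>) \<le> t}"
          using measurable_space[OF Xm] by (intro arg_cong[where f="measure (M n)"]) auto
      qed
      then show "\<bar>measure (M n) {\<omega> \<in> space (M n). sqrt (real n) * (exp (- log_mean p) * mean_ratio n k n p (X n \<omega>) - 1) \<le> t}
           - measure N {\<omega> \<in> space N. Z \<omega> \<le> t}\<bar> \<le> c * sqrt (ln (real n)) / sqrt (real n)"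
        using law[OF n, of "M n" "X n" t] X nk unfolding eZ Q_def by auto
    qed simp
  qed
qed

end
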